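(* Let $B$ be a Poisson Hopf algebra over $k$. Then: (1) $B^e$ is a free module over $B$ (with $B$ acting by left multiplication); (2) $B=(B^e)^{co\,\mathcal H(B)}={}^{co\,\mathcal H(B)}(B^e)$; (3) $B^e$ is an injective (right) comodule over $\mathcal H(B)$.
   Context: $k$ is a field. A Poisson algebra is a commutative $k$-algebra with a Lie bracket $\{\cdot,\cdot\}$ such that $\{a,bc\}=\{a,b\}c+b\{a,c\}$; the tensor square $A\otimes A$ of a Poisson algebra is Poisson with $\{a\otimes b,c\otimes d\}=ac\otimes\{b,d\}+\{a,c\}\otimes bd$. A Poisson Hopf algebra is a commutative Hopf algebra $B$ with a Poisson bracket such that $\Delta(\{a,b\})=\{\Delta(a),\Delta(b)\}$. Universal enveloping algebra: $B^e$ is the associative unital $k$-algebra generated by two copies $\{m_a:a\in B\}$ and $\{h_a:a\in B\}$ of the vector space $B$ (linear in $a$) subject to, for all $x,y\in B$, $$m_{xy}=m_xm_y,\quad h_{\{x,y\}}=h_xh_y-h_yh_x,\quad h_{xy}=m_yh_x+m_xh_y,\quad m_{\{x,y\}}=h_xm_y-m_yh_x,\quad m_1=1.$$ $B^e$ is a Hopf algebra with $\Delta(m_b)=m_{b_1}\otimes m_{b_2}$, $\epsilon(m_b)=\epsilon(b)$, $\Delta(h_b)=m_{b_1}\otimes h_{b_2}+h_{b_1}\otimes m_{b_2}$, $\epsilon(h_b)=0$. The map $b\mapsto m_b$ is injective and identifies $B$ with a Hopf subalgebra of $B^e$. With $B^+=\ker\epsilon|_B$, one has $B^eB^+=B^+B^e$,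 a Hopf ideal of $B^e$, and $\mathcal H(B):=B^e/B^eB^+$, with projection $\pi:B^e\to\mathcal H(B)$. $B^e$ is a right $\mathcal H(B)$-comodule via $(\mathrm{id}\otimes\pi)\Delta$ and a left one via $(\pi\otimes\mathrm{id})\Delta$. Coinvariants: $(B^e)^{co\,\mathcal H(B)}=\{z:(\mathrm{id}\otimes\pi)\Delta(z)=z\otimes1\}$ and ${}^{co\,\mathcal H(B)}(B^e)=\{z:(\pi\otimes\mathrm{id})\Delta(z)=1\otimes z\}$. *)

theory Defs
  imports "HOL-Algebra.QuotRing" "HOL-Algebra.Ideal_Product" "Jordan_Normal_Form.Missing_VectorSpace"
begin

text \<open>
  All structures are given by carriers. A vector space or an algebra over the field \<open>K\<close> is a record
  of type \<open>module\<close>; the multiplicative part of the record is irrelevant for a mere vector space.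
\<close>

section \<open>Linear algebra and quotients\<close>

definition scalar_algebra :: "('k, 'r) ring_scheme \<Rightarrow> ('k, 'k) module"
  where "scalar_algebra K = ring.extend (ring.truncate K) (module.fields (\<lambda>a b. a \<otimes>\<^bsub>K\<^esub> b))"

definition algebra_hom ::
    "('k, 'r) ring_scheme \<Rightarrow> ('k, 'a, 'm) module_scheme \<Rightarrow> ('k, 'c, 'n) module_scheme \<Rightarrow> ('a \<Rightarrow> 'c) set"
  where "algebra_hom K A C = ring_hom A C \<inter> module_hom K A C"

definition free_module :: "('r, 's) ring_scheme \<Rightarrow> ('r, 'a, 'm) module_scheme \<Rightarrow> bool"
  where "free_module R M \<longleftrightarrow> module R M \<and>
    (\<exists>S. S \<subseteq> carrier M \<and> \<not> LinearCombinations.module.lin_dep R M S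
       \<and> LinearCombinations.module.span R M S = carrier M)"

text \<open>Used both for quotients of algebras by ideals and for quotients of vector spaces by subspaces.\<close>

definition quot_algebra :: "('k, 'a, 'm) module_scheme \<Rightarrow> 'a set \<Rightarrow> ('k, 'a set) module"
  where "quot_algebra A I =
    ring.extend (A Quot I) (module.fields (\<lambda>c X. \<Union>x\<in>X. I +>\<^bsub>A\<^esub> (c \<odot>\<^bsub>A\<^esub> x)))"

definition point_mass :: "('k, 'r) ring_scheme \<Rightarrow> 's \<Rightarrow> 's \<Rightarrow> 'k"
  where "point_mass K s = (\<lambda>t. if t = s then \<one>\<^bsub>K\<^esub> else \<zero>\<^bsub>K\<^esub>)"

text \<open>
  \<open>K[G]\<close>, with \<open>point_mass K s\<close> as the basis vector belonging to \<open>s\<close>. As a vector space it is the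
  free vector space on \<open>carrier G\<close>.
\<close>

definition monoid_algebra :: "('k, 'r) ring_scheme \<Rightarrow> ('s, 't) monoid_scheme \<Rightarrow> ('k, 's \<Rightarrow> 'k) module"
  where "monoid_algebra K G =
    \<lparr>carrier = {f. f \<in> carrier G \<rightarrow> carrier K \<and> (\<forall>s. s \<notin> carrier G \<longrightarrow> f s = \<zero>\<^bsub>K\<^esub>)
                 \<and> finite {s. f s \<noteq> \<zero>\<^bsub>K\<^esub>}},
     monoid.mult = (\<lambda>f g s. \<Oplus>\<^bsub>K\<^esub>p\<in>{(x, y). f x \<noteq> \<zero>\<^bsub>K\<^esub> \<and> g y \<noteq> \<zero>\<^bsub>K\<^esub> \<and> x \<otimes>\<^bsub>G\<^esub> y = s}.
                       f (fst p) \<otimes>\<^bsub>K\<^esub> g (snd p)),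
     one = point_mass K \<one>\<^bsub>G\<^esub>,
     zero = (\<lambda>s. \<zero>\<^bsub>K\<^esub>),
     add = (\<lambda>f g s. f s \<oplus>\<^bsub>K\<^esub> g s),
     smult = (\<lambda>c f s. c \<otimes>\<^bsub>K\<^esub> f s)\<rparr>"

text \<open>
  Let \<open>Z\<close> be an element of a quotient of the free vector space on a set. The value at \<open>Z\<close> of the
  linear map into \<open>X\<close> given by \<open>\<phi>\<close> on the basis. The representative of \<open>Z\<close> does not matter as soon
  as the linear extension of \<open>\<phi>\<close> vanishes on the subspace that is divided out.
\<close>

definition lin_ext ::
    "('k, 'r) ring_scheme \<Rightarrow> ('k, 'x, 'm) module_scheme \<Rightarrow> ('s \<Rightarrow> 'x) \<Rightarrow> ('s \<Rightarrow> 'k) set \<Rightarrow> 'x"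
  where "lin_ext K X \<phi> Z =
    (let f = (SOME f. f \<in> Z) in \<Oplus>\<^bsub>X\<^esub>s\<in>{s. f s \<noteq> \<zero>\<^bsub>K\<^esub>}. f s \<odot>\<^bsub>X\<^esub> \<phi> s)"


section \<open>Tensor products\<close>

definition tensor_rels ::
    "('k, 'r) ring_scheme \<Rightarrow> ('k, 'v, 'm) module_scheme \<Rightarrow> ('k, 'w, 'n) module_scheme
      \<Rightarrow> ('v \<times> 'w \<Rightarrow> 'k) set"
  where "tensor_rels K V W =
    (let F = monoid_algebra K (V \<times>\<times> W); e = (\<lambda>v w. point_mass K (v, w)) in
       {e (v \<oplus>\<^bsub>V\<^esub> v') w \<ominus>\<^bsub>F\<^esub> (e v w \<oplus>\<^bsub>F\<^esub> e v' w) | v v' w.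
          v \<in> carrier V \<and> v' \<in> carrier V \<and> w \<in> carrier W} \<union>
       {e v (w \<oplus>\<^bsub>W\<^esub> w') \<ominus>\<^bsub>F\<^esub> (e v w \<oplus>\<^bsub>F\<^esub> e v w') | v w w'.
          v \<in> carrier V \<and> w \<in> carrier W \<and> w' \<in> carrier W} \<union>
       {e (c \<odot>\<^bsub>V\<^esub> v) w \<ominus>\<^bsub>F\<^esub> c \<odot>\<^bsub>F\<^esub> e v w | c v w.
          c \<in> carrier K \<and> v \<in> carrier V \<and> w \<in> carrier W} \<union>
       {e v (c \<odot>\<^bsub>W\<^esub> w) \<ominus>\<^bsub>F\<^esub> c \<odot>\<^bsub>F\<^esub> e v w | c v w.
          c \<in> carrier K \<and> v \<in> carrier V \<and> w \<in> carrier W})"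

definition tensor_null ::
    "('k, 'r) ring_scheme \<Rightarrow> ('k, 'v, 'm) module_scheme \<Rightarrow> ('k, 'w, 'n) module_scheme
      \<Rightarrow> ('v \<times> 'w \<Rightarrow> 'k) set"
  where "tensor_null K V W =
    LinearCombinations.module.span K (monoid_algebra K (V \<times>\<times> W)) (tensor_rels K V W)"

text \<open>
  If \<open>V\<close> and \<open>W\<close> are algebras, then \<open>tensor_null K V W\<close> is an ideal of the monoid algebra and the
  product induced on the quotient is \<open>(a \<otimes> b)(c \<otimes> d) = ac \<otimes> bd\<close>.
\<close>

definition tensor ::
    "('k, 'r) ring_scheme \<Rightarrow> ('k, 'v, 'm) module_scheme \<Rightarrow> ('k, 'w, 'n) module_scheme
      \<Rightarrow> ('k, ('v \<times> 'w \<Rightarrow> 'k) set) module"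
  where "tensor K V W = quot_algebra (monoid_algebra K (V \<times>\<times> W)) (tensor_null K V W)"

definition pure ::
    "('k, 'r) ring_scheme \<Rightarrow> ('k, 'v, 'm) module_scheme \<Rightarrow> ('k, 'w, 'n) module_scheme
      \<Rightarrow> 'v \<Rightarrow> 'w \<Rightarrow> ('v \<times> 'w \<Rightarrow> 'k) set"
  where "pure K V W v w = tensor_null K V W +>\<^bsub>monoid_algebra K (V \<times>\<times> W)\<^esub> point_mass K (v, w)"

text \<open>The linear map \<open>v \<otimes> w \<mapsto> \<beta> v w\<close> into \<open>X\<close>, for bilinear \<open>\<beta>\<close>.\<close>

definition tensor_lift ::
    "('k, 'r) ring_scheme \<Rightarrow> ('k, 'x, 'm) module_scheme \<Rightarrow> ('v \<Rightarrow> 'w \<Rightarrow> 'x) \<Rightarrow> ('v \<times> 'w \<Rightarrow> 'k) set \<Rightarrow> 'x"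
  where "tensor_lift K X \<beta> = lin_ext K X (\<lambda>(v, w). \<beta> v w)"

text \<open>\<open>V\<close> and \<open>W\<close> are the codomains of \<open>f\<close> and \<open>g\<close>.\<close>

definition tensor_map ::
    "('k, 'r) ring_scheme \<Rightarrow> ('k, 'v, 'm) module_scheme \<Rightarrow> ('k, 'w, 'n) module_scheme
      \<Rightarrow> ('a \<Rightarrow> 'v) \<Rightarrow> ('c \<Rightarrow> 'w) \<Rightarrow> ('a \<times> 'c \<Rightarrow> 'k) set \<Rightarrow> ('v \<times> 'w \<Rightarrow> 'k) set"
  where "tensor_map K V W f g = tensor_lift K (tensor K V W) (\<lambda>a c. pure K V W (f a) (g c))"

text \<open>\<open>(U \<otimes> V) \<otimes> W \<rightarrow> U \<otimes> (V \<otimes> W)\<close>\<close>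

definition tensor_assoc ::
    "('k, 'r) ring_scheme \<Rightarrow> ('k, 'u, 'l) module_scheme \<Rightarrow> ('k, 'v, 'm) module_scheme
      \<Rightarrow> ('k, 'w, 'n) module_scheme \<Rightarrow> (('u \<times> 'v \<Rightarrow> 'k) set \<times> 'w \<Rightarrow> 'k) set
      \<Rightarrow> ('u \<times> ('v \<times> 'w \<Rightarrow> 'k) set \<Rightarrow> 'k) set"
  where "tensor_assoc K U V W =
    (let T = tensor K U (tensor K V W) in
      tensor_lift K T (\<lambda>t w.
        tensor_lift K T (\<lambda>u v. pure K U (tensor K V W) u (pure K V W v w)) t))"


section \<open>Poisson Hopf algebras\<close>

locale poisson_algebra = field?: field K + algebra K B
  for K :: "('k, 'r) ring_scheme" (structure) and B :: "('k, 'b, 'm) module_scheme" +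
  fixes bracket :: "'b \<Rightarrow> 'b \<Rightarrow> 'b"
  assumes bracket_closed:
      "\<lbrakk>a \<in> carrier B; b \<in> carrier B\<rbrakk> \<Longrightarrow> bracket a b \<in> carrier B"
    and bracket_add_left:
      "\<lbrakk>a \<in> carrier B; b \<in> carrier B; c \<in> carrier B\<rbrakk>
        \<Longrightarrow> bracket (a \<oplus>\<^bsub>B\<^esub> b) c = bracket a c \<oplus>\<^bsub>B\<^esub> bracket b c"
    and bracket_add_right:
      "\<lbrakk>a \<in> carrier B; b \<in> carrier B; c \<in> carrier B\<rbrakk>
        \<Longrightarrow> bracket a (b \<oplus>\<^bsub>B\<^esub> c) = bracket a b \<oplus>\<^bsub>B\<^esub> bracket a c"
    and bracket_smult_left:
      "\<lbrakk>r \<in> carrier K; a \<in> carrier B; b \<in> carrier B\<rbrakk>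
        \<Longrightarrow> bracket (r \<odot>\<^bsub>B\<^esub> a) b = r \<odot>\<^bsub>B\<^esub> bracket a b"
    and bracket_smult_right:
      "\<lbrakk>r \<in> carrier K; a \<in> carrier B; b \<in> carrier B\<rbrakk>
        \<Longrightarrow> bracket a (r \<odot>\<^bsub>B\<^esub> b) = r \<odot>\<^bsub>B\<^esub> bracket a b"
    and bracket_alternating:
      "a \<in> carrier B \<Longrightarrow> bracket a a = \<zero>\<^bsub>B\<^esub>"
    and bracket_jacobi:
      "\<lbrakk>a \<in> carrier B; b \<in> carrier B; c \<in> carrier B\<rbrakk>
        \<Longrightarrow> bracket a (bracket b c) \<oplus>\<^bsub>B\<^esub> bracket b (bracket c a) \<oplus>\<^bsub>B\<^esub> bracket c (bracket a b) = \<zero>\<^bsub>B\<^esub>"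
    and bracket_leibniz:
      "\<lbrakk>a \<in> carrier B; b \<in> carrier B; c \<in> carrier B\<rbrakk>
        \<Longrightarrow> bracket a (b \<otimes>\<^bsub>B\<^esub> c) = bracket a b \<otimes>\<^bsub>B\<^esub> c \<oplus>\<^bsub>B\<^esub> b \<otimes>\<^bsub>B\<^esub> bracket a c"

definition tensor_bracket ::
    "('k, 'r) ring_scheme \<Rightarrow> ('k, 'b, 'm) module_scheme \<Rightarrow> ('b \<Rightarrow> 'b \<Rightarrow> 'b)
      \<Rightarrow> ('b \<times> 'b \<Rightarrow> 'k) set \<Rightarrow> ('b \<times> 'b \<Rightarrow> 'k) set \<Rightarrow> ('b \<times> 'b \<Rightarrow> 'k) set"
  where "tensor_bracket K B bracket t u =
    (let T = tensor K B B in
      tensor_lift K T (\<lambda>a b.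
        tensor_lift K T (\<lambda>c d.
          pure K B B (a \<otimes>\<^bsub>B\<^esub> c) (bracket b d) \<oplus>\<^bsub>T\<^esub> pure K B B (bracket a c) (b \<otimes>\<^bsub>B\<^esub> d)) u) t)"

locale coalgebra = vectorspace K C
  for K :: "('k, 'r) ring_scheme" (structure) and C :: "('k, 'c, 'm) module_scheme" +
  fixes \<Delta> :: "'c \<Rightarrow> ('c \<times> 'c \<Rightarrow> 'k) set" and \<epsilon> :: "'c \<Rightarrow> 'k"
  assumes comul_linear: "\<Delta> \<in> module_hom K C (tensor K C C)"
    and counit_linear: "\<epsilon> \<in> module_hom K C (scalar_algebra K)"
    and coassoc:
      "x \<in> carrier C \<Longrightarrow>
        tensor_assoc K C C C (tensor_map K (tensor K C C) C \<Delta> id (\<Delta> x))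
          = tensor_map K C (tensor K C C) id \<Delta> (\<Delta> x)"
    and counit_left: "x \<in> carrier C \<Longrightarrow> tensor_lift K C (\<lambda>a b. \<epsilon> a \<odot>\<^bsub>C\<^esub> b) (\<Delta> x) = x"
    and counit_right: "x \<in> carrier C \<Longrightarrow> tensor_lift K C (\<lambda>a b. \<epsilon> b \<odot>\<^bsub>C\<^esub> a) (\<Delta> x) = x"

locale comm_hopf_algebra = algebra K B + coalgebra K B \<Delta> \<epsilon>
  for K :: "('k, 'r) ring_scheme" (structure) and B :: "('k, 'b, 'm) module_scheme" and \<Delta> and \<epsilon> +
  fixes S :: "'b \<Rightarrow> 'b"
  assumes comul_hom: "\<Delta> \<in> algebra_hom K B (tensor K B B)"
    and counit_hom: "\<epsilon> \<in> algebra_hom K B (scalar_algebra K)"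
    and antipode_linear: "S \<in> module_hom K B B"
    and antipode_left:
      "x \<in> carrier B \<Longrightarrow> tensor_lift K B (\<lambda>a b. S a \<otimes>\<^bsub>B\<^esub> b) (\<Delta> x) = \<epsilon> x \<odot>\<^bsub>B\<^esub> \<one>\<^bsub>B\<^esub>"
    and antipode_right:
      "x \<in> carrier B \<Longrightarrow> tensor_lift K B (\<lambda>a b. a \<otimes>\<^bsub>B\<^esub> S b) (\<Delta> x) = \<epsilon> x \<odot>\<^bsub>B\<^esub> \<one>\<^bsub>B\<^esub>"

locale poisson_hopf_algebra = poisson_algebra K B bracket + comm_hopf_algebra K B \<Delta> \<epsilon> S
  for K :: "('k, 'r) ring_scheme" (structure) and B :: "('k, 'b, 'm) module_scheme"
    and bracket and \<Delta> and \<epsilon> and S +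
  assumes comul_bracket:
    "\<lbrakk>a \<in> carrier B; b \<in> carrier B\<rbrakk>
      \<Longrightarrow> \<Delta> (bracket a b) = tensor_bracket K B bracket (\<Delta> a) (\<Delta> b)"


section \<open>The universal enveloping algebra\<close>

definition word_monoid :: "'s set \<Rightarrow> 's list monoid"
  where "word_monoid X = \<lparr>carrier = lists X, monoid.mult = (@), one = []\<rparr>"

text \<open>
  The free associative algebra on two copies of \<open>B\<close>; the letters \<open>Inl a\<close> and \<open>Inr a\<close> are the
  generators \<open>m\<^sub>a\<close> and \<open>h\<^sub>a\<close>.
\<close>

definition env_free :: "('k, 'r) ring_scheme \<Rightarrow> ('k, 'b, 'm) module_scheme
    \<Rightarrow> ('k, ('b + 'b) list \<Rightarrow> 'k) module"
  where "env_free K B = monoid_algebra K (word_monoid (carrier B <+> carrier B))"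

definition env_rels :: "('k, 'r) ring_scheme \<Rightarrow> ('k, 'b, 'm) module_scheme \<Rightarrow> ('b \<Rightarrow> 'b \<Rightarrow> 'b)
    \<Rightarrow> (('b + 'b) list \<Rightarrow> 'k) set"
  where "env_rels K B bracket =
    (let F = env_free K B; m = (\<lambda>a. point_mass K [Inl a]); h = (\<lambda>a. point_mass K [Inr a]) in
       {m (x \<oplus>\<^bsub>B\<^esub> y) \<ominus>\<^bsub>F\<^esub> (m x \<oplus>\<^bsub>F\<^esub> m y) | x y. x \<in> carrier B \<and> y \<in> carrier B} \<union>
       {m (c \<odot>\<^bsub>B\<^esub> x) \<ominus>\<^bsub>F\<^esub> c \<odot>\<^bsub>F\<^esub> m x | c x. c \<in> carrier K \<and> x \<in> carrier B} \<union>
       {h (x \<oplus>\<^bsub>B\<^esub> y) \<ominus>\<^bsub>F\<^esub> (h x \<oplus>\<^bsub>F\<^esub> h y) | x y. x \<in> carrier B \<and> y \<in> carrier B} \<union>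
       {h (c \<odot>\<^bsub>B\<^esub> x) \<ominus>\<^bsub>F\<^esub> c \<odot>\<^bsub>F\<^esub> h x | c x. c \<in> carrier K \<and> x \<in> carrier B} \<union>
       {m (x \<otimes>\<^bsub>B\<^esub> y) \<ominus>\<^bsub>F\<^esub> m x \<otimes>\<^bsub>F\<^esub> m y | x y. x \<in> carrier B \<and> y \<in> carrier B} \<union>
       {h (bracket x y) \<ominus>\<^bsub>F\<^esub> (h x \<otimes>\<^bsub>F\<^esub> h y \<ominus>\<^bsub>F\<^esub> h y \<otimes>\<^bsub>F\<^esub> h x) | x y.
          x \<in> carrier B \<and> y \<in> carrier B} \<union>
       {h (x \<otimes>\<^bsub>B\<^esub> y) \<ominus>\<^bsub>F\<^esub> (m y \<otimes>\<^bsub>F\<^esub> h x \<oplus>\<^bsub>F\<^esub> m x \<otimes>\<^bsub>F\<^esub> h y) | x y.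
          x \<in> carrier B \<and> y \<in> carrier B} \<union>
       {m (bracket x y) \<ominus>\<^bsub>F\<^esub> (h x \<otimes>\<^bsub>F\<^esub> m y \<ominus>\<^bsub>F\<^esub> m y \<otimes>\<^bsub>F\<^esub> h x) | x y.
          x \<in> carrier B \<and> y \<in> carrier B} \<union>
       {m \<one>\<^bsub>B\<^esub> \<ominus>\<^bsub>F\<^esub> \<one>\<^bsub>F\<^esub>})"

definition env_ideal :: "('k, 'r) ring_scheme \<Rightarrow> ('k, 'b, 'm) module_scheme \<Rightarrow> ('b \<Rightarrow> 'b \<Rightarrow> 'b)
    \<Rightarrow> (('b + 'b) list \<Rightarrow> 'k) set"
  where "env_ideal K B bracket = Idl\<^bsub>env_free K B\<^esub> (env_rels K B bracket)"

definition env :: "('k, 'r) ring_scheme \<Rightarrow> ('k, 'b, 'm) module_scheme \<Rightarrow> ('b \<Rightarrow> 'b \<Rightarrow> 'b)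
    \<Rightarrow> ('k, (('b + 'b) list \<Rightarrow> 'k) set) module"
  where "env K B bracket = quot_algebra (env_free K B) (env_ideal K B bracket)"

definition env_m :: "('k, 'r) ring_scheme \<Rightarrow> ('k, 'b, 'm) module_scheme \<Rightarrow> ('b \<Rightarrow> 'b \<Rightarrow> 'b)
    \<Rightarrow> 'b \<Rightarrow> (('b + 'b) list \<Rightarrow> 'k) set"
  where "env_m K B bracket a = env_ideal K B bracket +>\<^bsub>env_free K B\<^esub> point_mass K [Inl a]"

definition env_h :: "('k, 'r) ring_scheme \<Rightarrow> ('k, 'b, 'm) module_scheme \<Rightarrow> ('b \<Rightarrow> 'b \<Rightarrow> 'b)
    \<Rightarrow> 'b \<Rightarrow> (('b + 'b) list \<Rightarrow> 'k) set"
  where "env_h K B bracket a = env_ideal K B bracket +>\<^bsub>env_free K B\<^esub> point_mass K [Inr a]"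

text \<open>
  The algebra map from the enveloping algebra to \<open>A\<close> with \<open>m\<^sub>a \<mapsto> \<mu> a\<close> and \<open>h\<^sub>a \<mapsto> \<eta> a\<close>, provided that
  \<open>\<mu>\<close> and \<open>\<eta>\<close> respect the defining relations.
\<close>

definition env_lift :: "('k, 'r) ring_scheme \<Rightarrow> ('k, 'a, 'm) module_scheme \<Rightarrow> ('b \<Rightarrow> 'a) \<Rightarrow> ('b \<Rightarrow> 'a)
    \<Rightarrow> (('b + 'b) list \<Rightarrow> 'k) set \<Rightarrow> 'a"
  where "env_lift K A \<mu> \<eta> = lin_ext K A (\<lambda>w. foldr (\<lambda>s y. case_sum \<mu> \<eta> s \<otimes>\<^bsub>A\<^esub> y) w \<one>\<^bsub>A\<^esub>)"

definition env_comul :: "('k, 'r) ring_scheme \<Rightarrow> ('k, 'b, 'm) module_scheme \<Rightarrow> ('b \<Rightarrow> 'b \<Rightarrow> 'b)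
    \<Rightarrow> ('b \<Rightarrow> ('b \<times> 'b \<Rightarrow> 'k) set) \<Rightarrow> (('b + 'b) list \<Rightarrow> 'k) set
    \<Rightarrow> ((('b + 'b) list \<Rightarrow> 'k) set \<times> (('b + 'b) list \<Rightarrow> 'k) set \<Rightarrow> 'k) set"
  where "env_comul K B bracket \<Delta> =
    (let U = env K B bracket; m = env_m K B bracket; h = env_h K B bracket; T = tensor K U U in
      env_lift K T
        (\<lambda>b. tensor_map K U U m m (\<Delta> b))
        (\<lambda>b. tensor_map K U U m h (\<Delta> b) \<oplus>\<^bsub>T\<^esub> tensor_map K U U h m (\<Delta> b)))"

definition env_counit :: "('k, 'r) ring_scheme \<Rightarrow> ('b \<Rightarrow> 'k) \<Rightarrow> (('b + 'b) list \<Rightarrow> 'k) set \<Rightarrow> 'k"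
  where "env_counit K \<epsilon> = env_lift K (scalar_algebra K) \<epsilon> (\<lambda>b. \<zero>\<^bsub>K\<^esub>)"

definition env_left_module :: "('k, 'r) ring_scheme \<Rightarrow> ('k, 'b, 'm) module_scheme \<Rightarrow> ('b \<Rightarrow> 'b \<Rightarrow> 'b)
    \<Rightarrow> ('b, (('b + 'b) list \<Rightarrow> 'k) set) module"
  where "env_left_module K B bracket =
    ring.extend (ring.truncate (env K B bracket))
      (module.fields (\<lambda>b z. env_m K B bracket b \<otimes>\<^bsub>env K B bracket\<^esub> z))"


section \<open>The quotient by the augmentation ideal of the Poisson Hopf algebra\<close>

text \<open>
  \<open>B\<^sup>eB\<^sup>+\<close>. The second factor is not an ideal of the enveloping algebra, but \<open>ideal_prod\<close> is the set
  of finite sums of products for arbitrary sets.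
\<close>

definition env_aug :: "('k, 'r) ring_scheme \<Rightarrow> ('k, 'b, 'm) module_scheme \<Rightarrow> ('b \<Rightarrow> 'b \<Rightarrow> 'b)
    \<Rightarrow> ('b \<Rightarrow> 'k) \<Rightarrow> (('b + 'b) list \<Rightarrow> 'k) set set"
  where "env_aug K B bracket \<epsilon> =
    carrier (env K B bracket) \<cdot>\<^bsub>env K B bracket\<^esub>
      (env_m K B bracket ` {b \<in> carrier B. \<epsilon> b = \<zero>\<^bsub>K\<^esub>})"

definition env_bar :: "('k, 'r) ring_scheme \<Rightarrow> ('k, 'b, 'm) module_scheme \<Rightarrow> ('b \<Rightarrow> 'b \<Rightarrow> 'b)
    \<Rightarrow> ('b \<Rightarrow> 'k) \<Rightarrow> ('k, (('b + 'b) list \<Rightarrow> 'k) set set) module"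
  where "env_bar K B bracket \<epsilon> = quot_algebra (env K B bracket) (env_aug K B bracket \<epsilon>)"

definition env_proj :: "('k, 'r) ring_scheme \<Rightarrow> ('k, 'b, 'm) module_scheme \<Rightarrow> ('b \<Rightarrow> 'b \<Rightarrow> 'b)
    \<Rightarrow> ('b \<Rightarrow> 'k) \<Rightarrow> (('b + 'b) list \<Rightarrow> 'k) set \<Rightarrow> (('b + 'b) list \<Rightarrow> 'k) set set"
  where "env_proj K B bracket \<epsilon> z = env_aug K B bracket \<epsilon> +>\<^bsub>env K B bracket\<^esub> z"

text \<open>The induced coalgebra structure, computed on an arbitrary representative.\<close>

definition env_bar_comul :: "('k, 'r) ring_scheme \<Rightarrow> ('k, 'b, 'm) module_scheme \<Rightarrow> ('b \<Rightarrow> 'b \<Rightarrow> 'b)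
    \<Rightarrow> ('b \<Rightarrow> ('b \<times> 'b \<Rightarrow> 'k) set) \<Rightarrow> ('b \<Rightarrow> 'k) \<Rightarrow> (('b + 'b) list \<Rightarrow> 'k) set set
    \<Rightarrow> ((('b + 'b) list \<Rightarrow> 'k) set set \<times> (('b + 'b) list \<Rightarrow> 'k) set set \<Rightarrow> 'k) set"
  where "env_bar_comul K B bracket \<Delta> \<epsilon> Z =
    (let H = env_bar K B bracket \<epsilon>; \<pi> = env_proj K B bracket \<epsilon> in
      tensor_map K H H \<pi> \<pi> (env_comul K B bracket \<Delta> (SOME z. z \<in> Z)))"

definition env_bar_counit :: "('k, 'r) ring_scheme \<Rightarrow> ('b \<Rightarrow> 'k) \<Rightarrow> (('b + 'b) list \<Rightarrow> 'k) set set \<Rightarrow> 'k"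
  where "env_bar_counit K \<epsilon> Z = env_counit K \<epsilon> (SOME z. z \<in> Z)"

definition env_right_coaction :: "('k, 'r) ring_scheme \<Rightarrow> ('k, 'b, 'm) module_scheme
    \<Rightarrow> ('b \<Rightarrow> 'b \<Rightarrow> 'b) \<Rightarrow> ('b \<Rightarrow> ('b \<times> 'b \<Rightarrow> 'k) set) \<Rightarrow> ('b \<Rightarrow> 'k) \<Rightarrow> (('b + 'b) list \<Rightarrow> 'k) set
    \<Rightarrow> ((('b + 'b) list \<Rightarrow> 'k) set \<times> (('b + 'b) list \<Rightarrow> 'k) set set \<Rightarrow> 'k) set"
  where "env_right_coaction K B bracket \<Delta> \<epsilon> z =
    tensor_map K (env K B bracket) (env_bar K B bracket \<epsilon>) id (env_proj K B bracket \<epsilon>)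
      (env_comul K B bracket \<Delta> z)"

definition env_left_coaction :: "('k, 'r) ring_scheme \<Rightarrow> ('k, 'b, 'm) module_scheme
    \<Rightarrow> ('b \<Rightarrow> 'b \<Rightarrow> 'b) \<Rightarrow> ('b \<Rightarrow> ('b \<times> 'b \<Rightarrow> 'k) set) \<Rightarrow> ('b \<Rightarrow> 'k) \<Rightarrow> (('b + 'b) list \<Rightarrow> 'k) set
    \<Rightarrow> ((('b + 'b) list \<Rightarrow> 'k) set set \<times> (('b + 'b) list \<Rightarrow> 'k) set \<Rightarrow> 'k) set"
  where "env_left_coaction K B bracket \<Delta> \<epsilon> z =
    tensor_map K (env_bar K B bracket \<epsilon>) (env K B bracket) (env_proj K B bracket \<epsilon>) id
      (env_comul K B bracket \<Delta> z)"

definition right_coinvariants :: "('k, 'r) ring_scheme \<Rightarrow> ('k, 'b, 'm) module_scheme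
    \<Rightarrow> ('b \<Rightarrow> 'b \<Rightarrow> 'b) \<Rightarrow> ('b \<Rightarrow> ('b \<times> 'b \<Rightarrow> 'k) set) \<Rightarrow> ('b \<Rightarrow> 'k) \<Rightarrow> (('b + 'b) list \<Rightarrow> 'k) set set"
  where "right_coinvariants K B bracket \<Delta> \<epsilon> =
    (let U = env K B bracket; H = env_bar K B bracket \<epsilon> in
      {z \<in> carrier U. env_right_coaction K B bracket \<Delta> \<epsilon> z = pure K U H z \<one>\<^bsub>H\<^esub>})"

definition left_coinvariants :: "('k, 'r) ring_scheme \<Rightarrow> ('k, 'b, 'm) module_scheme
    \<Rightarrow> ('b \<Rightarrow> 'b \<Rightarrow> 'b) \<Rightarrow> ('b \<Rightarrow> ('b \<times> 'b \<Rightarrow> 'k) set) \<Rightarrow> ('b \<Rightarrow> 'k) \<Rightarrow> (('b + 'b) list \<Rightarrow> 'k) set set"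
  where "left_coinvariants K B bracket \<Delta> \<epsilon> =
    (let U = env K B bracket; H = env_bar K B bracket \<epsilon> in
      {z \<in> carrier U. env_left_coaction K B bracket \<Delta> \<epsilon> z = pure K H U \<one>\<^bsub>H\<^esub> z})"


section \<open>Comodules\<close>

definition right_comodule :: "('k, 'r) ring_scheme \<Rightarrow> ('k, 'c, 'n) module_scheme
    \<Rightarrow> ('c \<Rightarrow> ('c \<times> 'c \<Rightarrow> 'k) set) \<Rightarrow> ('c \<Rightarrow> 'k)
    \<Rightarrow> ('k, 'a, 'm) module_scheme \<Rightarrow> ('a \<Rightarrow> ('a \<times> 'c \<Rightarrow> 'k) set) \<Rightarrow> bool"
  where "right_comodule K C \<Delta> \<epsilon> M \<rho> \<longleftrightarrow>
    vectorspace K M \<and> \<rho> \<in> module_hom K M (tensor K M C) \<and>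
    (\<forall>x \<in> carrier M.
       tensor_assoc K M C C (tensor_map K (tensor K M C) C \<rho> id (\<rho> x))
         = tensor_map K M (tensor K C C) id \<Delta> (\<rho> x)
     \<and> tensor_lift K M (\<lambda>y c. \<epsilon> c \<odot>\<^bsub>M\<^esub> y) (\<rho> x) = x)"

definition comodule_hom :: "('k, 'r) ring_scheme \<Rightarrow> ('k, 'c, 'n) module_scheme
    \<Rightarrow> ('k, 'a, 'm) module_scheme \<Rightarrow> ('a \<Rightarrow> ('a \<times> 'c \<Rightarrow> 'k) set)
    \<Rightarrow> ('k, 'd, 'l) module_scheme \<Rightarrow> ('d \<Rightarrow> ('d \<times> 'c \<Rightarrow> 'k) set) \<Rightarrow> ('a \<Rightarrow> 'd) set"
  where "comodule_hom K C M \<rho> N \<sigma> =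
    {f \<in> module_hom K M N. \<forall>x \<in> carrier M. \<sigma> (f x) = tensor_map K N C f id (\<rho> x)}"

text \<open>
  The test comodules \<open>M\<close> and \<open>N\<close> live on the types given by the two type arguments; injectivity
  proper is the property for all such types.
\<close>

definition injective_right_comodule :: "'x itself \<Rightarrow> 'y itself \<Rightarrow> ('k, 'r) ring_scheme
    \<Rightarrow> ('k, 'c, 'n) module_scheme \<Rightarrow> ('c \<Rightarrow> ('c \<times> 'c \<Rightarrow> 'k) set) \<Rightarrow> ('c \<Rightarrow> 'k)
    \<Rightarrow> ('k, 'a, 'm) module_scheme \<Rightarrow> ('a \<Rightarrow> ('a \<times> 'c \<Rightarrow> 'k) set) \<Rightarrow> bool"
  where "injective_right_comodule TX TY K C \<Delta> \<epsilon> E \<rho> \<longleftrightarrow>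
    right_comodule K C \<Delta> \<epsilon> E \<rho> \<and>
    (\<forall>(M :: ('k, 'x) module) \<mu> (N :: ('k, 'y) module) \<nu> i f.
       right_comodule K C \<Delta> \<epsilon> M \<mu> \<longrightarrow> right_comodule K C \<Delta> \<epsilon> N \<nu> \<longrightarrow>
       i \<in> comodule_hom K C M \<mu> N \<nu> \<longrightarrow> inj_on i (carrier M) \<longrightarrow>
       f \<in> comodule_hom K C M \<mu> E \<rho> \<longrightarrow>
       (\<exists>g \<in> comodule_hom K C N \<nu> E \<rho>. \<forall>x \<in> carrier M. g (i x) = f x))"

end

theory Submission
  imports Defs
begin

text \<open>
  \<open>B\<close> is a module coalgebra over \<open>B\<^sup>e\<close>, where \<open>m\<^sub>a\<close> acts as multiplication by \<open>a\<close> and \<open>h\<^sub>a\<close> as \<open>{a, -}\<close>. Hence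
  \<open>p(z) = z \<cdot> 1\<close> is a left \<open>B\<close>-linear coalgebra map \<open>B\<^sup>e \<rightarrow> B\<close>, and \<open>(p \<otimes> id)\<Delta>\<close> makes \<open>B\<^sup>e\<close> a Hopf module over
  \<open>B\<close>. As in the fundamental theorem of Hopf modules, \<open>P(z) = S(p(z\<^sub>1)) z\<^sub>2\<close> satisfies \<open>P(bz) = \<epsilon>(b) P(z)\<close> and
  \<open>z = p(z\<^sub>1) P(z\<^sub>2)\<close>. Since \<open>P\<close> vanishes on \<open>B\<^sup>+B\<^sup>e = B\<^sup>eB\<^sup>+\<close>, it factors through \<open>H = \<H>(B)\<close>, and
  \<open>(p \<otimes> \<pi>)\<Delta>\<close> is an isomorphism \<open>B\<^sup>e \<rightarrow> B \<otimes> H\<close> of left \<open>B\<close>-modules and right \<open>H\<close>-comodules. Thus \<open>B\<^sup>e\<close> is free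
  over \<open>B\<close> and cofree over \<open>H\<close>, and \<open>z = p(z\<^sub>1) P(z\<^sub>2)\<close> shows \<open>z = p(z)\<close> for a right coinvariant \<open>z\<close>. For left
  coinvariants the same argument applies to \<open>z = p(z\<^sub>2) S(p(z\<^sub>3)) z\<^sub>1\<close>, which holds because \<open>B\<close> is commutative.
  No PBW theorem is needed.
\<close>

section \<open>Free vector spaces and quotients\<close>

text \<open>The overview takes two computations for granted. First, B^+ B^e = B^e B^+ rests on
  \<epsilon>({a,b}) = 0, which is not an axiom: applying \<epsilon> \<otimes> \<epsilon> to
  \<Delta>({a,b}) gives x = x + x. Moving \<open>h a\<close> past \<open>m c\<close> then costs
  \<open>m\<close> of {a,c}, and {a,c} is again in B^+. Second, P(bz) = \<epsilon>(b) P(z) comes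
  from S(b_1 t) b_2 = \<epsilon>(b) S(t), an argument with convolution inverses; for commutative B
  the mirrored S(b_2 t) b_1 = \<epsilon>(b) S(t) holds as well, and the left coinvariants depend on
  it. The obstacle is the encoding: tensors are cosets of functions, and every map out of a quotient
  picks a representative. Once \<open>hom_some_mem\<close> has disposed of the choice, maps are
  handled through linearity and their values on generators. A Sweedler sum is the lift of a bilinear
  test function, and an identity on B^e is proved for all test functions at once, by induction on
  left multiplication by \<open>m b\<close> and \<open>h b\<close>. Injectivity uses that K is a
  field: an injection of comodules has a linear retraction, and cofreeness turns the resulting
  linear extension into a colinear one.\<close>

definition free_lift :: "('k, 'r) ring_scheme \<Rightarrow> ('k, 'x, 'm) module_scheme \<Rightarrow> ('s \<Rightarrow> 'x) \<Rightarrow> ('s \<Rightarrow> 'k) \<Rightarrow> 'x"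
  where "free_lift K X \<phi> f = (\<Oplus>\<^bsub>X\<^esub>s\<in>{s. f s \<noteq> \<zero>\<^bsub>K\<^esub>}. f s \<odot>\<^bsub>X\<^esub> \<phi> s)"

lemma monoid_algebra_simps [simp]:
  "\<zero>\<^bsub>monoid_algebra K G\<^esub> = (\<lambda>s. \<zero>\<^bsub>K\<^esub>)"
  "f \<oplus>\<^bsub>monoid_algebra K G\<^esub> g = (\<lambda>s. f s \<oplus>\<^bsub>K\<^esub> g s)"
  "c \<odot>\<^bsub>monoid_algebra K G\<^esub> f = (\<lambda>s. c \<otimes>\<^bsub>K\<^esub> f s)"
  "\<one>\<^bsub>monoid_algebra K G\<^esub> = point_mass K \<one>\<^bsub>G\<^esub>"
  by (simp_all add: monoid_algebra_def)

lemma mem_monoid_algebra_iff: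
  "f \<in> carrier (monoid_algebra K G) \<longleftrightarrow> (\<forall>s\<in>carrier G. f s \<in> carrier K)
     \<and> (\<forall>s. s \<notin> carrier G \<longrightarrow> f s = \<zero>\<^bsub>K\<^esub>) \<and> finite {s. f s \<noteq> \<zero>\<^bsub>K\<^esub>}"
  by (auto simp: monoid_algebra_def)

context cring begin

lemma monoid_algebra_value_closed [simp]: "f \<in> carrier (monoid_algebra R G) \<Longrightarrow> f s \<in> carrier R"
  by (cases "s \<in> carrier G") (auto simp: mem_monoid_algebra_iff)

lemma monoid_algebra_add_closed:
  assumes "f \<in> carrier (monoid_algebra R G)" "g \<in> carrier (monoid_algebra R G)"
  shows "(\<lambda>s. f s \<oplus> g s) \<in> carrier (monoid_algebra R G)"
proof -
  have "finite ({s. f s \<noteq> \<zero>} \<union> {s. g s \<noteq> \<zero>})"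
    using assms by (auto simp: mem_monoid_algebra_iff)
  then have "finite {s. f s \<oplus> g s \<noteq> \<zero>}"
    by (rule rev_finite_subset) auto
  with assms show ?thesis by (auto simp: mem_monoid_algebra_iff)
qed

lemma monoid_algebra_smult_closed:
  assumes "c \<in> carrier R" "f \<in> carrier (monoid_algebra R G)"
  shows "(\<lambda>s. c \<otimes> f s) \<in> carrier (monoid_algebra R G)"
proof -
  have "finite {s. f s \<noteq> \<zero>}" using assms by (auto simp: mem_monoid_algebra_iff)
  then have "finite {s. c \<otimes> f s \<noteq> \<zero>}"
    by (rule rev_finite_subset) (use assms in auto)
  with assms show ?thesis by (auto simp: mem_monoid_algebra_iff)
qed

lemma point_mass_closed [simp]: "s \<in> carrier G \<Longrightarrow> point_mass R s \<in> carrier (monoid_algebra R G)"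
  by (auto simp: mem_monoid_algebra_iff point_mass_def)

lemma monoid_algebra_module: "module R (monoid_algebra R G)"
proof (rule moduleI)
  show "abelian_group (monoid_algebra R G)"
  proof (rule abelian_groupI)
    fix f assume f: "f \<in> carrier (monoid_algebra R G)"
    define g where "g = (\<lambda>s. \<ominus> \<one> \<otimes> f s)"
    have "g \<in> carrier (monoid_algebra R G)"
      unfolding g_def using f by (intro monoid_algebra_smult_closed) auto
    moreover have "(\<lambda>s. g s \<oplus> f s) = (\<lambda>s. \<zero>)"
      using f by (simp add: g_def l_minus l_neg fun_eq_iff)
    ultimately show "\<exists>g\<in>carrier (monoid_algebra R G). g \<oplus>\<^bsub>monoid_algebra R G\<^esub> f = \<zero>\<^bsub>monoid_algebra R G\<^esub>"
      unfolding monoid_algebra_simps by blast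
  qed (auto simp: monoid_algebra_add_closed a_ac mem_monoid_algebra_iff[of "\<lambda>s. \<zero>"])
qed (simp_all add: monoid_algebra_smult_closed l_distr r_distr m_assoc is_cring)

text \<open>Induction on the support, one basis vector at a time. Only the carrier of G occurs, so
  the rule serves words, pairs and plain index sets alike.\<close>

lemma monoid_algebra_induct [consumes 1, case_names zero add]:
  assumes f: "f \<in> carrier (monoid_algebra R G)"
    and zero: "P (\<lambda>s. \<zero>)"
    and add: "\<And>c s g. \<lbrakk>c \<in> carrier R; s \<in> carrier G; g \<in> carrier (monoid_algebra R G); P g\<rbrakk>
      \<Longrightarrow> P (c \<odot>\<^bsub>monoid_algebra R G\<^esub> point_mass R s \<oplus>\<^bsub>monoid_algebra R G\<^esub> g)"
  shows "P f"
proof -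
  have "finite {s. f s \<noteq> \<zero>}" using f by (simp add: mem_monoid_algebra_iff)
  then show ?thesis using f
  proof (induction "{s. f s \<noteq> \<zero>}" arbitrary: f rule: finite_induct)
    case empty
    then have "f = (\<lambda>s. \<zero>)" by auto
    then show ?case using zero by simp
  next
    case (insert s A)
    let ?g = "\<lambda>t. if t = s then \<zero> else f t"
    from insert.hyps have fs: "f s \<noteq> \<zero>" by auto
    have s: "s \<in> carrier G" using fs insert.prems by (auto simp: mem_monoid_algebra_iff)
    have A: "A = {t. ?g t \<noteq> \<zero>}" using insert.hyps by auto
    then have fin: "finite {t. ?g t \<noteq> \<zero>}" using insert.hyps by simp
    have g: "?g \<in> carrier (monoid_algebra R G)"
      using insert.prems fin by (auto simp: mem_monoid_algebra_iff)
    have "P ?g" using insert.hyps(3)[OF A g] .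
    moreover have "f = f s \<odot>\<^bsub>monoid_algebra R G\<^esub> point_mass R s \<oplus>\<^bsub>monoid_algebra R G\<^esub> ?g"
      using insert.prems by (auto simp: point_mass_def fun_eq_iff)
    ultimately show ?case using add[OF _ s g] insert.prems
      by (metis monoid_algebra_value_closed)
  qed
qed

end

lemma module_homI:
  assumes "\<And>x. x \<in> carrier M \<Longrightarrow> f x \<in> carrier N"
    and "\<And>x y. \<lbrakk>x \<in> carrier M; y \<in> carrier M\<rbrakk> \<Longrightarrow> f (x \<oplus>\<^bsub>M\<^esub> y) = f x \<oplus>\<^bsub>N\<^esub> f y"
    and "\<And>r x. \<lbrakk>r \<in> carrier R; x \<in> carrier M\<rbrakk> \<Longrightarrow> f (r \<odot>\<^bsub>M\<^esub> x) = r \<odot>\<^bsub>N\<^esub> f x"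
  shows "f \<in> module_hom R M N"
  using assms by (simp add: module_hom_def)

lemma module_hom_mem: "\<lbrakk>f \<in> module_hom R M N; x \<in> carrier M\<rbrakk> \<Longrightarrow> f x \<in> carrier N"
  by (auto simp: module_hom_def)

lemma module_hom_zero:
  assumes "module R M" "module R N" "f \<in> module_hom R M N"
  shows "f \<zero>\<^bsub>M\<^esub> = \<zero>\<^bsub>N\<^esub>"
proof -
  interpret mod_hom R M N f using assms by (simp add: mod_hom_def mod_hom_axioms_def)
  show ?thesis by simp
qed

lemma module_hom_minus:
  assumes "module R M" "module R N" "f \<in> module_hom R M N" "x \<in> carrier M" "y \<in> carrier M"
  shows "f (x \<ominus>\<^bsub>M\<^esub> y) = f x \<ominus>\<^bsub>N\<^esub> f y"
proof -
  interpret mod_hom R M N f using assms by (simp add: mod_hom_def mod_hom_axioms_def)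
  show ?thesis using assms by simp
qed

lemma module_hom_cong:
  assumes "f \<in> module_hom R M N" "module R M" "\<And>x. x \<in> carrier M \<Longrightarrow> f x = g x"
  shows "g \<in> module_hom R M N"
proof -
  interpret module R M by fact
  show ?thesis
    by (rule module_homI)
       (use assms(1) in \<open>auto simp: assms(3)[symmetric] module_hom_mem module_hom_add module_hom_smult\<close>)
qed

lemma module_hom_comp:
  assumes "f \<in> module_hom R N L" "g \<in> module_hom R M N"
  shows "(\<lambda>x. f (g x)) \<in> module_hom R M L"
  using assms by (auto simp: module_hom_def Pi_def)

lemma module_hom_id: "(\<lambda>x. x) \<in> module_hom R M M"
  by (auto simp: module_hom_def)

lemma module_hom_add_fun:
  assumes "module R N" "f \<in> module_hom R M N" "g \<in> module_hom R M N"
  shows "(\<lambda>x. f x \<oplus>\<^bsub>N\<^esub> g x) \<in> module_hom R M N"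
proof -
  interpret module R N by fact
  have "f x \<oplus>\<^bsub>N\<^esub> f y \<oplus>\<^bsub>N\<^esub> (g x \<oplus>\<^bsub>N\<^esub> g y) = f x \<oplus>\<^bsub>N\<^esub> g x \<oplus>\<^bsub>N\<^esub> (f y \<oplus>\<^bsub>N\<^esub> g y)"
    if "x \<in> carrier M" "y \<in> carrier M" for x y
    using that assms(2,3)[THEN module_hom_mem] by (simp add: M.a_ac)
  then show ?thesis
    using assms by (auto intro!: module_homI
        simp: module_hom_add module_hom_smult module_hom_mem smult_r_distr)
qed

lemma module_hom_smult_fun:
  assumes "module R N" "c \<in> carrier R" "f \<in> module_hom R M N"
  shows "(\<lambda>x. c \<odot>\<^bsub>N\<^esub> f x) \<in> module_hom R M N"
proof -
  interpret module R N by fact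
  have "c \<odot>\<^bsub>N\<^esub> (r \<odot>\<^bsub>N\<^esub> f x) = r \<odot>\<^bsub>N\<^esub> (c \<odot>\<^bsub>N\<^esub> f x)" if "r \<in> carrier R" "x \<in> carrier M" for r x
    using that assms smult_assoc1[of c r "f x"] smult_assoc1[of r c "f x"]
    by (simp add: m_comm module_hom_mem)
  then show ?thesis
    using assms by (auto intro!: module_homI
        simp: module_hom_add module_hom_smult module_hom_mem smult_r_distr)
qed

lemma module_hom_zero_fun: "module R M \<Longrightarrow> module R N \<Longrightarrow> (\<lambda>x. \<zero>\<^bsub>N\<^esub>) \<in> module_hom R M N"
proof -
  assume "module R M" "module R N"
  then interpret M: module R M + N: module R N by auto
  show ?thesis by (auto intro!: module_homI)
qed

text \<open>Enlarging the index set beyond the support adds zero terms only. This provides a common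
  index set for two functions and their sum.\<close>

lemma free_lift_eq_finsum:
  assumes X: "module K X" and \<phi>: "\<phi> \<in> carrier G \<rightarrow> carrier X"
    and f: "f \<in> carrier (monoid_algebra K G)"
    and A: "finite A" "{s. f s \<noteq> \<zero>\<^bsub>K\<^esub>} \<subseteq> A" "A \<subseteq> carrier G"
  shows "free_lift K X \<phi> f = (\<Oplus>\<^bsub>X\<^esub>s\<in>A. f s \<odot>\<^bsub>X\<^esub> \<phi> s)"
proof -
  interpret module K X by fact
  show ?thesis unfolding free_lift_def
    by (rule M.add.finprod_mono_neutral_cong_left) (use A f \<phi> in \<open>auto simp: Pi_def\<close>)
qed

lemma free_lift_module_hom:
  assumes X: "module K X" and \<phi>: "\<phi> \<in> carrier G \<rightarrow> carrier X"
  shows "free_lift K X \<phi> \<in> module_hom K (monoid_algebra K G) X"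
proof -
  interpret module K X by fact
  let ?F = "monoid_algebra K G"
  interpret F: module K ?F by (rule monoid_algebra_module)
  have supp: "finite {s. f s \<noteq> \<zero>\<^bsub>K\<^esub>}" "{s. f s \<noteq> \<zero>\<^bsub>K\<^esub>} \<subseteq> carrier G"
    if "f \<in> carrier ?F" for f using that by (auto simp: mem_monoid_algebra_iff)
  show ?thesis
  proof (rule module_homI)
    fix f assume f: "f \<in> carrier ?F"
    then show "free_lift K X \<phi> f \<in> carrier X" unfolding free_lift_def
      using supp[OF f] \<phi> by (auto intro!: M.finsum_closed simp: Pi_def)
  next
    fix f g assume f: "f \<in> carrier ?F" and g: "g \<in> carrier ?F"
    let ?A = "{s. f s \<noteq> \<zero>\<^bsub>K\<^esub>} \<union> {s. g s \<noteq> \<zero>\<^bsub>K\<^esub>}"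
    have "free_lift K X \<phi> (f \<oplus>\<^bsub>?F\<^esub> g) = (\<Oplus>\<^bsub>X\<^esub>s\<in>?A. (f \<oplus>\<^bsub>?F\<^esub> g) s \<odot>\<^bsub>X\<^esub> \<phi> s)"
      by (rule free_lift_eq_finsum[OF X \<phi>]) (use f g supp[OF f] supp[OF g] in \<open>auto simp: monoid_algebra_add_closed\<close>)
    also have "\<dots> = (\<Oplus>\<^bsub>X\<^esub>s\<in>?A. f s \<odot>\<^bsub>X\<^esub> \<phi> s \<oplus>\<^bsub>X\<^esub> g s \<odot>\<^bsub>X\<^esub> \<phi> s)"
      by (rule M.finsum_cong') (use f g \<phi> supp[OF f] supp[OF g] in \<open>auto simp: smult_l_distr Pi_def subset_iff\<close>)
    also have "\<dots> = (\<Oplus>\<^bsub>X\<^esub>s\<in>?A. f s \<odot>\<^bsub>X\<^esub> \<phi> s) \<oplus>\<^bsub>X\<^esub> (\<Oplus>\<^bsub>X\<^esub>s\<in>?A. g s \<odot>\<^bsub>X\<^esub> \<phi> s)"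
      by (rule M.finsum_addf) (use f g \<phi> supp[OF f] supp[OF g] in \<open>auto simp: Pi_def subset_iff\<close>)
    also have "\<dots> = free_lift K X \<phi> f \<oplus>\<^bsub>X\<^esub> free_lift K X \<phi> g"
      using free_lift_eq_finsum[OF X \<phi> f, of ?A] free_lift_eq_finsum[OF X \<phi> g, of ?A] supp[OF f] supp[OF g] by auto
    finally show "free_lift K X \<phi> (f \<oplus>\<^bsub>?F\<^esub> g) = \<dots>" .
  next
    fix r f assume r: "r \<in> carrier K" and f: "f \<in> carrier ?F"
    let ?A = "{s. f s \<noteq> \<zero>\<^bsub>K\<^esub>}"
    have "free_lift K X \<phi> (r \<odot>\<^bsub>?F\<^esub> f) = (\<Oplus>\<^bsub>X\<^esub>s\<in>?A. (r \<odot>\<^bsub>?F\<^esub> f) s \<odot>\<^bsub>X\<^esub> \<phi> s)"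
      by (rule free_lift_eq_finsum[OF X \<phi>]) (use f r supp[OF f] in \<open>auto simp: monoid_algebra_smult_closed\<close>)
    also have "\<dots> = (\<Oplus>\<^bsub>X\<^esub>s\<in>?A. r \<odot>\<^bsub>X\<^esub> (f s \<odot>\<^bsub>X\<^esub> \<phi> s))"
      by (rule M.finsum_cong') (use f r \<phi> supp[OF f] in \<open>auto simp: smult_assoc1 Pi_def subset_iff\<close>)
    also have "\<dots> = r \<odot>\<^bsub>X\<^esub> free_lift K X \<phi> f" unfolding free_lift_def
      by (rule finsum_smult[symmetric]) (use f r \<phi> supp[OF f] in \<open>auto simp: Pi_def subset_iff\<close>)
    finally show "free_lift K X \<phi> (r \<odot>\<^bsub>?F\<^esub> f) = r \<odot>\<^bsub>X\<^esub> free_lift K X \<phi> f" .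
  qed
qed

lemma free_lift_point_mass:
  assumes X: "module K X" and \<phi>: "\<phi> s \<in> carrier X"
  shows "free_lift K X \<phi> (point_mass K s) = \<phi> s"
proof -
  interpret module K X by fact
  show ?thesis
  proof (cases "\<one>\<^bsub>K\<^esub> = \<zero>\<^bsub>K\<^esub>")
    \<comment> \<open>A module over a commutative ring allows 1 = 0. Then the point mass is the zero
      function, and X is trivial because 1 acts as the identity.\<close>
    case True
    have "\<phi> s = \<one>\<^bsub>K\<^esub> \<odot>\<^bsub>X\<^esub> \<phi> s" using \<phi> by simp
    also have "\<dots> = \<zero>\<^bsub>X\<^esub>" using True \<phi> by simp
    finally have "\<phi> s = \<zero>\<^bsub>X\<^esub>" .
    with True show ?thesis by (auto simp: free_lift_def point_mass_def)
  next
    case False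
    then have "{t. point_mass K s t \<noteq> \<zero>\<^bsub>K\<^esub>} = {s}" by (auto simp: point_mass_def)
    then show ?thesis using \<phi> by (simp add: free_lift_def) (simp add: point_mass_def)
  qed
qed

lemma module_hom_eq_on_monoid_algebra:
  assumes X: "module K X" and f: "f \<in> module_hom K (monoid_algebra K G) X" and g: "g \<in> module_hom K (monoid_algebra K G) X"
    and eq: "\<And>s. s \<in> carrier G \<Longrightarrow> f (point_mass K s) = g (point_mass K s)"
    and x: "x \<in> carrier (monoid_algebra K G)"
  shows "f x = g x"
proof -
  interpret X: module K X by fact
  interpret F: module K "monoid_algebra K G" by (rule X.monoid_algebra_module)
  show ?thesis using x
  proof (induction rule: X.monoid_algebra_induct)
    case zero
    then show ?case using module_hom_zero[OF F.module_axioms X f] module_hom_zero[OF F.module_axioms X g] by simp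
  next
    case (add c s h)
    then show ?case using f g eq
      by (simp only: module_hom_add module_hom_smult F.smult_closed X.point_mass_closed)
  qed
qed


section \<open>Quotients by subspaces\<close>

lemma module_minus_eq:
  assumes "module R M" "x \<in> carrier M"
  shows "\<ominus>\<^bsub>M\<^esub> x = (\<ominus>\<^bsub>R\<^esub> \<one>\<^bsub>R\<^esub>) \<odot>\<^bsub>M\<^esub> x"
proof -
  interpret module R M by fact
  show ?thesis using assms(2) by (simp add: smult_l_minus)
qed

lemma submodule_abelian_subgroup:
  assumes "submodule R N M"
  shows "abelian_subgroup N M"
proof -
  interpret submodule R N M by fact
  interpret module R M by (rule module)
  have "\<ominus>\<^bsub>M\<^esub> x \<in> N" if "x \<in> N" for x
    using that subset module_minus_eq[OF module, of x] smult_closed[of "\<ominus>\<^bsub>R\<^esub> \<one>\<^bsub>R\<^esub>" x] by auto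
  then show ?thesis
    by (intro abelian_subgroupI3 additive_subgroup.intro add.subgroupI notI is_abelian_group)
       (use subset submodule.zero_closed[OF assms] M.abelian_group_axioms in \<open>auto simp: a_inv_def \<close>)
qed

lemma quot_algebra_simps:
  "carrier (quot_algebra A I) = a_rcosets\<^bsub>A\<^esub> I"
  "\<zero>\<^bsub>quot_algebra A I\<^esub> = I"
  "\<one>\<^bsub>quot_algebra A I\<^esub> = I +>\<^bsub>A\<^esub> \<one>\<^bsub>A\<^esub>"
  "X \<oplus>\<^bsub>quot_algebra A I\<^esub> Y = X <+>\<^bsub>A\<^esub> Y"
  "X \<otimes>\<^bsub>quot_algebra A I\<^esub> Y = rcoset_mult A I X Y"
  "c \<odot>\<^bsub>quot_algebra A I\<^esub> X = (\<Union>x\<in>X. I +>\<^bsub>A\<^esub> (c \<odot>\<^bsub>A\<^esub> x))"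
  by (simp_all add: quot_algebra_def FactRing_def ring.defs module.defs)

lemma (in module) smult_r_diff:
  assumes "c \<in> carrier R" "x \<in> carrier M" "y \<in> carrier M"
  shows "c \<odot>\<^bsub>M\<^esub> (y \<ominus>\<^bsub>M\<^esub> x) = c \<odot>\<^bsub>M\<^esub> y \<ominus>\<^bsub>M\<^esub> c \<odot>\<^bsub>M\<^esub> x"
  unfolding a_minus_def using assms by (simp add: smult_r_distr smult_r_minus)

locale quotient_space = module K A + sub: submodule K I A
  for K :: "('k, 'r) ring_scheme" (structure) and A :: "('k, 'a, 'm) module_scheme" and I
begin

abbreviation Q where "Q \<equiv> quot_algebra A I"
abbreviation proj where "proj x \<equiv> I +>\<^bsub>A\<^esub> x"

interpretation I: abelian_subgroup I A
  by (rule submodule_abelian_subgroup) (rule sub.submodule_axioms)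

lemma carrier_Q: "carrier Q = proj ` carrier A"
  by (auto simp: quot_algebra_simps A_RCOSETS_defs a_r_coset_def)

lemma proj_closed: "x \<in> carrier A \<Longrightarrow> proj x \<in> carrier Q"
  by (auto simp: carrier_Q)

lemma proj_eq_iff:
  assumes "x \<in> carrier A" "y \<in> carrier A"
  shows "proj x = proj y \<longleftrightarrow> x \<ominus>\<^bsub>A\<^esub> y \<in> I"
proof -
  have "proj x = proj y \<longleftrightarrow> x \<in> proj y"
    using assms M.a_repr_independence[of x I y] I.a_subgroup I.a_rcos_self[of x] by auto
  then show ?thesis
    using I.a_rcos_module[of y x] assms by (simp add: a_minus_def)
qed

lemma mem_proj: "\<lbrakk>x \<in> carrier A; y \<in> proj x\<rbrakk> \<Longrightarrow> y \<in> carrier A \<and> proj y = proj x"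
  using M.a_repr_independence[of y I x] I.a_subgroup M.a_r_coset_subset_G[of I x] sub.subset by auto

lemma proj_self: "x \<in> carrier A \<Longrightarrow> x \<in> proj x"
  by (rule I.a_rcos_self)

lemma Q_add: "\<lbrakk>x \<in> carrier A; y \<in> carrier A\<rbrakk> \<Longrightarrow> proj x \<oplus>\<^bsub>Q\<^esub> proj y = proj (x \<oplus>\<^bsub>A\<^esub> y)"
  by (simp add: quot_algebra_simps I.a_rcos_sum)

lemma Q_zero: "\<zero>\<^bsub>Q\<^esub> = proj \<zero>\<^bsub>A\<^esub>"
  using sub.subset by (simp add: quot_algebra_simps M.a_coset_add_zero)

lemma Q_smult:
  assumes c: "c \<in> carrier K" and x: "x \<in> carrier A"
  shows "c \<odot>\<^bsub>Q\<^esub> proj x = proj (c \<odot>\<^bsub>A\<^esub> x)"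
proof -
  have "proj (c \<odot>\<^bsub>A\<^esub> y) = proj (c \<odot>\<^bsub>A\<^esub> x)" if "y \<in> proj x" for y
  proof -
    have y: "y \<in> carrier A" "proj y = proj x" using mem_proj[OF x that] by auto
    then have "c \<odot>\<^bsub>A\<^esub> (y \<ominus>\<^bsub>A\<^esub> x) \<in> I" using proj_eq_iff[of y x] x c by simp
    moreover have "c \<odot>\<^bsub>A\<^esub> (y \<ominus>\<^bsub>A\<^esub> x) = c \<odot>\<^bsub>A\<^esub> y \<ominus>\<^bsub>A\<^esub> c \<odot>\<^bsub>A\<^esub> x"
      using c x y(1) by (rule smult_r_diff)
    ultimately have "c \<odot>\<^bsub>A\<^esub> y \<ominus>\<^bsub>A\<^esub> c \<odot>\<^bsub>A\<^esub> x \<in> I" by metis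
    then show ?thesis using proj_eq_iff[of "c \<odot>\<^bsub>A\<^esub> y" "c \<odot>\<^bsub>A\<^esub> x"] c x y by simp
  qed
  then have "(\<Union>y\<in>proj x. proj (c \<odot>\<^bsub>A\<^esub> y)) = proj (c \<odot>\<^bsub>A\<^esub> x)" using proj_self[OF x] by blast
  then show ?thesis by (simp only: quot_algebra_simps)
qed

lemma proj_hom: "proj \<in> module_hom K A Q"
  by (rule module_homI) (simp_all add: proj_closed Q_add Q_smult)

lemma module_Q: "module K Q"
proof (rule moduleI)
  show "abelian_group Q"
  proof (rule abelian_groupI)
    fix X assume "X \<in> carrier Q"
    then obtain x where x: "x \<in> carrier A" "X = proj x" by (auto simp: carrier_Q)
    then have "proj (\<ominus>\<^bsub>A\<^esub> x) \<oplus>\<^bsub>Q\<^esub> X = \<zero>\<^bsub>Q\<^esub>" by (simp add: Q_add Q_zero M.l_neg)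
    with x show "\<exists>Y\<in>carrier Q. Y \<oplus>\<^bsub>Q\<^esub> X = \<zero>\<^bsub>Q\<^esub>" using proj_closed by blast
  qed (auto simp: carrier_Q Q_add Q_zero M.a_ac)
qed (auto simp: carrier_Q Q_add Q_smult smult_l_distr smult_r_distr smult_assoc1 is_cring)

text \<open>Two representatives of a coset differ by an element of \<open>I\<close>, on which g
  vanishes. Every definition by \<open>SOME\<close> in the development is justified through this
  lemma.\<close>

lemma hom_some_mem:
  assumes X: "module K X" and g: "g \<in> module_hom K A X" and null: "\<And>y. y \<in> I \<Longrightarrow> g y = \<zero>\<^bsub>X\<^esub>"
    and x: "x \<in> carrier A"
  shows "g (SOME y. y \<in> proj x) = g x"
proof -
  interpret X: module K X by fact
  define y where "y = (SOME y. y \<in> proj x)"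
  have "y \<in> proj x" unfolding y_def using proj_self[OF x] by (rule someI)
  then have y: "y \<in> carrier A" "proj y = proj x" using mem_proj[OF x] by auto
  then have "g (y \<ominus>\<^bsub>A\<^esub> x) = \<zero>\<^bsub>X\<^esub>" using proj_eq_iff[of y x] x null by simp
  then have "g y \<ominus>\<^bsub>X\<^esub> g x = \<zero>\<^bsub>X\<^esub>"
    using module_hom_minus[OF module_axioms X g] x y by simp
  then show ?thesis using g x y by (simp add: y_def[symmetric] module_hom_mem)
qed

text \<open>Here h is a bare function, typically one defined by choosing representatives; agreement
  with a linear map on representatives makes it linear.\<close>

lemma hom_from_Q:
  assumes "g \<in> module_hom K A X" "\<And>x. x \<in> carrier A \<Longrightarrow> h (proj x) = g x"
  shows "h \<in> module_hom K Q X"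
  using assms by (intro module_homI) (auto simp: carrier_Q Q_add Q_smult module_hom_mem module_hom_add module_hom_smult)

end

section \<open>Tensor products\<close>

text \<open>Phrased through \<open>module_hom\<close> in each argument separately, so that
  bilinearity goals split into linearity goals, which are closed by composing introduction
  rules.\<close>

definition bilin :: "('k, 'r) ring_scheme \<Rightarrow> ('k, 'v, 'm) module_scheme \<Rightarrow> ('k, 'w, 'n) module_scheme
    \<Rightarrow> ('k, 'x, 'l) module_scheme \<Rightarrow> ('v \<Rightarrow> 'w \<Rightarrow> 'x) \<Rightarrow> bool"
  where "bilin K V W X \<beta> \<longleftrightarrow>
    (\<forall>w\<in>carrier W. (\<lambda>v. \<beta> v w) \<in> module_hom K V X) \<and> (\<forall>v\<in>carrier V. (\<lambda>w. \<beta> v w) \<in> module_hom K W X)"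

lemma bilinI:
  assumes "\<And>w. w \<in> carrier W \<Longrightarrow> (\<lambda>v. \<beta> v w) \<in> module_hom K V X"
    and "\<And>v. v \<in> carrier V \<Longrightarrow> (\<lambda>w. \<beta> v w) \<in> module_hom K W X"
  shows "bilin K V W X \<beta>"
  using assms by (simp add: bilin_def)

lemma bilin_mem: "\<lbrakk>bilin K V W X \<beta>; v \<in> carrier V; w \<in> carrier W\<rbrakk> \<Longrightarrow> \<beta> v w \<in> carrier X"
  using module_hom_mem[of "\<beta> v" K W X w] by (simp add: bilin_def)

lemma bilin_left: "\<lbrakk>bilin K V W X \<beta>; w \<in> carrier W\<rbrakk> \<Longrightarrow> (\<lambda>v. \<beta> v w) \<in> module_hom K V X"
  and bilin_right: "\<lbrakk>bilin K V W X \<beta>; v \<in> carrier V\<rbrakk> \<Longrightarrow> \<beta> v \<in> module_hom K W X"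
  by (simp_all add: bilin_def)

locale two_modules = V: module K V + W: module K W
  for K :: "('k, 'r) ring_scheme" (structure) and V :: "('k, 'v, 'm) module_scheme"
    and W :: "('k, 'w, 'n) module_scheme"
begin

abbreviation F where "F \<equiv> monoid_algebra K (V \<times>\<times> W)"
abbreviation e where "e v w \<equiv> point_mass K (v, w)"
abbreviation T where "T \<equiv> tensor K V W"

lemma e_closed: "\<lbrakk>v \<in> carrier V; w \<in> carrier W\<rbrakk> \<Longrightarrow> e v w \<in> carrier F"
  by (rule V.point_mass_closed) (simp add: DirProd_def)

interpretation F: module K F by (rule V.monoid_algebra_module)

lemma tensor_rels_cases [consumes 1]:
  assumes "r \<in> tensor_rels K V W"
  obtains (add_left) v v' w where "v \<in> carrier V" "v' \<in> carrier V" "w \<in> carrier W"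
      "r = e (v \<oplus>\<^bsub>V\<^esub> v') w \<ominus>\<^bsub>F\<^esub> (e v w \<oplus>\<^bsub>F\<^esub> e v' w)"
    | (add_right) v w w' where "v \<in> carrier V" "w \<in> carrier W" "w' \<in> carrier W"
      "r = e v (w \<oplus>\<^bsub>W\<^esub> w') \<ominus>\<^bsub>F\<^esub> (e v w \<oplus>\<^bsub>F\<^esub> e v w')"
    | (smult_left) c v w where "c \<in> carrier K" "v \<in> carrier V" "w \<in> carrier W"
      "r = e (c \<odot>\<^bsub>V\<^esub> v) w \<ominus>\<^bsub>F\<^esub> c \<odot>\<^bsub>F\<^esub> e v w"
    | (smult_right) c v w where "c \<in> carrier K" "v \<in> carrier V" "w \<in> carrier W"
      "r = e v (c \<odot>\<^bsub>W\<^esub> w) \<ominus>\<^bsub>F\<^esub> c \<odot>\<^bsub>F\<^esub> e v w"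
  using assms unfolding tensor_rels_def Let_def
  by (elim UnE CollectE exE conjE) (erule (3) that | erule (2) that)+

lemma tensor_relsI:
  "\<lbrakk>v \<in> carrier V; v' \<in> carrier V; w \<in> carrier W\<rbrakk> \<Longrightarrow>
    e (v \<oplus>\<^bsub>V\<^esub> v') w \<ominus>\<^bsub>F\<^esub> (e v w \<oplus>\<^bsub>F\<^esub> e v' w) \<in> tensor_rels K V W"
  "\<lbrakk>v \<in> carrier V; w \<in> carrier W; w' \<in> carrier W\<rbrakk> \<Longrightarrow>
    e v (w \<oplus>\<^bsub>W\<^esub> w') \<ominus>\<^bsub>F\<^esub> (e v w \<oplus>\<^bsub>F\<^esub> e v w') \<in> tensor_rels K V W"
  "\<lbrakk>c \<in> carrier K; v \<in> carrier V; w \<in> carrier W\<rbrakk> \<Longrightarrow>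
    e (c \<odot>\<^bsub>V\<^esub> v) w \<ominus>\<^bsub>F\<^esub> c \<odot>\<^bsub>F\<^esub> e v w \<in> tensor_rels K V W"
  "\<lbrakk>c \<in> carrier K; v \<in> carrier V; w \<in> carrier W\<rbrakk> \<Longrightarrow>
    e v (c \<odot>\<^bsub>W\<^esub> w) \<ominus>\<^bsub>F\<^esub> c \<odot>\<^bsub>F\<^esub> e v w \<in> tensor_rels K V W"
  unfolding tensor_rels_def Let_def by blast+

lemma tensor_rels_closed: "tensor_rels K V W \<subseteq> carrier F"
  by (rule subsetI, erule tensor_rels_cases)
     (simp_all only: F.minus_closed F.add.m_closed F.smult_closed e_closed V.M.add.m_closed
       W.M.add.m_closed V.smult_closed W.smult_closed)

lemma submodule_tensor_null: "submodule K (tensor_null K V W) F"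
  unfolding tensor_null_def by (rule F.span_is_submodule[OF tensor_rels_closed])

lemma tensor_rels_null: "r \<in> tensor_rels K V W \<Longrightarrow> r \<in> tensor_null K V W"
  unfolding tensor_null_def using F.in_own_span[OF tensor_rels_closed] by auto

lemma tensor_null_subset: 
  assumes "submodule K N F" "tensor_rels K V W \<subseteq> N"
  shows "tensor_null K V W \<subseteq> N"
  unfolding tensor_null_def using assms F.span_is_subset by auto

sublocale Q: quotient_space K F "tensor_null K V W"
  by (intro quotient_space.intro submodule_tensor_null F.module_axioms)

lemma module_tensor: "module K T"
  unfolding tensor_def by (rule Q.module_Q)

lemma pure_eq_proj: "pure K V W v w = Q.proj (e v w)"
  by (simp add: pure_def)

lemma pure_closed: "\<lbrakk>v \<in> carrier V; w \<in> carrier W\<rbrakk> \<Longrightarrow> pure K V W v w \<in> carrier T"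
  unfolding tensor_def pure_eq_proj by (intro Q.proj_closed e_closed)

lemma pure_bilin: "bilin K V W T (pure K V W)"
proof (intro bilinI module_homI; (simp add: pure_closed)?)
  fix v v' w assume *: "v \<in> carrier V" "v' \<in> carrier V" "w \<in> carrier W"
  then have "Q.proj (e (v \<oplus>\<^bsub>V\<^esub> v') w) = Q.proj (e v w \<oplus>\<^bsub>F\<^esub> e v' w)"
    by (subst Q.proj_eq_iff)
      (auto intro!: tensor_rels_null tensor_relsI e_closed F.add.m_closed simp del: monoid_algebra_simps)
  with * show "pure K V W (v \<oplus>\<^bsub>V\<^esub> v') w = pure K V W v w \<oplus>\<^bsub>T\<^esub> pure K V W v' w"
    by (simp only: pure_eq_proj tensor_def Q.Q_add e_closed)
next
  fix v w w' assume *: "v \<in> carrier V" "w \<in> carrier W" "w' \<in> carrier W"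
  then have "Q.proj (e v (w \<oplus>\<^bsub>W\<^esub> w')) = Q.proj (e v w \<oplus>\<^bsub>F\<^esub> e v w')"
    by (subst Q.proj_eq_iff)
      (auto intro!: tensor_rels_null tensor_relsI e_closed F.add.m_closed simp del: monoid_algebra_simps)
  with * show "pure K V W v (w \<oplus>\<^bsub>W\<^esub> w') = pure K V W v w \<oplus>\<^bsub>T\<^esub> pure K V W v w'"
    by (simp only: pure_eq_proj tensor_def Q.Q_add e_closed)
next
  fix c v w assume *: "c \<in> carrier K" "v \<in> carrier V" "w \<in> carrier W"
  then have "Q.proj (e (c \<odot>\<^bsub>V\<^esub> v) w) = Q.proj (c \<odot>\<^bsub>F\<^esub> e v w)"
    by (subst Q.proj_eq_iff)
      (auto intro!: tensor_rels_null tensor_relsI e_closed F.smult_closed simp del: monoid_algebra_simps)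
  with * show "pure K V W (c \<odot>\<^bsub>V\<^esub> v) w = c \<odot>\<^bsub>T\<^esub> pure K V W v w"
    by (simp only: pure_eq_proj tensor_def Q.Q_smult e_closed)
  from * have "Q.proj (e v (c \<odot>\<^bsub>W\<^esub> w)) = Q.proj (c \<odot>\<^bsub>F\<^esub> e v w)"
    by (subst Q.proj_eq_iff)
      (auto intro!: tensor_rels_null tensor_relsI e_closed F.smult_closed simp del: monoid_algebra_simps)
  with * show "pure K V W v (c \<odot>\<^bsub>W\<^esub> w) = c \<odot>\<^bsub>T\<^esub> pure K V W v w"
    by (simp only: pure_eq_proj tensor_def Q.Q_smult e_closed)
qed

lemma tensor_cases:
  assumes "t \<in> carrier T"
  obtains f where "f \<in> carrier F" "t = Q.proj f"
  using assms unfolding tensor_def Q.carrier_Q by auto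

text \<open>A scalar is absorbed into the left factor, and zero is the pure tensor of two zeros.
  Hence sums of pure tensors exhaust the product and neither case has to be supplied.\<close>

lemma tensor_induct [consumes 1, case_names pure add]:
  assumes t: "t \<in> carrier T"
    and pure: "\<And>v w. \<lbrakk>v \<in> carrier V; w \<in> carrier W\<rbrakk> \<Longrightarrow> P (pure K V W v w)"
    and add: "\<And>t u. \<lbrakk>t \<in> carrier T; u \<in> carrier T; P t; P u\<rbrakk> \<Longrightarrow> P (t \<oplus>\<^bsub>T\<^esub> u)"
  shows "P t"
proof -
  interpret T: module K T by (rule module_tensor)
  obtain f where f: "f \<in> carrier F" "t = Q.proj f" using t by (rule tensor_cases)
  have "P (Q.proj f)" using f(1)
  proof (induction rule: V.monoid_algebra_induct)
    case zero
    have "Q.proj (\<lambda>s. \<zero>) = \<zero>\<^bsub>T\<^esub>" using Q.Q_zero by (simp add: tensor_def)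
    also have "\<dots> = pure K V W \<zero>\<^bsub>V\<^esub> \<zero>\<^bsub>W\<^esub>"
      using module_hom_zero[OF V.module_axioms module_tensor bilin_left[OF pure_bilin]] by simp
    finally show ?case using pure by simp
  next
    case (add c s g)
    obtain v w where s: "s = (v, w)" "v \<in> carrier V" "w \<in> carrier W" using add(2) by (auto simp: DirProd_def)
    have "Q.proj (c \<odot>\<^bsub>F\<^esub> e v w) = pure K V W (c \<odot>\<^bsub>V\<^esub> v) w"
      using module_hom_smult[OF bilin_left[OF pure_bilin s(3)] add(1) s(2)] s add(1)
      by (simp only: pure_eq_proj tensor_def Q.Q_smult e_closed)
    then have "Q.proj (c \<odot>\<^bsub>F\<^esub> e v w \<oplus>\<^bsub>F\<^esub> g) = pure K V W (c \<odot>\<^bsub>V\<^esub> v) w \<oplus>\<^bsub>T\<^esub> Q.proj g"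
      using add(1,3) s(2,3) by (metis Q.Q_add F.smult_closed e_closed tensor_def)
    moreover have "P (pure K V W (c \<odot>\<^bsub>V\<^esub> v) w \<oplus>\<^bsub>T\<^esub> Q.proj g)"
      using add s by (intro assms(3) pure pure_closed) (auto simp: tensor_def Q.proj_closed)
    ultimately show ?case by (simp only: s(1))
  qed
  with f show ?thesis by simp
qed

lemma tensor_hom_eqI:
  assumes "f \<in> module_hom K T X" "g \<in> module_hom K T X"
    and "\<And>v w. \<lbrakk>v \<in> carrier V; w \<in> carrier W\<rbrakk> \<Longrightarrow> f (pure K V W v w) = g (pure K V W v w)"
    and "t \<in> carrier T"
  shows "f t = g t"
  using assms(4)
  by (induction rule: tensor_induct)
     (simp_all add: assms(3) module_hom_add[OF assms(1)] module_hom_add[OF assms(2)])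

context
  fixes X :: "('k, 'x, 'l) module_scheme" and \<beta>
  assumes X: "module K X" and \<beta>: "bilin K V W X \<beta>"
begin

lemma free_lift_bilin_hom: "free_lift K X (\<lambda>(v, w). \<beta> v w) \<in> module_hom K F X"
  using X by (rule free_lift_module_hom) (auto simp: DirProd_def intro: bilin_mem[OF \<beta>])

lemma free_lift_bilin_e: "\<lbrakk>v \<in> carrier V; w \<in> carrier W\<rbrakk> \<Longrightarrow> free_lift K X (\<lambda>(v, w). \<beta> v w) (e v w) = \<beta> v w"
  using free_lift_point_mass[OF X, of "\<lambda>(v, w). \<beta> v w" "(v, w)"] bilin_mem[OF \<beta>] by simp

text \<open>The kernel of the lifted map is a submodule, and bilinearity puts the four kinds of
  relations into it; so it contains their span.\<close>

lemma free_lift_tensor_null: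
  assumes "y \<in> tensor_null K V W"
  shows "free_lift K X (\<lambda>(v, w). \<beta> v w) y = \<zero>\<^bsub>X\<^esub>"
proof -
  interpret X: module K X by (rule X)
  let ?f = "free_lift K X (\<lambda>(v, w). \<beta> v w)"
  interpret f: mod_hom K F X ?f
    by (simp add: mod_hom_def mod_hom_axioms_def F.module_axioms X free_lift_bilin_hom)
  note hom = module_hom_add[OF bilin_left[OF \<beta>]] module_hom_smult[OF bilin_left[OF \<beta>]]
    module_hom_add[OF bilin_right[OF \<beta>]] module_hom_smult[OF bilin_right[OF \<beta>]]
  have "?f r = \<zero>\<^bsub>X\<^esub>" if "r \<in> tensor_rels K V W" for r
    using that
    by (cases rule: tensor_rels_cases)
       (simp_all del: monoid_algebra_simps
         add: e_closed free_lift_bilin_e hom bilin_mem[OF \<beta>])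
  then have "tensor_rels K V W \<subseteq> f.ker"
    using tensor_rels_closed by (auto simp: f.ker_def)
  then have "tensor_null K V W \<subseteq> f.ker" by (rule tensor_null_subset[OF f.ker_is_submodule])
  with assms show ?thesis by (auto simp: f.ker_def)
qed

lemma tensor_lift_proj:
  assumes "f \<in> carrier F"
  shows "tensor_lift K X \<beta> (Q.proj f) = free_lift K X (\<lambda>(v, w). \<beta> v w) f"
  using Q.hom_some_mem[OF X free_lift_bilin_hom free_lift_tensor_null assms]
  by (simp add: tensor_lift_def lin_ext_def free_lift_def Let_def)

lemma tensor_lift_hom: "tensor_lift K X \<beta> \<in> module_hom K T X"
  unfolding tensor_def by (rule Q.hom_from_Q[OF free_lift_bilin_hom tensor_lift_proj])

lemma tensor_lift_pure:
  "\<lbrakk>v \<in> carrier V; w \<in> carrier W\<rbrakk> \<Longrightarrow> tensor_lift K X \<beta> (pure K V W v w) = \<beta> v w"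
  by (simp add: pure_eq_proj tensor_lift_proj e_closed free_lift_bilin_e)

end

lemma hom_tensor_lift:
  assumes X: "module K X" and Y: "module K Y" and \<beta>: "bilin K V W X \<beta>"
    and f: "f \<in> module_hom K X Y" and t: "t \<in> carrier T"
  shows "f (tensor_lift K X \<beta> t) = tensor_lift K Y (\<lambda>v w. f (\<beta> v w)) t"
proof -
  have b: "bilin K V W Y (\<lambda>v w. f (\<beta> v w))"
    using \<beta> f by (auto simp: bilin_def intro: module_hom_comp)
  show ?thesis
    by (rule tensor_hom_eqI[OF module_hom_comp[OF f tensor_lift_hom[OF X \<beta>]] tensor_lift_hom[OF Y b] _ t])
       (simp add: tensor_lift_pure[OF X \<beta>] tensor_lift_pure[OF Y b])
qed

text \<open>Agreement is available on the carriers only, so bilinearity of \<gamma> is inherited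
  from \<beta> before both lifts are compared on pure tensors.\<close>

lemma tensor_lift_cong:
  assumes X: "module K X" and \<beta>: "bilin K V W X \<beta>" and t: "t \<in> carrier T"
    and eq: "\<And>v w. \<lbrakk>v \<in> carrier V; w \<in> carrier W\<rbrakk> \<Longrightarrow> \<beta> v w = \<gamma> v w"
  shows "tensor_lift K X \<beta> t = tensor_lift K X \<gamma> t"
proof -
  have \<gamma>: "bilin K V W X \<gamma>"
  proof (rule bilinI)
    show "(\<lambda>v. \<gamma> v w) \<in> module_hom K V X" if "w \<in> carrier W" for w
      using bilin_left[OF \<beta> that] V.module_axioms by (rule module_hom_cong) (simp add: eq that)
    show "(\<lambda>w. \<gamma> v w) \<in> module_hom K W X" if "v \<in> carrier V" for v
      using bilin_right[OF \<beta> that] W.module_axioms by (rule module_hom_cong) (simp add: eq that)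
  qed
  show ?thesis
    by (rule tensor_hom_eqI[OF tensor_lift_hom[OF X \<beta>] tensor_lift_hom[OF X \<gamma>] _ t])
       (simp add: tensor_lift_pure[OF X \<beta>] tensor_lift_pure[OF X \<gamma>] eq)
qed

lemma tensor_lift_closed:
  "\<lbrakk>module K X; bilin K V W X \<beta>; t \<in> carrier T\<rbrakk> \<Longrightarrow> tensor_lift K X \<beta> t \<in> carrier X"
  by (rule module_hom_mem[OF tensor_lift_hom])

text \<open>Additivity and homogeneity in z are identities between linear maps of t, hence checked
  on pure tensors. The rule lets linearity proofs step inside an iterated Sweedler sum.\<close>

lemma tensor_lift_param_hom:
  assumes X: "module K X" and Z: "module K Z" and t: "t \<in> carrier T"
    and \<beta>: "\<And>z. z \<in> carrier Z \<Longrightarrow> bilin K V W X (\<beta> z)"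
    and hom: "\<And>v w. \<lbrakk>v \<in> carrier V; w \<in> carrier W\<rbrakk> \<Longrightarrow> (\<lambda>z. \<beta> z v w) \<in> module_hom K Z X"
  shows "(\<lambda>z. tensor_lift K X (\<beta> z) t) \<in> module_hom K Z X"
proof -
  interpret Z: module K Z by fact
  note h = tensor_lift_hom[OF X \<beta>] and p = tensor_lift_pure[OF X \<beta>]
  show ?thesis
  proof (rule module_homI)
    fix z assume "z \<in> carrier Z"
    then show "tensor_lift K X (\<beta> z) t \<in> carrier X" by (intro tensor_lift_closed X \<beta> t)
  next
    fix z z' assume z: "z \<in> carrier Z" "z' \<in> carrier Z"
    show "tensor_lift K X (\<beta> (z \<oplus>\<^bsub>Z\<^esub> z')) t = tensor_lift K X (\<beta> z) t \<oplus>\<^bsub>X\<^esub> tensor_lift K X (\<beta> z') t"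
      by (rule tensor_hom_eqI[OF h module_hom_add_fun[OF X h h] _ t]) (simp_all add: z p module_hom_add[OF hom])
  next
    fix r z assume z: "r \<in> carrier K" "z \<in> carrier Z"
    show "tensor_lift K X (\<beta> (r \<odot>\<^bsub>Z\<^esub> z)) t = r \<odot>\<^bsub>X\<^esub> tensor_lift K X (\<beta> z) t"
      by (rule tensor_hom_eqI[OF h module_hom_smult_fun[OF X _ h] _ t]) (simp_all add: z p module_hom_smult[OF hom])
  qed
qed

end

text \<open>Fubini for two independent Sweedler sums. Both sides are linear in t, and for a pure t
  each reduces to the same single sum over t'.\<close>

lemma tensor_lift_swap:
  assumes VW: "two_modules K V W" and VW': "two_modules K V' W'" and X: "module K X"
    and t: "t \<in> carrier (tensor K V W)" and t': "t' \<in> carrier (tensor K V' W')"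
    and \<beta>: "\<And>v w. \<lbrakk>v \<in> carrier V; w \<in> carrier W\<rbrakk> \<Longrightarrow> bilin K V' W' X (\<beta> v w)"
    and \<beta>': "\<And>v' w'. \<lbrakk>v' \<in> carrier V'; w' \<in> carrier W'\<rbrakk> \<Longrightarrow> bilin K V W X (\<lambda>v w. \<beta> v w v' w')"
  shows "tensor_lift K X (\<lambda>v w. tensor_lift K X (\<beta> v w) t') t
    = tensor_lift K X (\<lambda>v' w'. tensor_lift K X (\<lambda>v w. \<beta> v w v' w') t) t'"
proof -
  interpret A: two_modules K V W by fact
  interpret B: two_modules K V' W' by fact
  have b: "bilin K V W X (\<lambda>v w. tensor_lift K X (\<beta> v w) t')"
    by (rule bilinI; rule B.tensor_lift_param_hom[OF X _ t'])
       (auto intro: A.V.module_axioms A.W.module_axioms \<beta> bilin_left[OF \<beta>'] bilin_right[OF \<beta>'])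
  have b': "bilin K V' W' X (\<lambda>v' w'. tensor_lift K X (\<lambda>v w. \<beta> v w v' w') t)" if "t \<in> carrier A.T" for t
    by (rule bilinI; rule A.tensor_lift_param_hom[OF X _ that])
       (auto intro: B.V.module_axioms B.W.module_axioms \<beta>' bilin_left[OF \<beta>] bilin_right[OF \<beta>])
  show ?thesis
  proof (rule A.tensor_hom_eqI[OF A.tensor_lift_hom[OF X b] _ _ t])
    show "(\<lambda>t. tensor_lift K X (\<lambda>v' w'. tensor_lift K X (\<lambda>v w. \<beta> v w v' w') t) t') \<in> module_hom K A.T X"
      by (rule B.tensor_lift_param_hom[OF X A.module_tensor t'])
         (auto intro: b' A.tensor_lift_hom[OF X] \<beta>')
    fix v w assume vw: "v \<in> carrier V" "w \<in> carrier W"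
    have "tensor_lift K X (\<beta> v w) t'
      = tensor_lift K X (\<lambda>v' w'. tensor_lift K X (\<lambda>v w. \<beta> v w v' w') (pure K V W v w)) t'"
      by (rule B.tensor_lift_cong[OF X \<beta>[OF vw] t']) (simp add: A.tensor_lift_pure[OF X \<beta>'] vw)
    then show "tensor_lift K X (\<lambda>v w. tensor_lift K X (\<beta> v w) t') (pure K V W v w)
      = tensor_lift K X (\<lambda>v' w'. tensor_lift K X (\<lambda>v w. \<beta> v w v' w') (pure K V W v w)) t'"
      by (simp add: A.tensor_lift_pure[OF X b] vw)
  qed
qed

section \<open>Associative algebras\<close>

text \<open>The locale \<open>algebra\<close> is for commutative rings, whereas B^e and its tensor
  square are not commutative.\<close>

locale assoc_algebra = module K A + A: ring A
  for K :: "('k, 'r) ring_scheme" (structure) and A :: "('k, 'a, 'm) module_scheme" +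
  assumes smult_mult_left:
      "\<lbrakk>c \<in> carrier K; x \<in> carrier A; y \<in> carrier A\<rbrakk> \<Longrightarrow> (c \<odot>\<^bsub>A\<^esub> x) \<otimes>\<^bsub>A\<^esub> y = c \<odot>\<^bsub>A\<^esub> (x \<otimes>\<^bsub>A\<^esub> y)"
    and smult_mult_right:
      "\<lbrakk>c \<in> carrier K; x \<in> carrier A; y \<in> carrier A\<rbrakk> \<Longrightarrow> x \<otimes>\<^bsub>A\<^esub> (c \<odot>\<^bsub>A\<^esub> y) = c \<odot>\<^bsub>A\<^esub> (x \<otimes>\<^bsub>A\<^esub> y)"
begin

lemma mult_bilin: "bilin K A A A (\<lambda>x y. x \<otimes>\<^bsub>A\<^esub> y)"
  by (intro bilinI module_homI)
     (simp_all add: A.l_distr A.r_distr smult_mult_left smult_mult_right)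

lemma ideal_submodule:
  assumes "ideal I A"
  shows "submodule K I A"
proof -
  interpret I: ideal I A by fact
  have "c \<odot>\<^bsub>A\<^esub> x \<in> I" if "c \<in> carrier K" "x \<in> I" for c x
    using I.I_l_closed[OF that(2), of "c \<odot>\<^bsub>A\<^esub> \<one>\<^bsub>A\<^esub>"] that I.a_subset
    by (auto simp: smult_mult_left)
  then show ?thesis
    using I.a_subset by (auto intro!: submodule.intro module_axioms)
qed

end

locale assoc_quotient = assoc_algebra K A + ideal I A
  for K :: "('k, 'r) ring_scheme" (structure) and A :: "('k, 'a, 'm) module_scheme" and I
begin

sublocale quotient_space K A I
  by (intro quotient_space.intro module_axioms ideal_submodule ideal_axioms)

lemma Q_mult: "\<lbrakk>x \<in> carrier A; y \<in> carrier A\<rbrakk> \<Longrightarrow> proj x \<otimes>\<^bsub>Q\<^esub> proj y = proj (x \<otimes>\<^bsub>A\<^esub> y)"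
  by (simp add: quot_algebra_simps rcoset_mult_add)

lemma Q_one: "\<one>\<^bsub>Q\<^esub> = proj \<one>\<^bsub>A\<^esub>"
  by (simp add: quot_algebra_simps)

lemma assoc_algebra_Q: "assoc_algebra K Q"
proof -
  interpret Q: module K Q by (rule module_Q)
  have ring: "ring Q"
    by (rule ringI[OF Q.abelian_group_axioms monoidI])
       (auto simp: carrier_Q Q_mult Q_one Q_add A.m_assoc A.l_distr A.r_distr)
  then interpret QR: ring Q .
  show ?thesis
    by (intro assoc_algebra.intro assoc_algebra_axioms.intro module_Q ring)
       (auto simp: carrier_Q Q_mult Q_smult smult_mult_left smult_mult_right)
qed

end

lemma (in algebra) assoc_algebra: "assoc_algebra R M"
  by (intro assoc_algebra.intro assoc_algebra_axioms.intro module_axioms cring.axioms(1)[OF M_cring])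
     (simp_all add: smult_assoc2, metis comm_monoid.m_comm[OF cring.axioms(2)[OF M_cring]] smult_assoc2 smult_closed)

lemma module_hom_eq_on_monoid_algebra2:
  assumes X: "module K X" and f: "bilin K (monoid_algebra K G) (monoid_algebra K H) X f"
    and g: "bilin K (monoid_algebra K G) (monoid_algebra K H) X g"
    and eq: "\<And>s t. \<lbrakk>s \<in> carrier G; t \<in> carrier H\<rbrakk> \<Longrightarrow>
      f (point_mass K s) (point_mass K t) = g (point_mass K s) (point_mass K t)"
    and x: "x \<in> carrier (monoid_algebra K G)" and y: "y \<in> carrier (monoid_algebra K H)"
  shows "f x y = g x y"
proof -
  interpret X: module K X by fact
  have "f (point_mass K s) y = g (point_mass K s) y" if s: "s \<in> carrier G" for s
    by (rule module_hom_eq_on_monoid_algebra[OF X bilin_right[OF f] bilin_right[OF g] _ y])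
       (simp_all add: s eq)
  then show ?thesis
    by (intro module_hom_eq_on_monoid_algebra[OF X bilin_left[OF f y] bilin_left[OF g y] _ x])
qed

section \<open>The monoid algebra as an associative algebra\<close>

lemma monoid_algebra_mult:
  "(f \<otimes>\<^bsub>monoid_algebra K G\<^esub> g) s =
    (\<Oplus>\<^bsub>K\<^esub>p\<in>{(x, y). f x \<noteq> \<zero>\<^bsub>K\<^esub> \<and> g y \<noteq> \<zero>\<^bsub>K\<^esub> \<and> x \<otimes>\<^bsub>G\<^esub> y = s}. f (fst p) \<otimes>\<^bsub>K\<^esub> g (snd p))"
  by (simp add: monoid_algebra_def)

locale monoid_alg = G: monoid G + K: cring K
  for K :: "('k, 'r) ring_scheme" (structure) and G :: "('s, 't) monoid_scheme"
begin

abbreviation F where "F \<equiv> monoid_algebra K G"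

interpretation F: module K F by (rule K.monoid_algebra_module)

text \<open>In the definition of the product the index set depends on s and on both supports. An
  indicator over a fixed rectangle removes this dependence, so that products of different functions
  can be added termwise.\<close>

lemma mult_eq:
  assumes f: "f \<in> carrier F" and g: "g \<in> carrier F"
    and A: "finite A" "{x. f x \<noteq> \<zero>} \<subseteq> A" and C: "finite C" "{x. g x \<noteq> \<zero>} \<subseteq> C"
  shows "(f \<otimes>\<^bsub>F\<^esub> g) s = (\<Oplus>p\<in>A \<times> C. if fst p \<otimes>\<^bsub>G\<^esub> snd p = s then f (fst p) \<otimes> g (snd p) else \<zero>)"
proof -
  have "(f \<otimes>\<^bsub>F\<^esub> g) s = (\<Oplus>p\<in>{(x, y). f x \<noteq> \<zero> \<and> g y \<noteq> \<zero> \<and> x \<otimes>\<^bsub>G\<^esub> y = s}. f (fst p) \<otimes> g (snd p))"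
    by (rule monoid_algebra_mult)
  also have "\<dots> = (\<Oplus>p\<in>A \<times> C. if fst p \<otimes>\<^bsub>G\<^esub> snd p = s then f (fst p) \<otimes> g (snd p) else \<zero>)"
  proof (rule K.add.finprod_mono_neutral_cong_left)
    show "{(x, y). f x \<noteq> \<zero> \<and> g y \<noteq> \<zero> \<and> x \<otimes>\<^bsub>G\<^esub> y = s} \<subseteq> A \<times> C" using A(2) C(2) by blast
  qed (use A(1) C(1) f g in auto)
  finally show ?thesis .
qed

lemma supp: "f \<in> carrier F \<Longrightarrow> finite {x. f x \<noteq> \<zero>}"
  by (simp add: mem_monoid_algebra_iff)

lemma mult_closed:
  assumes f: "f \<in> carrier F" and g: "g \<in> carrier F"
  shows "f \<otimes>\<^bsub>F\<^esub> g \<in> carrier F"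
proof -
  let ?A = "{x. f x \<noteq> \<zero>}" and ?C = "{x. g x \<noteq> \<zero>}"
  have AC: "?A \<subseteq> carrier G" "?C \<subseteq> carrier G" using f g by (auto simp: mem_monoid_algebra_iff)
  have "{s. (f \<otimes>\<^bsub>F\<^esub> g) s \<noteq> \<zero>} \<subseteq> (\<lambda>(x, y). x \<otimes>\<^bsub>G\<^esub> y) ` (?A \<times> ?C)"
  proof
    fix s assume s: "s \<in> {s. (f \<otimes>\<^bsub>F\<^esub> g) s \<noteq> \<zero>}"
    show "s \<in> (\<lambda>(x, y). x \<otimes>\<^bsub>G\<^esub> y) ` (?A \<times> ?C)"
    proof (rule ccontr)
      assume "s \<notin> (\<lambda>(x, y). x \<otimes>\<^bsub>G\<^esub> y) ` (?A \<times> ?C)"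
      then have "{(x, y). f x \<noteq> \<zero> \<and> g y \<noteq> \<zero> \<and> x \<otimes>\<^bsub>G\<^esub> y = s} = {}" by auto
      then have "(f \<otimes>\<^bsub>F\<^esub> g) s = \<zero>" by (simp only: monoid_algebra_mult K.finsum_empty)
      with s show False by simp
    qed
  qed
  moreover have "(\<lambda>(x, y). x \<otimes>\<^bsub>G\<^esub> y) ` (?A \<times> ?C) \<subseteq> carrier G" using AC by auto
  moreover have "finite ((\<lambda>(x, y). x \<otimes>\<^bsub>G\<^esub> y) ` (?A \<times> ?C))"
    by (intro finite_imageI finite_cartesian_product supp f g)
  moreover have 1: "(f \<otimes>\<^bsub>F\<^esub> g) s \<in> carrier K" for s
    unfolding mult_eq[OF f g supp[OF f] order_refl supp[OF g] order_refl]
    by (rule K.finsum_closed) (use f g in auto)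
  ultimately have "finite {s. (f \<otimes>\<^bsub>F\<^esub> g) s \<noteq> \<zero>}" "{s. (f \<otimes>\<^bsub>F\<^esub> g) s \<noteq> \<zero>} \<subseteq> carrier G"
    by (simp_all only: finite_subset subset_trans)
  with 1 show ?thesis unfolding mem_monoid_algebra_iff by blast
qed

lemma mult_bilin: "bilin K F F F (\<lambda>f g. f \<otimes>\<^bsub>F\<^esub> g)"
proof (intro bilinI module_homI mult_closed)
  fix f f' g assume *: "f \<in> carrier F" "f' \<in> carrier F" "g \<in> carrier F"
  let ?A = "{x. f x \<noteq> \<zero>} \<union> {x. f' x \<noteq> \<zero>}" and ?C = "{x. g x \<noteq> \<zero>}"
  have fin: "finite ?A" "finite ?C" using * supp by auto
  show "(f \<oplus>\<^bsub>F\<^esub> f') \<otimes>\<^bsub>F\<^esub> g = f \<otimes>\<^bsub>F\<^esub> g \<oplus>\<^bsub>F\<^esub> f' \<otimes>\<^bsub>F\<^esub> g"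
  proof
    fix s
    have "((f \<oplus>\<^bsub>F\<^esub> f') \<otimes>\<^bsub>F\<^esub> g) s =
      (\<Oplus>p\<in>?A \<times> ?C. if fst p \<otimes>\<^bsub>G\<^esub> snd p = s then (f \<oplus>\<^bsub>F\<^esub> f') (fst p) \<otimes> g (snd p) else \<zero>)"
      by (rule mult_eq) (use * fin in \<open>auto simp: K.monoid_algebra_add_closed K.monoid_algebra_smult_closed\<close>)
    also have "\<dots> = (\<Oplus>p\<in>?A \<times> ?C. (if fst p \<otimes>\<^bsub>G\<^esub> snd p = s then f (fst p) \<otimes> g (snd p) else \<zero>)
      \<oplus> (if fst p \<otimes>\<^bsub>G\<^esub> snd p = s then f' (fst p) \<otimes> g (snd p) else \<zero>))"
      by (rule K.finsum_cong') (use * in \<open>auto simp: K.l_distr\<close>)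
    also have "\<dots> = (f \<otimes>\<^bsub>F\<^esub> g) s \<oplus> (f' \<otimes>\<^bsub>F\<^esub> g) s"
      using * fin by (subst K.finsum_addf) (auto simp: mult_eq[of _ _ ?A ?C])
    finally show "((f \<oplus>\<^bsub>F\<^esub> f') \<otimes>\<^bsub>F\<^esub> g) s = (f \<otimes>\<^bsub>F\<^esub> g \<oplus>\<^bsub>F\<^esub> f' \<otimes>\<^bsub>F\<^esub> g) s" by simp
  qed
next
  fix f g g' assume *: "f \<in> carrier F" "g \<in> carrier F" "g' \<in> carrier F"
  let ?A = "{x. f x \<noteq> \<zero>}" and ?C = "{x. g x \<noteq> \<zero>} \<union> {x. g' x \<noteq> \<zero>}"
  have fin: "finite ?A" "finite ?C" using * supp by auto
  show "f \<otimes>\<^bsub>F\<^esub> (g \<oplus>\<^bsub>F\<^esub> g') = f \<otimes>\<^bsub>F\<^esub> g \<oplus>\<^bsub>F\<^esub> f \<otimes>\<^bsub>F\<^esub> g'"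
  proof
    fix s
    have "(f \<otimes>\<^bsub>F\<^esub> (g \<oplus>\<^bsub>F\<^esub> g')) s =
      (\<Oplus>p\<in>?A \<times> ?C. if fst p \<otimes>\<^bsub>G\<^esub> snd p = s then f (fst p) \<otimes> (g \<oplus>\<^bsub>F\<^esub> g') (snd p) else \<zero>)"
      by (rule mult_eq) (use * fin in \<open>auto simp: K.monoid_algebra_add_closed K.monoid_algebra_smult_closed\<close>)
    also have "\<dots> = (\<Oplus>p\<in>?A \<times> ?C. (if fst p \<otimes>\<^bsub>G\<^esub> snd p = s then f (fst p) \<otimes> g (snd p) else \<zero>)
      \<oplus> (if fst p \<otimes>\<^bsub>G\<^esub> snd p = s then f (fst p) \<otimes> g' (snd p) else \<zero>))"
      by (rule K.finsum_cong') (use * in \<open>auto simp: K.r_distr\<close>)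
    also have "\<dots> = (f \<otimes>\<^bsub>F\<^esub> g) s \<oplus> (f \<otimes>\<^bsub>F\<^esub> g') s"
      using * fin by (subst K.finsum_addf) (auto simp: mult_eq[of _ _ ?A ?C])
    finally show "(f \<otimes>\<^bsub>F\<^esub> (g \<oplus>\<^bsub>F\<^esub> g')) s = (f \<otimes>\<^bsub>F\<^esub> g \<oplus>\<^bsub>F\<^esub> f \<otimes>\<^bsub>F\<^esub> g') s" by simp
  qed
next
  fix c f g assume *: "c \<in> carrier K" "f \<in> carrier F" "g \<in> carrier F"
  let ?A = "{x. f x \<noteq> \<zero>}" and ?C = "{x. g x \<noteq> \<zero>}"
  have fin: "finite ?A" "finite ?C" using * supp by auto
  have eq: "(\<Oplus>p\<in>?A \<times> ?C. if fst p \<otimes>\<^bsub>G\<^esub> snd p = s then c \<otimes> (f (fst p) \<otimes> g (snd p)) else \<zero>)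
    = c \<otimes> (f \<otimes>\<^bsub>F\<^esub> g) s" for s
  proof -
    have "c \<otimes> (f \<otimes>\<^bsub>F\<^esub> g) s = c \<otimes> (\<Oplus>p\<in>?A \<times> ?C. if fst p \<otimes>\<^bsub>G\<^esub> snd p = s then f (fst p) \<otimes> g (snd p) else \<zero>)"
      using mult_eq[OF *(2,3) fin(1) order_refl fin(2) order_refl] by simp
    also have "\<dots> = (\<Oplus>p\<in>?A \<times> ?C. c \<otimes> (if fst p \<otimes>\<^bsub>G\<^esub> snd p = s then f (fst p) \<otimes> g (snd p) else \<zero>))"
      by (rule K.finsum_rdistr) (use * fin in auto)
    also have "\<dots> = (\<Oplus>p\<in>?A \<times> ?C. if fst p \<otimes>\<^bsub>G\<^esub> snd p = s then c \<otimes> (f (fst p) \<otimes> g (snd p)) else \<zero>)"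
      by (rule K.finsum_cong') (use * in auto)
    finally show ?thesis by simp
  qed
  show "(c \<odot>\<^bsub>F\<^esub> f) \<otimes>\<^bsub>F\<^esub> g = c \<odot>\<^bsub>F\<^esub> (f \<otimes>\<^bsub>F\<^esub> g)"
  proof
    fix s
    have "((c \<odot>\<^bsub>F\<^esub> f) \<otimes>\<^bsub>F\<^esub> g) s =
      (\<Oplus>p\<in>?A \<times> ?C. if fst p \<otimes>\<^bsub>G\<^esub> snd p = s then (c \<odot>\<^bsub>F\<^esub> f) (fst p) \<otimes> g (snd p) else \<zero>)"
      by (rule mult_eq) (use * fin in \<open>auto simp: K.monoid_algebra_add_closed K.monoid_algebra_smult_closed\<close>)
    also have "\<dots> = (\<Oplus>p\<in>?A \<times> ?C. if fst p \<otimes>\<^bsub>G\<^esub> snd p = s then c \<otimes> (f (fst p) \<otimes> g (snd p)) else \<zero>)"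
      by (rule K.finsum_cong') (use * in \<open>auto simp: K.m_assoc\<close>)
    finally show "((c \<odot>\<^bsub>F\<^esub> f) \<otimes>\<^bsub>F\<^esub> g) s = (c \<odot>\<^bsub>F\<^esub> (f \<otimes>\<^bsub>F\<^esub> g)) s" by (simp add: eq)
  qed
  show "f \<otimes>\<^bsub>F\<^esub> (c \<odot>\<^bsub>F\<^esub> g) = c \<odot>\<^bsub>F\<^esub> (f \<otimes>\<^bsub>F\<^esub> g)"
  proof
    fix s
    have "(f \<otimes>\<^bsub>F\<^esub> (c \<odot>\<^bsub>F\<^esub> g)) s =
      (\<Oplus>p\<in>?A \<times> ?C. if fst p \<otimes>\<^bsub>G\<^esub> snd p = s then f (fst p) \<otimes> (c \<odot>\<^bsub>F\<^esub> g) (snd p) else \<zero>)"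
      by (rule mult_eq) (use * fin in \<open>auto simp: K.monoid_algebra_add_closed K.monoid_algebra_smult_closed\<close>)
    also have "\<dots> = (\<Oplus>p\<in>?A \<times> ?C. if fst p \<otimes>\<^bsub>G\<^esub> snd p = s then c \<otimes> (f (fst p) \<otimes> g (snd p)) else \<zero>)"
      by (rule K.finsum_cong') (use * in \<open>auto simp: K.m_lcomm\<close>)
    finally show "(f \<otimes>\<^bsub>F\<^esub> (c \<odot>\<^bsub>F\<^esub> g)) s = (c \<odot>\<^bsub>F\<^esub> (f \<otimes>\<^bsub>F\<^esub> g)) s" by (simp add: eq)
  qed
qed simp_all

lemma mult_point_mass: 
  assumes "s \<in> carrier G" "t \<in> carrier G"
  shows "point_mass K s \<otimes>\<^bsub>F\<^esub> point_mass K t = point_mass K (s \<otimes>\<^bsub>G\<^esub> t)"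
proof
  fix u
  have "(point_mass K s \<otimes>\<^bsub>F\<^esub> point_mass K t) u =
    (\<Oplus>p\<in>{s} \<times> {t}. if fst p \<otimes>\<^bsub>G\<^esub> snd p = u then point_mass K s (fst p) \<otimes> point_mass K t (snd p) else \<zero>)"
    by (rule mult_eq[OF K.point_mass_closed K.point_mass_closed])
       (use assms in \<open>auto simp: point_mass_def[abs_def] split: if_splits\<close>)
  then show "(point_mass K s \<otimes>\<^bsub>F\<^esub> point_mass K t) u = point_mass K (s \<otimes>\<^bsub>G\<^esub> t) u"
    by (simp add: point_mass_def)
qed

text \<open>Both sides are linear in each argument, so it suffices to compare basis vectors, where
  associativity of G applies: first g and h with f a basis vector, then f.\<close>

lemma mult_assoc:
  assumes "f \<in> carrier F" "g \<in> carrier F" "h \<in> carrier F"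
  shows "f \<otimes>\<^bsub>F\<^esub> g \<otimes>\<^bsub>F\<^esub> h = f \<otimes>\<^bsub>F\<^esub> (g \<otimes>\<^bsub>F\<^esub> h)"
proof -
  note l = bilin_left[OF mult_bilin] and r = bilin_right[OF mult_bilin]
  note c = module_hom_comp[OF l l] module_hom_comp[OF r l] module_hom_comp[OF l r] module_hom_comp[OF r r]
  have 1: "point_mass K s \<otimes>\<^bsub>F\<^esub> g \<otimes>\<^bsub>F\<^esub> h = point_mass K s \<otimes>\<^bsub>F\<^esub> (g \<otimes>\<^bsub>F\<^esub> h)"
    if s: "s \<in> carrier G" for s
  proof (rule module_hom_eq_on_monoid_algebra2[OF F.module_axioms _ _ _ assms(2,3)])
    fix t u assume "t \<in> carrier G" "u \<in> carrier G"
    with s show "point_mass K s \<otimes>\<^bsub>F\<^esub> point_mass K t \<otimes>\<^bsub>F\<^esub> point_mass K u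
      = point_mass K s \<otimes>\<^bsub>F\<^esub> (point_mass K t \<otimes>\<^bsub>F\<^esub> point_mass K u)"
      by (simp add: mult_point_mass G.m_assoc)
  qed (intro bilinI, simp_all add: c s mult_closed r)+
  show ?thesis
    by (rule module_hom_eq_on_monoid_algebra[OF F.module_axioms _ _ _ assms(1)])
       (simp_all add: 1 c assms l mult_closed)
qed

lemma assoc_algebra_F: "assoc_algebra K F"
proof -
  note hom = module_hom_add[OF bilin_left[OF mult_bilin]] module_hom_smult[OF bilin_left[OF mult_bilin]]
    module_hom_add[OF bilin_right[OF mult_bilin]] module_hom_smult[OF bilin_right[OF mult_bilin]]
  have one: "\<one>\<^bsub>F\<^esub> \<in> carrier F" by simp
  have l_one: "\<one>\<^bsub>F\<^esub> \<otimes>\<^bsub>F\<^esub> f = f" if "f \<in> carrier F" for f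
    by (rule module_hom_eq_on_monoid_algebra[OF F.module_axioms bilin_right[OF mult_bilin one] module_hom_id _ that])
       (simp add: mult_point_mass)
  have r_one: "f \<otimes>\<^bsub>F\<^esub> \<one>\<^bsub>F\<^esub> = f" if "f \<in> carrier F" for f
    by (rule module_hom_eq_on_monoid_algebra[OF F.module_axioms bilin_left[OF mult_bilin one] module_hom_id _ that])
       (simp add: mult_point_mass)
  have "ring F"
    by (rule ringI[OF F.abelian_group_axioms monoidI])
       (simp_all only: mult_closed one l_one r_one mult_assoc hom)
  then show ?thesis
    by (intro assoc_algebra.intro assoc_algebra_axioms.intro F.module_axioms) (simp_all only: hom)
qed

end

lemma (in abelian_group) minus_self: "x \<in> carrier G \<Longrightarrow> x \<ominus> x = \<zero>"
  by (simp add: a_minus_def r_neg)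

section \<open>Tensor products of algebras\<close>

locale two_algebras = V: assoc_algebra K V + W: assoc_algebra K W
  for K :: "('k, 'r) ring_scheme" (structure) and V :: "('k, 'v, 'm) module_scheme"
    and W :: "('k, 'w, 'n) module_scheme"
begin

sublocale two_modules K V W
  by (intro two_modules.intro V.module_axioms W.module_axioms)

interpretation G: monoid_alg K "V \<times>\<times> W"
  by (intro monoid_alg.intro DirProd_monoid V.A.monoid_axioms W.A.monoid_axioms V.is_cring)

interpretation FA: assoc_algebra K F by (rule G.assoc_algebra_F)

lemma e_mult:
  assumes "a \<in> carrier V" "b \<in> carrier W" "c \<in> carrier V" "d \<in> carrier W"
  shows "e a b \<otimes>\<^bsub>F\<^esub> e c d = e (a \<otimes>\<^bsub>V\<^esub> c) (b \<otimes>\<^bsub>W\<^esub> d)"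
  using assms by (simp add: G.mult_point_mass) 

lemma e_mult_minus:
  assumes "a \<in> carrier V" "b \<in> carrier W" "x \<in> carrier F" "y \<in> carrier F"
  shows "e a b \<otimes>\<^bsub>F\<^esub> (x \<ominus>\<^bsub>F\<^esub> y) = e a b \<otimes>\<^bsub>F\<^esub> x \<ominus>\<^bsub>F\<^esub> e a b \<otimes>\<^bsub>F\<^esub> y"
    and "(x \<ominus>\<^bsub>F\<^esub> y) \<otimes>\<^bsub>F\<^esub> e a b = x \<otimes>\<^bsub>F\<^esub> e a b \<ominus>\<^bsub>F\<^esub> y \<otimes>\<^bsub>F\<^esub> e a b"
  using module_hom_minus[OF V.monoid_algebra_module V.monoid_algebra_module bilin_right[OF G.mult_bilin]]
    module_hom_minus[OF V.monoid_algebra_module V.monoid_algebra_module bilin_left[OF G.mult_bilin]] assms e_closed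
  by auto

text \<open>A basis vector times a defining relation is again a defining relation, of the same kind.
  This is why the span of the relations is an ideal and the product passes to the tensor
  product.\<close>

lemma e_mult_rel:
  assumes ab: "a \<in> carrier V" "b \<in> carrier W" and r: "r \<in> tensor_rels K V W"
  shows "e a b \<otimes>\<^bsub>F\<^esub> r \<in> tensor_rels K V W" and "r \<otimes>\<^bsub>F\<^esub> e a b \<in> tensor_rels K V W"
proof -
  note simps = e_mult_minus e_mult e_closed FA.A.r_distr FA.A.l_distr FA.smult_mult_left
    FA.smult_mult_right V.A.r_distr V.A.l_distr W.A.r_distr W.A.l_distr
    V.smult_mult_left V.smult_mult_right W.smult_mult_left W.smult_mult_right
    ring.ring_simprules(1)[OF FA.A.ring_axioms] module.smult_closed[OF V.monoid_algebra_module] V.M.add.m_closed W.M.add.m_closed V.smult_closed W.smult_closed V.A.m_closed W.A.m_closed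
  show "e a b \<otimes>\<^bsub>F\<^esub> r \<in> tensor_rels K V W" using r
    by (cases rule: tensor_rels_cases) (simp_all only: simps ab tensor_relsI)
  show "r \<otimes>\<^bsub>F\<^esub> e a b \<in> tensor_rels K V W" using r
    by (cases rule: tensor_rels_cases) (simp_all only: simps ab tensor_relsI)
qed

lemma ideal_tensor_null: "ideal (tensor_null K V W) F"
proof -
  let ?I = "tensor_null K V W"
  interpret I': abelian_subgroup ?I F by (rule submodule_abelian_subgroup) (rule submodule_tensor_null)
  have rel: "f \<otimes>\<^bsub>F\<^esub> r \<in> ?I \<and> r \<otimes>\<^bsub>F\<^esub> f \<in> ?I" if f: "f \<in> carrier F" and r: "r \<in> tensor_rels K V W" for f r
    using f
  proof (induction rule: V.monoid_algebra_induct)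
    case zero
    have "r \<in> carrier F" using r tensor_rels_closed by auto
    then have "\<zero>\<^bsub>F\<^esub> \<otimes>\<^bsub>F\<^esub> r = \<zero>\<^bsub>F\<^esub>" "r \<otimes>\<^bsub>F\<^esub> \<zero>\<^bsub>F\<^esub> = \<zero>\<^bsub>F\<^esub>" by (rule FA.A.l_null FA.A.r_null)+
    then show ?case using submodule.zero_closed[OF submodule_tensor_null] by simp
  next
    case (add c s g)
    obtain v w where s: "s = (v, w)" "v \<in> carrier V" "w \<in> carrier W" using add(2) by (auto simp: DirProd_def)
    have r': "r \<in> carrier F" using r tensor_rels_closed by auto
    have "c \<odot>\<^bsub>F\<^esub> (e v w \<otimes>\<^bsub>F\<^esub> r) \<oplus>\<^bsub>F\<^esub> g \<otimes>\<^bsub>F\<^esub> r \<in> ?I"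
      using add s r e_mult_rel(1)[OF s(2,3) r] tensor_rels_null by (intro submodule.m_closed[OF submodule_tensor_null] submodule.smult_closed[OF submodule_tensor_null]) auto
    moreover have "c \<odot>\<^bsub>F\<^esub> (r \<otimes>\<^bsub>F\<^esub> e v w) \<oplus>\<^bsub>F\<^esub> r \<otimes>\<^bsub>F\<^esub> g \<in> ?I"
      using add s r e_mult_rel(2)[OF s(2,3) r] tensor_rels_null by (intro submodule.m_closed[OF submodule_tensor_null] submodule.smult_closed[OF submodule_tensor_null]) auto
    ultimately show ?case using add(1,3) r' s
      by (simp only: FA.A.r_distr FA.A.l_distr FA.smult_mult_left FA.smult_mult_right e_closed module.smult_closed[OF V.monoid_algebra_module])
  qed
  \<comment> \<open>Elements whose products with everything, on both sides, fall into the null space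
    form a submodule. It contains the relations, hence their span.\<close>
  have "submodule K {y \<in> carrier F. \<forall>f\<in>carrier F. f \<otimes>\<^bsub>F\<^esub> y \<in> ?I \<and> y \<otimes>\<^bsub>F\<^esub> f \<in> ?I} F"
    by (rule submodule.intro)
       (auto simp: V.monoid_algebra_module FA.A.r_distr FA.A.l_distr FA.smult_mult_left FA.smult_mult_right
         simp del: monoid_algebra_simps)
  from tensor_null_subset[OF this] rel tensor_rels_closed
  have "?I \<subseteq> {y \<in> carrier F. \<forall>f\<in>carrier F. f \<otimes>\<^bsub>F\<^esub> y \<in> ?I \<and> y \<otimes>\<^bsub>F\<^esub> f \<in> ?I}" by blast
  then show ?thesis
    by (intro idealI FA.A.ring_axioms I'.a_subgroup) auto
qed

sublocale T: assoc_quotient K F "tensor_null K V W"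
  by (intro assoc_quotient.intro G.assoc_algebra_F ideal_tensor_null)

lemma assoc_algebra_tensor: "assoc_algebra K T"
  unfolding tensor_def by (rule T.assoc_algebra_Q)

lemma pure_mult:
  assumes "a \<in> carrier V" "b \<in> carrier W" "c \<in> carrier V" "d \<in> carrier W"
  shows "pure K V W a b \<otimes>\<^bsub>T\<^esub> pure K V W c d = pure K V W (a \<otimes>\<^bsub>V\<^esub> c) (b \<otimes>\<^bsub>W\<^esub> d)"
  using assms by (simp only: pure_eq_proj tensor_def T.Q_mult e_closed e_mult)

lemma tensor_one: "\<one>\<^bsub>T\<^esub> = pure K V W \<one>\<^bsub>V\<^esub> \<one>\<^bsub>W\<^esub>"
  unfolding tensor_def T.Q_one pure_eq_proj by (simp add: DirProd_def)

end

lemma word_monoid_simps [simp]: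
  "carrier (word_monoid X) = lists X" "v \<otimes>\<^bsub>word_monoid X\<^esub> w = v @ w" "\<one>\<^bsub>word_monoid X\<^esub> = []"
  by (simp_all add: word_monoid_def)

lemma monoid_word_monoid: "monoid (word_monoid X)"
  by (rule monoidI) auto


section \<open>The universal property of the enveloping algebra\<close>

text \<open>With \<open>foldr\<close> the last letter acts first, as in a product of operators.
  \<open>env_lift\<close> is the special case of left multiplication in an algebra applied to the
  unit; the action on B itself is another instance.\<close>

definition env_act :: "('k, 'r) ring_scheme \<Rightarrow> ('k, 'x, 'm) module_scheme \<Rightarrow> ('s \<Rightarrow> 'x \<Rightarrow> 'x)
    \<Rightarrow> 'x \<Rightarrow> ('s list \<Rightarrow> 'k) set \<Rightarrow> 'x"
  where "env_act K X act x = lin_ext K X (\<lambda>w. foldr act w x)"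

context poisson_algebra
begin

abbreviation "E \<equiv> env_free K B"
abbreviation "R \<equiv> env_rels K B bracket"
abbreviation "I \<equiv> env_ideal K B bracket"
abbreviation "U \<equiv> env K B bracket"
abbreviation "m \<equiv> env_m K B bracket"
abbreviation "h \<equiv> env_h K B bracket"
abbreviation (input) "me a \<equiv> point_mass K [Inl a]"
abbreviation (input) "he a \<equiv> point_mass K [Inr a]"

interpretation G: monoid_alg K "word_monoid (carrier B <+> carrier B)"
  by (intro monoid_alg.intro monoid_word_monoid R_cring)

abbreviation U_mult (infixl \<open>\<bullet>\<close> 70) where "x \<bullet> y \<equiv> x \<otimes>\<^bsub>U\<^esub> y"
abbreviation B_mult (infixl \<open>\<star>\<close> 70) where "x \<star> y \<equiv> x \<otimes>\<^bsub>B\<^esub> y"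

lemma assoc_algebra_E: "assoc_algebra K E"
  unfolding env_free_def by (rule G.assoc_algebra_F)

sublocale E: assoc_algebra K E
  by (rule assoc_algebra_E)

lemma word_closed: "w \<in> lists (carrier B <+> carrier B) \<Longrightarrow> point_mass K w \<in> carrier E"
  unfolding env_free_def by (rule cring.point_mass_closed[OF R_cring]) simp

lemma me_closed: "a \<in> carrier B \<Longrightarrow> me a \<in> carrier E"
  and he_closed: "a \<in> carrier B \<Longrightarrow> he a \<in> carrier E"
  by (auto intro!: word_closed)

lemma word_mult:
  "\<lbrakk>v \<in> lists (carrier B <+> carrier B); w \<in> lists (carrier B <+> carrier B)\<rbrakk> \<Longrightarrow>
    point_mass K v \<otimes>\<^bsub>E\<^esub> point_mass K w = point_mass K (v @ w)"
  unfolding env_free_def using G.mult_point_mass by simp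

lemma env_free_one: "\<one>\<^bsub>E\<^esub> = point_mass K []"
  by (simp add: env_free_def)

lemma env_rels_closed: "R \<subseteq> carrier E"
  unfolding env_rels_def Let_def
  by (auto intro!: E.M.minus_closed E.M.add.m_closed E.smult_closed E.A.m_closed me_closed he_closed bracket_closed
     simp del: monoid_algebra_simps)

lemma ideal_I: "ideal I E"
  unfolding env_ideal_def by (rule E.A.genideal_ideal[OF env_rels_closed])

sublocale U: assoc_quotient K E I
  by (intro assoc_quotient.intro assoc_algebra_E ideal_I)

lemma assoc_algebra_U: "assoc_algebra K U"
  unfolding env_def by (rule U.assoc_algebra_Q)

lemma m_eq: "m a = U.proj (me a)" and h_eq: "h a = U.proj (he a)"
  by (simp_all add: env_m_def env_h_def)

lemma m_closed: "a \<in> carrier B \<Longrightarrow> m a \<in> carrier U"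
  and h_closed: "a \<in> carrier B \<Longrightarrow> h a \<in> carrier U"
  unfolding m_eq h_eq env_def by (simp_all add: U.proj_closed me_closed he_closed)

lemma proj_relI:
  assumes "x \<ominus>\<^bsub>E\<^esub> y \<in> R" "x \<in> carrier E" "y \<in> carrier E"
  shows "U.proj x = U.proj y"
  using assms E.A.genideal_self[OF env_rels_closed] U.proj_eq_iff[of x y] unfolding env_ideal_def by blast

lemma env_relsI:
  "\<lbrakk>x \<in> carrier B; y \<in> carrier B\<rbrakk> \<Longrightarrow> me (x \<oplus>\<^bsub>B\<^esub> y) \<ominus>\<^bsub>E\<^esub> (me x \<oplus>\<^bsub>E\<^esub> me y) \<in> R"
  "\<lbrakk>c \<in> carrier K; x \<in> carrier B\<rbrakk> \<Longrightarrow> me (c \<odot>\<^bsub>B\<^esub> x) \<ominus>\<^bsub>E\<^esub> c \<odot>\<^bsub>E\<^esub> me x \<in> R"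
  "\<lbrakk>x \<in> carrier B; y \<in> carrier B\<rbrakk> \<Longrightarrow> he (x \<oplus>\<^bsub>B\<^esub> y) \<ominus>\<^bsub>E\<^esub> (he x \<oplus>\<^bsub>E\<^esub> he y) \<in> R"
  "\<lbrakk>c \<in> carrier K; x \<in> carrier B\<rbrakk> \<Longrightarrow> he (c \<odot>\<^bsub>B\<^esub> x) \<ominus>\<^bsub>E\<^esub> c \<odot>\<^bsub>E\<^esub> he x \<in> R"
  "\<lbrakk>x \<in> carrier B; y \<in> carrier B\<rbrakk> \<Longrightarrow> me (x \<star> y) \<ominus>\<^bsub>E\<^esub> me x \<otimes>\<^bsub>E\<^esub> me y \<in> R"
  "\<lbrakk>x \<in> carrier B; y \<in> carrier B\<rbrakk> \<Longrightarrow>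
    he (bracket x y) \<ominus>\<^bsub>E\<^esub> (he x \<otimes>\<^bsub>E\<^esub> he y \<ominus>\<^bsub>E\<^esub> he y \<otimes>\<^bsub>E\<^esub> he x) \<in> R"
  "\<lbrakk>x \<in> carrier B; y \<in> carrier B\<rbrakk> \<Longrightarrow>
    he (x \<star> y) \<ominus>\<^bsub>E\<^esub> (me y \<otimes>\<^bsub>E\<^esub> he x \<oplus>\<^bsub>E\<^esub> me x \<otimes>\<^bsub>E\<^esub> he y) \<in> R"
  "\<lbrakk>x \<in> carrier B; y \<in> carrier B\<rbrakk> \<Longrightarrow>
    me (bracket x y) \<ominus>\<^bsub>E\<^esub> (he x \<otimes>\<^bsub>E\<^esub> me y \<ominus>\<^bsub>E\<^esub> me y \<otimes>\<^bsub>E\<^esub> he x) \<in> R"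
  "me \<one>\<^bsub>B\<^esub> \<ominus>\<^bsub>E\<^esub> \<one>\<^bsub>E\<^esub> \<in> R"
  unfolding env_rels_def Let_def by fast+

lemma proj_minus:
  "\<lbrakk>x \<in> carrier E; y \<in> carrier E\<rbrakk> \<Longrightarrow> U.proj (x \<ominus>\<^bsub>E\<^esub> y) = U.proj x \<ominus>\<^bsub>U\<^esub> U.proj y"
  unfolding env_def by (rule module_hom_minus[OF E.module_axioms U.module_Q U.proj_hom])

lemmas proj_hom_simps = m_eq h_eq U.Q_add[folded env_def] U.Q_mult[folded env_def] U.Q_smult[folded env_def]
  U.Q_one[folded env_def] proj_minus E.M.minus_closed E.M.add.m_closed E.smult_closed E.A.m_closed me_closed he_closed
  bracket_closed E.A.one_closed

lemma m_hom: "m \<in> module_hom K B U" and h_hom: "h \<in> module_hom K B U"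
proof -
  show "m \<in> module_hom K B U"
  proof (rule module_homI[OF m_closed])
    fix x y assume "x \<in> carrier B" "y \<in> carrier B"
    with proj_relI[OF env_relsI(1)[OF this]] show "m (x \<oplus>\<^bsub>B\<^esub> y) = m x \<oplus>\<^bsub>U\<^esub> m y"
      by (simp only: proj_hom_simps M.add.m_closed)
  next
    fix c x assume "c \<in> carrier K" "x \<in> carrier B"
    with proj_relI[OF env_relsI(2)[OF this]] show "m (c \<odot>\<^bsub>B\<^esub> x) = c \<odot>\<^bsub>U\<^esub> m x"
      by (simp only: proj_hom_simps smult_closed)
  qed
  show "h \<in> module_hom K B U"
  proof (rule module_homI[OF h_closed])
    fix x y assume "x \<in> carrier B" "y \<in> carrier B"
    with proj_relI[OF env_relsI(3)[OF this]] show "h (x \<oplus>\<^bsub>B\<^esub> y) = h x \<oplus>\<^bsub>U\<^esub> h y"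
      by (simp only: proj_hom_simps M.add.m_closed)
  next
    fix c x assume "c \<in> carrier K" "x \<in> carrier B"
    with proj_relI[OF env_relsI(4)[OF this]] show "h (c \<odot>\<^bsub>B\<^esub> x) = c \<odot>\<^bsub>U\<^esub> h x"
      by (simp only: proj_hom_simps smult_closed)
  qed
qed

lemma
  assumes xy: "x \<in> carrier B" "y \<in> carrier B"
  shows m_mult: "m (x \<star> y) = m x \<bullet> m y"
    and h_bracket: "h (bracket x y) = h x \<bullet> h y \<ominus>\<^bsub>U\<^esub> h y \<bullet> h x"
    and h_mult: "h (x \<star> y) = m y \<bullet> h x \<oplus>\<^bsub>U\<^esub> m x \<bullet> h y"
    and m_bracket: "m (bracket x y) = h x \<bullet> m y \<ominus>\<^bsub>U\<^esub> m y \<bullet> h x"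
  using proj_relI[OF env_relsI(5)[OF xy]] proj_relI[OF env_relsI(6)[OF xy]]
    proj_relI[OF env_relsI(7)[OF xy]] proj_relI[OF env_relsI(8)[OF xy]] xy cring.cring_simprules(5)[OF M_cring xy]
  by (simp_all only: proj_hom_simps)

lemma m_one: "m \<one>\<^bsub>B\<^esub> = \<one>\<^bsub>U\<^esub>"
  using proj_relI[OF env_relsI(9)] by (simp only: proj_hom_simps cring.cring_simprules(6)[OF M_cring])

lemma U_cases:
  assumes "z \<in> carrier U"
  obtains f where "f \<in> carrier E" "z = U.proj f"
  using assms unfolding env_def U.carrier_Q by auto

text \<open>Words are built from the empty word by prepending letters, so only left multiplication
  by a generator has to be considered. This matches the recursions for the coproduct and for
  actions, which are known for a generator on the left.\<close>

lemma U_induct [consumes 1, case_names one add smult m h]: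
  assumes z: "z \<in> carrier U"
    and one: "P \<one>\<^bsub>U\<^esub>"
    and add: "\<And>x y. \<lbrakk>x \<in> carrier U; y \<in> carrier U; P x; P y\<rbrakk> \<Longrightarrow> P (x \<oplus>\<^bsub>U\<^esub> y)"
    and smult: "\<And>c x. \<lbrakk>c \<in> carrier K; x \<in> carrier U; P x\<rbrakk> \<Longrightarrow> P (c \<odot>\<^bsub>U\<^esub> x)"
    and m: "\<And>b x. \<lbrakk>b \<in> carrier B; x \<in> carrier U; P x\<rbrakk> \<Longrightarrow> P (m b \<bullet> x)"
    and h: "\<And>b x. \<lbrakk>b \<in> carrier B; x \<in> carrier U; P x\<rbrakk> \<Longrightarrow> P (h b \<bullet> x)"
  shows "P z"
proof -
  interpret UA: assoc_algebra K U by (rule assoc_algebra_U)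
  have closed: "U.proj f \<in> carrier U" if "f \<in> carrier E" for f
    using that unfolding env_def by (rule U.proj_closed)
  have word: "P (U.proj (point_mass K w))" if "w \<in> lists (carrier B <+> carrier B)" for w
    using that
  proof (induction w)
    case Nil
    then show ?case using one U.Q_one by (simp add: env_def env_free_one)
  next
    case (Cons s w)
    have *: "U.proj (point_mass K (s # w)) = U.proj (point_mass K [s]) \<bullet> U.proj (point_mass K w)"
      using Cons.hyps word_mult[of "[s]" w]
      by (simp add: env_def U.Q_mult word_closed)
    show ?case
    proof (cases s)
      case (Inl b)
      then have "P (m b \<bullet> U.proj (point_mass K w))"
        using Cons by (intro m closed word_closed) auto
      then show ?thesis using * Inl by (simp add: m_eq)
    next
      case (Inr b)
      then have "P (h b \<bullet> U.proj (point_mass K w))"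
        using Cons by (intro h closed word_closed) auto
      then show ?thesis using * Inr by (simp add: h_eq)
    qed
  qed
  obtain f where f: "f \<in> carrier E" "z = U.proj f" using z by (rule U_cases)
  have "P (U.proj f)" using f(1)[unfolded env_free_def]
  proof (induction rule: cring.monoid_algebra_induct[OF R_cring, consumes 1, case_names zero add])
    case zero
    have "P (\<zero> \<odot>\<^bsub>U\<^esub> \<one>\<^bsub>U\<^esub>)" by (intro smult one) auto
    then have "P \<zero>\<^bsub>U\<^esub>" by simp
    then show ?case using U.Q_zero by (simp add: env_def env_free_def)
  next
    case (add c s g)
    note * = add[folded env_free_def]
    then have "s \<in> lists (carrier B <+> carrier B)" by simp
    then have "P (c \<odot>\<^bsub>U\<^esub> U.proj (point_mass K s) \<oplus>\<^bsub>U\<^esub> U.proj g)"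
      using * by (intro assms(3) smult word closed UA.smult_closed word_closed)
    also have "c \<odot>\<^bsub>U\<^esub> U.proj (point_mass K s) \<oplus>\<^bsub>U\<^esub> U.proj g
        = U.proj (c \<odot>\<^bsub>E\<^esub> point_mass K s \<oplus>\<^bsub>E\<^esub> g)"
      using * \<open>s \<in> lists _\<close> by (simp only: proj_hom_simps word_closed)
    finally show ?case by (simp only: env_free_def)
  qed
  with f show ?thesis by simp
qed

end

text \<open>The conditions are the defining relations of B^e read as identities of operators on X;
  such an X is a Poisson module over B.\<close>

locale env_module = poisson_algebra K B bracket + X: module K X
  for K :: "('k, 'r) ring_scheme" (structure) and B :: "('k, 'b, 'm) module_scheme" and bracket
    and X :: "('k, 'x, 'l) module_scheme" +
  fixes act :: "'b + 'b \<Rightarrow> 'x \<Rightarrow> 'x"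
  assumes act_hom: "\<And>s. s \<in> carrier B <+> carrier B \<Longrightarrow> act s \<in> module_hom K X X"
    and act_m_hom: "\<And>v. v \<in> carrier X \<Longrightarrow> (\<lambda>a. act (Inl a) v) \<in> module_hom K B X"
    and act_h_hom: "\<And>v. v \<in> carrier X \<Longrightarrow> (\<lambda>a. act (Inr a) v) \<in> module_hom K B X"
    and act_m_mult: "\<And>a b v. \<lbrakk>a \<in> carrier B; b \<in> carrier B; v \<in> carrier X\<rbrakk> \<Longrightarrow>
      act (Inl (a \<star> b)) v = act (Inl a) (act (Inl b) v)"
    and act_h_bracket: "\<And>a b v. \<lbrakk>a \<in> carrier B; b \<in> carrier B; v \<in> carrier X\<rbrakk> \<Longrightarrow>
      act (Inr (bracket a b)) v = act (Inr a) (act (Inr b) v) \<ominus>\<^bsub>X\<^esub> act (Inr b) (act (Inr a) v)"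
    and act_h_mult: "\<And>a b v. \<lbrakk>a \<in> carrier B; b \<in> carrier B; v \<in> carrier X\<rbrakk> \<Longrightarrow>
      act (Inr (a \<star> b)) v = act (Inl b) (act (Inr a) v) \<oplus>\<^bsub>X\<^esub> act (Inl a) (act (Inr b) v)"
    and act_m_bracket: "\<And>a b v. \<lbrakk>a \<in> carrier B; b \<in> carrier B; v \<in> carrier X\<rbrakk> \<Longrightarrow>
      act (Inl (bracket a b)) v = act (Inr a) (act (Inl b) v) \<ominus>\<^bsub>X\<^esub> act (Inl b) (act (Inr a) v)"
    and act_m_one: "\<And>v. v \<in> carrier X \<Longrightarrow> act (Inl \<one>\<^bsub>B\<^esub>) v = v"
begin

lemmas X = X.module_axioms

lemma foldr_act_hom: "w \<in> lists (carrier B <+> carrier B) \<Longrightarrow> foldr act w \<in> module_hom K X X"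
proof (induction w)
  case Nil
  then show ?case by (simp add: id_def module_hom_id)
next
  case (Cons s w)
  then show ?case using module_hom_comp[OF act_hom, of s "foldr act w"] by (simp add: comp_def)
qed

definition free_act where "free_act f x = free_lift K X (\<lambda>w. foldr act w x) f"

lemma free_act_hom: "x \<in> carrier X \<Longrightarrow> (\<lambda>f. free_act f x) \<in> module_hom K E X"
  unfolding free_act_def env_free_def
  by (rule free_lift_module_hom[OF X]) (auto intro: module_hom_mem[OF foldr_act_hom])

lemma free_act_word:
  "\<lbrakk>x \<in> carrier X; w \<in> lists (carrier B <+> carrier B)\<rbrakk> \<Longrightarrow> free_act (point_mass K w) x = foldr act w x"
  unfolding free_act_def by (rule free_lift_point_mass[OF X]) (rule module_hom_mem[OF foldr_act_hom])

lemma E_hom_eqI: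
  assumes "f \<in> module_hom K E X" "g \<in> module_hom K E X"
    and "\<And>w. w \<in> lists (carrier B <+> carrier B) \<Longrightarrow> f (point_mass K w) = g (point_mass K w)"
    and "x \<in> carrier E"
  shows "f x = g x"
  using module_hom_eq_on_monoid_algebra[OF X assms(1,2)[unfolded env_free_def] _ assms(4)[unfolded env_free_def]]
    assms(3) by simp

lemma free_act_hom_right:
  assumes f: "f \<in> carrier E"
  shows "free_act f \<in> module_hom K X X"
proof (rule module_homI)
  fix x assume "x \<in> carrier X"
  then show "free_act f x \<in> carrier X" by (rule module_hom_mem[OF free_act_hom f])
next
  fix x y assume xy: "x \<in> carrier X" "y \<in> carrier X"
  show "free_act f (x \<oplus>\<^bsub>X\<^esub> y) = free_act f x \<oplus>\<^bsub>X\<^esub> free_act f y"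
    by (rule E_hom_eqI[OF free_act_hom module_hom_add_fun[OF X free_act_hom free_act_hom] _ f])
       (simp_all add: xy free_act_word module_hom_add[OF foldr_act_hom])
next
  fix c x assume cx: "c \<in> carrier K" "x \<in> carrier X"
  show "free_act f (c \<odot>\<^bsub>X\<^esub> x) = c \<odot>\<^bsub>X\<^esub> free_act f x"
    by (rule E_hom_eqI[OF free_act_hom module_hom_smult_fun[OF X _ free_act_hom] _ f])
       (simp_all add: cx free_act_word module_hom_smult[OF foldr_act_hom])
qed

lemma free_act_mult:
  assumes fg: "f \<in> carrier E" "g \<in> carrier E" and x: "x \<in> carrier X"
  shows "free_act (f \<otimes>\<^bsub>E\<^esub> g) x = free_act f (free_act g x)"
proof -
  have *: "free_act (point_mass K w \<otimes>\<^bsub>E\<^esub> g) x = free_act (point_mass K w) (free_act g x)"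
    if w: "w \<in> lists (carrier B <+> carrier B)" for w
    by (rule E_hom_eqI[OF module_hom_comp[OF free_act_hom[OF x] bilin_right[OF E.mult_bilin word_closed[OF w]]]
          module_hom_comp[OF free_act_hom_right[OF word_closed[OF w]] free_act_hom[OF x]] _ fg(2)])
       (simp add: w x free_act_word word_mult module_hom_mem[OF foldr_act_hom])
  show ?thesis
    by (rule E_hom_eqI[OF module_hom_comp[OF free_act_hom[OF x] bilin_left[OF E.mult_bilin fg(2)]]
          free_act_hom[OF module_hom_mem[OF free_act_hom[OF x] fg(2)]] * fg(1)])
qed

text \<open>The set J is the annihilator of X in the free algebra. It is a two-sided ideal since the
  action is multiplicative, and the axioms of \<open>env_module\<close> say that it contains the
  relations.\<close>

lemma free_act_env_ideal:
  assumes f: "f \<in> I" and x: "x \<in> carrier X"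
  shows "free_act f x = \<zero>\<^bsub>X\<^esub>"
proof -
  define J where "J = {f \<in> carrier E. \<forall>x\<in>carrier X. free_act f x = \<zero>\<^bsub>X\<^esub>}"
  note add = module_hom_add[OF free_act_hom] and smult = module_hom_smult[OF free_act_hom]
  have "submodule K J E"
    by (rule submodule.intro)
       (auto simp: J_def E.module_axioms add smult module_hom_zero[OF E.module_axioms X free_act_hom])
  then interpret J: abelian_subgroup J E by (rule submodule_abelian_subgroup)
  have "ideal J E"
  proof (rule idealI[OF E.A.ring_axioms J.a_subgroup])
    fix a x assume "a \<in> J" and x: "x \<in> carrier E"
    then have a: "a \<in> carrier E" and a0: "\<And>v. v \<in> carrier X \<Longrightarrow> free_act a v = \<zero>\<^bsub>X\<^esub>"
      unfolding J_def by blast+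
    show "x \<otimes>\<^bsub>E\<^esub> a \<in> J" unfolding J_def
    proof (intro CollectI conjI ballI E.A.m_closed x a)
      fix v assume v: "v \<in> carrier X"
      show "free_act (x \<otimes>\<^bsub>E\<^esub> a) v = \<zero>\<^bsub>X\<^esub>"
        unfolding free_act_mult[OF x a v] a0[OF v] by (rule module_hom_zero[OF X X free_act_hom_right[OF x]])
    qed
    show "a \<otimes>\<^bsub>E\<^esub> x \<in> J" unfolding J_def
    proof (intro CollectI conjI ballI E.A.m_closed x a)
      fix v assume v: "v \<in> carrier X"
      show "free_act (a \<otimes>\<^bsub>E\<^esub> x) v = \<zero>\<^bsub>X\<^esub>"
        unfolding free_act_mult[OF a x v] by (rule a0[OF module_hom_mem[OF free_act_hom[OF v] x]])
    qed
  qed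
  moreover have "R \<subseteq> J"
  proof -
    note minus = module_hom_minus[OF E.module_axioms X free_act_hom]
    have c: "act (Inl a) v \<in> carrier X" "act (Inr a) v \<in> carrier X" if "a \<in> carrier B" "v \<in> carrier X" for a v
      using module_hom_mem[OF act_hom] that by auto
    have g: "free_act (me a) v = act (Inl a) v" "free_act (he a) v = act (Inr a) v"
      if "a \<in> carrier B" "v \<in> carrier X" for a v
      using that free_act_word[of v "[Inl a]"] free_act_word[of v "[Inr a]"] by auto
    have one: "free_act \<one>\<^bsub>E\<^esub> v = v" if "v \<in> carrier X" for v
      using that free_act_word[of v "[]"] by (simp add: env_free_one)
    have "free_act r v = \<zero>\<^bsub>X\<^esub>" if "r \<in> R" "v \<in> carrier X" for r v
      using that(1) that(2) unfolding env_rels_def Let_def Un_iff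
      apply (elim disjE CollectE exE conjE)
      by (simp_all only: minus add smult free_act_mult g c one act_m_mult act_h_bracket act_h_mult act_m_bracket
          act_m_one module_hom_add[OF act_m_hom] module_hom_add[OF act_h_hom] module_hom_smult[OF act_m_hom]
          module_hom_smult[OF act_h_hom] E.M.minus_closed E.M.add.m_closed E.smult_closed E.A.m_closed me_closed he_closed
          bracket_closed E.A.one_closed cring.cring_simprules(1,5,6)[OF M_cring] smult_closed singleton_iff
          X.M.add.m_closed X.smult_closed X.M.minus_closed X.M.minus_self)
    then show ?thesis using env_rels_closed unfolding J_def by blast
  qed
  ultimately have "I \<subseteq> J" unfolding env_ideal_def by (rule E.A.genideal_minimal)
  then show ?thesis using f x unfolding J_def by blast
qed

lemma env_act_proj:
  assumes f: "f \<in> carrier E" and x: "x \<in> carrier X"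
  shows "env_act K X act x (U.proj f) = free_act f x"
  using U.hom_some_mem[OF X free_act_hom[OF x] free_act_env_ideal[OF _ x] f]
  by (simp add: env_act_def lin_ext_def free_act_def free_lift_def Let_def)

lemma env_act_hom: "x \<in> carrier X \<Longrightarrow> env_act K X act x \<in> module_hom K U X"
  unfolding env_def by (rule U.hom_from_Q[OF free_act_hom env_act_proj])

lemma env_act_one: "x \<in> carrier X \<Longrightarrow> env_act K X act x \<one>\<^bsub>U\<^esub> = x"
  using env_act_proj[OF E.A.one_closed] free_act_word[of x "[]"] by (simp add: proj_hom_simps env_free_one)

lemma env_act_generator:
  assumes x: "x \<in> carrier X" and b: "b \<in> carrier B" and z: "z \<in> carrier U"
  shows "env_act K X act x (m b \<bullet> z) = act (Inl b) (env_act K X act x z)"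
    and "env_act K X act x (h b \<bullet> z) = act (Inr b) (env_act K X act x z)"
proof -
  obtain f where f: "f \<in> carrier E" "z = U.proj f" using z by (rule U_cases)
  have c: "free_act f x \<in> carrier X" using module_hom_mem[OF free_act_hom] x f by blast
  have "m b \<bullet> z = U.proj (me b \<otimes>\<^bsub>E\<^esub> f)" "h b \<bullet> z = U.proj (he b \<otimes>\<^bsub>E\<^esub> f)"
    by (simp_all only: proj_hom_simps f b)
  then show "env_act K X act x (m b \<bullet> z) = act (Inl b) (env_act K X act x z)"
    "env_act K X act x (h b \<bullet> z) = act (Inr b) (env_act K X act x z)"
    using free_act_word[OF c, of "[Inl b]"] free_act_word[OF c, of "[Inr b]"] b
    by (simp_all add: f env_act_proj E.A.m_closed me_closed he_closed x free_act_mult InlI InrI)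
qed

end

locale env_algebra_map = poisson_algebra K B bracket + A: assoc_algebra K A
  for K :: "('k, 'r) ring_scheme" (structure) and B :: "('k, 'b, 'm) module_scheme" and bracket
    and A :: "('k, 'x, 'l) module_scheme" +
  fixes \<mu> \<eta> :: "'b \<Rightarrow> 'x"
  assumes \<mu>: "\<mu> \<in> module_hom K B A" and \<eta>: "\<eta> \<in> module_hom K B A"
    and \<mu>_mult: "\<And>a b. \<lbrakk>a \<in> carrier B; b \<in> carrier B\<rbrakk> \<Longrightarrow> \<mu> (a \<star> b) = \<mu> a \<otimes>\<^bsub>A\<^esub> \<mu> b"
    and \<eta>_bracket: "\<And>a b. \<lbrakk>a \<in> carrier B; b \<in> carrier B\<rbrakk> \<Longrightarrow>
      \<eta> (bracket a b) = \<eta> a \<otimes>\<^bsub>A\<^esub> \<eta> b \<ominus>\<^bsub>A\<^esub> \<eta> b \<otimes>\<^bsub>A\<^esub> \<eta> a"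
    and \<eta>_mult: "\<And>a b. \<lbrakk>a \<in> carrier B; b \<in> carrier B\<rbrakk> \<Longrightarrow>
      \<eta> (a \<star> b) = \<mu> b \<otimes>\<^bsub>A\<^esub> \<eta> a \<oplus>\<^bsub>A\<^esub> \<mu> a \<otimes>\<^bsub>A\<^esub> \<eta> b"
    and \<mu>_bracket: "\<And>a b. \<lbrakk>a \<in> carrier B; b \<in> carrier B\<rbrakk> \<Longrightarrow>
      \<mu> (bracket a b) = \<eta> a \<otimes>\<^bsub>A\<^esub> \<mu> b \<ominus>\<^bsub>A\<^esub> \<mu> b \<otimes>\<^bsub>A\<^esub> \<eta> a"
    and \<mu>_one: "\<mu> \<one>\<^bsub>B\<^esub> = \<one>\<^bsub>A\<^esub>"
begin

lemma \<mu>_closed: "b \<in> carrier B \<Longrightarrow> \<mu> b \<in> carrier A"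
  and \<eta>_closed: "b \<in> carrier B \<Longrightarrow> \<eta> b \<in> carrier A"
  using \<mu> \<eta> by (auto intro: module_hom_mem)

lemma l_minus_distr:
  assumes "x \<in> carrier A" "y \<in> carrier A" "v \<in> carrier A"
  shows "(x \<ominus>\<^bsub>A\<^esub> y) \<otimes>\<^bsub>A\<^esub> v = x \<otimes>\<^bsub>A\<^esub> v \<ominus>\<^bsub>A\<^esub> y \<otimes>\<^bsub>A\<^esub> v"
  using module_hom_minus[OF A.module_axioms A.module_axioms bilin_left[OF A.mult_bilin assms(3)]] assms by simp

text \<open>The algebra A is a B^e-module by left multiplication with \<mu> b and \<eta> b, and
  \<open>env_lift\<close> is the action on the unit. The universal property thus follows from the
  one for modules, in the form with a generator on the left.\<close>

sublocale act: env_module K B bracket A "\<lambda>s y. case_sum \<mu> \<eta> s \<otimes>\<^bsub>A\<^esub> y"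
proof (intro env_module.intro env_module_axioms.intro poisson_algebra_axioms A.module_axioms)
  fix v assume v: "v \<in> carrier A"
  show "(\<lambda>a. case_sum \<mu> \<eta> (Inl a) \<otimes>\<^bsub>A\<^esub> v) \<in> module_hom K B A"
    "(\<lambda>a. case_sum \<mu> \<eta> (Inr a) \<otimes>\<^bsub>A\<^esub> v) \<in> module_hom K B A"
    using module_hom_comp[OF bilin_left[OF A.mult_bilin v]] \<mu> \<eta> by auto
qed (auto intro!: bilin_right[OF A.mult_bilin] simp: \<mu>_closed \<eta>_closed \<mu>_mult \<eta>_bracket \<eta>_mult \<mu>_bracket \<mu>_one
    l_minus_distr A.A.l_distr A.A.m_assoc bracket_closed)

lemma env_lift_eq: "env_lift K A \<mu> \<eta> = env_act K A (\<lambda>s y. case_sum \<mu> \<eta> s \<otimes>\<^bsub>A\<^esub> y) \<one>\<^bsub>A\<^esub>"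
  by (simp add: env_lift_def env_act_def fun_eq_iff)

lemma env_lift_hom: "env_lift K A \<mu> \<eta> \<in> module_hom K U A"
  unfolding env_lift_eq by (rule act.env_act_hom) simp

lemma env_lift_one: "env_lift K A \<mu> \<eta> \<one>\<^bsub>U\<^esub> = \<one>\<^bsub>A\<^esub>"
  unfolding env_lift_eq by (rule act.env_act_one) simp

lemma env_lift_mult:
  assumes "b \<in> carrier B" "z \<in> carrier U"
  shows "env_lift K A \<mu> \<eta> (m b \<bullet> z) = \<mu> b \<otimes>\<^bsub>A\<^esub> env_lift K A \<mu> \<eta> z"
    and "env_lift K A \<mu> \<eta> (h b \<bullet> z) = \<eta> b \<otimes>\<^bsub>A\<^esub> env_lift K A \<mu> \<eta> z"
  using act.env_act_generator[of "\<one>\<^bsub>A\<^esub>", OF _ assms] by (simp_all add: env_lift_eq)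

end

section \<open>Linearity of iterated lifts\<close>

lemma module_tensorI: "\<lbrakk>module K V; module K W\<rbrakk> \<Longrightarrow> module K (tensor K V W)"
  by (rule two_modules.module_tensor) (rule two_modules.intro)

lemma pure_hom_left:
  assumes "module K V" "module K W" "g \<in> module_hom K X V" "w \<in> carrier W"
  shows "(\<lambda>x. pure K V W (g x) w) \<in> module_hom K X (tensor K V W)"
  using module_hom_comp[OF bilin_left[OF two_modules.pure_bilin[OF two_modules.intro[OF assms(1,2)]] assms(4)] assms(3)] .

lemma pure_hom_right:
  assumes "module K V" "module K W" "g \<in> module_hom K X W" "v \<in> carrier V"
  shows "(\<lambda>x. pure K V W v (g x)) \<in> module_hom K X (tensor K V W)"
  using module_hom_comp[OF bilin_right[OF two_modules.pure_bilin[OF two_modules.intro[OF assms(1,2)]] assms(4)] assms(3)] .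

lemma tensor_lift_comp_hom:
  assumes "module K V" "module K W" "module K X" "bilin K V W X \<beta>" "g \<in> module_hom K Z (tensor K V W)"
  shows "(\<lambda>z. tensor_lift K X \<beta> (g z)) \<in> module_hom K Z X"
  by (rule module_hom_comp[OF two_modules.tensor_lift_hom[OF two_modules.intro[OF assms(1,2)] assms(3,4)] assms(5)])

lemma bilin_comp_left: "\<lbrakk>bilin K V W X \<beta>; g \<in> module_hom K Z V; w \<in> carrier W\<rbrakk> \<Longrightarrow> (\<lambda>z. \<beta> (g z) w) \<in> module_hom K Z X"
  and bilin_comp_right: "\<lbrakk>bilin K V W X \<beta>; g' \<in> module_hom K Z W; v \<in> carrier V\<rbrakk> \<Longrightarrow> (\<lambda>z. \<beta> v (g' z)) \<in> module_hom K Z X"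
  by (rule module_hom_comp[OF bilin_left], assumption+) (rule module_hom_comp[OF bilin_right], assumption+)

definition trilin :: "('k, 'r) ring_scheme \<Rightarrow> ('k, 'u, 'm) module_scheme \<Rightarrow> ('k, 'v, 'n) module_scheme
    \<Rightarrow> ('k, 'w, 'o) module_scheme \<Rightarrow> ('k, 'x, 'l) module_scheme \<Rightarrow> ('u \<Rightarrow> 'v \<Rightarrow> 'w \<Rightarrow> 'x) \<Rightarrow> bool"
  where "trilin K U V W X \<beta> \<longleftrightarrow>
    (\<forall>w\<in>carrier W. bilin K U V X (\<lambda>u v. \<beta> u v w)) \<and> (\<forall>u\<in>carrier U. bilin K V W X (\<beta> u))"

lemma trilinI:
  assumes "\<And>v w. \<lbrakk>v \<in> carrier V; w \<in> carrier W\<rbrakk> \<Longrightarrow> (\<lambda>u. \<beta> u v w) \<in> module_hom K U X"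
    and "\<And>u w. \<lbrakk>u \<in> carrier U; w \<in> carrier W\<rbrakk> \<Longrightarrow> (\<lambda>v. \<beta> u v w) \<in> module_hom K V X"
    and "\<And>u v. \<lbrakk>u \<in> carrier U; v \<in> carrier V\<rbrakk> \<Longrightarrow> (\<lambda>w. \<beta> u v w) \<in> module_hom K W X"
  shows "trilin K U V W X \<beta>"
  using assms by (simp add: trilin_def bilin_def)

lemma trilin_comp:
  assumes "trilin K U V W X \<beta>"
  shows "\<lbrakk>g \<in> module_hom K Z U; v \<in> carrier V; w \<in> carrier W\<rbrakk> \<Longrightarrow> (\<lambda>z. \<beta> (g z) v w) \<in> module_hom K Z X"
    and "\<lbrakk>g' \<in> module_hom K Z V; u \<in> carrier U; w \<in> carrier W\<rbrakk> \<Longrightarrow> (\<lambda>z. \<beta> u (g' z) w) \<in> module_hom K Z X"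
    and "\<lbrakk>g'' \<in> module_hom K Z W; u \<in> carrier U; v \<in> carrier V\<rbrakk> \<Longrightarrow> (\<lambda>z. \<beta> u v (g'' z)) \<in> module_hom K Z X"
    and "\<lbrakk>u \<in> carrier U; v \<in> carrier V; w \<in> carrier W\<rbrakk> \<Longrightarrow> \<beta> u v w \<in> carrier X"
  using assms bilin_comp_left[of K U V X "\<lambda>u v. \<beta> u v w" g Z v]
    bilin_comp_right[of K U V X "\<lambda>u v. \<beta> u v w" g' Z u] bilin_comp_right[of K V W X "\<beta> u" g'' Z v]
    bilin_mem[of K V W X "\<beta> u" v w]
  by (simp_all add: trilin_def)

lemma module_scalar_algebra:
  assumes "cring K"
  shows "module K (scalar_algebra K)"
proof -
  interpret cring K by fact
  have s: "carrier (scalar_algebra K) = carrier K" "\<And>x y. x \<oplus>\<^bsub>scalar_algebra K\<^esub> y = x \<oplus>\<^bsub>K\<^esub> y"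
    "\<zero>\<^bsub>scalar_algebra K\<^esub> = \<zero>\<^bsub>K\<^esub>" "\<And>c y. c \<odot>\<^bsub>scalar_algebra K\<^esub> y = c \<otimes>\<^bsub>K\<^esub> y"
    by (simp_all add: scalar_algebra_def ring.defs module.defs)
  show ?thesis
  proof (rule moduleI[OF assms])
    show "abelian_group (scalar_algebra K)"
      by (rule abelian_groupI) (auto simp: s a_ac intro: l_neg a_inv_closed)
  qed (simp_all add: s l_distr r_distr m_assoc)
qed

lemma scalar_algebra_simps:
  "carrier (scalar_algebra K) = carrier K" "x \<oplus>\<^bsub>scalar_algebra K\<^esub> y = x \<oplus>\<^bsub>K\<^esub> y"
  "\<zero>\<^bsub>scalar_algebra K\<^esub> = \<zero>\<^bsub>K\<^esub>" "x \<odot>\<^bsub>scalar_algebra K\<^esub> y = x \<otimes>\<^bsub>K\<^esub> y"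
  "x \<otimes>\<^bsub>scalar_algebra K\<^esub> y = x \<otimes>\<^bsub>K\<^esub> y" "\<one>\<^bsub>scalar_algebra K\<^esub> = \<one>\<^bsub>K\<^esub>"
  by (simp_all add: scalar_algebra_def ring.defs module.defs)

lemma scalar_smult_hom:
  assumes "module K Y" "g \<in> module_hom K X (scalar_algebra K)" "y \<in> carrier Y"
  shows "(\<lambda>x. g x \<odot>\<^bsub>Y\<^esub> y) \<in> module_hom K X Y"
proof -
  interpret module K Y by fact
  show ?thesis
    using assms module_hom_add[OF assms(2)] module_hom_smult[OF assms(2)] module_hom_mem[OF assms(2)]
    by (intro module_homI) (simp_all add: smult_l_distr smult_assoc1 scalar_algebra_simps)
qed

text \<open>The lift of \<open>pure\<close> is the identity, so any linear map on a tensor product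
  can be unfolded into a Sweedler sum.\<close>

lemma tensor_lift_pure_hom:
  assumes V: "module K V" and W: "module K W" and Y: "module K Y" and t: "t \<in> carrier (tensor K V W)"
    and f: "f \<in> module_hom K (tensor K V W) Y"
  shows "tensor_lift K Y (\<lambda>v w. f (pure K V W v w)) t = f t"
proof -
  interpret two_modules K V W by (rule two_modules.intro[OF V W])
  have "f (tensor_lift K T (pure K V W) t) = tensor_lift K Y (\<lambda>v w. f (pure K V W v w)) t"
    by (rule hom_tensor_lift[OF module_tensor Y pure_bilin f t])
  moreover have "tensor_lift K T (pure K V W) t = t"
    by (rule tensor_hom_eqI[OF tensor_lift_hom[OF module_tensor pure_bilin] module_hom_id _ t])
       (rule tensor_lift_pure[OF module_tensor pure_bilin])
  ultimately show ?thesis by simp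
qed

text \<open>Covers the coproduct of B, the coaction on B^e and the coaction of a test comodule.
  Coassociativity is left to \<open>coassoc_elim\<close>, because for the coaction on B^e it is
  still to be proved when the locale is instantiated.\<close>

locale coaction_data = M: module K M + C: module K C
  for K :: "('k, 'r) ring_scheme" (structure) and M :: "('k, 'a, 'm) module_scheme"
    and C :: "('k, 'c, 'n) module_scheme" +
  fixes \<rho> :: "'a \<Rightarrow> ('a \<times> 'c \<Rightarrow> 'k) set" and \<Delta> :: "'c \<Rightarrow> ('c \<times> 'c \<Rightarrow> 'k) set"
  assumes \<rho>: "\<rho> \<in> module_hom K M (tensor K M C)" and \<Delta>: "\<Delta> \<in> module_hom K C (tensor K C C)"
begin

abbreviation T3 where "T3 \<equiv> tensor K M (tensor K C C)"

lemmas modules = M.module_axioms C.module_axioms module_tensorI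
lemmas lin = bilinI modules module_hom_id pure_hom_left pure_hom_right two_modules.pure_closed two_modules.intro
  tensor_lift_comp_hom[OF M.module_axioms C.module_axioms]
  tensor_lift_comp_hom[OF C.module_axioms C.module_axioms] two_modules.tensor_lift_param_hom[rotated 2]
  module_hom_comp[OF \<rho>] module_hom_comp[OF \<Delta>] module_hom_mem[OF \<rho>] module_hom_mem[OF \<Delta>]
  two_modules.tensor_lift_closed

interpretation MC: two_modules K M C by (rule two_modules.intro modules)+
interpretation CC: two_modules K C C by (rule two_modules.intro modules)+

lemma tensor_assoc_map:
  assumes t: "t \<in> carrier (tensor K M C)"
  shows "tensor_assoc K M C C (tensor_map K (tensor K M C) C \<rho> id t)
    = tensor_lift K T3 (\<lambda>a c. tensor_lift K T3 (\<lambda>a' c'. pure K M (tensor K C C) a' (pure K C C c' c)) (\<rho> a)) t"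
proof -
  interpret D: two_modules K "tensor K M C" C by (rule two_modules.intro modules)+
  have b: "bilin K (tensor K M C) C T3
     (\<lambda>t w. tensor_lift K T3 (\<lambda>u v. pure K M (tensor K C C) u (pure K C C v w)) t)"
    by (assumption | rule lin)+
  have "tensor_assoc K M C C (tensor_map K (tensor K M C) C \<rho> id t)
    = tensor_lift K T3 (\<lambda>a c. tensor_lift K T3 (\<lambda>t w. tensor_lift K T3 (\<lambda>u v. pure K M (tensor K C C) u (pure K C C v w)) t)
        (pure K (tensor K M C) C (\<rho> a) c)) t"
    unfolding tensor_assoc_def tensor_map_def Let_def id_apply
    by (rule MC.hom_tensor_lift) (assumption | rule lin D.tensor_lift_hom[OF _ b] t)+
  also have "\<dots> = tensor_lift K T3 (\<lambda>a c. tensor_lift K T3 (\<lambda>a' c'. pure K M (tensor K C C) a' (pure K C C c' c)) (\<rho> a)) t"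
  proof (rule MC.tensor_lift_cong[OF _ _ t])
    fix a c assume "a \<in> carrier M" "c \<in> carrier C"
    then show "tensor_lift K T3 (\<lambda>t w. tensor_lift K T3 (\<lambda>u v. pure K M (tensor K C C) u (pure K C C v w)) t)
        (pure K (tensor K M C) C (\<rho> a) c)
      = tensor_lift K T3 (\<lambda>a' c'. pure K M (tensor K C C) a' (pure K C C c' c)) (\<rho> a)"
      by (intro D.tensor_lift_pure[OF _ b]) (assumption | rule lin)+
  qed (assumption | rule lin D.tensor_lift_hom[OF _ b] | rule module_hom_comp[OF D.tensor_lift_hom[OF _ b]])+
  finally show ?thesis .
qed

lemma tensor_map_right:
  assumes t: "t \<in> carrier (tensor K M C)"
  shows "tensor_map K M (tensor K C C) id \<Delta> t
    = tensor_lift K T3 (\<lambda>a c. tensor_lift K T3 (\<lambda>c1 c2. pure K M (tensor K C C) a (pure K C C c1 c2)) (\<Delta> c)) t"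
  unfolding tensor_map_def id_apply
proof (rule MC.tensor_lift_cong[OF _ _ t])
  fix a c assume "a \<in> carrier M" "c \<in> carrier C"
  then show "pure K M (tensor K C C) a (\<Delta> c)
    = tensor_lift K T3 (\<lambda>c1 c2. pure K M (tensor K C C) a (pure K C C c1 c2)) (\<Delta> c)"
    by (intro tensor_lift_pure_hom[symmetric]) (assumption | rule lin)+
qed (assumption | rule lin)+

text \<open>Converts an equation in a triple tensor product into an exchange rule for iterated sums
  with an arbitrary trilinear test function, the form in which coassociativity is applied everywhere
  below.\<close>

lemma coassoc_elim:
  assumes x: "x \<in> carrier M"
    and eq: "tensor_assoc K M C C (tensor_map K (tensor K M C) C \<rho> id (\<rho> x)) = tensor_map K M (tensor K C C) id \<Delta> (\<rho> x)"
    and X: "module K X" and \<beta>: "trilin K M C C X \<beta>"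
  shows "tensor_lift K X (\<lambda>a c. tensor_lift K X (\<lambda>a' c'. \<beta> a' c' c) (\<rho> a)) (\<rho> x)
    = tensor_lift K X (\<lambda>a c. tensor_lift K X (\<lambda>c1 c2. \<beta> a c1 c2) (\<Delta> c)) (\<rho> x)"
proof -
  interpret D: two_modules K M "tensor K C C" by (rule two_modules.intro modules)+
  have t: "\<rho> x \<in> carrier (tensor K M C)" using x by (rule module_hom_mem[OF \<rho>])
  note lin = lin trilin_comp[OF \<beta>] X
  \<comment> \<open>The linear map out of the triple tensor product that is induced by \<beta>;
    applied to both sides of the hypothesis it yields the two iterated sums.\<close>
  define F where "F = tensor_lift K X (\<lambda>a. tensor_lift K X (\<beta> a))"
  have b: "bilin K M (tensor K C C) X (\<lambda>a. tensor_lift K X (\<beta> a))"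
    by (assumption | rule lin)+
  have F: "F \<in> module_hom K T3 X" unfolding F_def by (rule D.tensor_lift_hom[OF X b])
  have F_pure: "F (pure K M (tensor K C C) a (pure K C C c c')) = \<beta> a c c'"
    if "a \<in> carrier M" "c \<in> carrier C" "c' \<in> carrier C" for a c c'
  proof -
    have "F (pure K M (tensor K C C) a (pure K C C c c')) = tensor_lift K X (\<beta> a) (pure K C C c c')"
      unfolding F_def by (rule D.tensor_lift_pure[OF X b]) (use that in \<open>simp_all add: CC.pure_closed\<close>)
    also have "\<dots> = \<beta> a c c'"
      by (rule CC.tensor_lift_pure[OF X]) (use \<beta> that in \<open>simp_all add: trilin_def\<close>)
    finally show ?thesis .
  qed
  have "F (tensor_lift K T3 (\<lambda>a c. tensor_lift K T3 (\<lambda>a' c'. pure K M (tensor K C C) a' (pure K C C c' c)) (\<rho> a)) (\<rho> x))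
    = tensor_lift K X (\<lambda>a c. F (tensor_lift K T3 (\<lambda>a' c'. pure K M (tensor K C C) a' (pure K C C c' c)) (\<rho> a))) (\<rho> x)"
    by (rule MC.hom_tensor_lift[OF _ X _ F t]) (assumption | rule lin)+
  also have "\<dots> = tensor_lift K X (\<lambda>a c. tensor_lift K X (\<lambda>a' c'. \<beta> a' c' c) (\<rho> a)) (\<rho> x)"
  proof (rule MC.tensor_lift_cong[OF X _ t])
    fix a c assume ac: "a \<in> carrier M" "c \<in> carrier C"
    have "F (tensor_lift K T3 (\<lambda>a' c'. pure K M (tensor K C C) a' (pure K C C c' c)) (\<rho> a))
      = tensor_lift K X (\<lambda>a' c'. F (pure K M (tensor K C C) a' (pure K C C c' c))) (\<rho> a)"
      by (rule MC.hom_tensor_lift[OF _ X _ F]) (assumption | rule lin ac)+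
    also have "\<dots> = tensor_lift K X (\<lambda>a' c'. \<beta> a' c' c) (\<rho> a)"
      by (rule MC.tensor_lift_cong[OF X]) (simp_all add: F_pure ac module_hom_mem[OF \<rho>], (assumption | rule lin module_hom_comp[OF F] ac)+)
    finally show "F (tensor_lift K T3 (\<lambda>a' c'. pure K M (tensor K C C) a' (pure K C C c' c)) (\<rho> a))
      = tensor_lift K X (\<lambda>a' c'. \<beta> a' c' c) (\<rho> a)" .
  qed (assumption | rule lin module_hom_comp[OF F])+
  finally have 1: "F (tensor_assoc K M C C (tensor_map K (tensor K M C) C \<rho> id (\<rho> x))) = \<dots>"
    by (simp only: tensor_assoc_map[OF t])
  have "F (tensor_lift K T3 (\<lambda>a c. tensor_lift K T3 (\<lambda>c1 c2. pure K M (tensor K C C) a (pure K C C c1 c2)) (\<Delta> c)) (\<rho> x))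
    = tensor_lift K X (\<lambda>a c. F (tensor_lift K T3 (\<lambda>c1 c2. pure K M (tensor K C C) a (pure K C C c1 c2)) (\<Delta> c))) (\<rho> x)"
    by (rule MC.hom_tensor_lift[OF _ X _ F t]) (assumption | rule lin)+
  also have "\<dots> = tensor_lift K X (\<lambda>a c. tensor_lift K X (\<lambda>c1 c2. \<beta> a c1 c2) (\<Delta> c)) (\<rho> x)"
  proof (rule MC.tensor_lift_cong[OF X _ t])
    fix a c assume ac: "a \<in> carrier M" "c \<in> carrier C"
    have "F (tensor_lift K T3 (\<lambda>c1 c2. pure K M (tensor K C C) a (pure K C C c1 c2)) (\<Delta> c))
      = tensor_lift K X (\<lambda>c1 c2. F (pure K M (tensor K C C) a (pure K C C c1 c2))) (\<Delta> c)"
      by (rule CC.hom_tensor_lift[OF _ X _ F]) (assumption | rule lin ac)+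
    also have "\<dots> = tensor_lift K X (\<lambda>c1 c2. \<beta> a c1 c2) (\<Delta> c)"
      by (rule CC.tensor_lift_cong[OF X]) (simp_all add: F_pure ac module_hom_mem[OF \<Delta>], (assumption | rule lin module_hom_comp[OF F] ac)+)
    finally show "F (tensor_lift K T3 (\<lambda>c1 c2. pure K M (tensor K C C) a (pure K C C c1 c2)) (\<Delta> c))
      = tensor_lift K X (\<lambda>c1 c2. \<beta> a c1 c2) (\<Delta> c)" .
  qed (assumption | rule lin module_hom_comp[OF F])+
  finally show ?thesis using 1 eq tensor_map_right[OF t] by simp
qed

end

section \<open>Sweedler sums over the Poisson Hopf algebra\<close>

lemma (in abelian_group) eq_minusI:
  assumes "y = x \<oplus> z" "x \<in> carrier G" "z \<in> carrier G"
  shows "x = y \<ominus> z"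
  using assms by (simp add: a_minus_def a_assoc r_neg)

lemma (in abelian_group) eq_addI:
  assumes "x = y \<ominus> z" "y \<in> carrier G" "z \<in> carrier G"
  shows "y = z \<oplus> x"
  using assms by (simp add: a_minus_def a_lcomm r_neg)

lemmas lin_basic = bilinI trilinI module_hom_id module_tensorI pure_hom_left pure_hom_right two_modules.pure_closed
  two_modules.intro module_hom_add_fun scalar_smult_hom module_hom_smult_fun

text \<open>Both sides are bilinear in t and u, and for pure tensors the claim is the product rule
  \<open>pure_mult\<close>.\<close>

lemma (in two_algebras) tensor_lift_mult:
  assumes X: "module K X" and \<beta>: "bilin K V W X \<beta>" and t: "t \<in> carrier T" and u: "u \<in> carrier T"
  shows "tensor_lift K X \<beta> (t \<otimes>\<^bsub>T\<^esub> u)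
    = tensor_lift K X (\<lambda>a b. tensor_lift K X (\<lambda>c d. \<beta> (a \<otimes>\<^bsub>V\<^esub> c) (b \<otimes>\<^bsub>W\<^esub> d)) u) t"
proof -
  interpret TA: assoc_algebra K T by (rule assoc_algebra_tensor)
  note lin = lin_basic V.module_axioms W.module_axioms X bilin_comp_left[OF \<beta>] bilin_comp_right[OF \<beta>]
    bilin_comp_left[OF V.mult_bilin] bilin_comp_right[OF V.mult_bilin] bilin_mem[OF V.mult_bilin]
    bilin_comp_left[OF W.mult_bilin] bilin_comp_right[OF W.mult_bilin] bilin_mem[OF W.mult_bilin]
    module_tensor TA.module_axioms
  have b1: "bilin K V W X (\<lambda>c d. \<beta> (a \<otimes>\<^bsub>V\<^esub> c) (b \<otimes>\<^bsub>W\<^esub> d))" if "a \<in> carrier V" "b \<in> carrier W" for a b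
    using that by - (assumption | rule lin)+
  have b2: "bilin K V W X (\<lambda>a b. tensor_lift K X (\<lambda>c d. \<beta> (a \<otimes>\<^bsub>V\<^esub> c) (b \<otimes>\<^bsub>W\<^esub> d)) u)" if "u \<in> carrier T" for u
    using that by - (assumption | rule lin tensor_lift_param_hom)+
  show ?thesis
  proof (rule tensor_hom_eqI[OF _ tensor_lift_hom[OF X b2[OF u]] _ t])
    show "(\<lambda>t. tensor_lift K X \<beta> (t \<otimes>\<^bsub>T\<^esub> u)) \<in> module_hom K T X"
      by (rule module_hom_comp[OF tensor_lift_hom[OF X \<beta>] bilin_left[OF TA.mult_bilin u]])
    fix a b assume ab: "a \<in> carrier V" "b \<in> carrier W"
    have "tensor_lift K X \<beta> (pure K V W a b \<otimes>\<^bsub>T\<^esub> u)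
      = tensor_lift K X (\<lambda>c d. \<beta> (a \<otimes>\<^bsub>V\<^esub> c) (b \<otimes>\<^bsub>W\<^esub> d)) u"
    proof (rule tensor_hom_eqI[OF module_hom_comp[OF tensor_lift_hom[OF X \<beta>] bilin_right[OF TA.mult_bilin]]
          tensor_lift_hom[OF X b1[OF ab]] _ u])
      show "pure K V W a b \<in> carrier T" using ab by (rule pure_closed)
      fix c d assume cd: "c \<in> carrier V" "d \<in> carrier W"
      show "tensor_lift K X \<beta> (pure K V W a b \<otimes>\<^bsub>T\<^esub> pure K V W c d)
        = tensor_lift K X (\<lambda>c d. \<beta> (a \<otimes>\<^bsub>V\<^esub> c) (b \<otimes>\<^bsub>W\<^esub> d)) (pure K V W c d)"
        by (simp only: pure_mult ab cd tensor_lift_pure[OF X \<beta>] tensor_lift_pure[OF X b1[OF ab]]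
            V.A.m_closed W.A.m_closed)
    qed
    then show "tensor_lift K X \<beta> (pure K V W a b \<otimes>\<^bsub>T\<^esub> u)
      = tensor_lift K X (\<lambda>a b. tensor_lift K X (\<lambda>c d. \<beta> (a \<otimes>\<^bsub>V\<^esub> c) (b \<otimes>\<^bsub>W\<^esub> d)) u) (pure K V W a b)"
      by (simp only: tensor_lift_pure[OF X b2[OF u]] ab)
  qed
qed

context poisson_hopf_algebra
begin

lemma assoc_algebra_B: "assoc_algebra K B" by (rule assoc_algebra)

sublocale BB: two_algebras K B B
  by (intro two_algebras.intro assoc_algebra_B)

sublocale UU: two_algebras K U U
  by (intro two_algebras.intro assoc_algebra_U)

lemmas K_simps = cring.cring_simprules[OF R_cring]

lemmas K_abelian = ring.is_abelian_group[OF cring.axioms(1)[OF R_cring]]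

lemmas B_simps = cring.cring_simprules[OF M_cring]

text \<open>Positions cited below: 1, 5 and 6 are closure of sum, product and unit, 11 is
  associativity, 12 the left unit law, 13 and 23 are the distributive laws.\<close>

lemmas U_simps = ring.ring_simprules[OF assoc_algebra.axioms(2)[OF assoc_algebra_U]]

lemmas B_smult_mult = assoc_algebra.smult_mult_left[OF assoc_algebra_B] assoc_algebra.smult_mult_right[OF assoc_algebra_B]

lemmas module_B = assoc_algebra.axioms(1)[OF assoc_algebra_B]
  and module_U = assoc_algebra.axioms(1)[OF assoc_algebra_U]
  and B_mult_bilin = assoc_algebra.mult_bilin[OF assoc_algebra_B]
  and U_mult_bilin = assoc_algebra.mult_bilin[OF assoc_algebra_U]

lemma bracket_bilin: "bilin K B B B bracket"
  by (intro bilinI module_homI bracket_closed bracket_add_left bracket_add_right bracket_smult_left bracket_smult_right)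

lemma module_scalar: "module K (scalar_algebra K)"
  by (rule module_scalar_algebra[OF R_cring])

lemma \<epsilon>_closed: "x \<in> carrier B \<Longrightarrow> \<epsilon> x \<in> carrier K"
  using module_hom_mem[OF counit_linear] by (simp add: scalar_algebra_simps)

text \<open>
  Sweedler sums: \<open>swB X \<beta> b\<close> is \<open>\<Sum> \<beta> b\<^sub>1 b\<^sub>2\<close>, and \<open>swU\<close> below is the same for the enveloping algebra.
\<close>

definition swB :: "('k, 'x, 'l) module_scheme \<Rightarrow> ('b \<Rightarrow> 'b \<Rightarrow> 'x) \<Rightarrow> 'b \<Rightarrow> 'x"
  where "swB X \<beta> b = tensor_lift K X \<beta> (\<Delta> b)"

lemma \<Delta>_closed: "x \<in> carrier B \<Longrightarrow> \<Delta> x \<in> carrier (tensor K B B)"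
  by (rule module_hom_mem[OF comul_linear])

lemma swB_comp_hom:
  "\<lbrakk>g \<in> module_hom K Z B; module K X; bilin K B B X \<beta>\<rbrakk> \<Longrightarrow> (\<lambda>z. swB X \<beta> (g z)) \<in> module_hom K Z X"
  unfolding swB_def
  by (rule module_hom_comp[OF BB.tensor_lift_hom module_hom_comp[OF comul_linear]])

lemma swB_param_hom:
  "\<lbrakk>b \<in> carrier B; module K Z; module K X;
    \<And>v w. \<lbrakk>v \<in> carrier B; w \<in> carrier B\<rbrakk> \<Longrightarrow> (\<lambda>z. \<beta> z v w) \<in> module_hom K Z X;
    \<And>z. z \<in> carrier Z \<Longrightarrow> bilin K B B X (\<beta> z)\<rbrakk>
  \<Longrightarrow> (\<lambda>z. swB X (\<beta> z) b) \<in> module_hom K Z X"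
  unfolding swB_def by (rule BB.tensor_lift_param_hom) (assumption | rule \<Delta>_closed)+

lemma swB_closed: "\<lbrakk>b \<in> carrier B; module K X; bilin K B B X \<beta>\<rbrakk> \<Longrightarrow> swB X \<beta> b \<in> carrier X"
  unfolding swB_def by (intro BB.tensor_lift_closed \<Delta>_closed)

lemma swB_cong:
  "\<lbrakk>b \<in> carrier B; module K X; bilin K B B X \<beta>;
    \<And>x y. \<lbrakk>x \<in> carrier B; y \<in> carrier B\<rbrakk> \<Longrightarrow> \<beta> x y = \<gamma> x y\<rbrakk> \<Longrightarrow> swB X \<beta> b = swB X \<gamma> b"
  unfolding swB_def by (intro BB.tensor_lift_cong \<Delta>_closed)

lemma swB_map:
  "\<lbrakk>b \<in> carrier B; module K X; module K Y; bilin K B B X \<beta>; f \<in> module_hom K X Y\<rbrakk>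
    \<Longrightarrow> f (swB X \<beta> b) = swB Y (\<lambda>x y. f (\<beta> x y)) b"
  unfolding swB_def by (intro BB.hom_tensor_lift \<Delta>_closed)

text \<open>
  Linearity and membership side conditions are proved by \<open>(assumption | rule lin)+\<close>: each rule
  strips the outermost operation of a function that is linear in its bound variable.
\<close>

lemmas lin = lin_basic module_B module_U module_scalar UU.module_tensor BB.module_tensor
  module_hom_comp[OF m_hom] module_hom_comp[OF h_hom] m_closed h_closed
  module_hom_comp[OF antipode_linear] module_hom_mem[OF antipode_linear]
  module_hom_comp[OF counit_linear] \<epsilon>_closed module_hom_mem[OF counit_linear]
  bilin_comp_left[OF bracket_bilin] bilin_comp_right[OF bracket_bilin] bracket_closed
  bilin_comp_left[OF B_mult_bilin] bilin_comp_right[OF B_mult_bilin] bilin_mem[OF B_mult_bilin]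
  bilin_comp_left[OF U_mult_bilin] bilin_comp_right[OF U_mult_bilin] bilin_mem[OF U_mult_bilin]
  swB_comp_hom swB_param_hom swB_closed B_simps(1,6) U_simps(1,6)
  module.smult_closed[OF module_B] module.smult_closed[OF module_U]

lemma swB_swap:
  assumes "module K X" "a \<in> carrier B" "b \<in> carrier B"
    "\<And>v w. \<lbrakk>v \<in> carrier B; w \<in> carrier B\<rbrakk> \<Longrightarrow> bilin K B B X (\<beta> v w)"
    "\<And>v w. \<lbrakk>v \<in> carrier B; w \<in> carrier B\<rbrakk> \<Longrightarrow> bilin K B B X (\<lambda>x y. \<beta> x y v w)"
  shows "swB X (\<lambda>v w. swB X (\<beta> v w) b) a = swB X (\<lambda>x y. swB X (\<lambda>v w. \<beta> v w x y) a) b"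
  unfolding swB_def
  by (rule tensor_lift_swap) (assumption | rule BB.two_modules_axioms assms \<Delta>_closed)+

lemma swB_add:
  assumes "module K X" "b \<in> carrier B" "bilin K B B X \<beta>" "bilin K B B X \<gamma>"
  shows "swB X (\<lambda>x y. \<beta> x y \<oplus>\<^bsub>X\<^esub> \<gamma> x y) b = swB X \<beta> b \<oplus>\<^bsub>X\<^esub> swB X \<gamma> b"
proof -
  note l = BB.tensor_lift_hom[OF assms(1)] and p = BB.tensor_lift_pure[OF assms(1)]
  have s: "bilin K B B X (\<lambda>x y. \<beta> x y \<oplus>\<^bsub>X\<^esub> \<gamma> x y)"
    by (assumption | rule lin assms(1) bilin_left[OF assms(3)] bilin_left[OF assms(4)]
       bilin_right[OF assms(3)] bilin_right[OF assms(4)])+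
  show ?thesis unfolding swB_def
    by (rule BB.tensor_hom_eqI[OF l[OF s] module_hom_add_fun[OF assms(1) l[OF assms(3)] l[OF assms(4)]] _ \<Delta>_closed[OF assms(2)]])
       (simp add: p[OF s] p[OF assms(3)] p[OF assms(4)])
qed

lemma comul_mult: "\<lbrakk>a \<in> carrier B; b \<in> carrier B\<rbrakk> \<Longrightarrow> \<Delta> (a \<star> b) = \<Delta> a \<otimes>\<^bsub>tensor K B B\<^esub> \<Delta> b"
  and comul_one: "\<Delta> \<one>\<^bsub>B\<^esub> = pure K B B \<one>\<^bsub>B\<^esub> \<one>\<^bsub>B\<^esub>"
  using comul_hom BB.tensor_one by (auto simp: algebra_hom_def ring_hom_def)

lemma \<epsilon>_mult: "\<lbrakk>a \<in> carrier B; b \<in> carrier B\<rbrakk> \<Longrightarrow> \<epsilon> (a \<star> b) = \<epsilon> a \<otimes> \<epsilon> b"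
  and \<epsilon>_one: "\<epsilon> \<one>\<^bsub>B\<^esub> = \<one>"
  using counit_hom by (auto simp: algebra_hom_def ring_hom_def scalar_algebra_simps)

lemma swB_mult:
  assumes "module K X" "bilin K B B X \<beta>" "a \<in> carrier B" "b \<in> carrier B"
  shows "swB X \<beta> (a \<star> b) = swB X (\<lambda>a1 a2. swB X (\<lambda>b1 b2. \<beta> (a1 \<star> b1) (a2 \<star> b2)) b) a"
  unfolding swB_def comul_mult[OF assms(3,4)]
  by (rule BB.tensor_lift_mult[OF assms(1,2) \<Delta>_closed[OF assms(3)] \<Delta>_closed[OF assms(4)]])

lemma swB_one: "\<lbrakk>module K X; bilin K B B X \<beta>\<rbrakk> \<Longrightarrow> swB X \<beta> \<one>\<^bsub>B\<^esub> = \<beta> \<one>\<^bsub>B\<^esub> \<one>\<^bsub>B\<^esub>"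
  unfolding swB_def comul_one by (intro BB.tensor_lift_pure) (assumption | rule lin)+

text \<open>The compatibility of \<Delta> with the bracket enters the development here: the two
  summands are those of the Poisson bracket on the tensor square.\<close>

lemma swB_bracket:
  assumes X: "module K X" and \<beta>: "bilin K B B X \<beta>" and a: "a \<in> carrier B" and b: "b \<in> carrier B"
  shows "swB X \<beta> (bracket a b) = swB X (\<lambda>a1 a2. swB X (\<lambda>b1 b2.
    \<beta> (a1 \<star> b1) (bracket a2 b2) \<oplus>\<^bsub>X\<^esub> \<beta> (bracket a1 b1) (a2 \<star> b2)) b) a"
proof -
  let ?T = "tensor K B B"
  let ?br = "\<lambda>a1 a2 b1 b2. pure K B B (a1 \<star> b1) (bracket a2 b2) \<oplus>\<^bsub>?T\<^esub> pure K B B (bracket a1 b1) (a2 \<star> b2)"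
  define F where "F = tensor_lift K X \<beta>"
  have F: "F \<in> module_hom K ?T X" unfolding F_def by (rule BB.tensor_lift_hom[OF X \<beta>])
  have F_pure: "F (pure K B B x y) = \<beta> x y" if "x \<in> carrier B" "y \<in> carrier B" for x y
    unfolding F_def using that by (rule BB.tensor_lift_pure[OF X \<beta>])
  note lin = lin X
  have "swB X \<beta> (bracket a b) = F (swB ?T (\<lambda>a1 a2. swB ?T (?br a1 a2) b) a)"
    by (simp add: swB_def F_def comul_bracket[OF a b] tensor_bracket_def Let_def)
  also have "\<dots> = swB X (\<lambda>a1 a2. F (swB ?T (?br a1 a2) b)) a"
    by (rule swB_map[OF a _ X _ F]) (assumption | rule lin a b)+
  also have "\<dots> = swB X (\<lambda>a1 a2. swB X (\<lambda>b1 b2.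
    \<beta> (a1 \<star> b1) (bracket a2 b2) \<oplus>\<^bsub>X\<^esub> \<beta> (bracket a1 b1) (a2 \<star> b2)) b) a"
  proof (rule swB_cong[OF a X])
    fix a1 a2 assume c: "a1 \<in> carrier B" "a2 \<in> carrier B"
    have "F (swB ?T (?br a1 a2) b) = swB X (\<lambda>b1 b2. F (?br a1 a2 b1 b2)) b"
      by (rule swB_map[OF b _ X _ F]) (assumption | rule lin c)+
    also have "\<dots> = swB X (\<lambda>b1 b2.
      \<beta> (a1 \<star> b1) (bracket a2 b2) \<oplus>\<^bsub>X\<^esub> \<beta> (bracket a1 b1) (a2 \<star> b2)) b"
    proof (rule swB_cong[OF b X])
      fix b1 b2 assume d: "b1 \<in> carrier B" "b2 \<in> carrier B"
      show "F (?br a1 a2 b1 b2) = \<beta> (a1 \<star> b1) (bracket a2 b2) \<oplus>\<^bsub>X\<^esub> \<beta> (bracket a1 b1) (a2 \<star> b2)"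
        using c d by (simp add: module_hom_add[OF F] BB.pure_closed bracket_closed B_simps F_pure)
    qed (assumption | rule lin module_hom_comp[OF F] c)+
    finally show "F (swB ?T (?br a1 a2) b) = \<dots>" .
  qed (assumption | rule lin module_hom_comp[OF F] a b)+
  finally show ?thesis .
qed

sublocale B: coaction_data K B B \<Delta> \<Delta>
  by (intro coaction_data.intro coaction_data_axioms.intro module_B comul_linear)

lemma swB_coassoc:
  assumes "module K X" "b \<in> carrier B" "trilin K B B B X \<beta>"
  shows "swB X (\<lambda>x z. swB X (\<lambda>x' y'. \<beta> x' y' z) x) b = swB X (\<lambda>x z. swB X (\<lambda>y' z'. \<beta> x y' z') z) b"
  unfolding swB_def by (rule B.coassoc_elim[OF assms(2) coassoc[OF assms(2)] assms(1,3)])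

lemma swB_counit_left:
  assumes X: "module K X" and f: "f \<in> module_hom K B X" and b: "b \<in> carrier B"
  shows "swB X (\<lambda>x y. \<epsilon> x \<odot>\<^bsub>X\<^esub> f y) b = f b"
proof -
  have "f b = f (swB B (\<lambda>x y. \<epsilon> x \<odot>\<^bsub>B\<^esub> y) b)" using counit_left[OF b] by (simp add: swB_def)
  also have "\<dots> = swB X (\<lambda>x y. f (\<epsilon> x \<odot>\<^bsub>B\<^esub> y)) b"
    by (rule swB_map[OF b _ X _ f]) (assumption | rule lin)+
  also have "\<dots> = swB X (\<lambda>x y. \<epsilon> x \<odot>\<^bsub>X\<^esub> f y) b"
    by (rule swB_cong[OF b X]) (simp_all add: module_hom_smult[OF f] \<epsilon>_closed, (assumption | rule lin X module_hom_comp[OF f])+)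
  finally show ?thesis by simp
qed

lemma swB_counit_right:
  assumes X: "module K X" and f: "f \<in> module_hom K B X" and b: "b \<in> carrier B"
  shows "swB X (\<lambda>x y. \<epsilon> y \<odot>\<^bsub>X\<^esub> f x) b = f b"
proof -
  have "f b = f (swB B (\<lambda>x y. \<epsilon> y \<odot>\<^bsub>B\<^esub> x) b)" using counit_right[OF b] by (simp add: swB_def)
  also have "\<dots> = swB X (\<lambda>x y. f (\<epsilon> y \<odot>\<^bsub>B\<^esub> x)) b"
    by (rule swB_map[OF b _ X _ f]) (assumption | rule lin)+
  also have "\<dots> = swB X (\<lambda>x y. \<epsilon> y \<odot>\<^bsub>X\<^esub> f x) b"
    by (rule swB_cong[OF b X]) (simp_all add: module_hom_smult[OF f] \<epsilon>_closed, (assumption | rule lin X module_hom_comp[OF f])+)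
  finally show ?thesis by simp
qed

lemma swB_antipode_left: "b \<in> carrier B \<Longrightarrow> swB B (\<lambda>x y. S x \<star> y) b = \<epsilon> b \<odot>\<^bsub>B\<^esub> \<one>\<^bsub>B\<^esub>"
  and swB_antipode_right: "b \<in> carrier B \<Longrightarrow> swB B (\<lambda>x y. x \<star> S y) b = \<epsilon> b \<odot>\<^bsub>B\<^esub> \<one>\<^bsub>B\<^esub>"
  by (simp_all add: swB_def antipode_left antipode_right)

text \<open>Applying \<epsilon> \<otimes> \<epsilon> to \<Delta>({a,b}), each of the two summands
  collapses to \<epsilon>({a,b}) by the counit laws. So x = x + x, which forces x = 0 in every
  characteristic.\<close>

lemma \<epsilon>_bracket:
  assumes a: "a \<in> carrier B" and b: "b \<in> carrier B"
  shows "\<epsilon> (bracket a b) = \<zero>"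
proof -
  let ?k = "scalar_algebra K"
  interpret k: module K ?k by (rule module_scalar)
  note lin = lin a b
  \<comment> \<open>The factor \<epsilon>(a1 b1) splits as \<epsilon>(a1) \<epsilon>(b1); the counit
    law for b and then the one for a remove both.\<close>
  have 1: "swB ?k (\<lambda>a1 a2. swB ?k (\<lambda>b1 b2. \<epsilon> (a1 \<star> b1) \<odot>\<^bsub>?k\<^esub> \<epsilon> (bracket a2 b2)) b) a = \<epsilon> (bracket a b)"
  proof -
    have "swB ?k (\<lambda>a1 a2. swB ?k (\<lambda>b1 b2. \<epsilon> (a1 \<star> b1) \<odot>\<^bsub>?k\<^esub> \<epsilon> (bracket a2 b2)) b) a
      = swB ?k (\<lambda>a1 a2. \<epsilon> a1 \<odot>\<^bsub>?k\<^esub> \<epsilon> (bracket a2 b)) a"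
    proof (rule swB_cong[OF a module_scalar])
      fix a1 a2 assume c: "a1 \<in> carrier B" "a2 \<in> carrier B"
      have "swB ?k (\<lambda>b1 b2. \<epsilon> (a1 \<star> b1) \<odot>\<^bsub>?k\<^esub> \<epsilon> (bracket a2 b2)) b
        = swB ?k (\<lambda>b1 b2. \<epsilon> b1 \<odot>\<^bsub>?k\<^esub> (\<epsilon> a1 \<odot>\<^bsub>?k\<^esub> \<epsilon> (bracket a2 b2))) b"
      proof (rule swB_cong[OF b module_scalar])
        fix x y assume d: "x \<in> carrier B" "y \<in> carrier B"
        show "\<epsilon> (a1 \<star> x) \<odot>\<^bsub>?k\<^esub> \<epsilon> (bracket a2 y) = \<epsilon> x \<odot>\<^bsub>?k\<^esub> (\<epsilon> a1 \<odot>\<^bsub>?k\<^esub> \<epsilon> (bracket a2 y))"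
          using c d \<epsilon>_closed[OF c(1)] \<epsilon>_closed[OF d(1)] \<epsilon>_closed[OF bracket_closed[OF c(2) d(2)]]
          by (simp only: \<epsilon>_mult scalar_algebra_simps K_simps)
      qed (assumption | rule lin c)+
      also have "\<dots> = \<epsilon> a1 \<odot>\<^bsub>?k\<^esub> \<epsilon> (bracket a2 b)"
        by (rule swB_counit_left[OF module_scalar _ b]) (assumption | rule lin c)+
      finally show "swB ?k (\<lambda>b1 b2. \<epsilon> (a1 \<star> b1) \<odot>\<^bsub>?k\<^esub> \<epsilon> (bracket a2 b2)) b = \<dots>" .
    qed (assumption | rule lin)+
    also have "\<dots> = \<epsilon> (bracket a b)"
      by (rule swB_counit_left[OF module_scalar _ a]) (assumption | rule lin)+
    finally show ?thesis .
  qed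
  have 2: "swB ?k (\<lambda>a1 a2. swB ?k (\<lambda>b1 b2. \<epsilon> (bracket a1 b1) \<odot>\<^bsub>?k\<^esub> \<epsilon> (a2 \<star> b2)) b) a = \<epsilon> (bracket a b)"
  proof -
    have "swB ?k (\<lambda>a1 a2. swB ?k (\<lambda>b1 b2. \<epsilon> (bracket a1 b1) \<odot>\<^bsub>?k\<^esub> \<epsilon> (a2 \<star> b2)) b) a
      = swB ?k (\<lambda>a1 a2. \<epsilon> a2 \<odot>\<^bsub>?k\<^esub> \<epsilon> (bracket a1 b)) a"
    proof (rule swB_cong[OF a module_scalar])
      fix a1 a2 assume c: "a1 \<in> carrier B" "a2 \<in> carrier B"
      have "swB ?k (\<lambda>b1 b2. \<epsilon> (bracket a1 b1) \<odot>\<^bsub>?k\<^esub> \<epsilon> (a2 \<star> b2)) b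
        = swB ?k (\<lambda>b1 b2. \<epsilon> b2 \<odot>\<^bsub>?k\<^esub> (\<epsilon> a2 \<odot>\<^bsub>?k\<^esub> \<epsilon> (bracket a1 b1))) b"
      proof (rule swB_cong[OF b module_scalar])
        fix x y assume d: "x \<in> carrier B" "y \<in> carrier B"
        show "\<epsilon> (bracket a1 x) \<odot>\<^bsub>?k\<^esub> \<epsilon> (a2 \<star> y) = \<epsilon> y \<odot>\<^bsub>?k\<^esub> (\<epsilon> a2 \<odot>\<^bsub>?k\<^esub> \<epsilon> (bracket a1 x))"
          using c d \<epsilon>_closed[OF c(2)] \<epsilon>_closed[OF d(2)] \<epsilon>_closed[OF bracket_closed[OF c(1) d(1)]]
          by (simp only: \<epsilon>_mult scalar_algebra_simps K_simps)
      qed (assumption | rule lin c)+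
      also have "\<dots> = \<epsilon> a2 \<odot>\<^bsub>?k\<^esub> \<epsilon> (bracket a1 b)"
        by (rule swB_counit_right[OF module_scalar _ b]) (assumption | rule lin c)+
      finally show "swB ?k (\<lambda>b1 b2. \<epsilon> (bracket a1 b1) \<odot>\<^bsub>?k\<^esub> \<epsilon> (a2 \<star> b2)) b = \<dots>" .
    qed (assumption | rule lin)+
    also have "\<dots> = \<epsilon> (bracket a b)"
      by (rule swB_counit_right[OF module_scalar _ a]) (assumption | rule lin)+
    finally show ?thesis .
  qed
  have "\<epsilon> (bracket a b) = swB ?k (\<lambda>x y. \<epsilon> x \<odot>\<^bsub>?k\<^esub> \<epsilon> y) (bracket a b)"
    by (rule swB_counit_left[symmetric]) (assumption | rule lin)+
  also have "\<dots> = swB ?k (\<lambda>a1 a2. swB ?k (\<lambda>b1 b2. \<epsilon> (a1 \<star> b1) \<odot>\<^bsub>?k\<^esub> \<epsilon> (bracket a2 b2)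
      \<oplus>\<^bsub>?k\<^esub> \<epsilon> (bracket a1 b1) \<odot>\<^bsub>?k\<^esub> \<epsilon> (a2 \<star> b2)) b) a"
    by (rule swB_bracket) (assumption | rule lin)+
  also have "\<dots> = swB ?k (\<lambda>a1 a2. swB ?k (\<lambda>b1 b2. \<epsilon> (a1 \<star> b1) \<odot>\<^bsub>?k\<^esub> \<epsilon> (bracket a2 b2)) b
      \<oplus>\<^bsub>?k\<^esub> swB ?k (\<lambda>b1 b2. \<epsilon> (bracket a1 b1) \<odot>\<^bsub>?k\<^esub> \<epsilon> (a2 \<star> b2)) b) a"
  proof (rule swB_cong[OF a module_scalar], goal_cases)
    case (2 a1 a2)
    then show ?case by (intro swB_add[OF module_scalar b]) (assumption | rule lin)+
  qed (assumption | rule lin)+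
  also have "\<dots> = \<epsilon> (bracket a b) \<oplus>\<^bsub>?k\<^esub> \<epsilon> (bracket a b)"
    by (subst swB_add[OF module_scalar a]) (simp_all only: 1 2, (assumption | rule lin)+)
  finally have "\<epsilon> (bracket a b) = \<epsilon> (bracket a b) \<oplus> \<epsilon> (bracket a b)" by (simp add: scalar_algebra_simps)
  moreover have e: "\<epsilon> (bracket a b) \<in> carrier K" by (intro \<epsilon>_closed bracket_closed a b)
  ultimately have "\<epsilon> (bracket a b) = \<epsilon> (bracket a b) \<ominus> \<epsilon> (bracket a b)"
    using abelian_group.eq_minusI[OF K_abelian] by blast
  with e show ?thesis using abelian_group.minus_self[OF K_abelian e] by simp
qed

text \<open>
  The next two lemmas replace multiplicativity of the antipode.
\<close>

lemma antipode_cancel_left: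
  assumes b: "b \<in> carrier B" and t: "t \<in> carrier B"
  shows "swB B (\<lambda>b1 b2. S (b1 \<star> t) \<star> b2) b = \<epsilon> b \<odot>\<^bsub>B\<^esub> S t"
proof -
  \<comment> \<open>For fixed b the convolution of \<phi> with the identity is u \<mapsto>
    \<epsilon>(bu) 1 by the antipode law at the product bu; this is \<open>\<psi>\<close>.
    Convolving with S on the right cancels the identity and leaves \<phi> = \<epsilon>(b) S.\<close>
  define \<phi> where "\<phi> = (\<lambda>t. swB B (\<lambda>b1 b2. S (b1 \<star> t) \<star> b2) b)"
  have \<phi>: "\<phi> \<in> module_hom K B B" unfolding \<phi>_def by (assumption | rule lin b)+
  note lin = lin b t module_hom_comp[OF \<phi>] module_hom_mem[OF \<phi>]
  have \<psi>: "swB B (\<lambda>x y. \<phi> x \<star> y) u = \<epsilon> (b \<star> u) \<odot>\<^bsub>B\<^esub> \<one>\<^bsub>B\<^esub>" if u: "u \<in> carrier B" for u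
  proof -
    have "swB B (\<lambda>x y. \<phi> x \<star> y) u
      = swB B (\<lambda>x y. swB B (\<lambda>b1 b2. S (b1 \<star> x) \<star> (b2 \<star> y)) b) u"
    proof (rule swB_cong[OF u module_B])
      fix x y assume c: "x \<in> carrier B" "y \<in> carrier B"
      have "\<phi> x \<star> y = swB B (\<lambda>b1 b2. S (b1 \<star> x) \<star> b2 \<star> y) b"
        unfolding \<phi>_def by (rule swB_map[OF b module_B module_B]) (assumption | rule lin c)+
      also have "\<dots> = swB B (\<lambda>b1 b2. S (b1 \<star> x) \<star> (b2 \<star> y)) b"
        by (rule swB_cong[OF b module_B])
           (simp_all add: B_simps c module_hom_mem[OF antipode_linear], (assumption | rule lin c)+)
      finally show "\<phi> x \<star> y = \<dots>" .
    qed (assumption | rule lin u)+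
    also have "\<dots> = swB B (\<lambda>b1 b2. swB B (\<lambda>x y. S (b1 \<star> x) \<star> (b2 \<star> y)) u) b"
      by (rule swB_swap[OF module_B u b]) (assumption | rule lin)+
    also have "\<dots> = swB B (\<lambda>x y. S x \<star> y) (b \<star> u)"
      by (rule swB_mult[symmetric, OF module_B _ b u]) (assumption | rule lin)+
    also have "\<dots> = \<epsilon> (b \<star> u) \<odot>\<^bsub>B\<^esub> \<one>\<^bsub>B\<^esub>"
      by (intro swB_antipode_left B_simps b u)
    finally show ?thesis .
  qed
  have "\<phi> t = swB B (\<lambda>t1 t2. \<epsilon> t2 \<odot>\<^bsub>B\<^esub> \<phi> t1) t"
    by (rule swB_counit_right[symmetric, OF module_B \<phi> t])
  also have "\<dots> = swB B (\<lambda>t1 t2. swB B (\<lambda>x y. \<phi> t1 \<star> (x \<star> S y)) t2) t"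
  proof (rule swB_cong[OF t module_B])
    fix t1 t2 assume c: "t1 \<in> carrier B" "t2 \<in> carrier B"
    have "\<epsilon> t2 \<odot>\<^bsub>B\<^esub> \<phi> t1 = \<phi> t1 \<star> swB B (\<lambda>x y. x \<star> S y) t2"
      using c by (simp add: swB_antipode_right B_smult_mult \<epsilon>_closed
          module_hom_mem[OF \<phi>] B_simps)
    also have "\<dots> = swB B (\<lambda>x y. \<phi> t1 \<star> (x \<star> S y)) t2"
      by (rule swB_map[OF c(2) module_B module_B]) (assumption | rule lin c)+
    finally show "\<epsilon> t2 \<odot>\<^bsub>B\<^esub> \<phi> t1 = \<dots>" .
  qed (assumption | rule lin)+
  also have "\<dots> = swB B (\<lambda>t1 t2. swB B (\<lambda>x y. \<phi> x \<star> (y \<star> S t2)) t1) t"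
    by (rule swB_coassoc[symmetric, OF module_B t]) (assumption | rule lin)+
  also have "\<dots> = swB B (\<lambda>t1 t2. \<epsilon> t1 \<odot>\<^bsub>B\<^esub> (\<epsilon> b \<odot>\<^bsub>B\<^esub> S t2)) t"
  proof (rule swB_cong[OF t module_B])
    fix t1 t2 assume c: "t1 \<in> carrier B" "t2 \<in> carrier B"
    have "swB B (\<lambda>x y. \<phi> x \<star> (y \<star> S t2)) t1 = swB B (\<lambda>x y. \<phi> x \<star> y \<star> S t2) t1"
      by (rule swB_cong[OF c(1) module_B])
         (simp_all add: B_simps c module_hom_mem[OF antipode_linear] module_hom_mem[OF \<phi>], (assumption | rule lin c)+)
    also have "\<dots> = swB B (\<lambda>x y. \<phi> x \<star> y) t1 \<star> S t2"
      by (rule swB_map[symmetric, OF c(1) module_B module_B]) (assumption | rule lin c)+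
    also have "\<dots> = \<epsilon> t1 \<odot>\<^bsub>B\<^esub> (\<epsilon> b \<odot>\<^bsub>B\<^esub> S t2)"
      using c b t by (simp add: \<psi> \<epsilon>_mult B_smult_mult \<epsilon>_closed B_simps
          module_hom_mem[OF antipode_linear] smult_assoc1[symmetric] field.m_comm)
    finally show "swB B (\<lambda>x y. \<phi> x \<star> (y \<star> S t2)) t1 = \<dots>" .
  qed (assumption | rule lin)+
  also have "\<dots> = \<epsilon> b \<odot>\<^bsub>B\<^esub> S t"
    by (rule swB_counit_left[OF module_B _ t]) (assumption | rule lin)+
  finally show ?thesis unfolding \<phi>_def .
qed

lemma antipode_cancel_right:
  assumes b: "b \<in> carrier B" and t: "t \<in> carrier B"
  shows "swB B (\<lambda>b1 b2. S (b2 \<star> t) \<star> b1) b = \<epsilon> b \<odot>\<^bsub>B\<^esub> S t"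
proof -
  \<comment> \<open>The mirror image: the identity is convolved with \<phi> from the left, where
    commutativity of B brings b1 next to x, and S on the left cancels it.\<close>
  define \<phi> where "\<phi> = (\<lambda>t. swB B (\<lambda>b1 b2. S (b2 \<star> t) \<star> b1) b)"
  have \<phi>: "\<phi> \<in> module_hom K B B" unfolding \<phi>_def by (assumption | rule lin b)+
  note lin = lin b t module_hom_comp[OF \<phi>] module_hom_mem[OF \<phi>]
  have \<psi>: "swB B (\<lambda>x y. x \<star> \<phi> y) u = \<epsilon> (b \<star> u) \<odot>\<^bsub>B\<^esub> \<one>\<^bsub>B\<^esub>" if u: "u \<in> carrier B" for u
  proof -
    have "swB B (\<lambda>x y. x \<star> \<phi> y) u
      = swB B (\<lambda>x y. swB B (\<lambda>b1 b2. (b1 \<star> x) \<star> S (b2 \<star> y)) b) u"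
    proof (rule swB_cong[OF u module_B])
      fix x y assume c: "x \<in> carrier B" "y \<in> carrier B"
      have "x \<star> \<phi> y = swB B (\<lambda>b1 b2. x \<star> (S (b2 \<star> y) \<star> b1)) b"
        unfolding \<phi>_def by (rule swB_map[OF b module_B module_B]) (assumption | rule lin c)+
      also have "\<dots> = swB B (\<lambda>b1 b2. (b1 \<star> x) \<star> S (b2 \<star> y)) b"
        by (rule swB_cong[OF b module_B])
           (simp_all add: B_simps c module_hom_mem[OF antipode_linear], (assumption | rule lin c)+)
      finally show "x \<star> \<phi> y = \<dots>" .
    qed (assumption | rule lin u)+
    also have "\<dots> = swB B (\<lambda>b1 b2. swB B (\<lambda>x y. (b1 \<star> x) \<star> S (b2 \<star> y)) u) b"
      by (rule swB_swap[OF module_B u b]) (assumption | rule lin)+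
    also have "\<dots> = swB B (\<lambda>x y. x \<star> S y) (b \<star> u)"
      by (rule swB_mult[symmetric, OF module_B _ b u]) (assumption | rule lin)+
    also have "\<dots> = \<epsilon> (b \<star> u) \<odot>\<^bsub>B\<^esub> \<one>\<^bsub>B\<^esub>"
      by (intro swB_antipode_right B_simps b u)
    finally show ?thesis .
  qed
  have "\<phi> t = swB B (\<lambda>t1 t2. \<epsilon> t1 \<odot>\<^bsub>B\<^esub> \<phi> t2) t"
    by (rule swB_counit_left[symmetric, OF module_B \<phi> t])
  also have "\<dots> = swB B (\<lambda>t1 t2. swB B (\<lambda>x y. S x \<star> y \<star> \<phi> t2) t1) t"
  proof (rule swB_cong[OF t module_B])
    fix t1 t2 assume c: "t1 \<in> carrier B" "t2 \<in> carrier B"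
    have "\<epsilon> t1 \<odot>\<^bsub>B\<^esub> \<phi> t2 = swB B (\<lambda>x y. S x \<star> y) t1 \<star> \<phi> t2"
      using c by (simp add: swB_antipode_left B_smult_mult \<epsilon>_closed
          module_hom_mem[OF \<phi>] B_simps)
    also have "\<dots> = swB B (\<lambda>x y. S x \<star> y \<star> \<phi> t2) t1"
      by (rule swB_map[OF c(1) module_B module_B]) (assumption | rule lin c)+
    finally show "\<epsilon> t1 \<odot>\<^bsub>B\<^esub> \<phi> t2 = \<dots>" .
  qed (assumption | rule lin)+
  also have "\<dots> = swB B (\<lambda>t1 t2. swB B (\<lambda>x y. S t1 \<star> x \<star> \<phi> y) t2) t"
    by (rule swB_coassoc[OF module_B t]) (assumption | rule lin)+
  also have "\<dots> = swB B (\<lambda>t1 t2. \<epsilon> t2 \<odot>\<^bsub>B\<^esub> (\<epsilon> b \<odot>\<^bsub>B\<^esub> S t1)) t"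
  proof (rule swB_cong[OF t module_B])
    fix t1 t2 assume c: "t1 \<in> carrier B" "t2 \<in> carrier B"
    have "swB B (\<lambda>x y. S t1 \<star> x \<star> \<phi> y) t2 = swB B (\<lambda>x y. S t1 \<star> (x \<star> \<phi> y)) t2"
      by (rule swB_cong[OF c(2) module_B])
         (simp_all add: B_simps c module_hom_mem[OF antipode_linear] module_hom_mem[OF \<phi>], (assumption | rule lin c)+)
    also have "\<dots> = S t1 \<star> swB B (\<lambda>x y. x \<star> \<phi> y) t2"
      by (rule swB_map[symmetric, OF c(2) module_B module_B]) (assumption | rule lin c)+
    also have "\<dots> = \<epsilon> t2 \<odot>\<^bsub>B\<^esub> (\<epsilon> b \<odot>\<^bsub>B\<^esub> S t1)"
      using c b t by (simp add: \<psi> \<epsilon>_mult B_smult_mult \<epsilon>_closed B_simps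
          module_hom_mem[OF antipode_linear] smult_assoc1[symmetric] field.m_comm)
    finally show "swB B (\<lambda>x y. S t1 \<star> x \<star> \<phi> y) t2 = \<dots>" .
  qed (assumption | rule lin)+
  also have "\<dots> = \<epsilon> b \<odot>\<^bsub>B\<^esub> S t"
    by (rule swB_counit_right[OF module_B _ t]) (assumption | rule lin)+
  finally show ?thesis unfolding \<phi>_def .
qed

section \<open>The coproduct of the enveloping algebra\<close>


lemma swB_times:
  assumes "assoc_algebra K X" "a \<in> carrier B" "b \<in> carrier B" "bilin K B B X \<beta>" "bilin K B B X \<gamma>"
  shows "swB X \<beta> a \<otimes>\<^bsub>X\<^esub> swB X \<gamma> b = swB X (\<lambda>a1 a2. swB X (\<lambda>b1 b2. \<beta> a1 a2 \<otimes>\<^bsub>X\<^esub> \<gamma> b1 b2) b) a"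
proof -
  interpret X: assoc_algebra K X by fact
  note lin = lin X.module_axioms bilin_comp_left[OF X.mult_bilin] bilin_comp_right[OF X.mult_bilin] bilin_mem[OF X.mult_bilin]
    bilin_comp_left[OF assms(4)] bilin_comp_right[OF assms(4)] bilin_mem[OF assms(4)]
    bilin_comp_left[OF assms(5)] bilin_comp_right[OF assms(5)] bilin_mem[OF assms(5)] assms(2,3)
  have "swB X \<beta> a \<otimes>\<^bsub>X\<^esub> swB X \<gamma> b = swB X (\<lambda>a1 a2. \<beta> a1 a2 \<otimes>\<^bsub>X\<^esub> swB X \<gamma> b) a"
    by (rule swB_map[OF assms(2) X.module_axioms X.module_axioms assms(4)]) (assumption | rule lin)+
  also have "\<dots> = swB X (\<lambda>a1 a2. swB X (\<lambda>b1 b2. \<beta> a1 a2 \<otimes>\<^bsub>X\<^esub> \<gamma> b1 b2) b) a"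
  proof (rule swB_cong[OF assms(2) X.module_axioms])
    fix x y assume c: "x \<in> carrier B" "y \<in> carrier B"
    show "\<beta> x y \<otimes>\<^bsub>X\<^esub> swB X \<gamma> b = swB X (\<lambda>b1 b2. \<beta> x y \<otimes>\<^bsub>X\<^esub> \<gamma> b1 b2) b"
      by (rule swB_map[OF assms(3) X.module_axioms X.module_axioms assms(5)]) (assumption | rule lin c)+
  qed (assumption | rule lin)+
  finally show ?thesis .
qed

text \<open>The factors are reversed but the sum over a stays outside, so that the two orders of a
  commutator can be compared summand by summand.\<close>

lemma swB_times_rev:
  assumes "assoc_algebra K X" "a \<in> carrier B" "b \<in> carrier B" "bilin K B B X \<beta>" "bilin K B B X \<gamma>"
  shows "swB X \<gamma> b \<otimes>\<^bsub>X\<^esub> swB X \<beta> a = swB X (\<lambda>a1 a2. swB X (\<lambda>b1 b2. \<gamma> b1 b2 \<otimes>\<^bsub>X\<^esub> \<beta> a1 a2) b) a"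
proof -
  interpret X: assoc_algebra K X by fact
  note lin = lin X.module_axioms bilin_comp_left[OF X.mult_bilin] bilin_comp_right[OF X.mult_bilin] bilin_mem[OF X.mult_bilin]
    bilin_comp_left[OF assms(4)] bilin_comp_right[OF assms(4)] bilin_mem[OF assms(4)]
    bilin_comp_left[OF assms(5)] bilin_comp_right[OF assms(5)] bilin_mem[OF assms(5)] assms(2,3)
  show ?thesis unfolding swB_times[OF assms(1,3,2,5,4)]
    by (rule swB_swap[OF X.module_axioms]) (assumption | rule lin)+
qed

section \<open>Commutation rules in the enveloping algebra and its tensor square\<close>

lemma m_comm: "\<lbrakk>a \<in> carrier B; b \<in> carrier B\<rbrakk> \<Longrightarrow> m a \<bullet> m b = m b \<bullet> m a"
  by (simp only: m_mult[symmetric] B_simps)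

lemma U_abelian: "abelian_group U"
  using ring.is_abelian_group[OF assoc_algebra.axioms(2)[OF assoc_algebra_U]] .

text \<open>Commutation rules without subtraction serve as rewrite rules; the checks in the tensor
  square become rearrangements of sums.\<close>

lemma h_m_comm: "\<lbrakk>a \<in> carrier B; b \<in> carrier B\<rbrakk> \<Longrightarrow> h a \<bullet> m b = m b \<bullet> h a \<oplus>\<^bsub>U\<^esub> m (bracket a b)"
  by (rule abelian_group.eq_addI[OF U_abelian m_bracket]) (simp_all add: U_simps m_closed h_closed)

lemma h_h_comm: "\<lbrakk>a \<in> carrier B; b \<in> carrier B\<rbrakk> \<Longrightarrow> h a \<bullet> h b = h b \<bullet> h a \<oplus>\<^bsub>U\<^esub> h (bracket a b)"
  by (rule abelian_group.eq_addI[OF U_abelian h_bracket]) (simp_all add: U_simps m_closed h_closed)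

lemma bracket_antisym:
  assumes "a \<in> carrier B" "b \<in> carrier B"
  shows "bracket b a \<oplus>\<^bsub>B\<^esub> bracket a b = \<zero>\<^bsub>B\<^esub>"
proof -
  have "\<zero>\<^bsub>B\<^esub> = bracket (a \<oplus>\<^bsub>B\<^esub> b) (a \<oplus>\<^bsub>B\<^esub> b)"
    by (rule bracket_alternating[symmetric]) (simp add: assms B_simps)
  also have "\<dots> = bracket b a \<oplus>\<^bsub>B\<^esub> bracket a b"
    using assms by (simp add: bracket_add_left bracket_add_right bracket_alternating[OF assms(1)] bracket_alternating[OF assms(2)]
      bracket_closed B_simps)
  finally show ?thesis by (rule sym)
qed

text \<open>Expanding \<open>h b \<bullet> m a\<close> on the right leaves \<open>m\<close> of {b,a}
  plus \<open>m\<close> of {a,b}, which cancel.\<close>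

lemma m_h_comm:
  assumes "a \<in> carrier B" "b \<in> carrier B"
  shows "m a \<bullet> h b = h b \<bullet> m a \<oplus>\<^bsub>U\<^esub> m (bracket a b)"
proof -
  have "m (bracket b a) \<oplus>\<^bsub>U\<^esub> m (bracket a b) = m (bracket b a \<oplus>\<^bsub>B\<^esub> bracket a b)"
    by (rule module_hom_add[OF m_hom, symmetric]) (simp_all add: bracket_closed assms)
  also have "\<dots> = \<zero>\<^bsub>U\<^esub>" using module_hom_zero[OF module_B module_U m_hom] assms by (simp add: bracket_antisym)
  finally have 0: "m (bracket b a) \<oplus>\<^bsub>U\<^esub> m (bracket a b) = \<zero>\<^bsub>U\<^esub>" .
  show ?thesis
    using assms by (simp only: h_m_comm U_simps(1,5,7,15) m_closed h_closed bracket_closed 0)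
qed

abbreviation TU where "TU \<equiv> tensor K U U"
abbreviation P2 where "P2 x y \<equiv> pure K U U x y"

lemma assoc_algebra_TU: "assoc_algebra K TU"
  by (rule UU.assoc_algebra_tensor)

lemmas TU_simps = ring.ring_simprules[OF assoc_algebra.axioms(2)[OF assoc_algebra_TU]]
  and module_TU = assoc_algebra.axioms(1)[OF assoc_algebra_TU]
  and TU_mult_bilin = assoc_algebra.mult_bilin[OF assoc_algebra_TU]
  and TU_abelian = ring.is_abelian_group[OF assoc_algebra.axioms(2)[OF assoc_algebra_TU]]

lemma P2_add:
  "\<lbrakk>x \<in> carrier U; y \<in> carrier U; z \<in> carrier U\<rbrakk> \<Longrightarrow> P2 (x \<oplus>\<^bsub>U\<^esub> y) z = P2 x z \<oplus>\<^bsub>TU\<^esub> P2 y z"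
  "\<lbrakk>x \<in> carrier U; y \<in> carrier U; z \<in> carrier U\<rbrakk> \<Longrightarrow> P2 z (x \<oplus>\<^bsub>U\<^esub> y) = P2 z x \<oplus>\<^bsub>TU\<^esub> P2 z y"
  using module_hom_add[OF bilin_left[OF UU.pure_bilin]] module_hom_add[OF bilin_right[OF UU.pure_bilin]] by auto

text \<open>
  \<open>MM a b\<close> and \<open>HH a b\<close> play the role of \<open>m\<close> and \<open>h\<close> at \<open>a \<otimes> b\<close> in \<open>(B \<otimes> B)\<^sup>e = B\<^sup>e \<otimes> B\<^sup>e\<close>.
\<close>

definition MM where "MM x y = P2 (m x) (m y)"
definition HH where "HH x y = P2 (m x) (h y) \<oplus>\<^bsub>TU\<^esub> P2 (h x) (m y)"

lemma MM_bilin: "bilin K B B TU MM" and HH_bilin: "bilin K B B TU HH"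
  unfolding MM_def HH_def by (assumption | rule lin)+

lemma MM_closed: "\<lbrakk>x \<in> carrier B; y \<in> carrier B\<rbrakk> \<Longrightarrow> MM x y \<in> carrier TU"
  and HH_closed: "\<lbrakk>x \<in> carrier B; y \<in> carrier B\<rbrakk> \<Longrightarrow> HH x y \<in> carrier TU"
  by (rule bilin_mem[OF MM_bilin], assumption+) (rule bilin_mem[OF HH_bilin], assumption+)

lemmas closed = m_closed h_closed bracket_closed B_simps(1,5) U_simps(1,5) UU.pure_closed TU_simps(1,5)

context
  fixes a c b d
  assumes abcd: "a \<in> carrier B" "c \<in> carrier B" "b \<in> carrier B" "d \<in> carrier B"
begin

text \<open>These identities concern the elements a \<otimes> c and b \<otimes> d of B \<otimes> B,
  whose product is ab \<otimes> cd and whose bracket is ab \<otimes> {c,d} + {a,b} \<otimes> cd. The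
  relations with a commutator are stated with the subtracted term on the other side.\<close>

lemma MM_mult: "MM (a \<star> b) (c \<star> d) = MM a c \<otimes>\<^bsub>TU\<^esub> MM b d"
  unfolding MM_def using abcd by (simp only: UU.pure_mult m_mult closed)

lemma HH_mult:
  "HH (a \<star> b) (c \<star> d) = MM b d \<otimes>\<^bsub>TU\<^esub> HH a c \<oplus>\<^bsub>TU\<^esub> MM a c \<otimes>\<^bsub>TU\<^esub> HH b d"
proof -
  have comm: "m b \<bullet> m a = m a \<bullet> m b" "m d \<bullet> m c = m c \<bullet> m d"
    by (rule m_comm; rule abcd)+
  show ?thesis unfolding MM_def HH_def using abcd
    by (simp only: UU.pure_mult m_mult h_mult P2_add closed TU_simps(23) comm)
       (simp only: TU_simps(1,5,7,10,22) closed)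
qed

lemma MM_bracket:
  "MM (a \<star> b) (bracket c d) \<oplus>\<^bsub>TU\<^esub> MM (bracket a b) (c \<star> d) \<oplus>\<^bsub>TU\<^esub> MM b d \<otimes>\<^bsub>TU\<^esub> HH a c
    = HH a c \<otimes>\<^bsub>TU\<^esub> MM b d"
proof -
  have comm: "m b \<bullet> m a = m a \<bullet> m b" "m d \<bullet> m c = m c \<bullet> m d"
    "h a \<bullet> m b = m b \<bullet> h a \<oplus>\<^bsub>U\<^esub> m (bracket a b)"
    "h c \<bullet> m d = m d \<bullet> h c \<oplus>\<^bsub>U\<^esub> m (bracket c d)"
    by (rule m_comm h_m_comm; rule abcd)+
  show ?thesis unfolding MM_def HH_def using abcd
    by (simp only: UU.pure_mult m_mult P2_add closed TU_simps(13,23) comm)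
       (simp only: TU_simps(1,5,7,10,22) closed)
qed

text \<open>In normal form the term \<open>m (bracket a b)\<close> \<otimes>
  \<open>m (bracket c d)\<close> occurs twice on each side: on the right from the two mixed
  products, on the left from expanding \<open>h\<close> of ab and of cd and then reordering.\<close>

lemma HH_bracket:
  "HH (a \<star> b) (bracket c d) \<oplus>\<^bsub>TU\<^esub> HH (bracket a b) (c \<star> d) \<oplus>\<^bsub>TU\<^esub> HH b d \<otimes>\<^bsub>TU\<^esub> HH a c
    = HH a c \<otimes>\<^bsub>TU\<^esub> HH b d"
proof -
  have comm: "m b \<bullet> m a = m a \<bullet> m b" "m d \<bullet> m c = m c \<bullet> m d"
    "h a \<bullet> m b = m b \<bullet> h a \<oplus>\<^bsub>U\<^esub> m (bracket a b)"
    "h c \<bullet> m d = m d \<bullet> h c \<oplus>\<^bsub>U\<^esub> m (bracket c d)"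
    "m a \<bullet> h b = h b \<bullet> m a \<oplus>\<^bsub>U\<^esub> m (bracket a b)"
    "m c \<bullet> h d = h d \<bullet> m c \<oplus>\<^bsub>U\<^esub> m (bracket c d)"
    "h a \<bullet> h b = h b \<bullet> h a \<oplus>\<^bsub>U\<^esub> h (bracket a b)"
    "h c \<bullet> h d = h d \<bullet> h c \<oplus>\<^bsub>U\<^esub> h (bracket c d)"
    by (rule m_comm h_m_comm m_h_comm h_h_comm; rule abcd)+
  show ?thesis unfolding HH_def using abcd
    by (simp only: UU.pure_mult m_mult h_mult P2_add closed TU_simps(13,23) comm)
       (simp only: TU_simps(1,5,7,10,22) closed)
qed

end

abbreviation mu where "mu b \<equiv> tensor_map K U U m m (\<Delta> b)"
abbreviation eta where "eta b \<equiv> tensor_map K U U m h (\<Delta> b) \<oplus>\<^bsub>TU\<^esub> tensor_map K U U h m (\<Delta> b)"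

lemma mu_eq: "mu b = swB TU MM b"
  by (simp add: tensor_map_def swB_def MM_def[abs_def])

lemma eta_eq: "b \<in> carrier B \<Longrightarrow> eta b = swB TU HH b"
  unfolding HH_def by (subst swB_add) (assumption | rule lin | simp add: tensor_map_def swB_def)+

lemma swB2_cong:
  assumes "a \<in> carrier B" "b \<in> carrier B" "module K X"
    and "\<And>v w. \<lbrakk>v \<in> carrier B; w \<in> carrier B\<rbrakk> \<Longrightarrow> bilin K B B X (\<beta> v w)"
    and "\<And>v w. \<lbrakk>v \<in> carrier B; w \<in> carrier B\<rbrakk> \<Longrightarrow> bilin K B B X (\<lambda>x y. \<beta> x y v w)"
    and "\<And>x y v w. \<lbrakk>x \<in> carrier B; y \<in> carrier B; v \<in> carrier B; w \<in> carrier B\<rbrakk> \<Longrightarrow> \<beta> x y v w = \<gamma> x y v w"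
  shows "swB X (\<lambda>x y. swB X (\<beta> x y) b) a = swB X (\<lambda>x y. swB X (\<gamma> x y) b) a"
  by (rule swB_cong[OF assms(1,3)])
     (assumption | rule lin assms swB_cong[OF assms(2,3)] bilin_left[OF assms(5)] bilin_right[OF assms(5)])+

lemma swB2_add:
  assumes "a \<in> carrier B" "b \<in> carrier B" "module K X"
    and "\<And>v w. \<lbrakk>v \<in> carrier B; w \<in> carrier B\<rbrakk> \<Longrightarrow> bilin K B B X (\<beta> v w)"
    and "\<And>v w. \<lbrakk>v \<in> carrier B; w \<in> carrier B\<rbrakk> \<Longrightarrow> bilin K B B X (\<lambda>x y. \<beta> x y v w)"
    and "\<And>v w. \<lbrakk>v \<in> carrier B; w \<in> carrier B\<rbrakk> \<Longrightarrow> bilin K B B X (\<gamma> v w)"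
    and "\<And>v w. \<lbrakk>v \<in> carrier B; w \<in> carrier B\<rbrakk> \<Longrightarrow> bilin K B B X (\<lambda>x y. \<gamma> x y v w)"
  shows "swB X (\<lambda>x y. swB X (\<lambda>v w. \<beta> x y v w \<oplus>\<^bsub>X\<^esub> \<gamma> x y v w) b) a
    = swB X (\<lambda>x y. swB X (\<beta> x y) b) a \<oplus>\<^bsub>X\<^esub> swB X (\<lambda>x y. swB X (\<gamma> x y) b) a"
proof -
  note lin = lin assms(1-4) assms(6) bilin_left[OF assms(5)] bilin_right[OF assms(5)] bilin_left[OF assms(7)] bilin_right[OF assms(7)]
     bilin_left[OF assms(4)] bilin_right[OF assms(4)] bilin_left[OF assms(6)] bilin_right[OF assms(6)]
  have "swB X (\<lambda>x y. swB X (\<lambda>v w. \<beta> x y v w \<oplus>\<^bsub>X\<^esub> \<gamma> x y v w) b) a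
    = swB X (\<lambda>x y. swB X (\<beta> x y) b \<oplus>\<^bsub>X\<^esub> swB X (\<gamma> x y) b) a"
    by (rule swB_cong[OF assms(1,3)]) (assumption | rule lin swB_add)+
  also have "\<dots> = swB X (\<lambda>x y. swB X (\<beta> x y) b) a \<oplus>\<^bsub>X\<^esub> swB X (\<lambda>x y. swB X (\<gamma> x y) b) a"
    by (rule swB_add[OF assms(3,1)]) (assumption | rule lin)+
  finally show ?thesis .
qed

lemmas lin2 = lin module_TU bilin_comp_left[OF TU_mult_bilin] bilin_comp_right[OF TU_mult_bilin] bilin_mem[OF TU_mult_bilin]
  bilin_comp_left[OF MM_bilin] bilin_comp_right[OF MM_bilin] MM_closed
  bilin_comp_left[OF HH_bilin] bilin_comp_right[OF HH_bilin] HH_closed TU_simps(1)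

text \<open>Summing the identities for \<open>MM\<close> and \<open>HH\<close> over \<Delta>(a) and
  \<Delta>(b) gives the relations for \<open>mu\<close> and \<open>eta\<close>; the bracket on the
  left is expanded by \<open>swB_bracket\<close>.\<close>

sublocale coprod: env_algebra_map K B bracket TU mu eta
proof (intro env_algebra_map.intro env_algebra_map_axioms.intro poisson_algebra_axioms assoc_algebra_TU)
  have e: "swB TU HH b = eta b" if "b \<in> carrier B" for b using that by (simp only: eta_eq)
  show "mu \<in> module_hom K B TU" unfolding mu_eq by (assumption | rule lin MM_bilin)+
  show "eta \<in> module_hom K B TU"
    by (rule module_hom_cong[OF _ module_B e]) (assumption | rule lin HH_bilin)+
  show "mu \<one>\<^bsub>B\<^esub> = \<one>\<^bsub>TU\<^esub>"
    unfolding mu_eq UU.tensor_one swB_one[OF module_TU MM_bilin] by (simp add: MM_def m_one)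
  fix a b assume ab: "a \<in> carrier B" "b \<in> carrier B"
  note times = swB_times[OF assoc_algebra_TU ab] swB_times_rev[OF assoc_algebra_TU ab]
  have c: "mu x \<in> carrier TU" "eta x \<in> carrier TU" if "x \<in> carrier B" for x
    unfolding mu_eq eta_eq[OF that] using that by (auto intro!: swB_closed module_TU MM_bilin HH_bilin)
  show "mu (a \<star> b) = mu a \<otimes>\<^bsub>TU\<^esub> mu b"
    unfolding mu_eq swB_mult[OF module_TU MM_bilin ab] swB_times[OF assoc_algebra_TU ab MM_bilin MM_bilin]
    by (rule swB2_cong[OF ab module_TU]) (assumption | rule lin2 MM_mult)+
  show "eta (a \<star> b) = mu b \<otimes>\<^bsub>TU\<^esub> eta a \<oplus>\<^bsub>TU\<^esub> mu a \<otimes>\<^bsub>TU\<^esub> eta b"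
  proof -
    have "swB TU HH (a \<star> b)
      = swB TU (\<lambda>x y. swB TU (\<lambda>v w. MM v w \<otimes>\<^bsub>TU\<^esub> HH x y \<oplus>\<^bsub>TU\<^esub> MM x y \<otimes>\<^bsub>TU\<^esub> HH v w) b) a"
      unfolding swB_mult[OF module_TU HH_bilin ab]
      by (rule swB2_cong[OF ab module_TU]) (assumption | rule lin2 HH_mult)+
    also have "\<dots> = swB TU MM b \<otimes>\<^bsub>TU\<^esub> swB TU HH a \<oplus>\<^bsub>TU\<^esub> swB TU MM a \<otimes>\<^bsub>TU\<^esub> swB TU HH b"
      unfolding swB_times[OF assoc_algebra_TU ab MM_bilin HH_bilin] swB_times_rev[OF assoc_algebra_TU ab HH_bilin MM_bilin]
      by (rule swB2_add[OF ab module_TU]) (assumption | rule lin2)+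
    finally show ?thesis using ab by (simp only: mu_eq eta_eq B_simps(5))
  qed
  have "swB TU MM (bracket a b) \<oplus>\<^bsub>TU\<^esub> swB TU MM b \<otimes>\<^bsub>TU\<^esub> swB TU HH a
    = swB TU (\<lambda>x y. swB TU (\<lambda>v w. MM (x \<star> v) (bracket y w) \<oplus>\<^bsub>TU\<^esub> MM (bracket x v) (y \<star> w)
        \<oplus>\<^bsub>TU\<^esub> MM v w \<otimes>\<^bsub>TU\<^esub> HH x y) b) a"
    unfolding swB_bracket[OF module_TU MM_bilin ab] swB_times_rev[OF assoc_algebra_TU ab HH_bilin MM_bilin]
    by (rule swB2_add[OF ab module_TU, symmetric]) (assumption | rule lin2)+
  also have "\<dots> = swB TU HH a \<otimes>\<^bsub>TU\<^esub> swB TU MM b"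
    unfolding swB_times[OF assoc_algebra_TU ab HH_bilin MM_bilin]
    by (rule swB2_cong[OF ab module_TU]) (assumption | rule lin2 MM_bracket)+
  finally have "mu (bracket a b) \<oplus>\<^bsub>TU\<^esub> mu b \<otimes>\<^bsub>TU\<^esub> eta a = eta a \<otimes>\<^bsub>TU\<^esub> mu b"
    using ab by (simp only: mu_eq eta_eq)
  then show "mu (bracket a b) = eta a \<otimes>\<^bsub>TU\<^esub> mu b \<ominus>\<^bsub>TU\<^esub> mu b \<otimes>\<^bsub>TU\<^esub> eta a"
    by (intro abelian_group.eq_minusI[OF TU_abelian] TU_simps c bracket_closed ab) simp
  have "swB TU HH (bracket a b) \<oplus>\<^bsub>TU\<^esub> swB TU HH b \<otimes>\<^bsub>TU\<^esub> swB TU HH a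
    = swB TU (\<lambda>x y. swB TU (\<lambda>v w. HH (x \<star> v) (bracket y w) \<oplus>\<^bsub>TU\<^esub> HH (bracket x v) (y \<star> w)
        \<oplus>\<^bsub>TU\<^esub> HH v w \<otimes>\<^bsub>TU\<^esub> HH x y) b) a"
    unfolding swB_bracket[OF module_TU HH_bilin ab] swB_times_rev[OF assoc_algebra_TU ab HH_bilin HH_bilin]
    by (rule swB2_add[OF ab module_TU, symmetric]) (assumption | rule lin2)+
  also have "\<dots> = swB TU HH a \<otimes>\<^bsub>TU\<^esub> swB TU HH b"
    unfolding swB_times[OF assoc_algebra_TU ab HH_bilin HH_bilin]
    by (rule swB2_cong[OF ab module_TU]) (assumption | rule lin2 HH_bracket)+
  finally have "eta (bracket a b) \<oplus>\<^bsub>TU\<^esub> eta b \<otimes>\<^bsub>TU\<^esub> eta a = eta a \<otimes>\<^bsub>TU\<^esub> eta b"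
    using ab by (simp only: mu_eq eta_eq bracket_closed)
  then show "eta (bracket a b) = eta a \<otimes>\<^bsub>TU\<^esub> eta b \<ominus>\<^bsub>TU\<^esub> eta b \<otimes>\<^bsub>TU\<^esub> eta a"
    by (intro abelian_group.eq_minusI[OF TU_abelian] TU_simps c bracket_closed ab) simp
qed


section \<open>Sweedler sums over the enveloping algebra\<close>

lemma env_comul_eq: "env_comul K B bracket \<Delta> = env_lift K TU mu eta"
  by (simp add: env_comul_def Let_def)

lemma env_comul_hom: "env_comul K B bracket \<Delta> \<in> module_hom K U TU"
  unfolding env_comul_eq by (rule coprod.env_lift_hom)

definition swU :: "('k, 'x, 'l) module_scheme \<Rightarrow> ((('b + 'b) list \<Rightarrow> 'k) set \<Rightarrow> (('b + 'b) list \<Rightarrow> 'k) set \<Rightarrow> 'x)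
    \<Rightarrow> (('b + 'b) list \<Rightarrow> 'k) set \<Rightarrow> 'x"
  where "swU X \<beta> z = tensor_lift K X \<beta> (env_comul K B bracket \<Delta> z)"

lemma env_comul_closed: "z \<in> carrier U \<Longrightarrow> env_comul K B bracket \<Delta> z \<in> carrier TU"
  by (rule module_hom_mem[OF env_comul_hom])

lemma swU_comp_hom:
  "\<lbrakk>g \<in> module_hom K Z U; module K X; bilin K U U X \<beta>\<rbrakk> \<Longrightarrow> (\<lambda>z. swU X \<beta> (g z)) \<in> module_hom K Z X"
  unfolding swU_def
  by (rule module_hom_comp[OF UU.tensor_lift_hom module_hom_comp[OF env_comul_hom]])

lemma swU_param_hom:
  "\<lbrakk>z \<in> carrier U; module K Z; module K X;
    \<And>v w. \<lbrakk>v \<in> carrier U; w \<in> carrier U\<rbrakk> \<Longrightarrow> (\<lambda>y. \<beta> y v w) \<in> module_hom K Z X;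
    \<And>y. y \<in> carrier Z \<Longrightarrow> bilin K U U X (\<beta> y)\<rbrakk>
  \<Longrightarrow> (\<lambda>y. swU X (\<beta> y) z) \<in> module_hom K Z X"
  unfolding swU_def by (rule UU.tensor_lift_param_hom) (assumption | rule env_comul_closed)+

lemma swU_closed: "\<lbrakk>z \<in> carrier U; module K X; bilin K U U X \<beta>\<rbrakk> \<Longrightarrow> swU X \<beta> z \<in> carrier X"
  unfolding swU_def by (intro UU.tensor_lift_closed env_comul_closed)

lemma swU_cong:
  "\<lbrakk>z \<in> carrier U; module K X; bilin K U U X \<beta>;
    \<And>x y. \<lbrakk>x \<in> carrier U; y \<in> carrier U\<rbrakk> \<Longrightarrow> \<beta> x y = \<gamma> x y\<rbrakk> \<Longrightarrow> swU X \<beta> z = swU X \<gamma> z"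
  unfolding swU_def by (intro UU.tensor_lift_cong env_comul_closed)

lemma swU_map:
  "\<lbrakk>z \<in> carrier U; module K X; module K Y; bilin K U U X \<beta>; f \<in> module_hom K X Y\<rbrakk>
    \<Longrightarrow> f (swU X \<beta> z) = swU Y (\<lambda>x y. f (\<beta> x y)) z"
  unfolding swU_def by (intro UU.hom_tensor_lift env_comul_closed)

lemmas linU = lin swU_comp_hom swU_param_hom swU_closed

lemma swU_swap_swB:
  assumes "module K X" "z \<in> carrier U" "b \<in> carrier B"
    "\<And>v w. \<lbrakk>v \<in> carrier U; w \<in> carrier U\<rbrakk> \<Longrightarrow> bilin K B B X (\<beta> v w)"
    "\<And>v w. \<lbrakk>v \<in> carrier B; w \<in> carrier B\<rbrakk> \<Longrightarrow> bilin K U U X (\<lambda>x y. \<beta> x y v w)"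
  shows "swU X (\<lambda>v w. swB X (\<beta> v w) b) z = swB X (\<lambda>x y. swU X (\<lambda>v w. \<beta> v w x y) z) b"
  unfolding swU_def swB_def
  by (rule tensor_lift_swap)
     (assumption | rule UU.two_modules_axioms BB.two_modules_axioms assms \<Delta>_closed env_comul_closed)+

lemma swU_add:
  assumes "module K X" "z \<in> carrier U" "bilin K U U X \<beta>" "bilin K U U X \<gamma>"
  shows "swU X (\<lambda>x y. \<beta> x y \<oplus>\<^bsub>X\<^esub> \<gamma> x y) z = swU X \<beta> z \<oplus>\<^bsub>X\<^esub> swU X \<gamma> z"
proof -
  note l = UU.tensor_lift_hom[OF assms(1)] and p = UU.tensor_lift_pure[OF assms(1)]
  have s: "bilin K U U X (\<lambda>x y. \<beta> x y \<oplus>\<^bsub>X\<^esub> \<gamma> x y)"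
    by (assumption | rule lin assms(1) bilin_left[OF assms(3)] bilin_left[OF assms(4)]
       bilin_right[OF assms(3)] bilin_right[OF assms(4)])+
  show ?thesis unfolding swU_def
    by (rule UU.tensor_hom_eqI[OF l[OF s] module_hom_add_fun[OF assms(1) l[OF assms(3)] l[OF assms(4)]] _ env_comul_closed[OF assms(2)]])
       (simp add: p[OF s] p[OF assms(3)] p[OF assms(4)])
qed

lemma swU_one: "\<lbrakk>module K X; bilin K U U X \<beta>\<rbrakk> \<Longrightarrow> swU X \<beta> \<one>\<^bsub>U\<^esub> = \<beta> \<one>\<^bsub>U\<^esub> \<one>\<^bsub>U\<^esub>"
  unfolding swU_def env_comul_eq coprod.env_lift_one UU.tensor_one
  by (intro UU.tensor_lift_pure) (assumption | rule lin)+

text \<open>One summand of the coproduct of a generator times z. F and G name the letters on the two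
  legs: m yields the pair (m, m), h yields (m, h) and (h, m).\<close>

abbreviation sw2 where
  "sw2 F G X \<beta> b z \<equiv> swB X (\<lambda>x y. swU X (\<lambda>v w. \<beta> (F x \<bullet> v) (G y \<bullet> w)) z) b"

lemma tensor_lift_swB_mult:
  assumes X: "module K X" and \<beta>: "bilin K U U X \<beta>" and b: "b \<in> carrier B" and t: "t \<in> carrier TU"
    and F: "F \<in> module_hom K B U" and G: "G \<in> module_hom K B U"
  shows "tensor_lift K X \<beta> (tensor_map K U U F G (\<Delta> b) \<otimes>\<^bsub>TU\<^esub> t)
    = swB X (\<lambda>x y. tensor_lift K X (\<lambda>v w. \<beta> (F x \<bullet> v) (G y \<bullet> w)) t) b"
proof -
  note lin = lin2 X module_hom_comp[OF F] module_hom_comp[OF G] module_hom_mem[OF F] module_hom_mem[OF G] t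
    bilin_comp_left[OF \<beta>] bilin_comp_right[OF \<beta>] bilin_mem[OF \<beta>] UU.tensor_lift_param_hom[OF X _ t]
    UU.tensor_lift_closed
  have l: "(\<lambda>q. tensor_lift K X \<beta> (q \<otimes>\<^bsub>TU\<^esub> t)) \<in> module_hom K TU X"
    by (rule module_hom_comp[OF UU.tensor_lift_hom[OF X \<beta>] bilin_left[OF TU_mult_bilin t]])
  have "tensor_lift K X \<beta> (tensor_map K U U F G (\<Delta> b) \<otimes>\<^bsub>TU\<^esub> t)
    = tensor_lift K X \<beta> (swB TU (\<lambda>x y. P2 (F x) (G y)) b \<otimes>\<^bsub>TU\<^esub> t)"
    by (simp add: tensor_map_def swB_def)
  also have "\<dots> = swB X (\<lambda>x y. tensor_lift K X \<beta> (P2 (F x) (G y) \<otimes>\<^bsub>TU\<^esub> t)) b"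
    by (rule swB_map[OF b module_TU X _ l]) (assumption | rule lin)+
  also have "\<dots> = swB X (\<lambda>x y. tensor_lift K X (\<lambda>v w. \<beta> (F x \<bullet> v) (G y \<bullet> w)) t) b"
  proof (rule swB_cong[OF b X])
    fix x y assume c: "x \<in> carrier B" "y \<in> carrier B"
    have "tensor_lift K X \<beta> (P2 (F x) (G y) \<otimes>\<^bsub>TU\<^esub> t)
      = tensor_lift K X (\<lambda>a c. tensor_lift K X (\<lambda>v w. \<beta> (a \<bullet> v) (c \<bullet> w)) t) (P2 (F x) (G y))"
      by (rule UU.tensor_lift_mult[OF X \<beta> _ t]) (assumption | rule lin c)+
    also have "\<dots> = tensor_lift K X (\<lambda>v w. \<beta> (F x \<bullet> v) (G y \<bullet> w)) t"
      by (rule UU.tensor_lift_pure[OF X]) (assumption | rule lin c)+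
    finally show "tensor_lift K X \<beta> (P2 (F x) (G y) \<otimes>\<^bsub>TU\<^esub> t) = \<dots>" .
  qed (assumption | rule lin module_hom_comp[OF l])+
  finally show ?thesis .
qed

lemma tensor_map_swB_closed:
  assumes "F \<in> module_hom K B U" "G \<in> module_hom K B U" "b \<in> carrier B"
  shows "tensor_map K U U F G (\<Delta> b) \<in> carrier TU"
proof -
  have "swB TU (\<lambda>x y. P2 (F x) (G y)) b \<in> carrier TU"
    by (assumption | rule lin assms module_hom_comp[OF assms(1)] module_hom_comp[OF assms(2)]
     module_hom_mem[OF assms(1)] module_hom_mem[OF assms(2)])+
  then show ?thesis by (simp add: tensor_map_def swB_def)
qed

text \<open>Together with \<open>swU_one\<close> and \<open>swU_h\<close> this is the recursion for
  Sweedler sums that drives the inductions over \<open>U_induct\<close>.\<close>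

lemma swU_m:
  assumes "module K X" "bilin K U U X \<beta>" "b \<in> carrier B" "z \<in> carrier U"
  shows "swU X \<beta> (m b \<bullet> z) = sw2 m m X \<beta> b z"
  unfolding swU_def env_comul_eq coprod.env_lift_mult(1)[OF assms(3,4)]
  by (rule tensor_lift_swB_mult) (assumption | rule assms m_hom env_comul_closed[unfolded env_comul_eq])+

lemma swU_h:
  assumes "module K X" "bilin K U U X \<beta>" "b \<in> carrier B" "z \<in> carrier U"
  shows "swU X \<beta> (h b \<bullet> z) = sw2 m h X \<beta> b z \<oplus>\<^bsub>X\<^esub> sw2 h m X \<beta> b z"
proof -
  note c = tensor_map_swB_closed[OF m_hom h_hom assms(3)] tensor_map_swB_closed[OF h_hom m_hom assms(3)]
  have t: "env_comul K B bracket \<Delta> z \<in> carrier TU" by (rule env_comul_closed[OF assms(4)])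
  have "swU X \<beta> (h b \<bullet> z) = tensor_lift K X \<beta> (tensor_map K U U m h (\<Delta> b) \<otimes>\<^bsub>TU\<^esub> env_comul K B bracket \<Delta> z
      \<oplus>\<^bsub>TU\<^esub> tensor_map K U U h m (\<Delta> b) \<otimes>\<^bsub>TU\<^esub> env_comul K B bracket \<Delta> z)"
    using coprod.env_lift_mult(2)[OF assms(3,4)] c t
    by (simp add: swU_def env_comul_eq TU_simps(13))
  also have "\<dots> = tensor_lift K X \<beta> (tensor_map K U U m h (\<Delta> b) \<otimes>\<^bsub>TU\<^esub> env_comul K B bracket \<Delta> z)
      \<oplus>\<^bsub>X\<^esub> tensor_lift K X \<beta> (tensor_map K U U h m (\<Delta> b) \<otimes>\<^bsub>TU\<^esub> env_comul K B bracket \<Delta> z)"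
    using c t by (intro module_hom_add[OF UU.tensor_lift_hom[OF assms(1,2)]] TU_simps)
  finally show ?thesis
    unfolding tensor_lift_swB_mult[OF assms(1-3) t m_hom h_hom] tensor_lift_swB_mult[OF assms(1-3) t h_hom m_hom]
    by (simp add: swU_def)
qed

text \<open>
  The induction step of coassociativity; \<open>F\<close>, \<open>G\<close>, \<open>H\<close> range over \<open>m\<close> and \<open>h\<close>.
\<close>

lemma coassoc_step:
  assumes X: "module K X" and F: "F \<in> module_hom K B U" and G: "G \<in> module_hom K B U" and H: "H \<in> module_hom K B U"
    and z: "z \<in> carrier U" and b: "b \<in> carrier B" and \<beta>: "trilin K U U U X \<beta>"
    and IH: "\<And>\<gamma>. trilin K U U U X \<gamma> \<Longrightarrow> swU X (\<lambda>a c. swU X (\<lambda>a1 a2. \<gamma> a1 a2 c) a) z = swU X (\<lambda>a c. swU X (\<gamma> a) c) z"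
  shows "swB X (\<lambda>b1 b2. swU X (\<lambda>a c. sw2 F G X (\<lambda>a1 a2. \<beta> a1 a2 (H b2 \<bullet> c)) b1 a) z) b
    = swB X (\<lambda>b1 b2. swU X (\<lambda>a c. sw2 G H X (\<beta> (F b1 \<bullet> a)) b2 c) z) b"
proof -
  note lin = linU X module_hom_comp[OF F] module_hom_comp[OF G] module_hom_comp[OF H]
    module_hom_mem[OF F] module_hom_mem[OF G] module_hom_mem[OF H] z b trilin_comp[OF \<beta>]
  \<comment> \<open>The sums over b are moved outside the sums over z; then the induction hypothesis
    and coassociativity of B are applied in turn, and the sums are moved back.\<close>
  have "swB X (\<lambda>b1 b2. swU X (\<lambda>a c. sw2 F G X (\<lambda>a1 a2. \<beta> a1 a2 (H b2 \<bullet> c)) b1 a) z) b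
    = swB X (\<lambda>b1 b2. swB X (\<lambda>x y. swU X (\<lambda>a c. swU X (\<lambda>a1 a2. \<beta> (F x \<bullet> a1) (G y \<bullet> a2) (H b2 \<bullet> c)) a) z) b1) b"
  proof (rule swB_cong[OF b X], goal_cases)
    case (2 b1 b2)
    then show ?case by (intro swU_swap_swB[OF X z]) (assumption | rule lin)+
  qed (assumption | rule lin)+
  also have "\<dots> = swB X (\<lambda>b1 b2. swB X (\<lambda>x y. swU X (\<lambda>a c. swU X (\<lambda>c1 c2. \<beta> (F x \<bullet> a) (G y \<bullet> c1) (H b2 \<bullet> c2)) c) z) b1) b"
  proof (rule swB_cong[OF b X], goal_cases)
    case (2 b1 b2)
    note b12 = 2
    show ?case
    proof (rule swB_cong[OF b12(1) X], goal_cases)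
      case (2 x y)
      then show ?case using b12 by (intro IH) (assumption | rule lin)+
    qed (assumption | rule lin b12)+
  qed (assumption | rule lin)+
  also have "\<dots> = swB X (\<lambda>b1 b2. swB X (\<lambda>x y. swU X (\<lambda>a c. swU X (\<lambda>c1 c2. \<beta> (F b1 \<bullet> a) (G x \<bullet> c1) (H y \<bullet> c2)) c) z) b2) b"
    by (rule swB_coassoc[OF X b]) (assumption | rule lin)+
  also have "\<dots> = swB X (\<lambda>b1 b2. swU X (\<lambda>a c. sw2 G H X (\<beta> (F b1 \<bullet> a)) b2 c) z) b"
  proof (rule swB_cong[OF b X], goal_cases)
    case (2 b1 b2)
    then show ?case by (intro swU_swap_swB[OF X z, symmetric]) (assumption | rule lin)+
  qed (assumption | rule lin)+
  finally show ?thesis .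
qed

lemma sw2_cong:
  assumes "module K X" "b \<in> carrier B" "z \<in> carrier U"
    and "\<And>x y. \<lbrakk>x \<in> carrier B; y \<in> carrier B\<rbrakk> \<Longrightarrow> bilin K U U X (\<beta> x y)"
    and "\<And>v w. \<lbrakk>v \<in> carrier U; w \<in> carrier U\<rbrakk> \<Longrightarrow> bilin K B B X (\<lambda>x y. \<beta> x y v w)"
    and "\<And>x y v w. \<lbrakk>x \<in> carrier B; y \<in> carrier B; v \<in> carrier U; w \<in> carrier U\<rbrakk> \<Longrightarrow> \<beta> x y v w = \<gamma> x y v w"
  shows "swB X (\<lambda>x y. swU X (\<beta> x y) z) b = swB X (\<lambda>x y. swU X (\<gamma> x y) z) b"
  by (rule swB_cong[OF assms(2,1)])
     (assumption | rule linU assms swU_cong[OF assms(3,1)] bilin_left[OF assms(5)] bilin_right[OF assms(5)])+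

lemma sw2_add:
  assumes "module K X" "b \<in> carrier B" "z \<in> carrier U"
    and "\<And>x y. \<lbrakk>x \<in> carrier B; y \<in> carrier B\<rbrakk> \<Longrightarrow> bilin K U U X (\<beta> x y)"
    and "\<And>v w. \<lbrakk>v \<in> carrier U; w \<in> carrier U\<rbrakk> \<Longrightarrow> bilin K B B X (\<lambda>x y. \<beta> x y v w)"
    and "\<And>x y. \<lbrakk>x \<in> carrier B; y \<in> carrier B\<rbrakk> \<Longrightarrow> bilin K U U X (\<gamma> x y)"
    and "\<And>v w. \<lbrakk>v \<in> carrier U; w \<in> carrier U\<rbrakk> \<Longrightarrow> bilin K B B X (\<lambda>x y. \<gamma> x y v w)"
  shows "swB X (\<lambda>x y. swU X (\<lambda>v w. \<beta> x y v w \<oplus>\<^bsub>X\<^esub> \<gamma> x y v w) z) b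
    = swB X (\<lambda>x y. swU X (\<beta> x y) z) b \<oplus>\<^bsub>X\<^esub> swB X (\<lambda>x y. swU X (\<gamma> x y) z) b"
proof -
  note lin = linU assms(1-4) assms(6) bilin_left[OF assms(5)] bilin_right[OF assms(5)] bilin_left[OF assms(7)] bilin_right[OF assms(7)]
     bilin_left[OF assms(4)] bilin_right[OF assms(4)] bilin_left[OF assms(6)] bilin_right[OF assms(6)]
  have "swB X (\<lambda>x y. swU X (\<lambda>v w. \<beta> x y v w \<oplus>\<^bsub>X\<^esub> \<gamma> x y v w) z) b
    = swB X (\<lambda>x y. swU X (\<beta> x y) z \<oplus>\<^bsub>X\<^esub> swU X (\<gamma> x y) z) b"
    by (rule swB_cong[OF assms(2,1)]) (assumption | rule lin swU_add)+
  also have "\<dots> = swB X (\<lambda>x y. swU X (\<beta> x y) z) b \<oplus>\<^bsub>X\<^esub> swB X (\<lambda>x y. swU X (\<gamma> x y) z) b"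
    by (rule swB_add[OF assms(1,2)]) (assumption | rule lin)+
  finally show ?thesis .
qed

text \<open>The test function is arbitrary because the induction step applies the hypothesis to
  \<beta> with letters already inserted into its three arguments.\<close>

lemma swU_coassoc:
  assumes X: "module K X" and z: "z \<in> carrier U" and \<beta>: "trilin K U U U X \<beta>"
  shows "swU X (\<lambda>a c. swU X (\<lambda>a1 a2. \<beta> a1 a2 c) a) z = swU X (\<lambda>a c. swU X (\<beta> a) c) z"
  using z \<beta>
proof (induction arbitrary: \<beta> rule: U_induct)
  case (one \<beta>)
  note lin = linU X trilin_comp[OF one]
  have "swU X (\<lambda>a c. swU X (\<lambda>a1 a2. \<beta> a1 a2 c) a) \<one>\<^bsub>U\<^esub> = swU X (\<lambda>a1 a2. \<beta> a1 a2 \<one>\<^bsub>U\<^esub>) \<one>\<^bsub>U\<^esub>"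
    by (rule swU_one[OF X]) (assumption | rule lin)+
  also have "\<dots> = \<beta> \<one>\<^bsub>U\<^esub> \<one>\<^bsub>U\<^esub> \<one>\<^bsub>U\<^esub>" by (rule swU_one[OF X]) (assumption | rule lin)+
  also have "\<dots> = swU X (\<beta> \<one>\<^bsub>U\<^esub>) \<one>\<^bsub>U\<^esub>" by (rule swU_one[OF X, symmetric]) (assumption | rule lin)+
  also have "\<dots> = swU X (\<lambda>a c. swU X (\<beta> a) c) \<one>\<^bsub>U\<^esub>" by (rule swU_one[OF X, symmetric]) (assumption | rule lin)+
  finally show ?case .
next
  case (add x y \<beta>)
  note lin = linU X trilin_comp[OF add(5)]
  have "(\<lambda>z. swU X (\<lambda>a c. swU X (\<lambda>a1 a2. \<beta> a1 a2 c) a) z) \<in> module_hom K U X"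
    "(\<lambda>z. swU X (\<lambda>a c. swU X (\<beta> a) c) z) \<in> module_hom K U X" by (assumption | rule lin)+
  from this[THEN module_hom_add, OF add(1,2)] show ?case by (simp only: add)
next
  case (smult r x \<beta>)
  note lin = linU X trilin_comp[OF smult(4)]
  have "(\<lambda>z. swU X (\<lambda>a c. swU X (\<lambda>a1 a2. \<beta> a1 a2 c) a) z) \<in> module_hom K U X"
    "(\<lambda>z. swU X (\<lambda>a c. swU X (\<beta> a) c) z) \<in> module_hom K U X" by (assumption | rule lin)+
  from this[THEN module_hom_smult, OF smult(1,2)] show ?case by (simp only: smult)
next
  case (m b x \<beta>)
  note lin = linU X trilin_comp[OF m(4)] m(1,2)
  have "swU X (\<lambda>a c. swU X (\<lambda>a1 a2. \<beta> a1 a2 c) a) (m b \<bullet> x)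
    = swB X (\<lambda>b1 b2. swU X (\<lambda>a c. swU X (\<lambda>a1 a2. \<beta> a1 a2 (m b2 \<bullet> c)) (m b1 \<bullet> a)) x) b"
    by (rule swU_m[OF X _ m(1,2)]) (assumption | rule lin)+
  also have "\<dots> = swB X (\<lambda>b1 b2. swU X (\<lambda>a c. sw2 m m X (\<lambda>a1 a2. \<beta> a1 a2 (m b2 \<bullet> c)) b1 a) x) b"
    by (rule sw2_cong[OF X m(1,2)]) (assumption | rule lin swU_m)+
  also have "\<dots> = swB X (\<lambda>b1 b2. swU X (\<lambda>a c. sw2 m m X (\<beta> (m b1 \<bullet> a)) b2 c) x) b"
    by (rule coassoc_step[OF X m_hom m_hom m_hom m(2,1,4,3)])
  also have "\<dots> = swB X (\<lambda>b1 b2. swU X (\<lambda>a c. swU X (\<beta> (m b1 \<bullet> a)) (m b2 \<bullet> c)) x) b"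
    by (rule sw2_cong[OF X m(1,2)]) (assumption | rule lin swU_m[symmetric])+
  also have "\<dots> = swU X (\<lambda>a c. swU X (\<beta> a) c) (m b \<bullet> x)"
    by (rule swU_m[OF X _ m(1,2), symmetric]) (assumption | rule lin)+
  finally show ?case .
next
  case (h b x \<beta>)
  note lin = linU X trilin_comp[OF h(4)] h(1,2)
  let ?L = "\<lambda>F G H. swB X (\<lambda>b1 b2. swU X (\<lambda>a c. sw2 F G X (\<lambda>a1 a2. \<beta> a1 a2 (H b2 \<bullet> c)) b1 a) x) b"
  let ?R = "\<lambda>F G H. swB X (\<lambda>b1 b2. swU X (\<lambda>a c. sw2 G H X (\<beta> (F b1 \<bullet> a)) b2 c) x) b"
  note step = coassoc_step[OF X _ _ _ h(2,1,4,3)]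
  have "swU X (\<lambda>a c. swU X (\<lambda>a1 a2. \<beta> a1 a2 c) a) (h b \<bullet> x)
    = swB X (\<lambda>b1 b2. swU X (\<lambda>a c. swU X (\<lambda>a1 a2. \<beta> a1 a2 (h b2 \<bullet> c)) (m b1 \<bullet> a)) x) b
      \<oplus>\<^bsub>X\<^esub> swB X (\<lambda>b1 b2. swU X (\<lambda>a c. swU X (\<lambda>a1 a2. \<beta> a1 a2 (m b2 \<bullet> c)) (h b1 \<bullet> a)) x) b"
    by (rule swU_h[OF X _ h(1,2)]) (assumption | rule lin)+
  also have "swB X (\<lambda>b1 b2. swU X (\<lambda>a c. swU X (\<lambda>a1 a2. \<beta> a1 a2 (h b2 \<bullet> c)) (m b1 \<bullet> a)) x) b = ?L m m h"
    by (rule sw2_cong[OF X h(1,2)]) (assumption | rule lin swU_m)+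
  also have "swB X (\<lambda>b1 b2. swU X (\<lambda>a c. swU X (\<lambda>a1 a2. \<beta> a1 a2 (m b2 \<bullet> c)) (h b1 \<bullet> a)) x) b
    = swB X (\<lambda>b1 b2. swU X (\<lambda>a c. sw2 m h X (\<lambda>a1 a2. \<beta> a1 a2 (m b2 \<bullet> c)) b1 a
         \<oplus>\<^bsub>X\<^esub> sw2 h m X (\<lambda>a1 a2. \<beta> a1 a2 (m b2 \<bullet> c)) b1 a) x) b"
    by (rule sw2_cong[OF X h(1,2)]) (assumption | rule lin swU_h)+
  also have "\<dots> = ?L m h m \<oplus>\<^bsub>X\<^esub> ?L h m m"
    by (rule sw2_add[OF X h(1,2)]) (assumption | rule lin)+
  also have "?L m m h = ?R m m h" by (rule step[OF m_hom m_hom h_hom])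
  also have "?L m h m = ?R m h m" by (rule step[OF m_hom h_hom m_hom])
  also have "?L h m m = ?R h m m" by (rule step[OF h_hom m_hom m_hom])
  also have "?R m m h \<oplus>\<^bsub>X\<^esub> (?R m h m \<oplus>\<^bsub>X\<^esub> ?R h m m) = (?R m m h \<oplus>\<^bsub>X\<^esub> ?R m h m) \<oplus>\<^bsub>X\<^esub> ?R h m m"
    by (rule abelian_monoid.a_assoc[OF abelian_group.axioms(1)[OF module.axioms(2)[OF X]], symmetric]) (assumption | rule lin)+
  also have "?R m m h \<oplus>\<^bsub>X\<^esub> ?R m h m = swB X (\<lambda>b1 b2. swU X (\<lambda>a c. sw2 m h X (\<beta> (m b1 \<bullet> a)) b2 c
      \<oplus>\<^bsub>X\<^esub> sw2 h m X (\<beta> (m b1 \<bullet> a)) b2 c) x) b"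
    by (rule sw2_add[OF X h(1,2), symmetric]) (assumption | rule lin)+
  also have "\<dots> = swB X (\<lambda>b1 b2. swU X (\<lambda>a c. swU X (\<beta> (m b1 \<bullet> a)) (h b2 \<bullet> c)) x) b"
    by (rule sw2_cong[OF X h(1,2)]) (assumption | rule lin swU_h[symmetric])+
  also have "?R h m m = swB X (\<lambda>b1 b2. swU X (\<lambda>a c. swU X (\<beta> (h b1 \<bullet> a)) (m b2 \<bullet> c)) x) b"
    by (rule sw2_cong[OF X h(1,2)]) (assumption | rule lin swU_m[symmetric])+
  also have "swB X (\<lambda>b1 b2. swU X (\<lambda>a c. swU X (\<beta> (m b1 \<bullet> a)) (h b2 \<bullet> c)) x) b \<oplus>\<^bsub>X\<^esub> \<dots>
    = swU X (\<lambda>a c. swU X (\<beta> a) c) (h b \<bullet> x)"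
    by (rule swU_h[OF X _ h(1,2), symmetric]) (assumption | rule lin)+
  finally show ?case .
qed

section \<open>The canonical action on the Poisson Hopf algebra\<close>


lemma bracket_flip:
  assumes "a \<in> carrier B" "b \<in> carrier B"
  shows "bracket b a = \<ominus>\<^bsub>B\<^esub> bracket a b"
  using abelian_group.minus_equality[OF module.axioms(2)[OF module_B] bracket_antisym[OF assms]] assms
  by (simp add: bracket_closed)

lemma bracket_minus_right:
  assumes "a \<in> carrier B" "b \<in> carrier B"
  shows "bracket a (\<ominus>\<^bsub>B\<^esub> b) = \<ominus>\<^bsub>B\<^esub> bracket a b"
proof -
  interpret mod_hom K B B "bracket a"
    using bilin_right[OF bracket_bilin assms(1)] by (simp add: mod_hom_def mod_hom_axioms_def module_B)
  show ?thesis using assms by simp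
qed

definition "actB s v = (case s of Inl a \<Rightarrow> a \<star> v | Inr a \<Rightarrow> bracket a v)"

lemma actB_simps [simp]: "actB (Inl a) v = a \<star> v" "actB (Inr a) v = bracket a v"
  by (simp_all add: actB_def)

text \<open>The relation for h of a bracket is the Jacobi identity, the one for m of a bracket is
  the Leibniz rule, and the one for h of a product is the Leibniz rule in the first argument,
  obtained by antisymmetry.\<close>

sublocale actB: env_module K B bracket B actB
proof (intro env_module.intro env_module_axioms.intro poisson_algebra_axioms module_B; (simp only: actB_simps)?)
  fix s assume "s \<in> carrier B <+> carrier B"
  then show "actB s \<in> module_hom K B B"
    by (auto simp: actB_def[abs_def] intro: bilin_right[OF B_mult_bilin] bilin_right[OF bracket_bilin])
next
  fix v assume "v \<in> carrier B"
  then show "(\<lambda>a. a \<star> v) \<in> module_hom K B B" "(\<lambda>a. bracket a v) \<in> module_hom K B B"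
    by (rule bilin_left[OF B_mult_bilin] bilin_left[OF bracket_bilin])+
next
  fix a b v assume c: "a \<in> carrier B" "b \<in> carrier B" "v \<in> carrier B"
  show "a \<star> b \<star> v = a \<star> (b \<star> v)" using c by (simp only: B_simps)
  show "bracket (bracket a b) v = bracket a (bracket b v) \<ominus>\<^bsub>B\<^esub> bracket b (bracket a v)"
  proof -
    have "bracket a (bracket b v) \<oplus>\<^bsub>B\<^esub> \<ominus>\<^bsub>B\<^esub> bracket b (bracket a v) \<oplus>\<^bsub>B\<^esub> \<ominus>\<^bsub>B\<^esub> bracket (bracket a b) v = \<zero>\<^bsub>B\<^esub>"
      using bracket_jacobi[OF c] bracket_flip[OF c(1,3)] bracket_flip[OF bracket_closed[OF c(1,2)] c(3)] c
      by (simp add: bracket_minus_right bracket_closed)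
    from abelian_group.minus_equality[OF module.axioms(2)[OF module_B] this]
    have "\<ominus>\<^bsub>B\<^esub> (\<ominus>\<^bsub>B\<^esub> bracket (bracket a b) v) = bracket a (bracket b v) \<oplus>\<^bsub>B\<^esub> \<ominus>\<^bsub>B\<^esub> bracket b (bracket a v)"
      using c by (simp only: bracket_closed B_simps(1,3))
    then show ?thesis using c by (simp only: bracket_closed B_simps)
  qed
  show "bracket (a \<star> b) v = b \<star> bracket a v \<oplus>\<^bsub>B\<^esub> a \<star> bracket b v"
    using c by (simp add: bracket_flip[of v "a \<star> b"] bracket_flip[of a v] bracket_flip[of b v]
        bracket_leibniz bracket_closed B_simps)
  show "bracket a b \<star> v = bracket a (b \<star> v) \<ominus>\<^bsub>B\<^esub> b \<star> bracket a v"
    by (rule abelian_group.eq_minusI[OF module.axioms(2)[OF module_B] bracket_leibniz])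
       (use c in \<open>simp_all add: bracket_closed B_simps\<close>)
next
  fix v assume "v \<in> carrier B"
  then show "\<one>\<^bsub>B\<^esub> \<star> v = v" by (rule B_simps)
qed

text \<open>
  \<open>ev z\<close> is \<open>z \<cdot> 1\<close>, a left \<open>B\<close>-linear coalgebra map that splits \<open>m\<close>.
\<close>

definition "ev = env_act K B actB \<one>\<^bsub>B\<^esub>"

lemma ev_hom: "ev \<in> module_hom K U B"
  unfolding ev_def by (rule actB.env_act_hom) (rule B_simps)

lemma ev_one: "ev \<one>\<^bsub>U\<^esub> = \<one>\<^bsub>B\<^esub>"
  unfolding ev_def by (rule actB.env_act_one) (rule B_simps)

lemma ev_m: "\<lbrakk>b \<in> carrier B; z \<in> carrier U\<rbrakk> \<Longrightarrow> ev (m b \<bullet> z) = b \<star> ev z"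
  and ev_h: "\<lbrakk>b \<in> carrier B; z \<in> carrier U\<rbrakk> \<Longrightarrow> ev (h b \<bullet> z) = bracket b (ev z)"
  using actB.env_act_generator[OF B_simps(6)] by (simp_all add: ev_def)

lemma ev_closed: "z \<in> carrier U \<Longrightarrow> ev z \<in> carrier B"
  by (rule module_hom_mem[OF ev_hom])

lemmas linE = linU module_hom_comp[OF ev_hom] ev_closed

text \<open>In the induction m acts by multiplication and h by the bracket, and \<Delta> respects
  both. The two summands of \<open>swB_bracket\<close> match the two letter patterns of \<Delta>(h
  b).\<close>

lemma swB_ev:
  assumes X: "module K X" and z: "z \<in> carrier U" and \<beta>: "bilin K B B X \<beta>"
  shows "swB X \<beta> (ev z) = swU X (\<lambda>a c. \<beta> (ev a) (ev c)) z"
  using z \<beta>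
proof (induction arbitrary: \<beta> rule: U_induct)
  case (one \<beta>)
  note lin = linE X bilin_comp_left[OF one] bilin_comp_right[OF one]
  have "swU X (\<lambda>a c. \<beta> (ev a) (ev c)) \<one>\<^bsub>U\<^esub> = \<beta> (ev \<one>\<^bsub>U\<^esub>) (ev \<one>\<^bsub>U\<^esub>)"
    by (rule swU_one[OF X]) (assumption | rule lin)+
  then show ?case by (simp add: ev_one swB_one[OF X one])
next
  case (add x y \<beta>)
  note lin = linE X bilin_comp_left[OF add(5)] bilin_comp_right[OF add(5)] add(5)
  have "(\<lambda>z. swB X \<beta> (ev z)) \<in> module_hom K U X"
    "(\<lambda>z. swU X (\<lambda>a c. \<beta> (ev a) (ev c)) z) \<in> module_hom K U X" by (assumption | rule lin)+
  from this[THEN module_hom_add, OF add(1,2)] show ?case by (simp only: add)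
next
  case (smult r x \<beta>)
  note lin = linE X bilin_comp_left[OF smult(4)] bilin_comp_right[OF smult(4)] smult(4)
  have "(\<lambda>z. swB X \<beta> (ev z)) \<in> module_hom K U X"
    "(\<lambda>z. swU X (\<lambda>a c. \<beta> (ev a) (ev c)) z) \<in> module_hom K U X" by (assumption | rule lin)+
  from this[THEN module_hom_smult, OF smult(1,2)] show ?case by (simp only: smult)
next
  case (m b x \<beta>)
  note lin = linE X bilin_comp_left[OF m(4)] bilin_comp_right[OF m(4)] bilin_mem[OF m(4)] m(1,2)
  have "swB X \<beta> (ev (m b \<bullet> x))
    = swB X (\<lambda>b1 b2. swB X (\<lambda>v w. \<beta> (b1 \<star> v) (b2 \<star> w)) (ev x)) b"
    unfolding ev_m[OF m(1,2)] by (rule swB_mult[OF X m(4)]) (assumption | rule lin)+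
  also have "\<dots> = swB X (\<lambda>b1 b2. swU X (\<lambda>v w. \<beta> (b1 \<star> ev v) (b2 \<star> ev w)) x) b"
    by (rule swB_cong[OF m(1) X]) (assumption | rule lin m(3))+
  also have "\<dots> = sw2 m m X (\<lambda>a c. \<beta> (ev a) (ev c)) b x"
    by (rule sw2_cong[OF X m(1,2)]) (assumption | rule lin | simp only: ev_m)+
  also have "\<dots> = swU X (\<lambda>a c. \<beta> (ev a) (ev c)) (m b \<bullet> x)"
    by (rule swU_m[OF X _ m(1,2), symmetric]) (assumption | rule lin)+
  finally show ?case .
next
  case (h b x \<beta>)
  note lin = linE X bilin_comp_left[OF h(4)] bilin_comp_right[OF h(4)] bilin_mem[OF h(4)] h(1,2)
  have "swB X \<beta> (ev (h b \<bullet> x))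
    = swB X (\<lambda>b1 b2. swB X (\<lambda>v w. \<beta> (b1 \<star> v) (bracket b2 w) \<oplus>\<^bsub>X\<^esub> \<beta> (bracket b1 v) (b2 \<star> w)) (ev x)) b"
    unfolding ev_h[OF h(1,2)] by (rule swB_bracket[OF X h(4)]) (assumption | rule lin)+
  also have "\<dots> = swB X (\<lambda>b1 b2. swU X (\<lambda>v w. \<beta> (b1 \<star> ev v) (bracket b2 (ev w)) \<oplus>\<^bsub>X\<^esub> \<beta> (bracket b1 (ev v)) (b2 \<star> ev w)) x) b"
    by (rule swB_cong[OF h(1) X]) (assumption | rule lin h(3))+
  also have "\<dots> = swB X (\<lambda>b1 b2. swU X (\<lambda>v w. \<beta> (b1 \<star> ev v) (bracket b2 (ev w))) x) b
     \<oplus>\<^bsub>X\<^esub> swB X (\<lambda>b1 b2. swU X (\<lambda>v w. \<beta> (bracket b1 (ev v)) (b2 \<star> ev w)) x) b"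
    by (rule sw2_add[OF X h(1,2)]) (assumption | rule lin)+
  also have "swB X (\<lambda>b1 b2. swU X (\<lambda>v w. \<beta> (b1 \<star> ev v) (bracket b2 (ev w))) x) b
    = sw2 m h X (\<lambda>a c. \<beta> (ev a) (ev c)) b x"
    by (rule sw2_cong[OF X h(1,2)]) (assumption | rule lin | simp only: ev_m ev_h)+
  also have "swB X (\<lambda>b1 b2. swU X (\<lambda>v w. \<beta> (bracket b1 (ev v)) (b2 \<star> ev w)) x) b
    = sw2 h m X (\<lambda>a c. \<beta> (ev a) (ev c)) b x"
    by (rule sw2_cong[OF X h(1,2)]) (assumption | rule lin | simp only: ev_m ev_h)+
  also have "sw2 m h X (\<lambda>a c. \<beta> (ev a) (ev c)) b x \<oplus>\<^bsub>X\<^esub> \<dots> = swU X (\<lambda>a c. \<beta> (ev a) (ev c)) (h b \<bullet> x)"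
    by (rule swU_h[OF X _ h(1,2), symmetric]) (assumption | rule lin)+
  finally show ?case .
qed

text \<open>The composite \<epsilon>(ev z) is the counit of B^e, as \<open>env_counit_eq\<close>
  confirms later. In this form it is available before the counit is constructed as a lift.\<close>

lemma \<epsilon>_ev_m: "\<lbrakk>b \<in> carrier B; z \<in> carrier U\<rbrakk> \<Longrightarrow> \<epsilon> (ev (m b \<bullet> z)) = \<epsilon> b \<otimes> \<epsilon> (ev z)"
  and \<epsilon>_ev_h: "\<lbrakk>b \<in> carrier B; z \<in> carrier U\<rbrakk> \<Longrightarrow> \<epsilon> (ev (h b \<bullet> z)) = \<zero>"
  by (simp_all add: ev_m ev_h ev_closed \<epsilon>_mult \<epsilon>_bracket)

lemma swB_zero:
  assumes "module K X" "b \<in> carrier B"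
  shows "swB X (\<lambda>x y. \<zero>\<^bsub>X\<^esub>) b = \<zero>\<^bsub>X\<^esub>"
proof -
  have z: "bilin K B B X (\<lambda>x y. \<zero>\<^bsub>X\<^esub>)"
    by (assumption | rule lin assms module_hom_zero_fun)+
  show ?thesis unfolding swB_def
    by (rule BB.tensor_hom_eqI[OF BB.tensor_lift_hom[OF assms(1) z] module_hom_zero_fun[OF _ assms(1)] _ \<Delta>_closed[OF assms(2)]])
       (simp_all add: BB.tensor_lift_pure[OF assms(1) z] BB.module_tensor)
qed

lemma \<epsilon>_ev_hom: "(\<lambda>z. \<epsilon> (ev z)) \<in> module_hom K U (scalar_algebra K)"
  by (assumption | rule linE)+

text \<open>The function \<phi> is what the counit sees of the letter F: \<epsilon> if F is m, zero
  if F is h. The sum over z then collapses by the induction hypothesis and a sum over b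
  remains.\<close>

lemma counit_step_left:
  assumes X: "module K X" and F: "F \<in> module_hom K B U" and G: "G \<in> module_hom K B U"
    and \<phi>: "\<phi> \<in> module_hom K B (scalar_algebra K)"
    and eq: "\<And>x v. \<lbrakk>x \<in> carrier B; v \<in> carrier U\<rbrakk> \<Longrightarrow> \<epsilon> (ev (F x \<bullet> v)) = \<phi> x \<otimes> \<epsilon> (ev v)"
    and b: "b \<in> carrier B" and z: "z \<in> carrier U" and f: "f \<in> module_hom K U X"
    and IH: "\<And>g. g \<in> module_hom K U X \<Longrightarrow> swU X (\<lambda>a c. \<epsilon> (ev a) \<odot>\<^bsub>X\<^esub> g c) z = g z"
  shows "sw2 F G X (\<lambda>a c. \<epsilon> (ev a) \<odot>\<^bsub>X\<^esub> f c) b z = swB X (\<lambda>x y. \<phi> x \<odot>\<^bsub>X\<^esub> f (G y \<bullet> z)) b"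
proof (rule swB_cong[OF b X])
  interpret X: module K X by (rule X)
  have \<phi>_closed: "\<And>x. x \<in> carrier B \<Longrightarrow> \<phi> x \<in> carrier K"
    using module_hom_mem[OF \<phi>] by (simp add: scalar_algebra_simps)
  note lin = linE X module_hom_comp[OF F] module_hom_comp[OF G] module_hom_mem[OF F] module_hom_mem[OF G]
    module_hom_comp[OF f] module_hom_mem[OF f] b z \<phi>_closed
  show "bilin K B B X (\<lambda>x y. swU X (\<lambda>v w. \<epsilon> (ev (F x \<bullet> v)) \<odot>\<^bsub>X\<^esub> f (G y \<bullet> w)) z)"
    by (assumption | rule lin)+
  fix x y assume c: "x \<in> carrier B" "y \<in> carrier B"
  have "swU X (\<lambda>v w. \<epsilon> (ev (F x \<bullet> v)) \<odot>\<^bsub>X\<^esub> f (G y \<bullet> w)) z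
    = swU X (\<lambda>v w. \<epsilon> (ev v) \<odot>\<^bsub>X\<^esub> (\<phi> x \<odot>\<^bsub>X\<^esub> f (G y \<bullet> w))) z"
  proof (rule swU_cong[OF z X])
    fix v w assume d: "v \<in> carrier U" "w \<in> carrier U"
    have e: "\<phi> x \<in> carrier K" "\<epsilon> (ev v) \<in> carrier K" "f (G y \<bullet> w) \<in> carrier X"
      by (assumption | rule lin c d)+
    then show "\<epsilon> (ev (F x \<bullet> v)) \<odot>\<^bsub>X\<^esub> f (G y \<bullet> w)
      = \<epsilon> (ev v) \<odot>\<^bsub>X\<^esub> (\<phi> x \<odot>\<^bsub>X\<^esub> f (G y \<bullet> w))"
      by (simp only: eq[OF c(1) d(1)] K_simps(14)[OF e(1,2)] X.smult_assoc1)
  qed (assumption | rule lin c)+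
  also have "\<dots> = \<phi> x \<odot>\<^bsub>X\<^esub> f (G y \<bullet> z)"
    by (rule IH) (assumption | rule lin c)+
  finally show "swU X (\<lambda>v w. \<epsilon> (ev (F x \<bullet> v)) \<odot>\<^bsub>X\<^esub> f (G y \<bullet> w)) z = \<dots>" .
qed

lemma counit_step_right:
  assumes X: "module K X" and F: "F \<in> module_hom K B U" and G: "G \<in> module_hom K B U"
    and \<phi>: "\<phi> \<in> module_hom K B (scalar_algebra K)"
    and eq: "\<And>x v. \<lbrakk>x \<in> carrier B; v \<in> carrier U\<rbrakk> \<Longrightarrow> \<epsilon> (ev (G x \<bullet> v)) = \<phi> x \<otimes> \<epsilon> (ev v)"
    and b: "b \<in> carrier B" and z: "z \<in> carrier U" and f: "f \<in> module_hom K U X"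
    and IH: "\<And>g. g \<in> module_hom K U X \<Longrightarrow> swU X (\<lambda>a c. \<epsilon> (ev c) \<odot>\<^bsub>X\<^esub> g a) z = g z"
  shows "sw2 F G X (\<lambda>a c. \<epsilon> (ev c) \<odot>\<^bsub>X\<^esub> f a) b z = swB X (\<lambda>x y. \<phi> y \<odot>\<^bsub>X\<^esub> f (F x \<bullet> z)) b"
proof (rule swB_cong[OF b X])
  interpret X: module K X by (rule X)
  have \<phi>_closed: "\<And>x. x \<in> carrier B \<Longrightarrow> \<phi> x \<in> carrier K"
    using module_hom_mem[OF \<phi>] by (simp add: scalar_algebra_simps)
  note lin = linE X module_hom_comp[OF F] module_hom_comp[OF G] module_hom_mem[OF F] module_hom_mem[OF G]
    module_hom_comp[OF f] module_hom_mem[OF f] b z \<phi>_closed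
  show "bilin K B B X (\<lambda>x y. swU X (\<lambda>v w. \<epsilon> (ev (G y \<bullet> w)) \<odot>\<^bsub>X\<^esub> f (F x \<bullet> v)) z)"
    by (assumption | rule lin)+
  fix x y assume c: "x \<in> carrier B" "y \<in> carrier B"
  have "swU X (\<lambda>v w. \<epsilon> (ev (G y \<bullet> w)) \<odot>\<^bsub>X\<^esub> f (F x \<bullet> v)) z
    = swU X (\<lambda>v w. \<epsilon> (ev w) \<odot>\<^bsub>X\<^esub> (\<phi> y \<odot>\<^bsub>X\<^esub> f (F x \<bullet> v))) z"
  proof (rule swU_cong[OF z X])
    fix v w assume d: "v \<in> carrier U" "w \<in> carrier U"
    have e: "\<phi> y \<in> carrier K" "\<epsilon> (ev w) \<in> carrier K" "f (F x \<bullet> v) \<in> carrier X"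
      by (assumption | rule lin c d)+
    then show "\<epsilon> (ev (G y \<bullet> w)) \<odot>\<^bsub>X\<^esub> f (F x \<bullet> v)
      = \<epsilon> (ev w) \<odot>\<^bsub>X\<^esub> (\<phi> y \<odot>\<^bsub>X\<^esub> f (F x \<bullet> v))"
      by (simp only: eq[OF c(2) d(2)] K_simps(14)[OF e(1,2)] X.smult_assoc1)
  qed (assumption | rule lin c)+
  also have "\<dots> = \<phi> y \<odot>\<^bsub>X\<^esub> f (F x \<bullet> z)"
    by (rule IH) (assumption | rule lin c)+
  finally show "swU X (\<lambda>v w. \<epsilon> (ev (G y \<bullet> w)) \<odot>\<^bsub>X\<^esub> f (F x \<bullet> v)) z = \<dots>" .
qed

lemma zero_scalar_hom: "(\<lambda>x. \<zero>) \<in> module_hom K B (scalar_algebra K)"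
  using module_hom_zero_fun[OF module_B module_scalar] by (simp add: scalar_algebra_simps)

lemma \<epsilon>_ev_h': "\<lbrakk>b \<in> carrier B; z \<in> carrier U\<rbrakk> \<Longrightarrow> \<epsilon> (ev (h b \<bullet> z)) = \<zero> \<otimes> \<epsilon> (ev z)"
  using \<epsilon>_closed[OF ev_closed] by (simp add: \<epsilon>_ev_h K_simps)

text \<open>Inductively, the counit of B collapses the summand whose counit leg carries m; for h,
  the other summand vanishes.\<close>

lemma swU_counit:
  assumes X: "module K X" and z: "z \<in> carrier U" and f: "f \<in> module_hom K U X"
  shows swU_counit_left: "swU X (\<lambda>a c. \<epsilon> (ev a) \<odot>\<^bsub>X\<^esub> f c) z = f z"
    and swU_counit_right: "swU X (\<lambda>a c. \<epsilon> (ev c) \<odot>\<^bsub>X\<^esub> f a) z = f z"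
proof -
  interpret X: module K X by (rule X)
  have "swU X (\<lambda>a c. \<epsilon> (ev a) \<odot>\<^bsub>X\<^esub> f c) z = f z \<and> swU X (\<lambda>a c. \<epsilon> (ev c) \<odot>\<^bsub>X\<^esub> f a) z = f z"
    using z f
  proof (induction arbitrary: f rule: U_induct)
    case (one f)
    note lin = linE X module_hom_comp[OF one] module_hom_mem[OF one]
    have "swU X (\<lambda>a c. \<epsilon> (ev a) \<odot>\<^bsub>X\<^esub> f c) \<one>\<^bsub>U\<^esub> = \<epsilon> (ev \<one>\<^bsub>U\<^esub>) \<odot>\<^bsub>X\<^esub> f \<one>\<^bsub>U\<^esub>"
      "swU X (\<lambda>a c. \<epsilon> (ev c) \<odot>\<^bsub>X\<^esub> f a) \<one>\<^bsub>U\<^esub> = \<epsilon> (ev \<one>\<^bsub>U\<^esub>) \<odot>\<^bsub>X\<^esub> f \<one>\<^bsub>U\<^esub>"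
      by (rule swU_one[OF X], (assumption | rule lin)+)+
    then show ?case using module_hom_mem[OF one U_simps(6)] by (simp add: ev_one \<epsilon>_one)
  next
    case (add x y f)
    note lin = linE X module_hom_comp[OF add(5)] module_hom_mem[OF add(5)]
    have "swU X (\<lambda>a c. \<epsilon> (ev a) \<odot>\<^bsub>X\<^esub> f c) \<in> module_hom K U X" "swU X (\<lambda>a c. \<epsilon> (ev c) \<odot>\<^bsub>X\<^esub> f a) \<in> module_hom K U X"
      by (assumption | rule lin)+
    from this[THEN module_hom_add, OF add(1,2)] module_hom_add[OF add(5,1,2)] show ?case by (simp only: add simp_thms)
  next
    case (smult r x f)
    note lin = linE X module_hom_comp[OF smult(4)] module_hom_mem[OF smult(4)]
    have "swU X (\<lambda>a c. \<epsilon> (ev a) \<odot>\<^bsub>X\<^esub> f c) \<in> module_hom K U X" "swU X (\<lambda>a c. \<epsilon> (ev c) \<odot>\<^bsub>X\<^esub> f a) \<in> module_hom K U X"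
      by (assumption | rule lin)+
    from this[THEN module_hom_smult, OF smult(1,2)] module_hom_smult[OF smult(4,1,2)] show ?case by (simp only: smult simp_thms)
  next
    case (m b x f)
    note lin = linE X module_hom_comp[OF m(4)] module_hom_mem[OF m(4)] m(1,2)
    note IH = m(3)[THEN conjunct1] m(3)[THEN conjunct2]
    have "swU X (\<lambda>a c. \<epsilon> (ev a) \<odot>\<^bsub>X\<^esub> f c) (m b \<bullet> x) = sw2 m m X (\<lambda>a c. \<epsilon> (ev a) \<odot>\<^bsub>X\<^esub> f c) b x"
      by (rule swU_m[OF X _ m(1,2)]) (assumption | rule lin)+
    also have "\<dots> = swB X (\<lambda>x' y. \<epsilon> x' \<odot>\<^bsub>X\<^esub> f (m y \<bullet> x)) b"
      by (rule counit_step_left[OF X m_hom m_hom counit_linear \<epsilon>_ev_m m(1,2,4) IH(1)])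
    also have "\<dots> = f (m b \<bullet> x)"
      by (rule swB_counit_left[OF X _ m(1)]) (assumption | rule lin)+
    finally have 1: "swU X (\<lambda>a c. \<epsilon> (ev a) \<odot>\<^bsub>X\<^esub> f c) (m b \<bullet> x) = \<dots>" .
    have "swU X (\<lambda>a c. \<epsilon> (ev c) \<odot>\<^bsub>X\<^esub> f a) (m b \<bullet> x) = sw2 m m X (\<lambda>a c. \<epsilon> (ev c) \<odot>\<^bsub>X\<^esub> f a) b x"
      by (rule swU_m[OF X _ m(1,2)]) (assumption | rule lin)+
    also have "\<dots> = swB X (\<lambda>x' y. \<epsilon> y \<odot>\<^bsub>X\<^esub> f (m x' \<bullet> x)) b"
      by (rule counit_step_right[OF X m_hom m_hom counit_linear \<epsilon>_ev_m m(1,2,4) IH(2)])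
    also have "\<dots> = f (m b \<bullet> x)"
      by (rule swB_counit_right[OF X _ m(1)]) (assumption | rule lin)+
    finally show ?case using 1 by simp
  next
    case (h b x f)
    note lin = linE X module_hom_comp[OF h(4)] module_hom_mem[OF h(4)] h(1,2)
    note IH = h(3)[THEN conjunct1] h(3)[THEN conjunct2]
    have fc: "f (m y \<bullet> x) \<in> carrier X" if "y \<in> carrier B" for y
      by (assumption | rule lin that)+
    have hc: "f (h b \<bullet> x) \<in> carrier X"
      by (assumption | rule lin)+
    have "swU X (\<lambda>a c. \<epsilon> (ev a) \<odot>\<^bsub>X\<^esub> f c) (h b \<bullet> x) = sw2 m h X (\<lambda>a c. \<epsilon> (ev a) \<odot>\<^bsub>X\<^esub> f c) b x
       \<oplus>\<^bsub>X\<^esub> sw2 h m X (\<lambda>a c. \<epsilon> (ev a) \<odot>\<^bsub>X\<^esub> f c) b x"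
      by (rule swU_h[OF X _ h(1,2)]) (assumption | rule lin)+
    also have "sw2 m h X (\<lambda>a c. \<epsilon> (ev a) \<odot>\<^bsub>X\<^esub> f c) b x = swB X (\<lambda>x' y. \<epsilon> x' \<odot>\<^bsub>X\<^esub> f (h y \<bullet> x)) b"
      by (rule counit_step_left[OF X m_hom h_hom counit_linear \<epsilon>_ev_m h(1,2,4) IH(1)])
    also have "\<dots> = f (h b \<bullet> x)"
      by (rule swB_counit_left[OF X _ h(1)]) (assumption | rule lin)+
    \<comment> \<open>The summand with h on the leg of the counit: the counit kills
      \<open>h\<close>, so it contributes zero.\<close>
    also have "sw2 h m X (\<lambda>a c. \<epsilon> (ev a) \<odot>\<^bsub>X\<^esub> f c) b x = swB X (\<lambda>x' y. \<zero> \<odot>\<^bsub>X\<^esub> f (m y \<bullet> x)) b"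
      by (rule counit_step_left[OF X h_hom m_hom zero_scalar_hom \<epsilon>_ev_h' h(1,2,4) IH(1)])
    also have "\<dots> = swB X (\<lambda>x' y. \<zero>\<^bsub>X\<^esub>) b"
      by (rule swB_cong[OF h(1) X, symmetric]) (assumption | rule lin module_hom_zero_fun X.smult_l_null[symmetric] fc)+
    also have "\<dots> = \<zero>\<^bsub>X\<^esub>" by (rule swB_zero[OF X h(1)])
    finally have 1: "swU X (\<lambda>a c. \<epsilon> (ev a) \<odot>\<^bsub>X\<^esub> f c) (h b \<bullet> x) = f (h b \<bullet> x)" using hc by simp
    have "swU X (\<lambda>a c. \<epsilon> (ev c) \<odot>\<^bsub>X\<^esub> f a) (h b \<bullet> x) = sw2 m h X (\<lambda>a c. \<epsilon> (ev c) \<odot>\<^bsub>X\<^esub> f a) b x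
       \<oplus>\<^bsub>X\<^esub> sw2 h m X (\<lambda>a c. \<epsilon> (ev c) \<odot>\<^bsub>X\<^esub> f a) b x"
      by (rule swU_h[OF X _ h(1,2)]) (assumption | rule lin)+
    also have "sw2 h m X (\<lambda>a c. \<epsilon> (ev c) \<odot>\<^bsub>X\<^esub> f a) b x = swB X (\<lambda>x' y. \<epsilon> y \<odot>\<^bsub>X\<^esub> f (h x' \<bullet> x)) b"
      by (rule counit_step_right[OF X h_hom m_hom counit_linear \<epsilon>_ev_m h(1,2,4) IH(2)])
    also have "\<dots> = f (h b \<bullet> x)"
      by (rule swB_counit_right[OF X _ h(1)]) (assumption | rule lin)+
    also have "sw2 m h X (\<lambda>a c. \<epsilon> (ev c) \<odot>\<^bsub>X\<^esub> f a) b x = swB X (\<lambda>x' y. \<zero> \<odot>\<^bsub>X\<^esub> f (m x' \<bullet> x)) b"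
      by (rule counit_step_right[OF X m_hom h_hom zero_scalar_hom \<epsilon>_ev_h' h(1,2,4) IH(2)])
    also have "\<dots> = swB X (\<lambda>x' y. \<zero>\<^bsub>X\<^esub>) b"
      by (rule swB_cong[OF h(1) X, symmetric]) (assumption | rule lin module_hom_zero_fun X.smult_l_null[symmetric] fc)+
    also have "\<dots> = \<zero>\<^bsub>X\<^esub>" by (rule swB_zero[OF X h(1)])
    finally show ?case using 1 hc by simp
  qed
  then show "swU X (\<lambda>a c. \<epsilon> (ev a) \<odot>\<^bsub>X\<^esub> f c) z = f z" "swU X (\<lambda>a c. \<epsilon> (ev c) \<odot>\<^bsub>X\<^esub> f a) z = f z" by simp_all
qed

section \<open>The splitting of the enveloping algebra\<close>


text \<open>
  \<open>S (ev z\<^sub>1) z\<^sub>2\<close> and \<open>S (ev z\<^sub>2) z\<^sub>1\<close>. The second one is also \<open>\<epsilon>\<close>-linear over \<open>B\<close> because \<open>B\<close> is commutative;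
  it handles the left coinvariants.
\<close>

definition "sec = swU U (\<lambda>a c. m (S (ev a)) \<bullet> c)"
definition "sec' = swU U (\<lambda>a c. m (S (ev c)) \<bullet> a)"

lemma sec_hom: "sec \<in> module_hom K U U" and sec'_hom: "sec' \<in> module_hom K U U"
  unfolding sec_def sec'_def by (assumption | rule linE)+

lemma sec_closed: "z \<in> carrier U \<Longrightarrow> sec z \<in> carrier U"
  and sec'_closed: "z \<in> carrier U \<Longrightarrow> sec' z \<in> carrier U"
  by (rule module_hom_mem[OF sec_hom], assumption) (rule module_hom_mem[OF sec'_hom])

lemmas linS = linE module_hom_comp[OF sec_hom] module_hom_comp[OF sec'_hom] sec_closed sec'_closed

lemma S_closed: "b \<in> carrier B \<Longrightarrow> S b \<in> carrier B"
  by (rule module_hom_mem[OF antipode_linear])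

lemma m_smult: "\<lbrakk>c \<in> carrier K; b \<in> carrier B\<rbrakk> \<Longrightarrow> m (c \<odot>\<^bsub>B\<^esub> b) = c \<odot>\<^bsub>U\<^esub> m b"
  by (rule module_hom_smult[OF m_hom])

lemmas U_smult_mult = assoc_algebra.smult_mult_left[OF assoc_algebra_U] assoc_algebra.smult_mult_right[OF assoc_algebra_U]

text \<open>By left B-linearity of \<open>ev\<close> the terms become S(b1 p(z1)) b2 z2. The sum
  over b is taken innermost, where \<open>antipode_cancel_left\<close> removes it.\<close>

lemma sec_m:
  assumes b: "b \<in> carrier B" and z: "z \<in> carrier U"
  shows "sec (m b \<bullet> z) = \<epsilon> b \<odot>\<^bsub>U\<^esub> sec z"
proof -
  note lin = linE b z
  have "sec (m b \<bullet> z) = sw2 m m U (\<lambda>a c. m (S (ev a)) \<bullet> c) b z"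
    unfolding sec_def by (rule swU_m[OF module_U _ b z]) (assumption | rule lin)+
  also have "\<dots> = swB U (\<lambda>x y. swU U (\<lambda>v w. m (S (x \<star> ev v) \<star> y) \<bullet> w) z) b"
  proof (rule sw2_cong[OF module_U b z])
    fix x y v w assume c: "x \<in> carrier B" "y \<in> carrier B" "v \<in> carrier U" "w \<in> carrier U"
    then show "m (S (ev (m x \<bullet> v))) \<bullet> (m y \<bullet> w) = m (S (x \<star> ev v) \<star> y) \<bullet> w"
      by (simp only: ev_m m_mult S_closed ev_closed B_simps(5) m_closed U_simps(11))
  qed (assumption | rule lin)+
  also have "\<dots> = swU U (\<lambda>v w. swB U (\<lambda>x y. m (S (x \<star> ev v) \<star> y) \<bullet> w) b) z"
    by (rule swU_swap_swB[OF module_U z b, symmetric]) (assumption | rule lin)+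
  also have "\<dots> = swU U (\<lambda>v w. \<epsilon> b \<odot>\<^bsub>U\<^esub> (m (S (ev v)) \<bullet> w)) z"
  proof (rule swU_cong[OF z module_U])
    fix v w assume c: "v \<in> carrier U" "w \<in> carrier U"
    have "swB U (\<lambda>x y. m (S (x \<star> ev v) \<star> y) \<bullet> w) b
      = m (swB B (\<lambda>x y. S (x \<star> ev v) \<star> y) b) \<bullet> w"
      by (rule swB_map[OF b module_B module_U, symmetric]) (assumption | rule lin c)+
    then show "swB U (\<lambda>x y. m (S (x \<star> ev v) \<star> y) \<bullet> w) b = \<epsilon> b \<odot>\<^bsub>U\<^esub> (m (S (ev v)) \<bullet> w)"
      using b c by (simp only: antipode_cancel_left ev_closed m_smult S_closed \<epsilon>_closed U_smult_mult m_closed)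
  qed (assumption | rule lin)+
  also have "\<dots> = \<epsilon> b \<odot>\<^bsub>U\<^esub> sec z"
    unfolding sec_def by (rule swU_map[OF z module_U module_U, symmetric]) (assumption | rule lin)+
  finally show ?thesis .
qed

text \<open>The same with the legs exchanged: the terms are S(b2 p(z2)) b1 z1, and
  \<open>antipode_cancel_right\<close> applies.\<close>

lemma sec'_m:
  assumes b: "b \<in> carrier B" and z: "z \<in> carrier U"
  shows "sec' (m b \<bullet> z) = \<epsilon> b \<odot>\<^bsub>U\<^esub> sec' z"
proof -
  note lin = linE b z
  have "sec' (m b \<bullet> z) = sw2 m m U (\<lambda>a c. m (S (ev c)) \<bullet> a) b z"
    unfolding sec'_def by (rule swU_m[OF module_U _ b z]) (assumption | rule lin)+
  also have "\<dots> = swB U (\<lambda>x y. swU U (\<lambda>v w. m (S (y \<star> ev w) \<star> x) \<bullet> v) z) b"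
  proof (rule sw2_cong[OF module_U b z])
    fix x y v w assume c: "x \<in> carrier B" "y \<in> carrier B" "v \<in> carrier U" "w \<in> carrier U"
    then show "m (S (ev (m y \<bullet> w))) \<bullet> (m x \<bullet> v) = m (S (y \<star> ev w) \<star> x) \<bullet> v"
      by (simp only: ev_m m_mult S_closed ev_closed B_simps(5) m_closed U_simps(11))
  qed (assumption | rule lin)+
  also have "\<dots> = swU U (\<lambda>v w. swB U (\<lambda>x y. m (S (y \<star> ev w) \<star> x) \<bullet> v) b) z"
    by (rule swU_swap_swB[OF module_U z b, symmetric]) (assumption | rule lin)+
  also have "\<dots> = swU U (\<lambda>v w. \<epsilon> b \<odot>\<^bsub>U\<^esub> (m (S (ev w)) \<bullet> v)) z"
  proof (rule swU_cong[OF z module_U])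
    fix v w assume c: "v \<in> carrier U" "w \<in> carrier U"
    have "swB U (\<lambda>x y. m (S (y \<star> ev w) \<star> x) \<bullet> v) b
      = m (swB B (\<lambda>x y. S (y \<star> ev w) \<star> x) b) \<bullet> v"
      by (rule swB_map[OF b module_B module_U, symmetric]) (assumption | rule lin c)+
    then show "swB U (\<lambda>x y. m (S (y \<star> ev w) \<star> x) \<bullet> v) b = \<epsilon> b \<odot>\<^bsub>U\<^esub> (m (S (ev w)) \<bullet> v)"
      using b c by (simp only: antipode_cancel_right ev_closed m_smult S_closed \<epsilon>_closed U_smult_mult m_closed)
  qed (assumption | rule lin)+
  also have "\<dots> = \<epsilon> b \<odot>\<^bsub>U\<^esub> sec' z"
    unfolding sec'_def by (rule swU_map[OF z module_U module_U, symmetric]) (assumption | rule lin)+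
  finally show ?thesis .
qed

lemma m_smult_one_mult: "\<lbrakk>c \<in> carrier K; z \<in> carrier U\<rbrakk> \<Longrightarrow> m (c \<odot>\<^bsub>B\<^esub> \<one>\<^bsub>B\<^esub>) \<bullet> z = c \<odot>\<^bsub>U\<^esub> z"
  by (simp only: m_smult B_simps(6) m_one U_smult_mult U_simps(6,12))

text \<open>The sum is p(z1) S(p(z2)) z3. Since p is a coalgebra map, the first two factors are the
  antipode law of B at p of one leg, which leaves the counit.\<close>

lemma swU_ev_sec:
  assumes z: "z \<in> carrier U"
  shows "swU U (\<lambda>a c. m (ev a) \<bullet> sec c) z = z"
proof -
  note lin = linS z
  have "swU U (\<lambda>a c. m (ev a) \<bullet> sec c) z
    = swU U (\<lambda>a c. swU U (\<lambda>c1 c2. m (ev a) \<bullet> (m (S (ev c1)) \<bullet> c2)) c) z"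
  proof (rule swU_cong[OF z module_U])
    fix a c assume c: "a \<in> carrier U" "c \<in> carrier U"
    show "m (ev a) \<bullet> sec c = swU U (\<lambda>c1 c2. m (ev a) \<bullet> (m (S (ev c1)) \<bullet> c2)) c"
      unfolding sec_def by (rule swU_map[OF c(2) module_U module_U]) (assumption | rule lin c)+
  qed (assumption | rule lin)+
  also have "\<dots> = swU U (\<lambda>a c. swU U (\<lambda>a1 a2. m (ev a1) \<bullet> (m (S (ev a2)) \<bullet> c)) a) z"
    by (rule swU_coassoc[OF module_U z, symmetric]) (assumption | rule lin)+
  also have "\<dots> = swU U (\<lambda>a c. \<epsilon> (ev a) \<odot>\<^bsub>U\<^esub> c) z"
  proof (rule swU_cong[OF z module_U])
    fix a c assume c: "a \<in> carrier U" "c \<in> carrier U"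
    have "swU U (\<lambda>a1 a2. m (ev a1) \<bullet> (m (S (ev a2)) \<bullet> c)) a
      = swU U (\<lambda>a1 a2. m (ev a1 \<star> S (ev a2)) \<bullet> c) a"
      by (rule swU_cong[OF c(1) module_U])
         (assumption | rule lin c | simp only: m_mult S_closed ev_closed m_closed U_simps(11) c)+
    also have "\<dots> = m (swU B (\<lambda>a1 a2. ev a1 \<star> S (ev a2)) a) \<bullet> c"
      by (rule swU_map[OF c(1) module_B module_U, symmetric]) (assumption | rule lin c)+
    also have "swU B (\<lambda>a1 a2. ev a1 \<star> S (ev a2)) a = swB B (\<lambda>x y. x \<star> S y) (ev a)"
      by (rule swB_ev[OF module_B c(1), symmetric]) (assumption | rule lin c)+
    also have "\<dots> = \<epsilon> (ev a) \<odot>\<^bsub>B\<^esub> \<one>\<^bsub>B\<^esub>"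
      by (rule swB_antipode_right) (rule ev_closed[OF c(1)])
    finally show "swU U (\<lambda>a1 a2. m (ev a1) \<bullet> (m (S (ev a2)) \<bullet> c)) a = \<epsilon> (ev a) \<odot>\<^bsub>U\<^esub> c"
      using c by (simp only: m_smult_one_mult \<epsilon>_closed ev_closed)
  qed (assumption | rule lin)+
  also have "\<dots> = z" by (rule swU_counit_left[OF module_U z module_hom_id])
  finally show ?thesis .
qed

text \<open>Here the sum is p(z3) S(p(z2)) z1: coassociativity pairs the last two legs, and the
  antipode law is needed for p of that pair.\<close>

lemma swU_ev_sec':
  assumes z: "z \<in> carrier U"
  shows "swU U (\<lambda>a c. m (ev c) \<bullet> sec' a) z = z"
proof -
  note lin = linS z
  have "swU U (\<lambda>a c. m (ev c) \<bullet> sec' a) z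
    = swU U (\<lambda>a c. swU U (\<lambda>a1 a2. m (ev c) \<bullet> (m (S (ev a2)) \<bullet> a1)) a) z"
  proof (rule swU_cong[OF z module_U])
    fix a c assume c: "a \<in> carrier U" "c \<in> carrier U"
    show "m (ev c) \<bullet> sec' a = swU U (\<lambda>a1 a2. m (ev c) \<bullet> (m (S (ev a2)) \<bullet> a1)) a"
      unfolding sec'_def by (rule swU_map[OF c(1) module_U module_U]) (assumption | rule lin c)+
  qed (assumption | rule lin)+
  also have "\<dots> = swU U (\<lambda>a c. swU U (\<lambda>c1 c2. m (ev c2) \<bullet> (m (S (ev c1)) \<bullet> a)) c) z"
    by (rule swU_coassoc[OF module_U z]) (assumption | rule lin)+
  also have "\<dots> = swU U (\<lambda>a c. \<epsilon> (ev c) \<odot>\<^bsub>U\<^esub> a) z"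
  proof (rule swU_cong[OF z module_U])
    fix a c assume c: "a \<in> carrier U" "c \<in> carrier U"
    have "swU U (\<lambda>c1 c2. m (ev c2) \<bullet> (m (S (ev c1)) \<bullet> a)) c
      = swU U (\<lambda>c1 c2. m (S (ev c1) \<star> ev c2) \<bullet> a) c"
    proof (rule swU_cong[OF c(2) module_U])
      fix x y assume d: "x \<in> carrier U" "y \<in> carrier U"
      \<comment> \<open>The factors occur in the wrong order for the antipode law; B being
        commutative, they may be exchanged.\<close>
      have "m (ev y) \<bullet> m (S (ev x)) = m (S (ev x)) \<bullet> m (ev y)"
        by (rule m_comm) (assumption | rule lin d)+
      then show "m (ev y) \<bullet> (m (S (ev x)) \<bullet> a) = m (S (ev x) \<star> ev y) \<bullet> a"
        using c d by (simp only: m_mult S_closed ev_closed m_closed U_simps(11)[symmetric])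
    qed (assumption | rule lin c)+
    also have "\<dots> = m (swU B (\<lambda>c1 c2. S (ev c1) \<star> ev c2) c) \<bullet> a"
      by (rule swU_map[OF c(2) module_B module_U, symmetric]) (assumption | rule lin c)+
    also have "swU B (\<lambda>c1 c2. S (ev c1) \<star> ev c2) c = swB B (\<lambda>x y. S x \<star> y) (ev c)"
      by (rule swB_ev[OF module_B c(2), symmetric]) (assumption | rule lin c)+
    also have "\<dots> = \<epsilon> (ev c) \<odot>\<^bsub>B\<^esub> \<one>\<^bsub>B\<^esub>"
      by (rule swB_antipode_left) (rule ev_closed[OF c(2)])
    finally show "swU U (\<lambda>c1 c2. m (ev c2) \<bullet> (m (S (ev c1)) \<bullet> a)) c = \<epsilon> (ev c) \<odot>\<^bsub>U\<^esub> a"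
      using c by (simp only: m_smult_one_mult \<epsilon>_closed ev_closed)
  qed (assumption | rule lin)+
  also have "\<dots> = z" by (rule swU_counit_right[OF module_U z module_hom_id])
  finally show ?thesis .
qed

text \<open>B-linearity of p gives S(p(z1)) p(z2), to which the antipode law applies. This makes the
  coordinate functionals of the freeness proof take scalar values on \<open>sec\<close>.\<close>

lemma ev_sec:
  assumes z: "z \<in> carrier U"
  shows "ev (sec z) = \<epsilon> (ev z) \<odot>\<^bsub>B\<^esub> \<one>\<^bsub>B\<^esub>"
proof -
  note lin = linS z
  have "ev (sec z) = swU B (\<lambda>a c. ev (m (S (ev a)) \<bullet> c)) z"
    unfolding sec_def by (rule swU_map[OF z module_U module_B _ ev_hom]) (assumption | rule lin)+
  also have "\<dots> = swU B (\<lambda>a c. S (ev a) \<star> ev c) z"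
    by (rule swU_cong[OF z module_B]) (assumption | rule lin | simp only: ev_m S_closed ev_closed)+
  also have "\<dots> = swB B (\<lambda>x y. S x \<star> y) (ev z)"
    by (rule swB_ev[OF module_B z, symmetric]) (assumption | rule lin)+
  also have "\<dots> = \<epsilon> (ev z) \<odot>\<^bsub>B\<^esub> \<one>\<^bsub>B\<^esub>"
    by (rule swB_antipode_left) (rule ev_closed[OF z])
  finally show ?thesis .
qed

lemma sec_one: "sec \<one>\<^bsub>U\<^esub> = \<one>\<^bsub>U\<^esub>" and sec'_one: "sec' \<one>\<^bsub>U\<^esub> = \<one>\<^bsub>U\<^esub>"
proof -
  have "S \<one>\<^bsub>B\<^esub> \<star> \<one>\<^bsub>B\<^esub> = swB B (\<lambda>x y. S x \<star> y) \<one>\<^bsub>B\<^esub>"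
    by (rule swB_one[OF module_B, symmetric]) (assumption | rule lin)+
  then have "S \<one>\<^bsub>B\<^esub> = \<one>\<^bsub>B\<^esub>"
    by (simp add: swB_antipode_left \<epsilon>_one S_closed B_simps)
  moreover have "sec \<one>\<^bsub>U\<^esub> = m (S (ev \<one>\<^bsub>U\<^esub>)) \<bullet> \<one>\<^bsub>U\<^esub>" "sec' \<one>\<^bsub>U\<^esub> = m (S (ev \<one>\<^bsub>U\<^esub>)) \<bullet> \<one>\<^bsub>U\<^esub>"
    unfolding sec_def sec'_def by (rule swU_one[OF module_U], (assumption | rule linE)+)+
  ultimately show "sec \<one>\<^bsub>U\<^esub> = \<one>\<^bsub>U\<^esub>" "sec' \<one>\<^bsub>U\<^esub> = \<one>\<^bsub>U\<^esub>" by (simp_all add: ev_one m_one U_simps)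
qed

text \<open>When the second leg sees B only through \<epsilon>, the sum of b1 \<epsilon>(b2) puts
  all of b on the first leg. For the test function a \<otimes> \<pi>(c) this is B-linearity of the
  right coaction.\<close>

lemma swU_m_aug:
  assumes X: "module K X" and \<beta>: "bilin K U U X \<beta>" and b: "b \<in> carrier B" and z: "z \<in> carrier U"
    and aug: "\<And>a b c. \<lbrakk>a \<in> carrier U; b \<in> carrier B; c \<in> carrier U\<rbrakk> \<Longrightarrow> \<beta> a (m b \<bullet> c) = \<epsilon> b \<odot>\<^bsub>X\<^esub> \<beta> a c"
  shows "swU X \<beta> (m b \<bullet> z) = swU X (\<lambda>v w. \<beta> (m b \<bullet> v) w) z"
proof -
  note lin = linS z b X bilin_comp_left[OF \<beta>] bilin_comp_right[OF \<beta>] bilin_mem[OF \<beta>] \<beta>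
  have "swU X \<beta> (m b \<bullet> z) = sw2 m m X \<beta> b z"
    by (rule swU_m[OF X \<beta> b z])
  also have "\<dots> = swB X (\<lambda>x y. \<epsilon> y \<odot>\<^bsub>X\<^esub> swU X (\<lambda>v w. \<beta> (m x \<bullet> v) w) z) b"
  proof (rule swB_cong[OF b X])
    fix x y assume d: "x \<in> carrier B" "y \<in> carrier B"
    have "swU X (\<lambda>v w. \<beta> (m x \<bullet> v) (m y \<bullet> w)) z = swU X (\<lambda>v w. \<epsilon> y \<odot>\<^bsub>X\<^esub> \<beta> (m x \<bullet> v) w) z"
      by (rule swU_cong[OF z X]) (assumption | rule lin d aug)+
    also have "\<dots> = \<epsilon> y \<odot>\<^bsub>X\<^esub> swU X (\<lambda>v w. \<beta> (m x \<bullet> v) w) z"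
      by (rule swU_map[OF z X X, symmetric]) (assumption | rule lin d)+
    finally show "swU X (\<lambda>v w. \<beta> (m x \<bullet> v) (m y \<bullet> w)) z = \<dots>" .
  qed (assumption | rule lin)+
  also have "\<dots> = swU X (\<lambda>v w. \<beta> (m b \<bullet> v) w) z"
    by (rule swB_counit_right[OF X _ b]) (assumption | rule lin)+
  finally show ?thesis .
qed

text \<open>This is colinearity of \<open>sec\<close> in Sweedler form: the factor S(p(z1)) moves
  entirely to the first leg by \<open>swU_m_aug\<close>, and coassociativity regroups the
  rest.\<close>

lemma swU_sec:
  assumes X: "module K X" and \<beta>: "bilin K U U X \<beta>" and z: "z \<in> carrier U"
    and aug: "\<And>a b c. \<lbrakk>a \<in> carrier U; b \<in> carrier B; c \<in> carrier U\<rbrakk> \<Longrightarrow> \<beta> a (m b \<bullet> c) = \<epsilon> b \<odot>\<^bsub>X\<^esub> \<beta> a c"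
  shows "swU X \<beta> (sec z) = swU X (\<lambda>a c. \<beta> (sec a) c) z"
proof -
  note lin = linS z X bilin_comp_left[OF \<beta>] bilin_comp_right[OF \<beta>] bilin_mem[OF \<beta>] \<beta>
  have "swU X \<beta> (sec z) = swU X (\<lambda>a c. swU X \<beta> (m (S (ev a)) \<bullet> c)) z"
    unfolding sec_def by (rule swU_map[OF z module_U X]) (assumption | rule lin)+
  also have "\<dots> = swU X (\<lambda>a c. swU X (\<lambda>v w. \<beta> (m (S (ev a)) \<bullet> v) w) c) z"
    by (rule swU_cong[OF z X]) (assumption | rule lin swU_m_aug[OF X \<beta> _ _ aug])+
  also have "\<dots> = swU X (\<lambda>a c. swU X (\<lambda>a1 a2. \<beta> (m (S (ev a1)) \<bullet> a2) c) a) z"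
    by (rule swU_coassoc[OF X z, symmetric]) (assumption | rule lin)+
  also have "\<dots> = swU X (\<lambda>a c. \<beta> (sec a) c) z"
  proof (rule swU_cong[OF z X])
    fix a c assume c: "a \<in> carrier U" "c \<in> carrier U"
    show "swU X (\<lambda>a1 a2. \<beta> (m (S (ev a1)) \<bullet> a2) c) a = \<beta> (sec a) c"
      unfolding sec_def by (rule swU_map[OF c(1) module_U X, symmetric]) (assumption | rule lin c)+
  qed (assumption | rule lin)+
  finally show ?thesis .
qed

section \<open>Coinvariants\<close>


abbreviation "aug \<equiv> env_aug K B bracket \<epsilon>"
abbreviation "Hb \<equiv> env_bar K B bracket \<epsilon>"
abbreviation "pr \<equiv> env_proj K B bracket \<epsilon>"

section \<open>The augmentation ideal and the quotient\<close>

lemma U_r_one: "z \<in> carrier U \<Longrightarrow> z \<bullet> \<one>\<^bsub>U\<^esub> = z"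
  by (rule monoid.r_one[OF ring.is_monoid[OF assoc_algebra.axioms(2)[OF assoc_algebra_U]]])

lemma aug_add: "\<lbrakk>v \<in> aug; w \<in> aug\<rbrakk> \<Longrightarrow> v \<oplus>\<^bsub>U\<^esub> w \<in> aug"
  unfolding env_aug_def by (rule ideal_prod.sum)

lemma aug_induct [consumes 1, case_names mult add]:
  assumes "w \<in> aug"
    and "\<And>z c. \<lbrakk>z \<in> carrier U; c \<in> carrier B; \<epsilon> c = \<zero>\<rbrakk> \<Longrightarrow> P (z \<bullet> m c)"
    and "\<And>v w. \<lbrakk>v \<in> aug; w \<in> aug; P v; P w\<rbrakk> \<Longrightarrow> P (v \<oplus>\<^bsub>U\<^esub> w)"
  shows "P w"
  using assms(1) unfolding env_aug_def
  by (induction rule: ideal_prod.induct) (use assms(2,3) in \<open>auto simp: env_aug_def\<close>)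

lemma aug_prod: "\<lbrakk>z \<in> carrier U; c \<in> carrier B; \<epsilon> c = \<zero>\<rbrakk> \<Longrightarrow> z \<bullet> m c \<in> aug"
  unfolding env_aug_def by (rule ideal_prod.prod) auto

lemma aug_closed: "w \<in> aug \<Longrightarrow> w \<in> carrier U"
  by (induction rule: aug_induct) (auto intro: U_simps m_closed)

lemma aug_left_mult:
  assumes "w \<in> aug" "u \<in> carrier U"
  shows "u \<bullet> w \<in> aug"
  using assms(1)
proof (induction rule: aug_induct)
  case (mult z c)
  then have "u \<bullet> z \<bullet> m c \<in> aug" using assms(2) by (intro aug_prod U_simps)
  then show ?case using mult assms(2) by (simp only: U_simps(11) m_closed)
next
  case (add v w)
  then show ?case using assms(2) by (simp only: U_simps(23) aug_closed aug_add)
qed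

lemma submodule_aug: "submodule K aug U"
proof (rule submodule.intro[OF module_U])
  show "aug \<subseteq> carrier U" using aug_closed by auto
  have "\<epsilon> \<zero>\<^bsub>B\<^esub> = \<zero>"
    using module_hom_zero[OF module_B module_scalar counit_linear] by (simp add: scalar_algebra_simps)
  then have "\<zero>\<^bsub>U\<^esub> \<bullet> m \<zero>\<^bsub>B\<^esub> \<in> aug" by (intro aug_prod U_simps B_simps)
  then show "\<zero>\<^bsub>U\<^esub> \<in> aug" by (simp only: U_simps(24) m_closed B_simps(2))
  fix c w assume c: "c \<in> carrier K" "w \<in> aug"
  then have "(c \<odot>\<^bsub>U\<^esub> \<one>\<^bsub>U\<^esub>) \<bullet> w \<in> aug"
    by (intro aug_left_mult module.smult_closed[OF module_U] U_simps)
  then show "c \<odot>\<^bsub>U\<^esub> w \<in> aug"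
    using c by (simp only: U_smult_mult U_simps(6,12) aug_closed)
qed (rule aug_add)

text \<open>The factor \<open>m c\<close> moves to the right through the letters of y. Passing
  \<open>h b\<close> leaves the extra term \<open>m (bracket c b)\<close>, with the bracket again in
  B^+ by \<open>\<epsilon>_bracket\<close>; therefore c varies in the induction.\<close>

lemma aug_m:
  assumes "y \<in> carrier U" "c \<in> carrier B" "\<epsilon> c = \<zero>"
  shows "m c \<bullet> y \<in> aug"
  using assms
proof (induction arbitrary: c rule: U_induct)
  case (one c)
  then have "\<one>\<^bsub>U\<^esub> \<bullet> m c \<in> aug" by (intro aug_prod U_simps)
  then show ?case using one by (simp only: U_simps(12) U_r_one m_closed)
next
  case (add x y c)
  then show ?case by (simp only: U_simps(23) m_closed aug_add)
next
  case (smult r x c)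
  then show ?case by (simp only: U_smult_mult m_closed submodule.smult_closed[OF submodule_aug])
next
  case (m b x c)
  have "m c \<bullet> (m b \<bullet> x) = m c \<bullet> m b \<bullet> x" using m by (simp only: U_simps(11) m_closed)
  also have "\<dots> = m b \<bullet> (m c \<bullet> x)"
    using m by (simp only: m_comm[of c b] U_simps(11) m_closed)
  finally show ?case using m by (simp only: aug_left_mult m_closed)
next
  case (h b x c)
  have "m c \<bullet> (h b \<bullet> x) = m c \<bullet> h b \<bullet> x" using h by (simp only: U_simps(11) m_closed h_closed)
  also have "\<dots> = h b \<bullet> (m c \<bullet> x) \<oplus>\<^bsub>U\<^esub> m (bracket c b) \<bullet> x"
    using h by (simp only: m_h_comm[of c b] U_simps(5,11,13) m_closed h_closed bracket_closed)
  finally show ?case using h by (simp only: aug_left_mult h_closed aug_add bracket_closed \<epsilon>_bracket)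
qed

text \<open>
  The values of \<open>f\<close> are only controlled on \<open>B\<^sup>+B\<^sup>e\<close>, so the proof shows that this contains \<open>B\<^sup>eB\<^sup>+\<close>.
\<close>

lemma aug_vanish:
  assumes X: "module K X" and f: "f \<in> module_hom K U X" and w: "w \<in> aug"
    and 0: "\<And>c y. \<lbrakk>c \<in> carrier B; y \<in> carrier U\<rbrakk> \<Longrightarrow> f (m c \<bullet> y) = \<epsilon> c \<odot>\<^bsub>X\<^esub> f y"
  shows "f w = \<zero>\<^bsub>X\<^esub>"
proof -
  interpret X: module K X by (rule X)
  let ?B = "m ` {b \<in> carrier B. \<epsilon> b = \<zero>}"
  \<comment> \<open>N is B^+ B^e, with the factors in the order opposite to \<open>aug\<close>; f
    vanishes on its generating products by the hypothesis \<open>0\<close>.\<close>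
  define N where "N = ?B \<cdot>\<^bsub>U\<^esub> carrier U"
  have N_prod: "m c \<bullet> y \<in> N" if "c \<in> carrier B" "\<epsilon> c = \<zero>" "y \<in> carrier U" for c y
    unfolding N_def by (rule ideal_prod.prod) (use that in auto)
  have N_add: "v \<oplus>\<^bsub>U\<^esub> w \<in> N" if "v \<in> N" "w \<in> N" for v w
    using that unfolding N_def by (rule ideal_prod.sum)
  have N_induct: "P n" if n: "n \<in> N" and "\<And>c y. \<lbrakk>c \<in> carrier B; \<epsilon> c = \<zero>; y \<in> carrier U\<rbrakk> \<Longrightarrow> P (m c \<bullet> y)"
    "\<And>v w. \<lbrakk>v \<in> N; w \<in> N; P v; P w\<rbrakk> \<Longrightarrow> P (v \<oplus>\<^bsub>U\<^esub> w)" for P n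
    using n unfolding N_def by (induction rule: ideal_prod.induct) (use that(2,3) in \<open>auto simp: N_def\<close>)
  have N_closed: "n \<in> carrier U" if "n \<in> N" for n
    using that by (rule N_induct) (auto intro: U_simps m_closed)
  have N_m: "m a \<bullet> n \<in> N" if n: "n \<in> N" and a: "a \<in> carrier B" for a n
    using n
  proof (rule N_induct)
    fix c y assume c: "c \<in> carrier B" "\<epsilon> c = \<zero>" "y \<in> carrier U"
    have "m a \<bullet> (m c \<bullet> y) = m a \<bullet> m c \<bullet> y" using c a by (simp only: U_simps(11) m_closed)
    also have "\<dots> = m c \<bullet> (m a \<bullet> y)" using c a by (simp only: m_comm[of a c] U_simps(11) m_closed)
    finally show "m a \<bullet> (m c \<bullet> y) \<in> N" using c a by (simp only: N_prod U_simps(5) m_closed)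
  qed (simp only: U_simps(23) m_closed a N_closed N_add)
  have N_h: "h a \<bullet> n \<in> N" if n: "n \<in> N" and a: "a \<in> carrier B" for a n
    using n
  proof (rule N_induct)
    fix c y assume c: "c \<in> carrier B" "\<epsilon> c = \<zero>" "y \<in> carrier U"
    have "h a \<bullet> (m c \<bullet> y) = h a \<bullet> m c \<bullet> y" using c a by (simp only: U_simps(11) m_closed h_closed)
    also have "\<dots> = m c \<bullet> (h a \<bullet> y) \<oplus>\<^bsub>U\<^esub> m (bracket a c) \<bullet> y"
      using c a by (simp only: h_m_comm[of a c] U_simps(5,11,13) m_closed h_closed bracket_closed)
    finally show "h a \<bullet> (m c \<bullet> y) \<in> N"
      using c a by (simp only: N_prod N_add U_simps(5) m_closed h_closed bracket_closed \<epsilon>_bracket)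
  qed (simp only: U_simps(23) h_closed a N_closed N_add)
  have N_smult: "r \<odot>\<^bsub>U\<^esub> n \<in> N" if n: "n \<in> N" and r: "r \<in> carrier K" for r n
    using n
  proof (rule N_induct)
    fix c y assume c: "c \<in> carrier B" "\<epsilon> c = \<zero>" "y \<in> carrier U"
    have "m c \<bullet> (r \<odot>\<^bsub>U\<^esub> y) \<in> N" using c r by (intro N_prod module.smult_closed[OF module_U])
    then show "r \<odot>\<^bsub>U\<^esub> (m c \<bullet> y) \<in> N" using c r by (simp only: U_smult_mult m_closed)
  qed (simp only: module.smult_r_distr[OF module_U] r N_closed N_add)
  \<comment> \<open>For z = 1 the product is \<open>m c\<close> itself, an element of N, and N is
    stable under left multiplication by the generators.\<close>
  have zc: "z \<bullet> m c \<in> N" if "z \<in> carrier U" and c: "c \<in> carrier B" "\<epsilon> c = \<zero>" for z c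
    using that(1)
  proof (induction rule: U_induct)
    case one
    have "m c \<bullet> \<one>\<^bsub>U\<^esub> \<in> N" using c by (intro N_prod U_simps)
    then show ?case using c by (simp only: U_simps(12) U_r_one m_closed)
  qed (simp_all only: U_simps(11,13) U_smult_mult m_closed h_closed c N_add N_m N_h N_smult)
  have "w \<in> N"
    using w by (induction rule: aug_induct) (simp_all only: zc N_add)
  then show ?thesis
  proof (rule N_induct)
    fix c y assume c: "c \<in> carrier B" "\<epsilon> c = \<zero>" "y \<in> carrier U"
    then show "f (m c \<bullet> y) = \<zero>\<^bsub>X\<^esub>" using module_hom_mem[OF f c(3)] by (simp add: 0)
  next
    fix v w assume "v \<in> N" "w \<in> N" "f v = \<zero>\<^bsub>X\<^esub>" "f w = \<zero>\<^bsub>X\<^esub>"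
    then show "f (v \<oplus>\<^bsub>U\<^esub> w) = \<zero>\<^bsub>X\<^esub>" by (simp add: module_hom_add[OF f] N_closed)
  qed
qed

sublocale H: quotient_space K U aug
  by (intro quotient_space.intro module_U submodule_aug)

lemma pr_eq: "pr z = H.proj z"
  by (simp add: env_proj_def)

lemma module_Hb: "module K Hb"
  unfolding env_bar_def by (rule H.module_Q)

lemma pr_hom: "pr \<in> module_hom K U Hb"
  unfolding pr_eq env_bar_def by (rule H.proj_hom)

lemma pr_closed: "z \<in> carrier U \<Longrightarrow> pr z \<in> carrier Hb"
  by (rule module_hom_mem[OF pr_hom])

lemma Hb_cases:
  assumes "Z \<in> carrier Hb"
  obtains z where "z \<in> carrier U" "Z = pr z"
  using assms unfolding env_bar_def pr_eq H.carrier_Q by auto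

lemma pr_one: "\<one>\<^bsub>Hb\<^esub> = pr \<one>\<^bsub>U\<^esub>"
  by (simp add: env_bar_def quot_algebra_simps pr_eq)

text \<open>The element b - \<epsilon>(b) 1 lies in B^+, so the two arguments of the projection
  differ by an element of \<open>aug\<close>, by \<open>aug_m\<close>.\<close>

lemma pr_m:
  assumes b: "b \<in> carrier B" and z: "z \<in> carrier U"
  shows "pr (m b \<bullet> z) = \<epsilon> b \<odot>\<^bsub>Hb\<^esub> pr z"
proof -
  let ?c = "b \<ominus>\<^bsub>B\<^esub> \<epsilon> b \<odot>\<^bsub>B\<^esub> \<one>\<^bsub>B\<^esub>"
  have e: "\<epsilon> b \<in> carrier K" "\<epsilon> b \<odot>\<^bsub>B\<^esub> \<one>\<^bsub>B\<^esub> \<in> carrier B" by (assumption | rule lin b)+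
  have "\<epsilon> (\<epsilon> b \<odot>\<^bsub>B\<^esub> \<one>\<^bsub>B\<^esub>) = \<epsilon> b"
    using module_hom_smult[OF counit_linear e(1) B_simps(6)] e by (simp add: scalar_algebra_simps \<epsilon>_one K_simps)
  then have "\<epsilon> ?c = \<zero>"
    using module_hom_minus[OF module_B module_scalar counit_linear b e(2)] e
      abelian_group.minus_self[OF module.axioms(2)[OF module_scalar], of "\<epsilon> b"]
    by (simp add: scalar_algebra_simps)
  moreover have c: "?c \<in> carrier B" using b e by (simp only: B_simps)
  ultimately have "m ?c \<bullet> z \<in> aug" using z by (intro aug_m)
  moreover have "m ?c \<bullet> z = m b \<bullet> z \<ominus>\<^bsub>U\<^esub> \<epsilon> b \<odot>\<^bsub>U\<^esub> z"
  proof -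
    have "(\<lambda>b. m b \<bullet> z) \<in> module_hom K B U" by (assumption | rule lin z)+
    from module_hom_minus[OF module_B module_U this b e(2)] show ?thesis
      by (simp only: m_smult_one_mult e z)
  qed
  ultimately have "H.proj (m b \<bullet> z) = H.proj (\<epsilon> b \<odot>\<^bsub>U\<^esub> z)"
    using H.proj_eq_iff[of "m b \<bullet> z" "\<epsilon> b \<odot>\<^bsub>U\<^esub> z"] b z e by (simp only: U_simps(5) m_closed module.smult_closed[OF module_U])
  then show ?thesis unfolding pr_eq env_bar_def H.Q_smult[OF e(1) z] .
qed

text \<open>
  The choice of a representative does not matter, since \<open>sec\<close> and \<open>sec'\<close> vanish on \<open>B\<^sup>eB\<^sup>+\<close>.
\<close>

definition "secH Z = sec (SOME z. z \<in> Z)"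
definition "secH' Z = sec' (SOME z. z \<in> Z)"

lemma secH_pr: "z \<in> carrier U \<Longrightarrow> secH (pr z) = sec z"
  unfolding secH_def pr_eq
  by (rule H.hom_some_mem[OF module_U sec_hom aug_vanish[OF module_U sec_hom _ sec_m]])

lemma secH'_pr: "z \<in> carrier U \<Longrightarrow> secH' (pr z) = sec' z"
  unfolding secH'_def pr_eq
  by (rule H.hom_some_mem[OF module_U sec'_hom aug_vanish[OF module_U sec'_hom _ sec'_m]])

lemma secH_hom: "secH \<in> module_hom K Hb U"
  unfolding env_bar_def by (rule H.hom_from_Q[OF sec_hom secH_pr[unfolded pr_eq]])

lemma secH'_hom: "secH' \<in> module_hom K Hb U"
  unfolding env_bar_def by (rule H.hom_from_Q[OF sec'_hom secH'_pr[unfolded pr_eq]])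

section \<open>The right coaction and recovery of an element from its coaction\<close>

abbreviation "rho \<equiv> env_right_coaction K B bracket \<Delta> \<epsilon>"
abbreviation "TH \<equiv> tensor K U Hb"

lemma rho_eq: "rho z = swU TH (\<lambda>a c. pure K U Hb a (pr c)) z"
  by (simp add: env_right_coaction_def tensor_map_def swU_def)

lemmas linH = linS module_Hb module_hom_comp[OF pr_hom] pr_closed module_hom_comp[OF secH_hom]
  module_hom_comp[OF secH'_hom] module_hom_mem[OF secH_hom] module_hom_mem[OF secH'_hom]

lemma rho_hom: "rho \<in> module_hom K U TH"
  unfolding rho_eq by (assumption | rule linH)+

lemma two_modules_UH: "two_modules K U Hb" and two_modules_HU: "two_modules K Hb U"
  by (rule two_modules.intro module_U module_Hb)+

lemma tensor_lift_rho:
  assumes X: "module K X" and z: "z \<in> carrier U" and \<beta>: "bilin K U Hb X \<beta>"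
  shows "tensor_lift K X \<beta> (rho z) = swU X (\<lambda>a c. \<beta> a (pr c)) z"
proof -
  note lin = linH X bilin_comp_left[OF \<beta>] bilin_comp_right[OF \<beta>] bilin_mem[OF \<beta>]
  have "tensor_lift K X \<beta> (rho z) = swU X (\<lambda>a c. tensor_lift K X \<beta> (pure K U Hb a (pr c))) z"
    unfolding rho_eq
    by (rule swU_map[OF z _ X _ two_modules.tensor_lift_hom[OF two_modules_UH X \<beta>]]) (assumption | rule lin)+
  also have "\<dots> = swU X (\<lambda>a c. \<beta> a (pr c)) z"
  proof (rule swU_cong[OF z X, symmetric])
    fix a c assume "a \<in> carrier U" "c \<in> carrier U"
    then show "\<beta> a (pr c) = tensor_lift K X \<beta> (pure K U Hb a (pr c))"
      by (intro two_modules.tensor_lift_pure[OF two_modules_UH X \<beta>, symmetric] pr_closed)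
  qed (assumption | rule lin)+
  finally show ?thesis .
qed

lemma m_times_secH_bilin: "bilin K U Hb U (\<lambda>a Z. m (ev a) \<bullet> secH Z)"
  and m_times_secH'_bilin: "bilin K Hb U U (\<lambda>Z a. m (ev a) \<bullet> secH' Z)"
  by (assumption | rule linH)+

text \<open>The identity of \<open>swU_ev_sec\<close> factors through \<pi> on the second leg, so z
  can be reconstructed from its coaction alone. Both the right coinvariants and injectivity rely on
  this.\<close>

lemma tensor_lift_secH_rho:
  assumes z: "z \<in> carrier U"
  shows "tensor_lift K U (\<lambda>a Z. m (ev a) \<bullet> secH Z) (rho z) = z"
proof -
  have "tensor_lift K U (\<lambda>a Z. m (ev a) \<bullet> secH Z) (rho z) = swU U (\<lambda>a c. m (ev a) \<bullet> secH (pr c)) z"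
    by (rule tensor_lift_rho[OF module_U z m_times_secH_bilin])
  also have "\<dots> = swU U (\<lambda>a c. m (ev a) \<bullet> sec c) z"
    by (rule swU_cong[OF z module_U]) (assumption | rule linH | simp only: secH_pr)+
  finally show ?thesis by (simp only: swU_ev_sec[OF z])
qed

lemma m_eq_m_one: "b \<in> carrier B \<Longrightarrow> m b = m b \<bullet> \<one>\<^bsub>U\<^esub>"
  by (simp only: U_r_one m_closed)

lemma swU_of_m:
  assumes X: "module K X" and \<beta>: "bilin K U U X \<beta>" and b: "b \<in> carrier B"
  shows "swU X \<beta> (m b) = swB X (\<lambda>x y. \<beta> (m x) (m y)) b"
proof -
  note lin = linH X bilin_comp_left[OF \<beta>] bilin_comp_right[OF \<beta>] bilin_mem[OF \<beta>] b
  have "swU X \<beta> (m b) = sw2 m m X \<beta> b \<one>\<^bsub>U\<^esub>"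
    by (subst m_eq_m_one[OF b]) (rule swU_m[OF X \<beta> b U_simps(6)])
  also have "\<dots> = swB X (\<lambda>x y. \<beta> (m x) (m y)) b"
  proof (rule swB_cong[OF b X])
    fix x y assume c: "x \<in> carrier B" "y \<in> carrier B"
    have "swU X (\<lambda>v w. \<beta> (m x \<bullet> v) (m y \<bullet> w)) \<one>\<^bsub>U\<^esub> = \<beta> (m x \<bullet> \<one>\<^bsub>U\<^esub>) (m y \<bullet> \<one>\<^bsub>U\<^esub>)"
      by (rule swU_one[OF X]) (assumption | rule lin c)+
    then show "swU X (\<lambda>v w. \<beta> (m x \<bullet> v) (m y \<bullet> w)) \<one>\<^bsub>U\<^esub> = \<beta> (m x) (m y)"
      using c by (simp only: m_eq_m_one[symmetric])
  qed (assumption | rule lin)+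
  finally show ?thesis .
qed

lemma pr_m': "b \<in> carrier B \<Longrightarrow> pr (m b) = \<epsilon> b \<odot>\<^bsub>Hb\<^esub> \<one>\<^bsub>Hb\<^esub>"
  using pr_m[OF _ U_simps(6)] by (simp only: m_eq_m_one[symmetric] pr_one)

lemma Hb_one_closed: "\<one>\<^bsub>Hb\<^esub> \<in> carrier Hb"
  unfolding pr_one by (rule pr_closed[OF U_simps(6)])

lemma right_coinvariants_eq: "right_coinvariants K B bracket \<Delta> \<epsilon> = m ` carrier B"
proof
  show "right_coinvariants K B bracket \<Delta> \<epsilon> \<subseteq> m ` carrier B"
  proof
    fix z assume "z \<in> right_coinvariants K B bracket \<Delta> \<epsilon>"
    then have z: "z \<in> carrier U" and eq: "rho z = pure K U Hb z \<one>\<^bsub>Hb\<^esub>"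
      by (simp_all add: right_coinvariants_def Let_def)
    have "z = tensor_lift K U (\<lambda>a Z. m (ev a) \<bullet> secH Z) (pure K U Hb z \<one>\<^bsub>Hb\<^esub>)"
      using tensor_lift_secH_rho[OF z] by (simp only: eq)
    also have "\<dots> = m (ev z) \<bullet> secH \<one>\<^bsub>Hb\<^esub>"
      by (rule two_modules.tensor_lift_pure[OF two_modules_UH module_U m_times_secH_bilin z Hb_one_closed])
    also have "\<dots> = m (ev z)"
      using z by (simp only: pr_one secH_pr U_simps(6) sec_one m_eq_m_one[symmetric] ev_closed)
    finally show "z \<in> m ` carrier B" using ev_closed[OF z] by blast
  qed
  show "m ` carrier B \<subseteq> right_coinvariants K B bracket \<Delta> \<epsilon>"
  proof
    fix z assume "z \<in> m ` carrier B"
    then obtain b where b: "b \<in> carrier B" "z = m b" by blast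
    \<comment> \<open>For the reverse inclusion the second leg of \<Delta>(b) becomes \<epsilon>(b2)
      in the quotient, and the counit law of B collapses the sum.\<close>
    have "rho (m b) = swB TH (\<lambda>x y. pure K U Hb (m x) (pr (m y))) b"
      unfolding rho_eq by (rule swU_of_m[OF _ _ b(1)]) (assumption | rule linH)+
    also have "\<dots> = swB TH (\<lambda>x y. \<epsilon> y \<odot>\<^bsub>TH\<^esub> pure K U Hb (m x) \<one>\<^bsub>Hb\<^esub>) b"
    proof (rule swB_cong[OF b(1)])
      fix x y assume c: "x \<in> carrier B" "y \<in> carrier B"
      show "pure K U Hb (m x) (pr (m y)) = \<epsilon> y \<odot>\<^bsub>TH\<^esub> pure K U Hb (m x) \<one>\<^bsub>Hb\<^esub>"
        unfolding pr_m'[OF c(2)]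
        by (rule module_hom_smult[OF bilin_right[OF two_modules.pure_bilin[OF two_modules_UH]]])
           (assumption | rule linH c Hb_one_closed)+
    qed (assumption | rule linH)+
    also have "\<dots> = pure K U Hb (m b) \<one>\<^bsub>Hb\<^esub>"
      by (rule swB_counit_right[OF _ _ b(1)]) (assumption | rule linH Hb_one_closed)+
    finally show "z \<in> right_coinvariants K B bracket \<Delta> \<epsilon>"
      using b by (simp add: right_coinvariants_def Let_def m_closed)
  qed
qed

lemma left_coaction_eq:
  "env_left_coaction K B bracket \<Delta> \<epsilon> z = swU (tensor K Hb U) (\<lambda>a c. pure K Hb U (pr a) c) z"
  by (simp add: env_left_coaction_def tensor_map_def swU_def)

lemma left_coinvariants_eq: "left_coinvariants K B bracket \<Delta> \<epsilon> = m ` carrier B"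
proof
  let ?T = "tensor K Hb U"
  \<comment> \<open>The roles of the legs are exchanged: the first one lies in the quotient and
    feeds \<open>secH'\<close>, the second one feeds \<open>ev\<close>.\<close>
  let ?L = "tensor_lift K U (\<lambda>Z a. m (ev a) \<bullet> secH' Z)"
  have L: "?L \<in> module_hom K ?T U"
    by (rule two_modules.tensor_lift_hom[OF two_modules_HU module_U m_times_secH'_bilin])
  show "left_coinvariants K B bracket \<Delta> \<epsilon> \<subseteq> m ` carrier B"
  proof
    fix z assume "z \<in> left_coinvariants K B bracket \<Delta> \<epsilon>"
    then have z: "z \<in> carrier U"
      and eq: "swU ?T (\<lambda>a c. pure K Hb U (pr a) c) z = pure K Hb U \<one>\<^bsub>Hb\<^esub> z"
      by (simp_all add: left_coinvariants_def Let_def left_coaction_eq)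
    have "z = swU U (\<lambda>a c. m (ev c) \<bullet> sec' a) z" by (rule swU_ev_sec'[OF z, symmetric])
    also have "\<dots> = swU U (\<lambda>a c. ?L (pure K Hb U (pr a) c)) z"
    proof (rule swU_cong[OF z module_U])
      fix a c assume c: "a \<in> carrier U" "c \<in> carrier U"
      show "m (ev c) \<bullet> sec' a = ?L (pure K Hb U (pr a) c)"
        using two_modules.tensor_lift_pure[OF two_modules_HU module_U m_times_secH'_bilin pr_closed[OF c(1)] c(2)] c
        by (simp only: secH'_pr)
    qed (assumption | rule linH)+
    also have "\<dots> = ?L (swU ?T (\<lambda>a c. pure K Hb U (pr a) c) z)"
      by (rule swU_map[OF z _ module_U _ L, symmetric]) (assumption | rule linH)+
    also have "\<dots> = m (ev z) \<bullet> secH' \<one>\<^bsub>Hb\<^esub>"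
      unfolding eq
      by (rule two_modules.tensor_lift_pure[OF two_modules_HU module_U m_times_secH'_bilin Hb_one_closed z])
    also have "\<dots> = m (ev z)"
      using z by (simp only: pr_one secH'_pr U_simps(6) sec'_one m_eq_m_one[symmetric] ev_closed)
    finally show "z \<in> m ` carrier B" using ev_closed[OF z] by blast
  qed
  show "m ` carrier B \<subseteq> left_coinvariants K B bracket \<Delta> \<epsilon>"
  proof
    fix z assume "z \<in> m ` carrier B"
    then obtain b where b: "b \<in> carrier B" "z = m b" by blast
    have "env_left_coaction K B bracket \<Delta> \<epsilon> (m b) = swB ?T (\<lambda>x y. pure K Hb U (pr (m x)) (m y)) b"
      unfolding left_coaction_eq by (rule swU_of_m[OF _ _ b(1)]) (assumption | rule linH)+
    also have "\<dots> = swB ?T (\<lambda>x y. \<epsilon> x \<odot>\<^bsub>?T\<^esub> pure K Hb U \<one>\<^bsub>Hb\<^esub> (m y)) b"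
    proof (rule swB_cong[OF b(1)])
      fix x y assume c: "x \<in> carrier B" "y \<in> carrier B"
      show "pure K Hb U (pr (m x)) (m y) = \<epsilon> x \<odot>\<^bsub>?T\<^esub> pure K Hb U \<one>\<^bsub>Hb\<^esub> (m y)"
        unfolding pr_m'[OF c(1)]
        by (rule module_hom_smult[OF bilin_left[OF two_modules.pure_bilin[OF two_modules_HU]]])
           (assumption | rule linH c Hb_one_closed)+
    qed (assumption | rule linH)+
    also have "\<dots> = pure K Hb U \<one>\<^bsub>Hb\<^esub> (m b)"
      by (rule swB_counit_left[OF _ _ b(1)]) (assumption | rule linH Hb_one_closed)+
    finally show "z \<in> left_coinvariants K B bracket \<Delta> \<epsilon>"
      using b by (simp add: left_coinvariants_def Let_def m_closed)
  qed
qed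

section \<open>The coaction\<close>


abbreviation "\<Delta>H \<equiv> env_bar_comul K B bracket \<Delta> \<epsilon>"
abbreviation "\<epsilon>H \<equiv> env_bar_counit K \<epsilon>"
abbreviation "THH \<equiv> tensor K Hb Hb"

text \<open>If both legs see B only through \<epsilon>, then so does the whole sum. With
  \<open>aug_vanish\<close> this makes the coproduct of the quotient well defined.\<close>

lemma swU_m_aug2:
  assumes X: "module K X" and \<beta>: "bilin K U U X \<beta>" and b: "b \<in> carrier B" and z: "z \<in> carrier U"
    and aug1: "\<And>a b c. \<lbrakk>a \<in> carrier U; b \<in> carrier B; c \<in> carrier U\<rbrakk> \<Longrightarrow> \<beta> (m b \<bullet> a) c = \<epsilon> b \<odot>\<^bsub>X\<^esub> \<beta> a c"
    and aug2: "\<And>a b c. \<lbrakk>a \<in> carrier U; b \<in> carrier B; c \<in> carrier U\<rbrakk> \<Longrightarrow> \<beta> a (m b \<bullet> c) = \<epsilon> b \<odot>\<^bsub>X\<^esub> \<beta> a c"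
  shows "swU X \<beta> (m b \<bullet> z) = \<epsilon> b \<odot>\<^bsub>X\<^esub> swU X \<beta> z"
proof -
  note lin = linS z b X bilin_comp_left[OF \<beta>] bilin_comp_right[OF \<beta>] bilin_mem[OF \<beta>] \<beta>
  have "swU X \<beta> (m b \<bullet> z) = swU X (\<lambda>v w. \<beta> (m b \<bullet> v) w) z"
    by (rule swU_m_aug[OF X \<beta> b z aug2])
  also have "\<dots> = swU X (\<lambda>v w. \<epsilon> b \<odot>\<^bsub>X\<^esub> \<beta> v w) z"
    by (rule swU_cong[OF z X]) (assumption | rule lin aug1)+
  also have "\<dots> = \<epsilon> b \<odot>\<^bsub>X\<^esub> swU X \<beta> z"
    by (rule swU_map[OF z X X, symmetric]) (assumption | rule lin)+
  finally show ?thesis .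
qed

lemma \<Delta>H_rep_hom: "(\<lambda>z. tensor_map K Hb Hb pr pr (env_comul K B bracket \<Delta> z)) \<in> module_hom K U THH"
  and \<Delta>H_rep_m: "\<lbrakk>b \<in> carrier B; z \<in> carrier U\<rbrakk> \<Longrightarrow>
    tensor_map K Hb Hb pr pr (env_comul K B bracket \<Delta> (m b \<bullet> z))
      = \<epsilon> b \<odot>\<^bsub>THH\<^esub> tensor_map K Hb Hb pr pr (env_comul K B bracket \<Delta> z)"
proof -
  have eq: "tensor_map K Hb Hb pr pr (env_comul K B bracket \<Delta> z) = swU THH (\<lambda>a c. pure K Hb Hb (pr a) (pr c)) z" for z
    by (simp add: tensor_map_def swU_def)
  show "(\<lambda>z. tensor_map K Hb Hb pr pr (env_comul K B bracket \<Delta> z)) \<in> module_hom K U THH"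
    unfolding eq by (assumption | rule linH)+
  note bil = two_modules.pure_bilin[OF two_modules.intro[OF module_Hb module_Hb]]
  show "tensor_map K Hb Hb pr pr (env_comul K B bracket \<Delta> (m b \<bullet> z))
      = \<epsilon> b \<odot>\<^bsub>THH\<^esub> tensor_map K Hb Hb pr pr (env_comul K B bracket \<Delta> z)"
    if "b \<in> carrier B" "z \<in> carrier U"
    unfolding eq
  proof (rule swU_m_aug2[OF _ _ that])
    fix a b c assume c: "a \<in> carrier U" "b \<in> carrier B" "c \<in> carrier U"
    show "pure K Hb Hb (pr (m b \<bullet> a)) (pr c) = \<epsilon> b \<odot>\<^bsub>THH\<^esub> pure K Hb Hb (pr a) (pr c)"
      unfolding pr_m[OF c(2,1)]
      by (rule module_hom_smult[OF bilin_left[OF bil]]) (assumption | rule linH c)+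
    show "pure K Hb Hb (pr a) (pr (m b \<bullet> c)) = \<epsilon> b \<odot>\<^bsub>THH\<^esub> pure K Hb Hb (pr a) (pr c)"
      unfolding pr_m[OF c(2,3)]
      by (rule module_hom_smult[OF bilin_right[OF bil]]) (assumption | rule linH c)+
  qed (assumption | rule linH)+
qed

text \<open>On representatives the map is \<epsilon>-linear over B by
  \<open>\<Delta>H_rep_m\<close>, hence vanishes on \<open>aug\<close>, and the chosen
  representative may be replaced by z.\<close>

lemma \<Delta>H_pr:
  assumes "z \<in> carrier U"
  shows "\<Delta>H (pr z) = swU THH (\<lambda>a c. pure K Hb Hb (pr a) (pr c)) z"
proof -
  have "\<Delta>H (pr z) = tensor_map K Hb Hb pr pr (env_comul K B bracket \<Delta> z)"
    unfolding env_bar_comul_def Let_def pr_eq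
    by (rule H.hom_some_mem[OF _ \<Delta>H_rep_hom[unfolded pr_eq] aug_vanish[OF _ \<Delta>H_rep_hom[unfolded pr_eq] _
        \<Delta>H_rep_m[unfolded pr_eq]] assms]) (assumption | rule linH)+
  then show ?thesis by (simp add: tensor_map_def swU_def)
qed

lemma \<Delta>H_hom: "\<Delta>H \<in> module_hom K Hb THH"
proof -
  have "(\<lambda>z. swU THH (\<lambda>a c. pure K Hb Hb (pr a) (pr c)) z) \<in> module_hom K U THH"
    by (assumption | rule linH)+
  then have "\<Delta>H \<in> module_hom K H.Q THH"
    by (rule H.hom_from_Q) (simp only: \<Delta>H_pr pr_eq[symmetric])
  then show ?thesis by (simp only: env_bar_def)
qed

lemma tensor_lift_\<Delta>H:
  assumes X: "module K X" and z: "z \<in> carrier U" and \<beta>: "bilin K Hb Hb X \<beta>"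
  shows "tensor_lift K X \<beta> (\<Delta>H (pr z)) = swU X (\<lambda>a c. \<beta> (pr a) (pr c)) z"
proof -
  note two = two_modules.intro[OF module_Hb module_Hb]
  note lin = linH X bilin_comp_left[OF \<beta>] bilin_comp_right[OF \<beta>] bilin_mem[OF \<beta>]
  have "tensor_lift K X \<beta> (\<Delta>H (pr z)) = swU X (\<lambda>a c. tensor_lift K X \<beta> (pure K Hb Hb (pr a) (pr c))) z"
    unfolding \<Delta>H_pr[OF z]
    by (rule swU_map[OF z _ X _ two_modules.tensor_lift_hom[OF two X \<beta>]]) (assumption | rule lin)+
  also have "\<dots> = swU X (\<lambda>a c. \<beta> (pr a) (pr c)) z"
  proof (rule swU_cong[OF z X, symmetric])
    fix a c assume "a \<in> carrier U" "c \<in> carrier U"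
    then show "\<beta> (pr a) (pr c) = tensor_lift K X \<beta> (pure K Hb Hb (pr a) (pr c))"
      by (intro two_modules.tensor_lift_pure[OF two X \<beta>, symmetric] pr_closed)
  qed (assumption | rule lin)+
  finally show ?thesis .
qed

lemma assoc_algebra_scalar: "assoc_algebra K (scalar_algebra K)"
proof -
  have "ring (scalar_algebra K)"
    by (rule ringI[OF module.axioms(2)[OF module_scalar] monoidI])
       (simp_all add: scalar_algebra_simps K_simps monoid.r_one[OF ring.is_monoid[OF cring.axioms(1)[OF R_cring]]])
  then show ?thesis
    by (intro assoc_algebra.intro assoc_algebra_axioms.intro module_scalar)
       (simp_all add: scalar_algebra_simps K_simps)
qed

text \<open>Since \<open>h\<close> is sent to zero, the relation for m of a bracket demands
  \<epsilon>({a,b}) = 0, supplied by \<open>\<epsilon>_bracket\<close>.\<close>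

sublocale counit: env_algebra_map K B bracket "scalar_algebra K" \<epsilon> "\<lambda>b. \<zero>"
proof (intro env_algebra_map.intro env_algebra_map_axioms.intro poisson_algebra_axioms assoc_algebra_scalar
    counit_linear zero_scalar_hom)
  have k: "\<zero> \<ominus>\<^bsub>scalar_algebra K\<^esub> \<zero> = \<zero>"
    using abelian_group.minus_self[OF module.axioms(2)[OF module_scalar], of \<zero>] K_simps(2)
    by (simp add: scalar_algebra_simps)
  fix a b assume ab: "a \<in> carrier B" "b \<in> carrier B"
  note e = \<epsilon>_closed[OF ab(1)] \<epsilon>_closed[OF ab(2)] K_simps(2)
  show "\<epsilon> (a \<star> b) = \<epsilon> a \<otimes>\<^bsub>scalar_algebra K\<^esub> \<epsilon> b"
    using ab by (simp add: scalar_algebra_simps \<epsilon>_mult)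
  show "\<zero> = \<zero> \<otimes>\<^bsub>scalar_algebra K\<^esub> \<zero> \<ominus>\<^bsub>scalar_algebra K\<^esub> \<zero> \<otimes>\<^bsub>scalar_algebra K\<^esub> \<zero>"
    using e by (simp add: scalar_algebra_simps(5) k K_simps)
  show "\<zero> = \<epsilon> b \<otimes>\<^bsub>scalar_algebra K\<^esub> \<zero> \<oplus>\<^bsub>scalar_algebra K\<^esub> \<epsilon> a \<otimes>\<^bsub>scalar_algebra K\<^esub> \<zero>"
    using e by (simp add: scalar_algebra_simps K_simps)
  show "\<epsilon> (bracket a b) = \<zero> \<otimes>\<^bsub>scalar_algebra K\<^esub> \<epsilon> b \<ominus>\<^bsub>scalar_algebra K\<^esub> \<epsilon> b \<otimes>\<^bsub>scalar_algebra K\<^esub> \<zero>"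
    using e ab by (simp add: scalar_algebra_simps(5) k \<epsilon>_bracket K_simps)
qed (simp add: scalar_algebra_simps \<epsilon>_one)

lemma env_counit_eq:
  assumes "z \<in> carrier U"
  shows "env_counit K \<epsilon> z = \<epsilon> (ev z)"
  using assms unfolding env_counit_def
proof (induction rule: U_induct)
  case one
  then show ?case by (simp add: counit.env_lift_one ev_one \<epsilon>_one scalar_algebra_simps)
next
  case (add x y)
  then show ?case by (simp only: module_hom_add[OF counit.env_lift_hom] module_hom_add[OF \<epsilon>_ev_hom])
next
  case (smult c x)
  then show ?case by (simp only: module_hom_smult[OF counit.env_lift_hom] module_hom_smult[OF \<epsilon>_ev_hom])
next
  case (m b x)
  then show ?case by (simp only: counit.env_lift_mult scalar_algebra_simps \<epsilon>_ev_m)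
next
  case (h b x)
  then show ?case by (simp only: counit.env_lift_mult scalar_algebra_simps \<epsilon>_ev_h')
qed

lemma \<epsilon>H_pr:
  assumes z: "z \<in> carrier U"
  shows "\<epsilon>H (pr z) = \<epsilon> (ev z)"
proof -
  have "env_counit K \<epsilon> (SOME y. y \<in> H.proj z) = env_counit K \<epsilon> z"
  proof (rule H.hom_some_mem[OF module_scalar _ _ z])
    show hom: "env_counit K \<epsilon> \<in> module_hom K U (scalar_algebra K)"
      unfolding env_counit_def by (rule counit.env_lift_hom)
    show "env_counit K \<epsilon> y = \<zero>\<^bsub>scalar_algebra K\<^esub>" if "y \<in> aug" for y
      by (rule aug_vanish[OF module_scalar hom that])
         (simp add: env_counit_eq U_simps m_closed \<epsilon>_ev_m scalar_algebra_simps)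
  qed
  then show ?thesis by (simp add: env_bar_counit_def pr_eq env_counit_eq[OF z])
qed

lemma \<epsilon>H_hom: "\<epsilon>H \<in> module_hom K Hb (scalar_algebra K)"
  using H.hom_from_Q[OF \<epsilon>_ev_hom \<epsilon>H_pr[unfolded pr_eq]] by (simp only: env_bar_def)

sublocale coact: coaction_data K U Hb rho \<Delta>H
  by (intro coaction_data.intro coaction_data_axioms.intro module_U module_Hb rho_hom \<Delta>H_hom)

text \<open>Both sides of each comodule law are turned into Sweedler sums over B^e with \<pi>
  inserted; there \<open>swU_coassoc\<close> and \<open>swU_counit_right\<close> apply.\<close>

lemma right_comodule_U: "right_comodule K Hb \<Delta>H \<epsilon>H U rho"
  unfolding right_comodule_def
proof (intro conjI ballI rho_hom)
  show "vectorspace K U" by (intro vectorspace.intro module_U field_axioms)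
  fix z assume z: "z \<in> carrier U"
  have t: "rho z \<in> carrier TH" by (rule module_hom_mem[OF rho_hom z])
  let ?T3 = "tensor K U THH"
  note lin = linH module_hom_comp[OF rho_hom] module_hom_mem[OF rho_hom] module_hom_comp[OF \<Delta>H_hom] module_hom_mem[OF \<Delta>H_hom]
    tensor_lift_comp_hom[OF module_U module_Hb] tensor_lift_comp_hom[OF module_Hb module_Hb] two_modules.tensor_lift_param_hom[rotated 2]
  have "tensor_assoc K U Hb Hb (tensor_map K TH Hb rho id (rho z))
    = tensor_lift K ?T3 (\<lambda>a c. tensor_lift K ?T3 (\<lambda>a' c'. pure K U THH a' (pure K Hb Hb c' c)) (rho a)) (rho z)"
    by (rule coact.tensor_assoc_map[OF t])
  also have "\<dots> = swU ?T3 (\<lambda>a c. tensor_lift K ?T3 (\<lambda>a' c'. pure K U THH a' (pure K Hb Hb c' (pr c))) (rho a)) z"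
    by (rule tensor_lift_rho[OF _ z]) (assumption | rule lin)+
  also have "\<dots> = swU ?T3 (\<lambda>a c. swU ?T3 (\<lambda>a1 a2. pure K U THH a1 (pure K Hb Hb (pr a2) (pr c))) a) z"
  proof (rule swU_cong[OF z])
    fix a c assume c: "a \<in> carrier U" "c \<in> carrier U"
    show "tensor_lift K ?T3 (\<lambda>a' c'. pure K U THH a' (pure K Hb Hb c' (pr c))) (rho a)
      = swU ?T3 (\<lambda>a1 a2. pure K U THH a1 (pure K Hb Hb (pr a2) (pr c))) a"
      by (rule tensor_lift_rho[OF _ c(1)]) (assumption | rule lin c)+
  qed (assumption | rule lin)+
  also have "\<dots> = swU ?T3 (\<lambda>a c. swU ?T3 (\<lambda>c1 c2. pure K U THH a (pure K Hb Hb (pr c1) (pr c2))) c) z"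
    by (rule swU_coassoc[OF _ z]) (assumption | rule lin)+
  also have "\<dots> = swU ?T3 (\<lambda>a c. tensor_lift K ?T3 (\<lambda>c1 c2. pure K U THH a (pure K Hb Hb c1 c2)) (\<Delta>H (pr c))) z"
  proof (rule swU_cong[OF z])
    fix a c assume c: "a \<in> carrier U" "c \<in> carrier U"
    show "swU ?T3 (\<lambda>c1 c2. pure K U THH a (pure K Hb Hb (pr c1) (pr c2))) c
      = tensor_lift K ?T3 (\<lambda>c1 c2. pure K U THH a (pure K Hb Hb c1 c2)) (\<Delta>H (pr c))"
      by (rule tensor_lift_\<Delta>H[OF _ c(2), symmetric]) (assumption | rule lin c)+
  qed (assumption | rule lin)+
  also have "\<dots> = tensor_lift K ?T3 (\<lambda>a c. tensor_lift K ?T3 (\<lambda>c1 c2. pure K U THH a (pure K Hb Hb c1 c2)) (\<Delta>H c)) (rho z)"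
    by (rule tensor_lift_rho[OF _ z, symmetric]) (assumption | rule lin)+
  also have "\<dots> = tensor_map K U THH id \<Delta>H (rho z)"
    by (rule coact.tensor_map_right[OF t, symmetric])
  finally show "tensor_assoc K U Hb Hb (tensor_map K TH Hb rho id (rho z)) = tensor_map K U THH id \<Delta>H (rho z)" .
  have "tensor_lift K U (\<lambda>y c. \<epsilon>H c \<odot>\<^bsub>U\<^esub> y) (rho z) = swU U (\<lambda>a c. \<epsilon>H (pr c) \<odot>\<^bsub>U\<^esub> a) z"
    by (rule tensor_lift_rho[OF module_U z])
       (assumption | rule lin module_hom_comp[OF \<epsilon>H_hom] module_hom_mem[OF \<epsilon>H_hom, unfolded scalar_algebra_simps])+
  also have "\<dots> = swU U (\<lambda>a c. \<epsilon> (ev c) \<odot>\<^bsub>U\<^esub> a) z"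
    by (rule swU_cong[OF z module_U])
       (assumption | rule lin module_hom_comp[OF \<epsilon>H_hom] module_hom_mem[OF \<epsilon>H_hom, unfolded scalar_algebra_simps] | simp only: \<epsilon>H_pr)+
  also have "\<dots> = z" by (rule swU_counit_right[OF module_U z module_hom_id])
  finally show "tensor_lift K U (\<lambda>y c. \<epsilon>H c \<odot>\<^bsub>U\<^esub> y) (rho z) = z" .
qed

text \<open>Colinearity of b \<otimes> Z \<mapsto> \<open>m b \<bullet> secH Z\<close>, the inverse
  of the splitting: \<open>m b\<close> stays on the first leg by \<open>swU_m_aug\<close>, and
  \<open>swU_sec\<close> gives the coaction on \<open>sec\<close>.\<close>

lemma rho_m_secH:
  assumes b: "b \<in> carrier B" and Z: "Z \<in> carrier Hb"
  shows "rho (m b \<bullet> secH Z) = tensor_lift K TH (\<lambda>c1 c2. pure K U Hb (m b \<bullet> secH c1) c2) (\<Delta>H Z)"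
proof -
  obtain z where z: "z \<in> carrier U" "Z = pr z" using Z by (rule Hb_cases)
  note lin = linH b z(1)
  note bil = two_modules.pure_bilin[OF two_modules_UH]
  have sm: "pure K U Hb a (pr (m b' \<bullet> c)) = \<epsilon> b' \<odot>\<^bsub>TH\<^esub> pure K U Hb a (pr c)"
    if c: "a \<in> carrier U" "b' \<in> carrier B" "c \<in> carrier U" for a b' c
    unfolding pr_m[OF c(2,3)]
    by (rule module_hom_smult[OF bilin_right[OF bil]]) (assumption | rule lin c)+
  have "rho (m b \<bullet> secH Z) = swU TH (\<lambda>a c. pure K U Hb (m b \<bullet> a) (pr c)) (sec z)"
    unfolding z(2) secH_pr[OF z(1)] rho_eq
    by (rule swU_m_aug[OF _ _ b sec_closed[OF z(1)] sm]) (assumption | rule lin)+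
  also have "\<dots> = swU TH (\<lambda>a c. pure K U Hb (m b \<bullet> sec a) (pr c)) z"
    by (rule swU_sec[OF _ _ z(1)]) (assumption | rule lin sm)+
  also have "\<dots> = swU TH (\<lambda>a c. pure K U Hb (m b \<bullet> secH (pr a)) (pr c)) z"
    by (rule swU_cong[OF z(1)]) (assumption | rule lin | simp only: secH_pr)+
  also have "\<dots> = tensor_lift K TH (\<lambda>c1 c2. pure K U Hb (m b \<bullet> secH c1) c2) (\<Delta>H Z)"
    unfolding z(2) by (rule tensor_lift_\<Delta>H[OF _ z(1), symmetric]) (assumption | rule lin)+
  finally show ?thesis .
qed

text \<open>Since B^e is B \<otimes> H as a comodule, colinear maps into it correspond to linear
  maps into B; f corresponds to ev \<circ> f. This linear map is extended to N by the retraction r,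
  and g is the colinear map belonging to the extension.\<close>

lemma extend_comodule_hom:
  assumes M: "right_comodule K Hb \<Delta>H \<epsilon>H M \<mu>" and N: "right_comodule K Hb \<Delta>H \<epsilon>H N \<nu>"
    and i: "i \<in> comodule_hom K Hb M \<mu> N \<nu>" and f: "f \<in> comodule_hom K Hb M \<mu> U rho"
    and r: "r \<in> module_hom K N M" and ri: "\<And>x. x \<in> carrier M \<Longrightarrow> r (i x) = x"
  shows "\<exists>g \<in> comodule_hom K Hb N \<nu> U rho. \<forall>x \<in> carrier M. g (i x) = f x"
proof -
  have module_M: "module K M" and \<mu>: "\<mu> \<in> module_hom K M (tensor K M Hb)"
    using M by (auto simp: right_comodule_def vectorspace_def)
  have module_N: "module K N" and \<nu>: "\<nu> \<in> module_hom K N (tensor K N Hb)"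
    using N by (auto simp: right_comodule_def vectorspace_def)
  have i_hom: "i \<in> module_hom K M N" and f_hom: "f \<in> module_hom K M U"
    using i f by (auto simp: comodule_hom_def)
  interpret N: coaction_data K N Hb \<nu> \<Delta>H
    by (intro coaction_data.intro coaction_data_axioms.intro module_N module_Hb \<nu> \<Delta>H_hom)
  interpret NH: two_modules K N Hb by (rule two_modules.intro[OF module_N module_Hb])
  interpret MH: two_modules K M Hb by (rule two_modules.intro[OF module_M module_Hb])
  interpret UH: two_modules K U Hb by (rule two_modules_UH)
  define g0 where "g0 = (\<lambda>y. ev (f (r y)))"
  define g where "g = (\<lambda>y. tensor_lift K U (\<lambda>a Z. m (g0 a) \<bullet> secH Z) (\<nu> y))"
  have g0: "g0 \<in> module_hom K N B"
    unfolding g0_def by (intro module_hom_comp[OF ev_hom] module_hom_comp[OF f_hom] r)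
  note lin = linH module_M module_N module_hom_comp[OF g0] module_hom_mem[OF g0] module_hom_comp[OF \<nu>] module_hom_mem[OF \<nu>]
    module_hom_comp[OF \<mu>] module_hom_mem[OF \<mu>] module_hom_comp[OF rho_hom] module_hom_mem[OF rho_hom]
    module_hom_comp[OF \<Delta>H_hom] module_hom_mem[OF \<Delta>H_hom] module_hom_comp[OF f_hom] module_hom_mem[OF f_hom]
    module_hom_comp[OF i_hom] module_hom_mem[OF i_hom]
    tensor_lift_comp_hom[OF module_U module_Hb] tensor_lift_comp_hom[OF module_Hb module_Hb]
    tensor_lift_comp_hom[OF module_N module_Hb] two_modules.tensor_lift_param_hom[rotated 2] two_modules.tensor_lift_closed
  have g_hom: "g \<in> module_hom K N U"
    unfolding g_def by (assumption | rule lin)+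
  have gb: "bilin K N Hb U (\<lambda>a Z. m (g0 a) \<bullet> secH Z)"
    by (assumption | rule lin)+
  show ?thesis
  proof (rule bexI[of _ g], rule ballI)
    fix x assume x: "x \<in> carrier M"
    \<comment> \<open>Colinearity of i replaces the coaction of i x by that of x, r undoes i, and
      colinearity of f turns the sum into the coaction of f x, from which
      \<open>tensor_lift_secH_rho\<close> recovers f x.\<close>
    have "g (i x) = tensor_lift K U (\<lambda>a Z. m (g0 a) \<bullet> secH Z) (tensor_lift K (tensor K N Hb) (\<lambda>a c. pure K N Hb (i a) c) (\<mu> x))"
      using i x by (simp add: g_def comodule_hom_def tensor_map_def)
    also have "\<dots> = tensor_lift K U (\<lambda>a c. tensor_lift K U (\<lambda>a Z. m (g0 a) \<bullet> secH Z) (pure K N Hb (i a) c)) (\<mu> x)"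
      by (rule MH.hom_tensor_lift[OF _ module_U _ NH.tensor_lift_hom[OF module_U gb]]) (assumption | rule lin x)+
    also have "\<dots> = tensor_lift K U (\<lambda>a c. m (ev (f a)) \<bullet> secH c) (\<mu> x)"
    proof (rule MH.tensor_lift_cong[OF module_U])
      fix a c assume c: "a \<in> carrier M" "c \<in> carrier Hb"
      show "tensor_lift K U (\<lambda>a Z. m (g0 a) \<bullet> secH Z) (pure K N Hb (i a) c) = m (ev (f a)) \<bullet> secH c"
        using NH.tensor_lift_pure[OF module_U gb module_hom_mem[OF i_hom c(1)] c(2)] c by (simp add: g0_def ri)
    qed (assumption | rule lin x gb)+
    also have "\<dots> = tensor_lift K U (\<lambda>a c. tensor_lift K U (\<lambda>a Z. m (ev a) \<bullet> secH Z) (pure K U Hb (f a) c)) (\<mu> x)"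
    proof (rule MH.tensor_lift_cong[OF module_U])
      fix a c assume c: "a \<in> carrier M" "c \<in> carrier Hb"
      show "m (ev (f a)) \<bullet> secH c = tensor_lift K U (\<lambda>a Z. m (ev a) \<bullet> secH Z) (pure K U Hb (f a) c)"
        by (rule UH.tensor_lift_pure[OF module_U m_times_secH_bilin module_hom_mem[OF f_hom c(1)] c(2), symmetric])
    qed (assumption | rule lin x)+
    also have "\<dots> = tensor_lift K U (\<lambda>a Z. m (ev a) \<bullet> secH Z) (tensor_lift K TH (\<lambda>a c. pure K U Hb (f a) c) (\<mu> x))"
      by (rule MH.hom_tensor_lift[OF _ module_U _ UH.tensor_lift_hom[OF module_U m_times_secH_bilin], symmetric])
         (assumption | rule lin x)+
    also have "\<dots> = tensor_lift K U (\<lambda>a Z. m (ev a) \<bullet> secH Z) (rho (f x))"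
      using f x by (simp add: comodule_hom_def tensor_map_def)
    also have "\<dots> = f x" by (rule tensor_lift_secH_rho[OF module_hom_mem[OF f_hom x]])
    finally show "g (i x) = f x" .
  next
    have "rho (g y) = tensor_map K U Hb g id (\<nu> y)" if y: "y \<in> carrier N" for y
    proof -
      have "rho (g y) = tensor_lift K TH (\<lambda>a Z. rho (m (g0 a) \<bullet> secH Z)) (\<nu> y)"
        unfolding g_def by (rule NH.hom_tensor_lift[OF module_U _ gb rho_hom]) (assumption | rule lin y)+
      also have "\<dots> = tensor_lift K TH (\<lambda>a Z. tensor_lift K TH (\<lambda>c1 c2. pure K U Hb (m (g0 a) \<bullet> secH c1) c2) (\<Delta>H Z)) (\<nu> y)"
        by (rule NH.tensor_lift_cong) (assumption | rule lin y rho_m_secH)+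
      \<comment> \<open>Coassociativity of N trades the coproduct of the second leg for a second
        coaction on the first one; the inner lift is then g.\<close>
      also have "\<dots> = tensor_lift K TH (\<lambda>a c. tensor_lift K TH (\<lambda>a' c'. pure K U Hb (m (g0 a') \<bullet> secH c') c) (\<nu> a)) (\<nu> y)"
      proof (rule N.coassoc_elim[symmetric, OF y])
        show "tensor_assoc K N Hb Hb (tensor_map K (tensor K N Hb) Hb \<nu> id (\<nu> y)) = tensor_map K N THH id \<Delta>H (\<nu> y)"
          using N y by (simp add: right_comodule_def)
      qed (assumption | rule lin)+
      also have "\<dots> = tensor_lift K TH (\<lambda>a c. pure K U Hb (g a) c) (\<nu> y)"
      proof (rule NH.tensor_lift_cong)
        fix a c assume c: "a \<in> carrier N" "c \<in> carrier Hb"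
        show "tensor_lift K TH (\<lambda>a' c'. pure K U Hb (m (g0 a') \<bullet> secH c') c) (\<nu> a) = pure K U Hb (g a) c"
          unfolding g_def
          by (rule NH.hom_tensor_lift[OF module_U _ gb, symmetric]) (assumption | rule lin c)+
      qed (assumption | rule lin y)+
      finally show ?thesis by (simp add: tensor_map_def)
    qed
    with g_hom show "g \<in> comodule_hom K Hb N \<nu> U rho" by (simp add: comodule_hom_def)
  qed
qed

end

section \<open>Bases and the main theorem\<close>

lemma (in abelian_group) minus_zero_right: "x \<in> carrier G \<Longrightarrow> x \<ominus> \<zero> = x"
  using eq_minusI[of x x \<zero>] by simp

text \<open>A carrier with dummy operations, so that \<open>monoid_algebra\<close> provides the free
  vector space on S.\<close>

definition index_monoid :: "'a set \<Rightarrow> 'a monoid"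
  where "index_monoid S = \<lparr>carrier = S, monoid.mult = undefined, one = undefined\<rparr>"

lemma carrier_index_monoid [simp]: "carrier (index_monoid S) = S"
  by (simp add: index_monoid_def)

lemma (in cring) monoid_algebra_index_mono:
  assumes "c \<in> carrier (monoid_algebra R (index_monoid S))" "{s. c s \<noteq> \<zero>} \<subseteq> T"
  shows "c \<in> carrier (monoid_algebra R (index_monoid T))"
  using assms monoid_algebra_value_closed[OF assms(1)] by (auto simp: mem_monoid_algebra_iff)

text \<open>S lifts a basis of V/W and \<kappa> is the coordinate map of that quotient. It is
  applied twice: with W the image of an injection, to split it linearly, and with W =
  \<open>aug\<close>, to obtain a K-basis of H.\<close>

lemma basis_modulo_submodule:
  assumes K: "field K" and V: "module K V" and W: "submodule K W V"
  obtains S \<kappa> where "S \<subseteq> carrier V"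
    "\<kappa> \<in> module_hom K V (monoid_algebra K (index_monoid S))"
    "\<And>v. v \<in> carrier V \<Longrightarrow> v \<ominus>\<^bsub>V\<^esub> free_lift K V (\<lambda>s. s) (\<kappa> v) \<in> W"
    "\<And>w. w \<in> W \<Longrightarrow> \<kappa> w = (\<lambda>s. \<zero>\<^bsub>K\<^esub>)"
    "\<And>s. s \<in> S \<Longrightarrow> \<kappa> s = point_mass K s"
proof -
  interpret K: field K by (rule K)
  interpret V: module K V by (rule V)
  interpret W: submodule K W V by (rule W)
  let ?F = "\<lambda>S. monoid_algebra K (index_monoid S)"
  let ?e = "free_lift K V (\<lambda>s. s)"
  have W_zero: "\<zero>\<^bsub>V\<^esub> \<in> W" by (rule submodule.zero_closed[OF W])
  have W_minus: "v \<ominus>\<^bsub>V\<^esub> w \<in> W" if "v \<in> W" "w \<in> W" for v w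
  proof -
    have "w \<in> carrier V" using that(2) submodule.subset[OF W] by auto
    then have "v \<ominus>\<^bsub>V\<^esub> w = v \<oplus>\<^bsub>V\<^esub> (\<ominus>\<^bsub>K\<^esub> \<one>\<^bsub>K\<^esub>) \<odot>\<^bsub>V\<^esub> w"
      using module_minus_eq[OF V] by (simp add: a_minus_def)
    then show ?thesis using that submodule.m_closed[OF W] submodule.smult_closed[OF W] by simp
  qed
  \<comment> \<open>Linear independence modulo W, expressed by coefficient functions. The condition
    involves finite supports only, so it passes to unions of chains and Zorn applies.\<close>
  define indep where "indep S \<longleftrightarrow> S \<subseteq> carrier V \<and> (\<forall>c\<in>carrier (?F S). ?e c \<in> W \<longrightarrow> c = (\<lambda>s. \<zero>\<^bsub>K\<^esub>))" for S
  have "\<exists>M\<in>{S. indep S}. \<forall>X\<in>{S. indep S}. M \<subseteq> X \<longrightarrow> X = M"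
  proof (rule subset_Zorn')
    fix C assume C: "subset.chain {S. indep S} C"
    have "indep (\<Union>C)" unfolding indep_def
    proof (intro conjI ballI impI)
      show "\<Union>C \<subseteq> carrier V" using C by (auto simp: subset.chain_def indep_def)
      fix c assume c: "c \<in> carrier (?F (\<Union>C))" and ec: "?e c \<in> W"
      let ?A = "{s. c s \<noteq> \<zero>\<^bsub>K\<^esub>}"
      have fin: "finite ?A" "?A \<subseteq> \<Union>C" using c by (auto simp: mem_monoid_algebra_iff)
      show "c = (\<lambda>s. \<zero>\<^bsub>K\<^esub>)"
      proof (cases "C = {}")
        \<comment> \<open>The empty chain is a chain too; its union is empty, so the support is
          empty.\<close>
        case True
        with fin show ?thesis by auto
      next
        case False
        from finite_subset_Union_chain[OF fin False C] obtain S where S: "S \<in> C" "?A \<subseteq> S" by blast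
        have "indep S" using C S(1) by (auto simp: subset.chain_def)
        moreover have "c \<in> carrier (?F S)" using c S(2) by (rule K.monoid_algebra_index_mono)
        ultimately show ?thesis using ec by (auto simp: indep_def)
      qed
    qed
    then show "\<Union>C \<in> {S. indep S}" by simp
  qed
  then obtain S where S: "indep S" and max: "\<And>X. indep X \<Longrightarrow> S \<subseteq> X \<Longrightarrow> X = S" by auto
  have SV: "S \<subseteq> carrier V" using S by (simp add: indep_def)
  have e_hom: "?e \<in> module_hom K (?F T) V" if "T \<subseteq> carrier V" for T
    by (rule free_lift_module_hom[OF V]) (use that in auto)
  interpret F: module K "?F S" by (rule K.monoid_algebra_module)
  \<comment> \<open>If no combination of S equals v modulo W, then S with v adjoined is still
    independent, against maximality.\<close>
  have ex: "\<exists>c\<in>carrier (?F S). v \<ominus>\<^bsub>V\<^esub> ?e c \<in> W" if v: "v \<in> carrier V" for v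
  proof (rule ccontr)
    assume no: "\<not> ?thesis"
    have vS: "v \<notin> S"
    proof
      assume "v \<in> S"
      then have "point_mass K v \<in> carrier (?F S)" by (intro K.point_mass_closed) simp
      moreover have "v \<ominus>\<^bsub>V\<^esub> ?e (point_mass K v) \<in> W"
        using v W_zero by (simp add: free_lift_point_mass[OF V] V.M.minus_self)
      ultimately show False using no by blast
    qed
    have "indep (insert v S)" unfolding indep_def
    proof (intro conjI ballI impI)
      show iV: "insert v S \<subseteq> carrier V" using v SV by auto
      fix c assume c: "c \<in> carrier (?F (insert v S))" and ec: "?e c \<in> W"
      interpret F': module K "?F (insert v S)" by (rule K.monoid_algebra_module)
      have cv: "c v \<in> carrier K" using c by (rule K.monoid_algebra_value_closed)
      \<comment> \<open>The coefficient of v is split off, so that d is supported in S.\<close>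
      define d where "d = (\<lambda>s. if s = v then \<zero>\<^bsub>K\<^esub> else c s)"
      have "{s. d s \<noteq> \<zero>\<^bsub>K\<^esub>} \<subseteq> {s. c s \<noteq> \<zero>\<^bsub>K\<^esub>}" by (auto simp: d_def)
      then have d': "d \<in> carrier (?F (insert v S))" and d: "d \<in> carrier (?F S)"
        using c by (auto simp: mem_monoid_algebra_iff d_def intro: finite_subset)
      have ed: "?e d \<in> carrier V" using module_hom_mem[OF e_hom[OF SV] d] .
      have c_eq: "c = c v \<odot>\<^bsub>?F (insert v S)\<^esub> point_mass K v \<oplus>\<^bsub>?F (insert v S)\<^esub> d"
        using K.monoid_algebra_value_closed[OF c] by (auto simp: d_def point_mass_def fun_eq_iff)
      have pm: "point_mass K v \<in> carrier (?F (insert v S))" by (rule K.point_mass_closed) simp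
      have "?e c = ?e (c v \<odot>\<^bsub>?F (insert v S)\<^esub> point_mass K v \<oplus>\<^bsub>?F (insert v S)\<^esub> d)"
        by (rule arg_cong[OF c_eq])
      also have "\<dots> = c v \<odot>\<^bsub>V\<^esub> v \<oplus>\<^bsub>V\<^esub> ?e d"
        using module_hom_add[OF e_hom[OF iV] F'.smult_closed[OF cv pm] d']
          module_hom_smult[OF e_hom[OF iV] cv pm] free_lift_point_mass[OF V, of "\<lambda>s. s" v] v
        by (simp del: monoid_algebra_simps)
      finally have ec': "c v \<odot>\<^bsub>V\<^esub> v \<oplus>\<^bsub>V\<^esub> ?e d \<in> W" using ec by simp
      show "c = (\<lambda>s. \<zero>\<^bsub>K\<^esub>)"
      proof (cases "c v = \<zero>\<^bsub>K\<^esub>")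
        case True
        then have "?e d \<in> W" using ec' v ed by simp
        then have "d = (\<lambda>s. \<zero>\<^bsub>K\<^esub>)" using S d by (auto simp: indep_def)
        then show ?thesis using True by (auto simp: d_def fun_eq_iff split: if_splits)
      next
        case False
        \<comment> \<open>A nonzero coefficient of v is divided out, which is where K has to be a
          field; then v is a combination of S modulo W.\<close>
        let ?k = "inv\<^bsub>K\<^esub> c v"
        have k: "?k \<in> carrier K" "?k \<otimes>\<^bsub>K\<^esub> c v = \<one>\<^bsub>K\<^esub>"
          using False cv K.field_Units by (auto intro: K.Units_inv_closed K.Units_l_inv)
        have "?k \<odot>\<^bsub>V\<^esub> (c v \<odot>\<^bsub>V\<^esub> v \<oplus>\<^bsub>V\<^esub> ?e d) \<in> W"
          using submodule.smult_closed[OF W k(1) ec'] .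
        also have "?k \<odot>\<^bsub>V\<^esub> (c v \<odot>\<^bsub>V\<^esub> v \<oplus>\<^bsub>V\<^esub> ?e d) = v \<oplus>\<^bsub>V\<^esub> ?k \<odot>\<^bsub>V\<^esub> ?e d"
          using k cv v ed by (simp add: V.smult_r_distr V.smult_assoc1[symmetric])
        also have "\<dots> = v \<ominus>\<^bsub>V\<^esub> (\<ominus>\<^bsub>K\<^esub> ?k) \<odot>\<^bsub>V\<^esub> ?e d"
          using k v ed by (simp add: a_minus_def V.smult_l_minus)
        also have "\<dots> = v \<ominus>\<^bsub>V\<^esub> ?e ((\<ominus>\<^bsub>K\<^esub> ?k) \<odot>\<^bsub>?F S\<^esub> d)"
          using k d by (simp only: module_hom_smult[OF e_hom[OF SV]] K.a_inv_closed)
        finally show ?thesis using no k d F.smult_closed by blast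
      qed
    qed
    from max[OF this] vS show False by auto
  qed
  have uniq: "c = d" if c: "c \<in> carrier (?F S)" and d: "d \<in> carrier (?F S)" and v: "v \<in> carrier V"
    and cW: "v \<ominus>\<^bsub>V\<^esub> ?e c \<in> W" and dW: "v \<ominus>\<^bsub>V\<^esub> ?e d \<in> W" for c d v
  proof -
    note m = module_hom_mem[OF e_hom[OF SV]]
    have "(v \<ominus>\<^bsub>V\<^esub> ?e d) \<ominus>\<^bsub>V\<^esub> (v \<ominus>\<^bsub>V\<^esub> ?e c) \<in> W" by (rule W_minus[OF dW cW])
    also have "(v \<ominus>\<^bsub>V\<^esub> ?e d) \<ominus>\<^bsub>V\<^esub> (v \<ominus>\<^bsub>V\<^esub> ?e c) = ?e c \<ominus>\<^bsub>V\<^esub> ?e d"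
      using v m[OF c] m[OF d] by (simp add: a_minus_def V.M.minus_add V.M.a_ac V.M.r_neg1 V.M.r_neg2)
    also have "\<dots> = ?e (c \<ominus>\<^bsub>?F S\<^esub> d)"
      by (rule module_hom_minus[OF F.module_axioms V e_hom[OF SV] c d, symmetric])
    finally have "c \<ominus>\<^bsub>?F S\<^esub> d = \<zero>\<^bsub>?F S\<^esub>" using S c d by (auto simp: indep_def)
    then have "c = d \<oplus>\<^bsub>?F S\<^esub> \<zero>\<^bsub>?F S\<^esub>"
      by (intro abelian_group.eq_addI[OF module.axioms(2)[OF F.module_axioms]] c d) (rule sym)
    also have "\<dots> = d" by (rule F.M.r_zero[OF d])
    finally show ?thesis .
  qed
  \<comment> \<open>The coefficients are unique by independence, so the chosen map is linear: sums
    and multiples of coefficients satisfy the same condition.\<close>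
  define \<kappa> where "\<kappa> v = (SOME c. c \<in> carrier (?F S) \<and> v \<ominus>\<^bsub>V\<^esub> ?e c \<in> W)" for v
  have \<kappa>: "\<kappa> v \<in> carrier (?F S)" "v \<ominus>\<^bsub>V\<^esub> ?e (\<kappa> v) \<in> W" if "v \<in> carrier V" for v
    using someI_ex[OF ex[OF that, unfolded Bex_def]] by (auto simp: \<kappa>_def)
  have \<kappa>_eq: "\<kappa> v = c" if "v \<in> carrier V" "c \<in> carrier (?F S)" "v \<ominus>\<^bsub>V\<^esub> ?e c \<in> W" for v c
    by (rule uniq[OF \<kappa>(1) _ _ \<kappa>(2)]) (use that in auto)
  note m = module_hom_mem[OF e_hom[OF SV]]
  show thesis
  proof (rule that[OF SV _ \<kappa>(2)])
    show "\<kappa> \<in> module_hom K V (?F S)"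
    proof (rule module_homI[OF \<kappa>(1)])
      fix x y assume xy: "x \<in> carrier V" "y \<in> carrier V"
      have "x \<oplus>\<^bsub>V\<^esub> y \<ominus>\<^bsub>V\<^esub> ?e (\<kappa> x \<oplus>\<^bsub>?F S\<^esub> \<kappa> y) = (x \<ominus>\<^bsub>V\<^esub> ?e (\<kappa> x)) \<oplus>\<^bsub>V\<^esub> (y \<ominus>\<^bsub>V\<^esub> ?e (\<kappa> y))"
        unfolding module_hom_add[OF e_hom[OF SV] \<kappa>(1)[OF xy(1)] \<kappa>(1)[OF xy(2)]]
        using xy m[OF \<kappa>(1)[OF xy(1)]] m[OF \<kappa>(1)[OF xy(2)]] by (simp add: a_minus_def V.M.minus_add V.M.a_ac)
      then show "\<kappa> (x \<oplus>\<^bsub>V\<^esub> y) = \<kappa> x \<oplus>\<^bsub>?F S\<^esub> \<kappa> y"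
        using xy \<kappa> submodule.m_closed[OF W] F.M.add.m_closed by (intro \<kappa>_eq) auto
    next
      fix r x assume x: "r \<in> carrier K" "x \<in> carrier V"
      have "r \<odot>\<^bsub>V\<^esub> x \<ominus>\<^bsub>V\<^esub> ?e (r \<odot>\<^bsub>?F S\<^esub> \<kappa> x) = r \<odot>\<^bsub>V\<^esub> (x \<ominus>\<^bsub>V\<^esub> ?e (\<kappa> x))"
        unfolding module_hom_smult[OF e_hom[OF SV] x(1) \<kappa>(1)[OF x(2)]]
        by (rule V.smult_r_diff[symmetric]) (use x m \<kappa> in auto)
      then show "\<kappa> (r \<odot>\<^bsub>V\<^esub> x) = r \<odot>\<^bsub>?F S\<^esub> \<kappa> x"
        using x \<kappa> submodule.smult_closed[OF W] F.smult_closed by (intro \<kappa>_eq) auto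
    qed
  next
    fix w assume w: "w \<in> W"
    then have wV: "w \<in> carrier V" using submodule.subset[OF W] by auto
    have "?e (\<lambda>s. \<zero>\<^bsub>K\<^esub>) = \<zero>\<^bsub>V\<^esub>"
      using module_hom_zero[OF F.module_axioms V e_hom[OF SV]] by simp
    then have "w \<ominus>\<^bsub>V\<^esub> ?e (\<lambda>s. \<zero>\<^bsub>K\<^esub>) \<in> W" using w wV by (simp add: V.M.minus_zero_right)
    then show "\<kappa> w = (\<lambda>s. \<zero>\<^bsub>K\<^esub>)"
      using wV F.M.zero_closed by (intro \<kappa>_eq) auto
  next
    fix s assume s: "s \<in> S"
    then have sV: "s \<in> carrier V" using SV by auto
    have "s \<ominus>\<^bsub>V\<^esub> ?e (point_mass K s) \<in> W"
      using sV W_zero by (simp add: free_lift_point_mass[OF V] V.M.minus_self)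
    then show "\<kappa> s = point_mass K s"
      using sV s by (intro \<kappa>_eq K.point_mass_closed) auto
  qed
qed

text \<open>Subtracting the combination of S with coefficients \<kappa> v projects N onto the image
  of i; the inverse of i on its image then gives r.\<close>

lemma injective_hom_retraction:
  assumes K: "field K" and M: "module K M" and N: "module K N" and i: "i \<in> module_hom K M N" and inj: "inj_on i (carrier M)"
  obtains r where "r \<in> module_hom K N M" "\<And>x. x \<in> carrier M \<Longrightarrow> r (i x) = x"
proof -
  interpret M: module K M by (rule M)
  interpret N: module K N by (rule N)
  interpret i: mod_hom K M N i by (simp add: mod_hom_def mod_hom_axioms_def M N i)
  obtain S \<kappa> where S: "S \<subseteq> carrier N" "\<kappa> \<in> module_hom K N (monoid_algebra K (index_monoid S))"
    and \<kappa>: "\<And>v. v \<in> carrier N \<Longrightarrow> v \<ominus>\<^bsub>N\<^esub> free_lift K N (\<lambda>s. s) (\<kappa> v) \<in> i.im"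
    and \<kappa>0: "\<And>w. w \<in> i.im \<Longrightarrow> \<kappa> w = (\<lambda>s. \<zero>\<^bsub>K\<^esub>)"
    by (rule basis_modulo_submodule[OF K N i.im_is_submodule]) blast
  have e: "free_lift K N (\<lambda>s. s) \<in> module_hom K (monoid_algebra K (index_monoid S)) N"
    by (rule free_lift_module_hom[OF N]) (use S(1) in auto)
  \<comment> \<open>Subtraction is written with the scalar -1, so that the closure rules for linear
    maps apply.\<close>
  have "(\<lambda>v. (\<ominus>\<^bsub>K\<^esub> \<one>\<^bsub>K\<^esub>) \<odot>\<^bsub>N\<^esub> free_lift K N (\<lambda>s. s) (\<kappa> v)) \<in> module_hom K N N"
    by (intro module_hom_smult_fun[OF N] module_hom_comp[OF e S(2)]) simp
  from module_hom_add_fun[OF N module_hom_id this]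
  have "(\<lambda>v. v \<oplus>\<^bsub>N\<^esub> (\<ominus>\<^bsub>K\<^esub> \<one>\<^bsub>K\<^esub>) \<odot>\<^bsub>N\<^esub> free_lift K N (\<lambda>s. s) (\<kappa> v)) \<in> module_hom K N N" .
  moreover have "v \<oplus>\<^bsub>N\<^esub> (\<ominus>\<^bsub>K\<^esub> \<one>\<^bsub>K\<^esub>) \<odot>\<^bsub>N\<^esub> free_lift K N (\<lambda>s. s) (\<kappa> v) = v \<ominus>\<^bsub>N\<^esub> free_lift K N (\<lambda>s. s) (\<kappa> v)"
    if "v \<in> carrier N" for v
    using module_hom_mem[OF module_hom_comp[OF e S(2)] that] by (simp add: a_minus_def N.smult_l_minus)
  ultimately have q: "(\<lambda>v. v \<ominus>\<^bsub>N\<^esub> free_lift K N (\<lambda>s. s) (\<kappa> v)) \<in> module_hom K N N"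
    by (rule module_hom_cong[OF _ N])
  define r where "r v = inv_into (carrier M) i (v \<ominus>\<^bsub>N\<^esub> free_lift K N (\<lambda>s. s) (\<kappa> v))" for v
  have r: "r v \<in> carrier M" "i (r v) = v \<ominus>\<^bsub>N\<^esub> free_lift K N (\<lambda>s. s) (\<kappa> v)" if "v \<in> carrier N" for v
    using \<kappa>[OF that] unfolding i.im_def r_def by (auto intro: inv_into_into f_inv_into_f)
  have r_eq: "r v = x" if "v \<in> carrier N" "x \<in> carrier M" "i x = v \<ominus>\<^bsub>N\<^esub> free_lift K N (\<lambda>s. s) (\<kappa> v)" for v x
    using inj_onD[OF inj, of "r v" x] r that by simp
  show thesis
  proof (rule that)
    show "r \<in> module_hom K N M"
    proof (rule module_homI[OF r(1)])
      fix x y assume "x \<in> carrier N" "y \<in> carrier N"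
      then show "r (x \<oplus>\<^bsub>N\<^esub> y) = r x \<oplus>\<^bsub>M\<^esub> r y"
        using r module_hom_add[OF q] by (intro r_eq) (auto simp: module_hom_add[OF i])
    next
      fix c x assume "c \<in> carrier K" "x \<in> carrier N"
      then show "r (c \<odot>\<^bsub>N\<^esub> x) = c \<odot>\<^bsub>M\<^esub> r x"
        using r module_hom_smult[OF q] by (intro r_eq) (auto simp: module_hom_smult[OF i])
    qed
    fix x assume x: "x \<in> carrier M"
    then have ix: "i x \<in> carrier N" "i x \<in> i.im" using module_hom_mem[OF i] by (auto simp: i.im_def)
    have "free_lift K N (\<lambda>s. s) (\<lambda>s. \<zero>\<^bsub>K\<^esub>) = \<zero>\<^bsub>N\<^esub>"
      by (simp add: free_lift_def)
    then show "r (i x) = x" using x ix by (intro r_eq) (auto simp: \<kappa>0 N.M.minus_zero_right)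
  qed
qed

context poisson_hopf_algebra
begin

text \<open>A converse to \<open>aug_vanish\<close>: b - \<epsilon>(b) 1 is in B^+, so a map that
  kills \<open>aug\<close> cannot distinguish the two arguments. It applies to the coordinate
  functions, of which only the vanishing on \<open>aug\<close> is known.\<close>

lemma aug_hom_m:
  assumes X: "module K X" and f: "f \<in> module_hom K U X" and 0: "\<And>w. w \<in> aug \<Longrightarrow> f w = \<zero>\<^bsub>X\<^esub>"
    and b: "b \<in> carrier B" and z: "z \<in> carrier U"
  shows "f (m b \<bullet> z) = \<epsilon> b \<odot>\<^bsub>X\<^esub> f z"
proof -
  have e: "\<epsilon> b \<in> carrier K" by (rule \<epsilon>_closed[OF b])
  have c: "m b \<bullet> z \<in> carrier U" "\<epsilon> b \<odot>\<^bsub>U\<^esub> z \<in> carrier U" by (assumption | rule lin b z)+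
  have "pr (m b \<bullet> z) = pr (\<epsilon> b \<odot>\<^bsub>U\<^esub> z)"
    by (simp only: pr_m[OF b z] module_hom_smult[OF pr_hom e z])
  then have "m b \<bullet> z \<ominus>\<^bsub>U\<^esub> \<epsilon> b \<odot>\<^bsub>U\<^esub> z \<in> aug"
    unfolding pr_eq by (simp only: H.proj_eq_iff[OF c])
  then have "f (m b \<bullet> z) \<ominus>\<^bsub>X\<^esub> f (\<epsilon> b \<odot>\<^bsub>U\<^esub> z) = \<zero>\<^bsub>X\<^esub>"
    using 0 module_hom_minus[OF module_U X f c] by simp
  then have "f (m b \<bullet> z) = f (\<epsilon> b \<odot>\<^bsub>U\<^esub> z) \<oplus>\<^bsub>X\<^esub> \<zero>\<^bsub>X\<^esub>"
    by (intro abelian_group.eq_addI[OF module.axioms(2)[OF X]] module_hom_mem[OF f] c) (rule sym)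
  also have "\<dots> = f (\<epsilon> b \<odot>\<^bsub>U\<^esub> z)"
    by (rule abelian_monoid.r_zero[OF abelian_group.axioms(1)[OF module.axioms(2)[OF X]] module_hom_mem[OF f c(2)]])
  also have "\<dots> = \<epsilon> b \<odot>\<^bsub>X\<^esub> f z" by (rule module_hom_smult[OF f e z])
  finally show ?thesis .
qed

section \<open>Freeness over the Poisson Hopf algebra\<close>

abbreviation "BU \<equiv> env_left_module K B bracket"

lemma BU_simps:
  "carrier BU = carrier U" "x \<oplus>\<^bsub>BU\<^esub> y = x \<oplus>\<^bsub>U\<^esub> y" "\<zero>\<^bsub>BU\<^esub> = \<zero>\<^bsub>U\<^esub>" "b \<odot>\<^bsub>BU\<^esub> z = m b \<bullet> z"
  by (simp_all add: env_left_module_def ring.defs module.defs)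

lemma module_BU: "module B BU"
proof (rule moduleI[OF M_cring])
  show "abelian_group BU"
  proof (rule abelian_groupI)
    fix z assume "z \<in> carrier BU"
    then show "\<exists>y\<in>carrier BU. y \<oplus>\<^bsub>BU\<^esub> z = \<zero>\<^bsub>BU\<^esub>"
      by (intro bexI[of _ "\<ominus>\<^bsub>U\<^esub> z"]) (simp_all add: BU_simps U_simps(3,9))
  qed (simp_all add: BU_simps U_simps(1,2,7,8) , simp add: U_simps(10))
qed (simp_all add: BU_simps module_hom_add[OF m_hom] m_mult m_one U_simps m_closed)

lemma finsum_BU: "finsum BU f A = finsum U f A"
proof -
  have "add BU = add U" by (simp add: fun_eq_iff BU_simps)
  then show ?thesis by (simp add: finsum_def finprod_def BU_simps)
qed

text \<open>Under the isomorphism with B \<otimes> H a K-basis of H becomes a B-basis of B^e. With S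
  representing a basis of H, the B-basis is the image of S under \<open>sec\<close>.\<close>

lemma free_module_BU: "free_module B BU"
proof -
  interpret BU: module B BU by (rule module_BU)
  have fK: "field K" by (rule field_axioms)
  obtain S \<kappa> where SU: "S \<subseteq> carrier U" and \<kappa>_hom: "\<kappa> \<in> module_hom K U (monoid_algebra K (index_monoid S))"
    and \<kappa>: "\<And>v. v \<in> carrier U \<Longrightarrow> v \<ominus>\<^bsub>U\<^esub> free_lift K U (\<lambda>s. s) (\<kappa> v) \<in> aug"
    and \<kappa>0: "\<And>w. w \<in> aug \<Longrightarrow> \<kappa> w = (\<lambda>s. \<zero>)"
    and \<kappa>s: "\<And>s. s \<in> S \<Longrightarrow> \<kappa> s = point_mass K s"
    by (rule basis_modulo_submodule[OF fK module_U submodule_aug]) blast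
  let ?k = "scalar_algebra K"
  have \<phi>_hom: "(\<lambda>v. \<kappa> v s) \<in> module_hom K U ?k" for s
  proof -
    have "(\<lambda>f. f s) \<in> module_hom K (monoid_algebra K (index_monoid S)) ?k"
      by (rule module_homI) (simp_all add: scalar_algebra_simps cring.monoid_algebra_value_closed[OF R_cring])
    from module_hom_comp[OF this \<kappa>_hom] show ?thesis .
  qed
  have \<phi>_m: "\<kappa> (m b \<bullet> c) s = \<epsilon> b \<otimes> \<kappa> c s" if "b \<in> carrier B" "c \<in> carrier U" for b c s
    using aug_hom_m[OF module_scalar \<phi>_hom _ that, of s] by (simp add: \<kappa>0 scalar_algebra_simps)
  have \<phi>_closed: "\<kappa> c s \<in> carrier K" if "c \<in> carrier U" for c s
    using module_hom_mem[OF \<phi>_hom that] by (simp add: scalar_algebra_simps)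
  note linF = linS module_hom_comp[OF \<phi>_hom] \<phi>_closed
  \<comment> \<open>The coordinate functional of B \<otimes> H at s, pulled back along z \<mapsto>
    p(z1) \<otimes> \<pi>(z2); it is B-linear because \<kappa> sees B only through
    \<epsilon>.\<close>
  define lam where "lam s = swU B (\<lambda>a c. \<kappa> c s \<odot>\<^bsub>B\<^esub> ev a)" for s
  have lam_hom: "lam s \<in> module_hom K U B" for s
    unfolding lam_def by (assumption | rule linF)+
  have lam_m: "lam s (m b \<bullet> z) = b \<star> lam s z" if b: "b \<in> carrier B" and z: "z \<in> carrier U" for s b z
  proof -
    have "lam s (m b \<bullet> z) = swU B (\<lambda>v w. \<kappa> w s \<odot>\<^bsub>B\<^esub> ev (m b \<bullet> v)) z"
      unfolding lam_def
    proof (rule swU_m_aug[OF module_B _ b z])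
      fix a b c assume c: "a \<in> carrier U" "b \<in> carrier B" "c \<in> carrier U"
      then show "\<kappa> (m b \<bullet> c) s \<odot>\<^bsub>B\<^esub> ev a = \<epsilon> b \<odot>\<^bsub>B\<^esub> (\<kappa> c s \<odot>\<^bsub>B\<^esub> ev a)"
        by (simp add: \<phi>_m smult_assoc1 \<epsilon>_closed \<phi>_closed ev_closed)
    qed (assumption | rule linF)+
    also have "\<dots> = swU B (\<lambda>v w. b \<star> (\<kappa> w s \<odot>\<^bsub>B\<^esub> ev v)) z"
      by (rule swU_cong[OF z module_B])
         (assumption | rule linF b | simp only: ev_m b B_smult_mult \<phi>_closed ev_closed)+
    also have "\<dots> = b \<star> lam s z"
      unfolding lam_def by (rule swU_map[OF z module_B module_B, symmetric]) (assumption | rule linF b)+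
    finally show ?thesis .
  qed
  \<comment> \<open>Colinearity of \<open>sec\<close> together with \<open>ev_sec\<close> leaves
    \<epsilon>(p(t1)) times the coordinate of t2; the counit law reduces this to the coordinate of t
    itself.\<close>
  have lam_sec: "lam s (sec t) = (if t = s then \<one>\<^bsub>B\<^esub> else \<zero>\<^bsub>B\<^esub>)" if t: "t \<in> S" for s t
  proof -
    have tU: "t \<in> carrier U" using t SU by auto
    have "lam s (sec t) = swU B (\<lambda>a c. \<kappa> c s \<odot>\<^bsub>B\<^esub> ev (sec a)) t"
      unfolding lam_def
    proof (rule swU_sec[OF module_B _ tU])
      fix a b c assume c: "a \<in> carrier U" "b \<in> carrier B" "c \<in> carrier U"
      then show "\<kappa> (m b \<bullet> c) s \<odot>\<^bsub>B\<^esub> ev a = \<epsilon> b \<odot>\<^bsub>B\<^esub> (\<kappa> c s \<odot>\<^bsub>B\<^esub> ev a)"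
        by (simp add: \<phi>_m smult_assoc1 \<epsilon>_closed \<phi>_closed ev_closed)
    qed (assumption | rule linF)+
    also have "\<dots> = swU B (\<lambda>a c. \<epsilon> (ev a) \<odot>\<^bsub>B\<^esub> (\<kappa> c s \<odot>\<^bsub>B\<^esub> \<one>\<^bsub>B\<^esub>)) t"
    proof (rule swU_cong[OF tU module_B])
      fix a c assume c: "a \<in> carrier U" "c \<in> carrier U"
      have e: "\<kappa> c s \<in> carrier K" "\<epsilon> (ev a) \<in> carrier K" "\<one>\<^bsub>B\<^esub> \<in> carrier B"
        by (assumption | rule linF c)+
      show "\<kappa> c s \<odot>\<^bsub>B\<^esub> ev (sec a) = \<epsilon> (ev a) \<odot>\<^bsub>B\<^esub> (\<kappa> c s \<odot>\<^bsub>B\<^esub> \<one>\<^bsub>B\<^esub>)"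
        unfolding ev_sec[OF c(1)] smult_assoc1[OF e(1,2,3), symmetric] smult_assoc1[OF e(2,1,3), symmetric]
        by (simp only: K_simps(14)[OF e(1,2)])
    qed (assumption | rule linF)+
    also have "\<dots> = \<kappa> t s \<odot>\<^bsub>B\<^esub> \<one>\<^bsub>B\<^esub>"
      by (rule swU_counit_left[OF module_B tU]) (assumption | rule linF)+
    finally show ?thesis using module.smult_one[OF module_B] module.smult_l_null[OF module_B] B_simps(6)
      by (auto simp: \<kappa>s[OF t] point_mass_def)
  qed
  have secS: "sec ` S \<subseteq> carrier BU" using SU sec_closed by (auto simp: BU_simps)
  have "\<not> BU.lin_dep (sec ` S)"
  proof
    assume "BU.lin_dep (sec ` S)"
    then obtain A a v where A: "finite A" "A \<subseteq> sec ` S" and a: "a \<in> A \<rightarrow> carrier B"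
      and 0: "BU.lincomb a A = \<zero>\<^bsub>BU\<^esub>" and v: "v \<in> A" "a v \<noteq> \<zero>\<^bsub>B\<^esub>"
      unfolding BU.lin_dep_def by blast
    obtain s where s: "s \<in> S" "v = sec s" using A v by auto
    \<comment> \<open>The functional at s is 1 on v = sec s and 0 on every other element of A, since
      such an element is sec t for some t different from s. So it reads off the coefficient of
      v.\<close>
    have sum: "lam s (\<Oplus>\<^bsub>U\<^esub>w\<in>A. m (a w) \<bullet> w) = (if v \<in> A then a v else \<zero>\<^bsub>B\<^esub>)"
      using A a
    proof (induction A rule: finite_induct)
      case empty
      then show ?case using module_hom_zero[OF module_U module_B lam_hom] by simp
    next
      case (insert w A)
      have wU: "w \<in> carrier U" and aw: "a w \<in> carrier B" and AU: "A \<subseteq> carrier U"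
        using insert secS by (auto simp: BU_simps)
      have c: "m (a w) \<bullet> w \<in> carrier U" using wU aw by (simp add: U_simps m_closed)
      have c': "(\<lambda>w. m (a w) \<bullet> w) \<in> A \<rightarrow> carrier U"
        using insert(5) AU by (intro Pi_I U_simps(5) m_closed) auto
      have "lam s (\<Oplus>\<^bsub>U\<^esub>w\<in>insert w A. m (a w) \<bullet> w)
        = lam s (m (a w) \<bullet> w) \<oplus>\<^bsub>B\<^esub> lam s (\<Oplus>\<^bsub>U\<^esub>w\<in>A. m (a w) \<bullet> w)"
        unfolding abelian_monoid.finsum_insert[OF abelian_group.axioms(1)[OF U_abelian] insert(1,2) c' c]
        by (rule module_hom_add[OF lam_hom c abelian_monoid.finsum_closed[OF abelian_group.axioms(1)[OF U_abelian] c']])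
      also have "\<dots> = a w \<star> lam s w \<oplus>\<^bsub>B\<^esub> (if v \<in> A then a v else \<zero>\<^bsub>B\<^esub>)"
        using insert by (simp add: lam_m wU aw)
      also have "\<dots> = (if v \<in> insert w A then a v else \<zero>\<^bsub>B\<^esub>)"
      proof (cases "w = v")
        case True
        then have "lam s w = \<one>\<^bsub>B\<^esub>" using lam_sec[OF s(1), of s] s by simp
        then show ?thesis using True insert(2) aw by (auto simp: B_simps)
      next
        case False
        obtain t where t: "t \<in> S" "w = sec t" using insert(4) by auto
        then have "t \<noteq> s" using False s by auto
        then have "lam s w = \<zero>\<^bsub>B\<^esub>" using lam_sec[OF t(1), of s] t by simp
        moreover have "a v \<in> carrier B" if "v \<in> A" using insert(5) that by auto
        ultimately show ?thesis using False aw by (auto simp: B_simps)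
      qed
      finally show ?case .
    qed
    have "(\<Oplus>\<^bsub>U\<^esub>w\<in>A. m (a w) \<bullet> w) = \<zero>\<^bsub>U\<^esub>"
      using 0 by (simp add: BU.lincomb_def finsum_BU BU_simps)
    then have "a v = \<zero>\<^bsub>B\<^esub>"
      using sum v(1) module_hom_zero[OF module_U module_B lam_hom[of s]] by simp
    with v show False by simp
  qed
  moreover have "BU.span (sec ` S) = carrier BU"
  proof
    have sub: "submodule B (BU.span (sec ` S)) BU" by (rule BU.span_is_submodule[OF secS])
    then show "BU.span (sec ` S) \<subseteq> carrier BU" by (rule submodule.subset)
    note add_span = submodule.m_closed[OF sub, unfolded BU_simps]
    note mult = submodule.smult_closed[OF sub, unfolded BU_simps]
    have e_hom: "free_lift K U (\<lambda>s. s) \<in> module_hom K (monoid_algebra K (index_monoid S)) U"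
      by (rule free_lift_module_hom[OF module_U]) (use SU in auto)
    note se = module_hom_comp[OF sec_hom e_hom]
    \<comment> \<open>K-linear combinations are B-linear ones, because a scalar r acts as
      \<open>m\<close> of r times the unit of B.\<close>
    have lift: "sec (free_lift K U (\<lambda>s. s) c) \<in> BU.span (sec ` S)"
      if "c \<in> carrier (monoid_algebra K (index_monoid S))" for c
      using that
    proof (induction rule: cring.monoid_algebra_induct[OF R_cring, consumes 1, case_names zero add])
      case zero
      have "sec (free_lift K U (\<lambda>s. s) (\<lambda>s. \<zero>)) = \<zero>\<^bsub>U\<^esub>"
        using module_hom_zero[OF module_U module_U sec_hom] by (simp add: free_lift_def)
      then show ?case using submodule.zero_closed[OF sub] by (simp add: BU_simps)
    next
      case (add r s c)
      let ?F = "monoid_algebra K (index_monoid S)"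
      interpret F: module K ?F by (rule cring.monoid_algebra_module[OF R_cring])
      have s: "s \<in> S" "s \<in> carrier U" using add(2) SU by auto
      have pm: "point_mass K s \<in> carrier ?F" using add(2) by (rule cring.point_mass_closed[OF R_cring])
      have "sec (free_lift K U (\<lambda>s. s) (r \<odot>\<^bsub>?F\<^esub> point_mass K s \<oplus>\<^bsub>?F\<^esub> c))
        = r \<odot>\<^bsub>U\<^esub> sec (free_lift K U (\<lambda>s. s) (point_mass K s)) \<oplus>\<^bsub>U\<^esub> sec (free_lift K U (\<lambda>s. s) c)"
        using module_hom_add[OF se F.smult_closed[OF add(1) pm] add(3)] module_hom_smult[OF se add(1) pm] by simp
      also have "r \<odot>\<^bsub>U\<^esub> sec (free_lift K U (\<lambda>s. s) (point_mass K s)) = m (r \<odot>\<^bsub>B\<^esub> \<one>\<^bsub>B\<^esub>) \<bullet> sec s"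
        using free_lift_point_mass[OF module_U, of "\<lambda>s. s" s] s add(1) by (simp add: m_smult_one_mult sec_closed)
      finally have eq: "sec (free_lift K U (\<lambda>s. s) (r \<odot>\<^bsub>?F\<^esub> point_mass K s \<oplus>\<^bsub>?F\<^esub> c))
        = m (r \<odot>\<^bsub>B\<^esub> \<one>\<^bsub>B\<^esub>) \<bullet> sec s \<oplus>\<^bsub>U\<^esub> sec (free_lift K U (\<lambda>s. s) c)" .
      have "sec s \<in> BU.span (sec ` S)" using BU.in_own_span[OF secS] s by auto
      then show ?case unfolding eq
        by (intro add_span mult module.smult_closed[OF module_B] B_simps(6) add(1,4))
    qed
    \<comment> \<open>Modulo \<open>aug\<close> the element z is a K-combination of S, and
      \<open>sec\<close> vanishes on \<open>aug\<close>.\<close>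
    have sec_span: "sec z \<in> BU.span (sec ` S)" if z: "z \<in> carrier U" for z
    proof -
      let ?w = "free_lift K U (\<lambda>s. s) (\<kappa> z)"
      have \<kappa>z: "\<kappa> z \<in> carrier (monoid_algebra K (index_monoid S))" by (rule module_hom_mem[OF \<kappa>_hom z])
      have w: "?w \<in> carrier U" by (rule module_hom_mem[OF e_hom \<kappa>z])
      have "sec z \<ominus>\<^bsub>U\<^esub> sec ?w = \<zero>\<^bsub>U\<^esub>"
        using module_hom_minus[OF module_U module_U sec_hom z w] aug_vanish[OF module_U sec_hom \<kappa>[OF z] sec_m] by simp
      then have "sec z = sec ?w \<oplus>\<^bsub>U\<^esub> \<zero>\<^bsub>U\<^esub>"
        by (intro abelian_group.eq_addI[OF U_abelian] sec_closed z w) (rule sym)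
      then have "sec z = sec ?w" using sec_closed[OF w] by (simp add: U_simps)
      then show ?thesis using lift[OF \<kappa>z] by simp
    qed
    show "carrier BU \<subseteq> BU.span (sec ` S)"
    proof
      fix z assume "z \<in> carrier BU"
      then have z: "z \<in> carrier U" by (simp add: BU_simps)
      have b: "bilin K U U U (\<lambda>a c. m (ev a) \<bullet> sec c)" by (assumption | rule linS)+
      \<comment> \<open>The formula z = p(z1) sec(z2) writes z as a sum of B-multiples of values of
        \<open>sec\<close>. For the induction over sums of pure tensors the coproduct of z is
        replaced by an arbitrary tensor t.\<close>
      have "tensor_lift K U (\<lambda>a c. m (ev a) \<bullet> sec c) t \<in> BU.span (sec ` S)" if "t \<in> carrier TU" for t
        using that
      proof (induction rule: UU.tensor_induct)
        case (pure v w)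
        then show ?case
          by (simp only: UU.tensor_lift_pure[OF module_U b] mult sec_span ev_closed)
      next
        case (add t u)
        then show ?case
          by (simp only: module_hom_add[OF UU.tensor_lift_hom[OF module_U b]] add_span)
      qed
      from this[OF env_comul_closed[OF z]] show "z \<in> BU.span (sec ` S)"
        using swU_ev_sec[OF z] by (simp add: swU_def)
    qed
  qed
  ultimately show ?thesis unfolding free_module_def using module_BU secS by blast
qed

text \<open>Over a field the injection i splits linearly; cofreeness upgrades the resulting linear
  extension to a colinear one.\<close>

lemma injective_U: "injective_right_comodule TYPE('x) TYPE('y) K Hb \<Delta>H \<epsilon>H U rho"
  unfolding injective_right_comodule_def
proof (intro conjI right_comodule_U allI impI)
  fix M :: "('k, 'x) module" and \<mu> and N :: "('k, 'y) module" and \<nu> i f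
  assume M: "right_comodule K Hb \<Delta>H \<epsilon>H M \<mu>" and N: "right_comodule K Hb \<Delta>H \<epsilon>H N \<nu>"
    and i: "i \<in> comodule_hom K Hb M \<mu> N \<nu>" and inj: "inj_on i (carrier M)"
    and f: "f \<in> comodule_hom K Hb M \<mu> U rho"
  have "module K M" "module K N" "i \<in> module_hom K M N"
    using M N i by (auto simp: right_comodule_def vectorspace_def comodule_hom_def)
  from injective_hom_retraction[OF field_axioms this inj]
  obtain r where "r \<in> module_hom K N M" "\<And>x. x \<in> carrier M \<Longrightarrow> r (i x) = x" by blast
  then show "\<exists>g\<in>comodule_hom K Hb N \<nu> U rho. \<forall>x\<in>carrier M. g (i x) = f x"
    by (rule extend_comodule_hom[OF M N i f])
qed

end

theorem corollary6p7:
  fixes K :: "('k, 'r) ring_scheme" and B :: "('k, 'b, 'm) module_scheme"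
    and bracket :: "'b \<Rightarrow> 'b \<Rightarrow> 'b" and \<Delta> :: "'b \<Rightarrow> ('b \<times> 'b \<Rightarrow> 'k) set"
    and \<epsilon> :: "'b \<Rightarrow> 'k" and S :: "'b \<Rightarrow> 'b"
  assumes "poisson_hopf_algebra K B bracket \<Delta> \<epsilon> S"
  shows "free_module B (env_left_module K B bracket)
    \<and> (env_m K B bracket ` carrier B = right_coinvariants K B bracket \<Delta> \<epsilon>
       \<and> env_m K B bracket ` carrier B = left_coinvariants K B bracket \<Delta> \<epsilon>)
    \<and> injective_right_comodule TYPE('x) TYPE('y) K (env_bar K B bracket \<epsilon>)
        (env_bar_comul K B bracket \<Delta> \<epsilon>) (env_bar_counit K \<epsilon>)
        (env K B bracket) (env_right_coaction K B bracket \<Delta> \<epsilon>)"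
proof -
  interpret poisson_hopf_algebra K B bracket \<Delta> \<epsilon> S by fact
  show ?thesis
    using free_module_BU right_coinvariants_eq left_coinvariants_eq injective_U by simp
qed

end
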